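(* Let $\theta\ge1$ and $p\ge\theta$ with $p>1/H$, and let $\xi\in L^p(\Omega\to\mathbb R^d,\mathscr F_0,\mathbb P)$. Let $b:\Omega\times[0,T]\times\mathbb R^d\times\mathscr P_\theta(\mathbb R^d)\to\mathbb R^d$ and $\sigma:[0,T]\times\mathscr P_\theta(\mathbb R^d)\to\mathbb R^d\otimes\mathbb R^d$ satisfy hypothesis (H): there is a non-decreasing function $K:[0,T]\to[0,\infty)$ such that for all $t\in[0,T]$, $x,y\in\mathbb R^d$, $\mu,\nu\in\mathscr P_\theta(\mathbb R^d)$, $$|b(t,x,\mu)-b(t,y,\nu)|\le K(t)\big(|x-y|+\mathbb W_\theta(\mu,\nu)\big),\quad \|\sigma(t,\mu)-\sigma(t,\nu)\|\le K(t)\mathbb W_\theta(\mu,\nu),\quad |b(t,0,\delta_0)|+\|\sigma(t,\delta_0)\|\le K(t).$$ Then the equation $$X_t=\xi+\int_0^t b(s,X_s,\mathscr L_{X_s})\,ds+\int_0^t\sigma(s,\mathscr L_{X_s})\,dB^H_s,\qquad t\in[0,T],$$ has a unique solution $X\in\mathcal S^p([0,T])$ (i.e. a process in $\mathcal S^p([0,T])$ satisfying the equation $\mathbb P$-a.s. for all $t$; uniqueness holds among processes in $\mathcal S^p([0,T])$).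
   Context: Fix $T>0$, $d\ge1$, $H\in(1/2,1)$. A $d$-dimensional fractional Brownian motion $B^H=(B^{H,1},\dots,B^{H,d})$ with Hurst parameter $H$ is a centered Gaussian process with $\mathbb E(B^{H,i}_tB^{H,j}_s)=\delta_{ij}R_H(t,s)$, $R_H(t,s)=\frac12(t^{2H}+s^{2H}-|t-s|^{2H})$. $(\Omega,\mathscr F,\mathbb P)$ is the canonical space of $B^H$ ($\Omega=C_0([0,T],\mathbb R^d)$ with $B^H$ the coordinate process), $\mathscr F_0\subset\mathscr F$ is a sub-$\sigma$-algebra independent of $B^H$, rich enough that every $\mu\in\mathscr P_2(\mathbb R^d)$ is the law of some $\mathscr F_0$-measurable random variable, and $(\mathscr F_t)_{t\in[0,T]}$ is the filtration generated by $B^H$, completed and augmented by $\mathscr F_0$. $\mathscr P_\theta(\mathbb R^d)$ is the set of probability measures on $\mathbb R^d$ with finite $\theta$-th moment, $\mathbb W_\theta(\mu,\nu)=\inf_{\pi}\big(\int|x-y|^\theta\pi(dx,dy)\big)^{1/\theta}$ over couplings $\pi$ of $\mu,\nu$; $\mathscr L_X$ denotes the law of $X$; $\delta_0$ is the Dirac mass at $0$. Since $\sigma(\cdot,\mathscr L_{X_\cdot})$ is deterministic, $\int\sigma\,dB^H$ is a Wiener integral w.r.t. $B^H$. $\mathcal S^p([0,T])$ is the space of continuous $(\mathscr F_t)$-adapted $\mathbb R^d$-valued processes $\psi$ with $\mathbb E\sup_{t\in[0,T]}|\psi_t|^p<\infty$.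
   Formalization: Measurability is added: along W_θ-continuous flows of measures, σ is Borel in t and b is progressively measurable in (ω,t) (without adaptedness of b no adapted solution need exist); the canonical space is replaced by any complete probability space carrying B^H and ℱ_0. *)

theory Defs
  imports "HOL-Probability.Probability"
begin

definition P_moment :: "real \<Rightarrow> ('b::euclidean_space) measure \<Rightarrow> bool" where
  "P_moment \<theta> \<mu> \<longleftrightarrow> prob_space \<mu> \<and> sets \<mu> = sets borel \<and>
     (\<integral>\<^sup>+ x. ennreal (norm x powr \<theta>) \<partial>\<mu>) < \<infinity>"

definition coupling :: "('b::euclidean_space) measure \<Rightarrow> 'b measure \<Rightarrow> ('b \<times> 'b) measure \<Rightarrow> bool" where
  "coupling \<mu> \<nu> \<pi> \<longleftrightarrow> prob_space \<pi> \<and> sets \<pi> = sets (borel \<Otimes>\<^sub>M borel) \<and>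
     distr \<pi> borel fst = \<mu> \<and> distr \<pi> borel snd = \<nu>"

definition wasserstein :: "real \<Rightarrow> ('b::euclidean_space) measure \<Rightarrow> 'b measure \<Rightarrow> real" where
  "wasserstein \<theta> \<mu> \<nu> =
     Inf {(\<integral> z. norm (fst z - snd z) powr \<theta> \<partial>\<pi>) powr (1 / \<theta>) | \<pi>. coupling \<mu> \<nu> \<pi>}"

definition R_H :: "real \<Rightarrow> real \<Rightarrow> real \<Rightarrow> real" where
  "R_H H t s = (t powr (2*H) + s powr (2*H) - \<bar>t - s\<bar> powr (2*H)) / 2"

definition gaussian_rv :: "'a measure \<Rightarrow> ('a \<Rightarrow> real) \<Rightarrow> bool" where
  "gaussian_rv M Y \<longleftrightarrow>
     (\<exists>m s. (s > 0 \<and> distributed M lborel Y (normal_density m s)) \<or> (AE \<omega> in M. Y \<omega> = m))"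

definition is_fBm :: "'a measure \<Rightarrow> real \<Rightarrow> real \<Rightarrow> (real \<Rightarrow> 'a \<Rightarrow> real^'d) \<Rightarrow> bool" where
  "is_fBm M H T B \<longleftrightarrow>
     (\<forall>t\<in>{0..T}. B t \<in> borel_measurable M) \<and>
     (\<forall>\<omega>\<in>space M. continuous_on {0..T} (\<lambda>t. B t \<omega>) \<and> B 0 \<omega> = 0) \<and>
     (\<forall>(n::nat) (ts::nat \<Rightarrow> real) (cs::nat \<Rightarrow> real^'d). (\<forall>k<n. ts k \<in> {0..T}) \<longrightarrow>
         gaussian_rv M (\<lambda>\<omega>. \<Sum>k<n. cs k \<bullet> B (ts k) \<omega>)) \<and>
     (\<forall>t\<in>{0..T}. \<forall>i. integrable M (\<lambda>\<omega>. B t \<omega> $ i) \<and> (\<integral>\<omega>. B t \<omega> $ i \<partial>M) = 0) \<and>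
     (\<forall>t\<in>{0..T}. \<forall>s\<in>{0..T}. \<forall>i j.
         (\<integral>\<omega>. B t \<omega> $ i * B s \<omega> $ j \<partial>M) = (if i = j then R_H H t s else 0))"

definition fbm_filtration :: "'a measure \<Rightarrow> 'a set set \<Rightarrow> (real \<Rightarrow> 'a \<Rightarrow> real^'d) \<Rightarrow> real \<Rightarrow> 'a measure" where
  "fbm_filtration M F0 B t = sigma (space M)
     (F0 \<union> {B s -` A \<inter> space M | s A. s \<in> {0..t} \<and> A \<in> sets borel} \<union> null_sets M)"

definition step_fun_integral ::
  "(real \<Rightarrow> 'a \<Rightarrow> real) \<Rightarrow> real \<Rightarrow> (real \<Rightarrow> real) \<Rightarrow> ('a \<Rightarrow> real) \<Rightarrow> bool" where
  "step_fun_integral \<beta> t f I \<longleftrightarrow>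
     (\<exists>(n::nat) (s::nat \<Rightarrow> real) (c::nat \<Rightarrow> real).
        s 0 \<ge> 0 \<and> s n \<le> t \<and> (\<forall>k<n. s k \<le> s (Suc k)) \<and>
        f = (\<lambda>u. \<Sum>k<n. c k * indicator {s k<..s (Suc k)} u) \<and>
        I = (\<lambda>\<omega>. \<Sum>k<n. c k * (\<beta> (s (Suc k)) \<omega> - \<beta> (s k) \<omega>)))"

definition absH_norm2 :: "real \<Rightarrow> real \<Rightarrow> (real \<Rightarrow> real) \<Rightarrow> ennreal" where
  "absH_norm2 H t h = (\<integral>\<^sup>+ u. \<integral>\<^sup>+ v. ennreal (\<bar>h u\<bar> * \<bar>h v\<bar> * \<bar>u - v\<bar> powr (2*H - 2)
        * indicator {0..t} u * indicator {0..t} v) \<partial>lborel \<partial>lborel)"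

definition is_wiener_integral ::
  "'a measure \<Rightarrow> (real \<Rightarrow> 'a \<Rightarrow> real) \<Rightarrow> real \<Rightarrow> real \<Rightarrow> (real \<Rightarrow> real) \<Rightarrow> ('a \<Rightarrow> real) \<Rightarrow> bool" where
  "is_wiener_integral M \<beta> H t g Y \<longleftrightarrow>
     Y \<in> borel_measurable M \<and> g \<in> borel_measurable (restrict_space borel {0..t}) \<and>
     (\<exists>fs Is. (\<forall>n. step_fun_integral \<beta> t (fs n) (Is n)) \<and>
        (\<lambda>n. absH_norm2 H t (\<lambda>u. g u - fs n u)) \<longlonglongrightarrow> 0 \<and>
        (\<lambda>n. \<integral>\<^sup>+ \<omega>. ennreal ((Is n \<omega> - Y \<omega>)\<^sup>2) \<partial>M) \<longlonglongrightarrow> 0)"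

definition in_Sp :: "'a measure \<Rightarrow> (real \<Rightarrow> 'a measure) \<Rightarrow> real \<Rightarrow> real \<Rightarrow> (real \<Rightarrow> 'a \<Rightarrow> real^'d) \<Rightarrow> bool" where
  "in_Sp M F T p X \<longleftrightarrow>
     (\<forall>\<omega>\<in>space M. continuous_on {0..T} (\<lambda>t. X t \<omega>)) \<and>
     (\<forall>t\<in>{0..T}. X t \<in> borel_measurable (F t)) \<and>
     (\<integral>\<^sup>+ \<omega>. (\<Squnion>t\<in>{0..T}. ennreal (norm (X t \<omega>) powr p)) \<partial>M) < \<infinity>"

definition law :: "'a measure \<Rightarrow> ('a \<Rightarrow> 'b::topological_space) \<Rightarrow> 'b measure" where
  "law M Z = distr M borel Z"

definition is_solution ::
  "'a measure \<Rightarrow> real \<Rightarrow> real \<Rightarrow> (real \<Rightarrow> 'a \<Rightarrow> real^'d) \<Rightarrow> ('a \<Rightarrow> real^'d)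
   \<Rightarrow> ('a \<Rightarrow> real \<Rightarrow> real^'d \<Rightarrow> (real^'d) measure \<Rightarrow> real^'d)
   \<Rightarrow> (real \<Rightarrow> (real^'d) measure \<Rightarrow> real^'d^'d) \<Rightarrow> (real \<Rightarrow> 'a \<Rightarrow> real^'d) \<Rightarrow> bool" where
  "is_solution M H T B \<xi> b \<sigma> X \<longleftrightarrow>
     (\<forall>t\<in>{0..T}. \<exists>Y :: 'd \<Rightarrow> 'd \<Rightarrow> 'a \<Rightarrow> real.
        (\<forall>i j. is_wiener_integral M (\<lambda>s \<omega>. B s \<omega> $ j) H t (\<lambda>s. \<sigma> s (law M (X s)) $ i $ j) (Y i j)) \<and>
        (AE \<omega> in M.
           set_integrable lborel {0..t} (\<lambda>s. b \<omega> s (X s \<omega>) (law M (X s))) \<and>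
           X t \<omega> = \<xi> \<omega> + (LINT s:{0..t}|lborel. b \<omega> s (X s \<omega>) (law M (X s)))
                   + (\<chi> i. \<Sum>j\<in>UNIV. Y i j \<omega>)))"

text \<open>Flows of measures in P_theta that are continuous for W_theta (e.g. laws of S^p processes).\<close>
definition W_continuous_flow :: "real \<Rightarrow> real \<Rightarrow> (real \<Rightarrow> ('b::euclidean_space) measure) \<Rightarrow> bool" where
  "W_continuous_flow \<theta> T m \<longleftrightarrow> (\<forall>t\<in>{0..T}. P_moment \<theta> (m t)) \<and>
     (\<forall>t\<in>{0..T}. ((\<lambda>s. wasserstein \<theta> (m s) (m t)) \<longlongrightarrow> 0) (at t within {0..T}))"

end

theory Submission
  imports Defs
begin

text \<open>
  Freezing the flow of laws \<open>s \<mapsto> \<L>(V\<^sub>s)\<close> turns the equation into a pathwise integral equation with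
  Lipschitz drift, driven by a continuous version of the Wiener integral of a bounded deterministic
  function. Two estimates drive the argument: for interval sums the second moment of the Wiener
  integral is at most a constant times the squared \<open>L\<^sup>2\<close> norm of the integrand, and Gaussianity upgrades
  this to all moments. Hence, if two frozen flows are at Wasserstein distance at most
  \<open>a exp (\<lambda> s)\<close>, the corresponding solutions differ by at most \<open>(a / 2) exp (\<lambda> t)\<close> in \<open>L\<close>-\<open>\<theta>\<close> norm once
  \<open>\<lambda>\<close> is large. So the map sending a process to the solution with its laws frozen is a contraction
  for an exponentially weighted norm: Picard iteration gives existence, and the contraction gives
  uniqueness of the laws, hence of the solution. Completeness of the Wasserstein space is never
  used, because the limit law is realised by an almost sure limit of the iterates.
\<close>

section \<open>Moments of sums and Kolmogorov continuity\<close>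

text \<open>The covariance of the increments is \<open>\<alpha>\<close> times the integral of the
  kernel |u - v| powr (2H - 2), integrable near the diagonal because H > 1/2; a Schur test then
  bounds the kernel norm by the L2 norm. The obstacle is that \<open>is_wiener_integral\<close> lets
  its step functions converge in the kernel norm of absolute values only, without a uniform bound on
  their size. The integrals inside an arbitrary solution must therefore be identified with
  constructed ones before any moment estimate applies to them. Time integrals of the weight gain a
  factor 1 / \<lambda>, in the drift as well as in the variance of the noise. The dependence of the
  drift on the unknown path is absorbed by iterating the weighted estimate from a crude a priori
  bound, which does the work of Gronwall's lemma. Moments of sums are split with factors such as 2
  powr \<theta>, which is where the powers of 2 in the rate come from.\<close>

lemma nn_integral_exp_le:
  fixes c t :: real
  assumes "c > 0" "t \<ge> 0"
  shows "(\<integral>\<^sup>+s. ennreal (exp (c * s)) * indicator {0..t} s \<partial>lborel) \<le> ennreal (exp (c * t) / c)"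
proof -
  have "has_bochner_integral lborel (\<lambda>s. exp (c * s) * indicator {0..t} s) (exp (c * t) / c - exp (c * 0) / c)"
    using assms
    by (intro has_bochner_integral_FTC_Icc_real) (auto intro!: derivative_eq_intros continuous_intros)
  then have "(\<integral>\<^sup>+s. ennreal (exp (c * s) * indicator {0..t} s) \<partial>lborel) = ennreal (exp (c * t) / c - exp (c * 0) / c)"
    by (intro nn_integral_eq_integral[THEN trans]) (auto simp: has_bochner_integral_iff)
  also have "\<dots> \<le> ennreal (exp (c * t) / c)"
    using assms by (intro ennreal_leI) auto
  finally show ?thesis
    by (simp add: ennreal_mult' ennreal_indicator)
qed

text \<open>The sum is at most the cardinality times its largest term, and the q-th power of that
  term is one of the summands on the right. The constant is not optimal, but it serves all q >= 0 at
  once.\<close>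

lemma powr_sum_le:
  fixes x :: "'i \<Rightarrow> real"
  assumes "finite A" "\<And>i. i \<in> A \<Longrightarrow> 0 \<le> x i" "q \<ge> 0"
  shows "(\<Sum>i\<in>A. x i) powr q \<le> real (card A) powr q * (\<Sum>i\<in>A. x i powr q)"
proof (cases "A = {}")
  case False
  define m where "m = Max (x ` A)"
  have m: "m \<in> x ` A" "\<And>i. i \<in> A \<Longrightarrow> x i \<le> m"
    using assms(1) False by (auto simp: m_def)
  then obtain j where j: "j \<in> A" "m = x j" by auto
  have "(\<Sum>i\<in>A. x i) \<le> real (card A) * m"
    using sum_bounded_above[of A x m] m(2) by simp
  then have "(\<Sum>i\<in>A. x i) powr q \<le> (real (card A) * m) powr q"
    using assms by (intro powr_mono2 sum_nonneg) auto
  also have "\<dots> = real (card A) powr q * x j powr q"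
    using j assms by (simp add: powr_mult)
  also have "\<dots> \<le> real (card A) powr q * (\<Sum>i\<in>A. x i powr q)"
    using j assms(1) by (intro mult_left_mono member_le_sum) auto
  finally show ?thesis .
qed simp

lemma powr_add_le:
  fixes x y :: real
  assumes "0 \<le> x" "0 \<le> y" "q \<ge> 0"
  shows "(x + y) powr q \<le> 2 powr q * (x powr q + y powr q)"
  using powr_sum_le[of "{True, False}" "\<lambda>b. if b then x else y" q] assms by simp

lemma powr_le_one_plus_power:
  fixes x q :: real
  assumes "0 \<le> x" "0 \<le> q" "q \<le> real n"
  shows "x powr q \<le> 1 + x ^ n"
proof (cases "x \<le> 1")
  case True
  then have "x powr q \<le> 1" using assms by (intro powr_le1) auto
  then show ?thesis using assms by (smt (verit) zero_le_power)
next
  case False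
  then have "x powr q \<le> x powr real n" using assms by (intro powr_mono) auto
  then show ?thesis using False by (simp add: powr_realpow)
qed

text \<open>Weighting the increments by \<open>r powr (- k / 2)\<close> bounds each of them by a geometric sequence
  times a single random variable, which replaces Minkowski's inequality for infinite sums.\<close>

definition chain_const :: "real \<Rightarrow> real \<Rightarrow> real" where
  "chain_const r q = (1 / (1 - r powr (1 / (2 * q)))) powr q / (1 - sqrt r)"

lemma chain_const_nonneg: "0 < r \<Longrightarrow> r < 1 \<Longrightarrow> 0 \<le> chain_const r q"
  by (simp add: chain_const_def)

lemma summable_increments_moment:
  fixes \<Delta> :: "nat \<Rightarrow> 'a \<Rightarrow> real"
  assumes [measurable]: "\<And>k. \<Delta> k \<in> borel_measurable M"
    and nonneg: "\<And>k \<omega>. 0 \<le> \<Delta> k \<omega>"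
    and q: "q > 0" and r: "0 < r" "r < 1" and C: "C \<ge> 0"
    and moment: "\<And>k. (\<integral>\<^sup>+\<omega>. ennreal (\<Delta> k \<omega> powr q) \<partial>M) \<le> ennreal (C * r ^ k)"
  obtains S where "S \<in> borel_measurable M" "\<And>\<omega>. 0 \<le> S \<omega>"
    "AE \<omega> in M. summable (\<lambda>k. \<Delta> k \<omega>) \<and> (\<Sum>k. \<Delta> k \<omega>) \<le> S \<omega>"
    "(\<integral>\<^sup>+\<omega>. ennreal (S \<omega> powr q) \<partial>M) \<le> ennreal (C * chain_const r q)"
proof -
  \<comment> \<open>Half of the decay r^k pays for the convergence of the expectation of
    \<open>Y\<close>; the other half, through s powr q = sqrt r, is the decay left to the single
    increments.\<close>
  define s where "s = r powr (1 / (2 * q))"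
  have s: "0 < s" "s < 1"
    using r q powr_less_mono2[of "1 / (2*q)" r 1] by (auto simp: s_def)
  have sq: "s powr q = sqrt r"
    using r q by (simp add: s_def powr_powr powr_half_sqrt)
  define Y where "Y \<omega> = (\<Sum>k. ennreal (\<Delta> k \<omega> powr q / sqrt r ^ k))" for \<omega>
  have [measurable]: "Y \<in> borel_measurable M" unfolding Y_def by measurable
  have sr: "0 < sqrt r" "sqrt r < 1" using r by auto
  have "(\<integral>\<^sup>+\<omega>. Y \<omega> \<partial>M) = (\<Sum>k. \<integral>\<^sup>+\<omega>. ennreal (\<Delta> k \<omega> powr q / sqrt r ^ k) \<partial>M)"
    unfolding Y_def by (intro nn_integral_suminf) measurable
  also have "\<dots> \<le> (\<Sum>k. ennreal (C * sqrt r ^ k))"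
  proof (intro suminf_le summableI allI)
    fix k
    have "(\<integral>\<^sup>+\<omega>. ennreal (\<Delta> k \<omega> powr q / sqrt r ^ k) \<partial>M) =
        (\<integral>\<^sup>+\<omega>. ennreal (1 / sqrt r ^ k) * ennreal (\<Delta> k \<omega> powr q) \<partial>M)"
      using sr by (intro nn_integral_cong) (simp add: ennreal_mult'[symmetric])
    also have "\<dots> = ennreal (1 / sqrt r ^ k) * (\<integral>\<^sup>+\<omega>. ennreal (\<Delta> k \<omega> powr q) \<partial>M)"
      by (intro nn_integral_cmult) measurable
    also have "\<dots> \<le> ennreal (1 / sqrt r ^ k) * ennreal (C * r ^ k)"
      by (intro mult_left_mono moment) auto
    also have "\<dots> = ennreal (C * (r ^ k / sqrt r ^ k))"
      using sr by (subst ennreal_mult'[symmetric]) auto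
    also have "r ^ k / sqrt r ^ k = sqrt r ^ k"
      using r by (simp add: power_divide[symmetric] real_div_sqrt)
    finally show "(\<integral>\<^sup>+\<omega>. ennreal (\<Delta> k \<omega> powr q / sqrt r ^ k) \<partial>M) \<le> ennreal (C * sqrt r ^ k)" .
  qed
  also have "\<dots> = ennreal (C / (1 - sqrt r))"
    using sr C sums_mult[OF geometric_sums[of "sqrt r"], of C]
    by (intro suminf_ennreal_eq) auto
  finally have Yint: "(\<integral>\<^sup>+\<omega>. Y \<omega> \<partial>M) \<le> ennreal (C / (1 - sqrt r))" .
  \<comment> \<open>Each weighted power is at most \<open>Y\<close>, so the k-th increment is at
    most s^k times Y powr (1/q), and \<open>S\<close> is the sum of this geometric series.
    \<open>enn2real\<close> sends the value infinity to 0, which happens on a null set only.\<close>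
  define S where "S \<omega> = enn2real (Y \<omega>) powr (1 / q) / (1 - s)" for \<omega>
  have "S \<in> borel_measurable M" unfolding S_def by measurable
  moreover have "0 \<le> S \<omega>" for \<omega> using s by (simp add: S_def)
  moreover have "AE \<omega> in M. summable (\<lambda>k. \<Delta> k \<omega>) \<and> (\<Sum>k. \<Delta> k \<omega>) \<le> S \<omega>"
  proof -
    have "AE \<omega> in M. Y \<omega> \<noteq> \<infinity>"
      using Yint by (intro nn_integral_PInf_AE) (auto simp: top_unique)
    then show ?thesis
    proof eventually_elim
      case (elim \<omega>)
      have le: "\<Delta> k \<omega> \<le> s ^ k * enn2real (Y \<omega>) powr (1 / q)" for k
      proof -
        have "ennreal (\<Delta> k \<omega> powr q / sqrt r ^ k) \<le> Y \<omega>"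
          unfolding Y_def using sum_le_suminf[of "\<lambda>k. ennreal (\<Delta> k \<omega> powr q / sqrt r ^ k)" "{k}"] by simp
        also have "Y \<omega> = ennreal (enn2real (Y \<omega>))" using elim by (simp add: less_top)
        finally have "\<Delta> k \<omega> powr q / sqrt r ^ k \<le> enn2real (Y \<omega>)" by simp
        then have "\<Delta> k \<omega> powr q \<le> sqrt r ^ k * enn2real (Y \<omega>)"
          using sr by (simp add: field_simps)
        then have "(\<Delta> k \<omega> powr q) powr (1/q) \<le> (sqrt r ^ k * enn2real (Y \<omega>)) powr (1/q)"
          using q by (intro powr_mono2) auto
        also have "(\<Delta> k \<omega> powr q) powr (1/q) = \<Delta> k \<omega>"
          using q nonneg by (simp add: powr_powr)
        also have "(sqrt r ^ k * enn2real (Y \<omega>)) powr (1/q) = (sqrt r ^ k) powr (1/q) * enn2real (Y \<omega>) powr (1/q)"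
          using sr by (simp add: powr_mult)
        also have "(sqrt r ^ k) powr (1/q) = s ^ k"
          unfolding sq[symmetric] using s q by (simp add: powr_powr powr_realpow[symmetric] powr_power)
        finally show ?thesis .
      qed
      have geo: "(\<lambda>k. s ^ k * enn2real (Y \<omega>) powr (1 / q)) sums (S \<omega>)"
        using sums_mult2[OF geometric_sums[of s], of "enn2real (Y \<omega>) powr (1 / q)"] s
        by (simp add: S_def)
      have "summable (\<lambda>k. \<Delta> k \<omega>)"
        using le nonneg by (intro summable_comparison_test'[OF sums_summable[OF geo], of 0]) auto
      then show ?case
        using suminf_le[OF le _ sums_summable[OF geo]] sums_unique[OF geo] by simp
    qed
  qed
  moreover have "(\<integral>\<^sup>+\<omega>. ennreal (S \<omega> powr q) \<partial>M) \<le> ennreal (C * chain_const r q)"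
  proof -
    have "(\<integral>\<^sup>+\<omega>. ennreal (S \<omega> powr q) \<partial>M) \<le> (\<integral>\<^sup>+\<omega>. ennreal ((1 / (1 - s)) powr q) * Y \<omega> \<partial>M)"
    proof (rule nn_integral_mono)
      fix \<omega>
      have "S \<omega> powr q = (1 / (1 - s)) powr q * enn2real (Y \<omega>)"
        unfolding S_def using s q by (simp add: powr_divide powr_powr)
      then have "ennreal (S \<omega> powr q) = ennreal ((1 / (1 - s)) powr q) * ennreal (enn2real (Y \<omega>))"
        by (simp add: ennreal_mult)
      also have "\<dots> \<le> ennreal ((1 / (1 - s)) powr q) * Y \<omega>"
        by (intro mult_left_mono) (auto simp: ennreal_enn2real_if)
      finally show "ennreal (S \<omega> powr q) \<le> ennreal ((1 / (1 - s)) powr q) * Y \<omega>" .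
    qed
    also have "\<dots> = ennreal ((1 / (1 - s)) powr q) * (\<integral>\<^sup>+\<omega>. Y \<omega> \<partial>M)"
      by (intro nn_integral_cmult) measurable
    also have "\<dots> \<le> ennreal ((1 / (1 - s)) powr q) * ennreal (C / (1 - sqrt r))"
      by (intro mult_left_mono Yint) auto
    also have "\<dots> = ennreal (C * chain_const r q)"
      by (subst ennreal_mult'[symmetric]) (auto simp: chain_const_def s_def mult.commute)
    finally show ?thesis .
  qed
  ultimately show ?thesis by (rule that)
qed

text \<open>Telescoping: the increments form an absolutely convergent series. The tail bound for
  \<open>lim a - a k\<close> is the rate of convergence used for the Kolmogorov chaining, for the
  Wiener sums, for the pathwise Picard iterates and for the iteration of the laws.\<close>

lemma convergent_of_summable_increments:
  fixes a :: "nat \<Rightarrow> 'b::banach"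
  assumes d: "summable d" and le: "\<And>k. norm (a (Suc k) - a k) \<le> d k"
  shows "a \<longlonglongrightarrow> lim a" "norm (lim a - a k) \<le> (\<Sum>j. d (j + k))"
proof -
  have sd: "summable (\<lambda>k. a (Suc k) - a k)"
    using le by (intro summable_comparison_test'[OF d, of 0]) auto
  have "(\<lambda>n. a 0 + (\<Sum>k<n. a (Suc k) - a k)) \<longlonglongrightarrow> a 0 + (\<Sum>k. a (Suc k) - a k)"
    by (intro tendsto_add tendsto_const summable_LIMSEQ sd)
  then have "convergent a"
    by (auto simp: sum_lessThan_telescope convergent_def)
  then show *: "a \<longlonglongrightarrow> lim a" by (simp add: convergent_LIMSEQ_iff)
  have "(\<lambda>n. a (n + k) - a (0 + k)) \<longlonglongrightarrow> lim a - a k"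
    using LIMSEQ_ignore_initial_segment[OF *, of k] by (auto intro!: tendsto_eq_intros)
  moreover have "a (n + k) - a (0 + k) = (\<Sum>j<n. a (Suc (j + k)) - a (j + k))" for n
    using sum_lessThan_telescope[of "\<lambda>j. a (j + k)" n] by simp
  ultimately have "(\<lambda>j. a (Suc (j + k)) - a (j + k)) sums (lim a - a k)"
    by (simp add: sums_def)
  moreover have "summable (\<lambda>j. d (j + k))"
    using d by (simp add: summable_iff_shift)
  ultimately show "norm (lim a - a k) \<le> (\<Sum>j. d (j + k))"
    using norm_suminf_le[of "\<lambda>j. a (Suc (j + k)) - a (j + k)" "\<lambda>j. d (j + k)"] le
    by (auto dest!: sums_unique)
qed

text \<open>Chaining along dyadic grids. \<open>\<Delta> k\<close> is the l^q norm of the increments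
  of \<open>Z\<close> between neighbours of level k, hence an upper bound for each of them; its q-th
  moment adds up 2^k terms of order 2 powr (- k (1 + \<beta>)) and so decays like 2 powr (- k
  \<beta>). The version is continuous for every outcome and bounded in time by one random variable
  \<open>S\<close>, which later gives the integrability of the supremum.\<close>

theorem kolmogorov_continuity:
  fixes Z :: "real \<Rightarrow> 'a \<Rightarrow> real"
  assumes T: "T > 0" and q: "q > 0" and \<beta>: "\<beta> > 0" and C: "C \<ge> 0"
    and meas: "\<And>t. t \<in> {0..T} \<Longrightarrow> Z t \<in> borel_measurable M"
    and Z0: "AE \<omega> in M. Z 0 \<omega> = 0"
    and incr: "\<And>s t. s \<in> {0..T} \<Longrightarrow> t \<in> {0..T} \<Longrightarrow>
      (\<integral>\<^sup>+\<omega>. ennreal (\<bar>Z t \<omega> - Z s \<omega>\<bar> powr q) \<partial>M) \<le> ennreal (C * \<bar>t - s\<bar> powr (1 + \<beta>))"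
  obtains Z' S where "\<And>\<omega>. continuous_on {0..T} (\<lambda>t. Z' t \<omega>)"
    "\<And>t. t \<in> {0..T} \<Longrightarrow> AE \<omega> in M. Z' t \<omega> = Z t \<omega>"
    "S \<in> borel_measurable M" "\<And>t \<omega>. t \<in> {0..T} \<Longrightarrow> \<bar>Z' t \<omega>\<bar> \<le> S \<omega>"
    "(\<integral>\<^sup>+\<omega>. ennreal (S \<omega> powr q) \<partial>M) < \<infinity>"
proof -
  define gp where "gp k j = real j * T / 2 ^ k" for k j :: nat
  \<comment> \<open>Index of the last grid point of level k that is not after t; at t = T it is 2^k,
    the end of the grid.\<close>
  define idx where "idx k t = nat \<lfloor>t * 2 ^ k / T\<rfloor>" for k :: nat and t
  define Zk where "Zk k t = Z (gp k (idx k t))" for k t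
  define \<Delta> where "\<Delta> k \<omega> = (\<Sum>j<2^k. \<bar>Z (gp k (Suc j)) \<omega> - Z (gp k j) \<omega>\<bar> powr q) powr (1 / q)"
    for k and \<omega>
  have gp_in: "gp k j \<in> {0..T}" if "j \<le> 2 ^ k" for k j
  proof -
    have "real j \<le> 2 ^ k" using that by (metis of_nat_le_iff of_nat_numeral of_nat_power)
    then show ?thesis using T by (auto simp: gp_def field_simps)
  qed
  have idx_le: "idx k t \<le> 2 ^ k" if "t \<in> {0..T}" for k t
  proof -
    have "t * 2 ^ k / T \<le> 2 ^ k" using that T by (auto simp: field_simps)
    then have "\<lfloor>t * 2 ^ k / T\<rfloor> \<le> 2 ^ k"
      by (metis floor_mono floor_of_int of_int_numeral of_int_power)
    then show ?thesis unfolding idx_def by (simp add: nat_le_iff)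
  qed
  have idx_bounds: "real (idx k t) \<le> t * 2 ^ k / T" "t * 2 ^ k / T < real (idx k t) + 1"
    if "t \<in> {0..T}" for k t
  proof -
    have "0 \<le> \<lfloor>t * 2 ^ k / T\<rfloor>" using that T by auto
    then show "real (idx k t) \<le> t * 2 ^ k / T" "t * 2 ^ k / T < real (idx k t) + 1"
      unfolding idx_def by (simp_all add: of_nat_nat) 
  qed
  have gp_idx: "gp k (idx k t) \<le> t" "t < gp k (idx k t) + T / 2 ^ k" if "t \<in> {0..T}" for k t
    using idx_bounds[OF that, of k] T by (auto simp: gp_def field_simps)
  have step_le: "\<bar>Z (gp k (Suc j)) \<omega> - Z (gp k j) \<omega>\<bar> \<le> \<Delta> k \<omega>" if "j < 2 ^ k" for k j \<omega>
  proof -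
    have "\<bar>Z (gp k (Suc j)) \<omega> - Z (gp k j) \<omega>\<bar> = (\<bar>Z (gp k (Suc j)) \<omega> - Z (gp k j) \<omega>\<bar> powr q) powr (1/q)"
      using q by (simp add: powr_powr)
    also have "\<dots> \<le> \<Delta> k \<omega>"
      unfolding \<Delta>_def using that q by (intro powr_mono2 member_le_sum) auto
    finally show ?thesis .
  qed
  have [measurable]: "\<Delta> k \<in> borel_measurable M" for k
  proof -
    have "Z (gp k (Suc j)) \<in> borel_measurable M" "Z (gp k j) \<in> borel_measurable M" if "j \<in> {..<2^k}" for j
      using that by (auto intro!: meas gp_in)
    then show ?thesis unfolding \<Delta>_def by measurable
  qed
  have \<Delta>_nonneg: "0 \<le> \<Delta> k \<omega>" for k \<omega> by (simp add: \<Delta>_def)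
  define r where "r = (2::real) powr (- \<beta>)"
  have r: "0 < r" "r < 1" using \<beta> powr_less_mono[of "-\<beta>" 0 2] by (auto simp: r_def)
  have moment: "(\<integral>\<^sup>+\<omega>. ennreal (\<Delta> k \<omega> powr q) \<partial>M) \<le> ennreal (C * T powr (1+\<beta>) * r ^ k)" for k
  proof -
    have m: "Z (gp k (Suc j)) \<in> borel_measurable M" "Z (gp k j) \<in> borel_measurable M" if "j \<in> {..<2^k}" for j
      using that by (auto intro!: meas gp_in)
    have "(\<integral>\<^sup>+\<omega>. ennreal (\<Delta> k \<omega> powr q) \<partial>M)
        = (\<integral>\<^sup>+\<omega>. (\<Sum>j<2^k. ennreal (\<bar>Z (gp k (Suc j)) \<omega> - Z (gp k j) \<omega>\<bar> powr q)) \<partial>M)"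
      using q unfolding \<Delta>_def by (intro nn_integral_cong) (simp add: powr_powr sum_nonneg)
    also have "\<dots> = (\<Sum>j<2^k. \<integral>\<^sup>+\<omega>. ennreal (\<bar>Z (gp k (Suc j)) \<omega> - Z (gp k j) \<omega>\<bar> powr q) \<partial>M)"
    proof (intro nn_integral_sum)
      fix j :: nat assume "j \<in> {..<2^k}"
      from m[OF this]
      show "(\<lambda>\<omega>. ennreal (\<bar>Z (gp k (Suc j)) \<omega> - Z (gp k j) \<omega>\<bar> powr q)) \<in> borel_measurable M"
        by measurable
    qed
    also have "\<dots> \<le> (\<Sum>j<(2::nat)^k. ennreal (C * (T / 2 ^ k) powr (1 + \<beta>)))"
    proof (intro sum_mono)
      fix j :: nat assume j: "j \<in> {..<2^k}"
      have "\<bar>gp k (Suc j) - gp k j\<bar> = T / 2 ^ k"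
        using T by (simp add: gp_def field_simps)
      then show "(\<integral>\<^sup>+\<omega>. ennreal (\<bar>Z (gp k (Suc j)) \<omega> - Z (gp k j) \<omega>\<bar> powr q) \<partial>M)
          \<le> ennreal (C * (T / 2 ^ k) powr (1 + \<beta>))"
        using incr[of "gp k j" "gp k (Suc j)"] gp_in[of j k] gp_in[of "Suc j" k] j by auto
    qed
    also have "\<dots> = ennreal (2 ^ k * (C * (T / 2 ^ k) powr (1 + \<beta>)))"
      using C ennreal_power[of 2 k] by (simp add: ennreal_mult)
    also have "2 ^ k * (C * (T / 2 ^ k) powr (1 + \<beta>)) = C * T powr (1+\<beta>) * r ^ k"
    proof -
      have "(2 ^ k :: real) powr (1 + \<beta>) = 2 ^ k * (2 powr \<beta>) ^ k"
        by (simp add: powr_add powr_realpow[symmetric] powr_powr mult.commute)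
      moreover have "r ^ k = 1 / (2 powr \<beta>) ^ k"
        by (simp add: r_def powr_minus power_inverse inverse_eq_divide power_one_over)
      ultimately show ?thesis using T by (simp add: powr_divide)
    qed
    finally show ?thesis .
  qed
  obtain S where S: "S \<in> borel_measurable M" "\<And>\<omega>. 0 \<le> S \<omega>"
    "AE \<omega> in M. summable (\<lambda>k. \<Delta> k \<omega>) \<and> (\<Sum>k. \<Delta> k \<omega>) \<le> S \<omega>"
    "(\<integral>\<^sup>+\<omega>. ennreal (S \<omega> powr q) \<partial>M) \<le> ennreal (C * T powr (1+\<beta>) * chain_const r q)"
    by (rule summable_increments_moment[of \<Delta> M q r "C * T powr (1+\<beta>)",
          OF _ \<Delta>_nonneg q r _ moment]) (use C in auto)
  \<comment> \<open>\<open>S\<close> controls increments only, so the chain must start from a known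
    value: hence \<open>Z 0 \<omega> = 0\<close> is part of the good event. Off this event
    \<open>Z'\<close> is 0, which keeps continuity and the bound by \<open>S\<close> true for every
    outcome.\<close>
  define good where "good \<omega> \<longleftrightarrow> Z 0 \<omega> = 0 \<and> summable (\<lambda>k. \<Delta> k \<omega>) \<and> (\<Sum>k. \<Delta> k \<omega>) \<le> S \<omega>" for \<omega>
  define Z' where "Z' t \<omega> = (if good \<omega> then lim (\<lambda>k. Zk k t \<omega>) else 0)" for t \<omega>
  \<comment> \<open>Halving the mesh moves the left grid point either not at all or by one cell of
    level k + 1, so one increment of the finer level suffices.\<close>
  have Zk_step: "\<bar>Zk (Suc k) t \<omega> - Zk k t \<omega>\<bar> \<le> \<Delta> (Suc k) \<omega>" if t: "t \<in> {0..T}" for k t \<omega>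
  proof -
    have eq: "gp k j = gp (Suc k) (2 * j)" for j by (simp add: gp_def)
    have "t * 2 ^ Suc k / T = 2 * (t * 2 ^ k / T)" by simp
    then have "real (2 * idx k t) < real (idx (Suc k) t + 1)" "real (idx (Suc k) t) < real (2 * idx k t + 2)"
      using idx_bounds[OF t, of k] idx_bounds[OF t, of "Suc k"]
      unfolding of_nat_add of_nat_mult by linarith+
    then have "idx (Suc k) t = 2 * idx k t \<or> idx (Suc k) t = Suc (2 * idx k t)"
      unfolding of_nat_less_iff by linarith
    then show ?thesis
    proof
      assume "idx (Suc k) t = Suc (2 * idx k t)"
      then show ?thesis
        using idx_le[OF t, of "Suc k"] step_le[of "2 * idx k t" "Suc k" \<omega>] by (simp add: Zk_def eq)
    qed (simp add: Zk_def eq \<Delta>_nonneg)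
  qed
  \<comment> \<open>Two times at most one mesh width apart lie in the same cell or in neighbouring
    ones, so again one increment suffices. Together with the tail bound this gives the modulus of
    continuity of the limit.\<close>
  have Zk_mod: "\<bar>Zk k t \<omega> - Zk k s \<omega>\<bar> \<le> \<Delta> k \<omega>"
    if st: "s \<in> {0..T}" "t \<in> {0..T}" "s \<le> t" "t - s \<le> T / 2 ^ k" for s t k \<omega>
  proof -
    have "s * 2 ^ k / T \<le> t * 2 ^ k / T" "t * 2 ^ k / T \<le> s * 2 ^ k / T + 1"
      using st T by (auto simp: field_simps)
    then have "real (idx k s) < real (idx k t + 1)" "real (idx k t) < real (idx k s + 2)"
      using idx_bounds[OF st(1), of k] idx_bounds[OF st(2), of k] by linarith+
    then have "idx k t = idx k s \<or> idx k t = Suc (idx k s)"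
      unfolding of_nat_less_iff by linarith
    then show ?thesis
    proof
      assume "idx k t = Suc (idx k s)"
      then show ?thesis
        using idx_le[OF st(2), of k] step_le[of "idx k s" k \<omega>] by (simp add: Zk_def)
    qed (simp add: Zk_def \<Delta>_nonneg)
  qed
  have conv: "(\<lambda>k. Zk k t \<omega>) \<longlonglongrightarrow> Z' t \<omega>"
      "\<bar>Z' t \<omega> - Zk k t \<omega>\<bar> \<le> (\<Sum>j. \<Delta> (Suc (j + k)) \<omega>)"
    if t: "t \<in> {0..T}" and good: "good \<omega>" for t \<omega> k
  proof -
    have sm: "summable (\<lambda>k. \<Delta> (Suc k) \<omega>)"
      using good unfolding good_def by (subst summable_Suc_iff) auto
    have le: "norm (Zk (Suc k) t \<omega> - Zk k t \<omega>) \<le> \<Delta> (Suc k) \<omega>" for k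
      using Zk_step[OF t] by simp
    show "(\<lambda>k. Zk k t \<omega>) \<longlonglongrightarrow> Z' t \<omega>" "\<bar>Z' t \<omega> - Zk k t \<omega>\<bar> \<le> (\<Sum>j. \<Delta> (Suc (j + k)) \<omega>)"
      using convergent_of_summable_increments[of "\<lambda>k. \<Delta> (Suc k) \<omega>" "\<lambda>k. Zk k t \<omega>", OF sm le] good
      by (simp_all add: Z'_def)
  qed
  show ?thesis
  proof (rule that[of Z' S])
    fix \<omega>
    show "continuous_on {0..T} (\<lambda>t. Z' t \<omega>)"
    proof (cases "good \<omega>")
      case True
      then have sm: "summable (\<lambda>k. \<Delta> k \<omega>)" by (simp add: good_def)
      have lim0: "(\<lambda>k. 2 * (\<Sum>j. \<Delta> (Suc (j + k)) \<omega>) + \<Delta> k \<omega>) \<longlonglongrightarrow> 2 * 0 + 0"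
      proof (rule tendsto_add[OF tendsto_mult[OF tendsto_const] summable_LIMSEQ_zero[OF sm]])
        have "summable (\<lambda>k. \<Delta> (Suc k) \<omega>)" using sm by (subst summable_Suc_iff)
        from suminf_exist_split2[OF this] show "(\<lambda>k. \<Sum>j. \<Delta> (Suc (j + k)) \<omega>) \<longlonglongrightarrow> 0"
          by simp
      qed
      show ?thesis unfolding continuous_on_iff
      proof (intro ballI allI impI)
        fix x e :: real assume x: "x \<in> {0..T}" and e: "e > 0"
        from lim0 e have "\<forall>\<^sub>F k in sequentially. 2 * (\<Sum>j. \<Delta> (Suc (j + k)) \<omega>) + \<Delta> k \<omega> < e"
          by (intro order_tendstoD) auto
        then obtain k where k: "2 * (\<Sum>j. \<Delta> (Suc (j + k)) \<omega>) + \<Delta> k \<omega> < e"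
          by (auto simp: eventually_sequentially)
        have "dist (Z' y \<omega>) (Z' x \<omega>) < e" if y: "y \<in> {0..T}" "dist y x < T / 2 ^ k" for y
        proof -
          have "\<bar>Zk k y \<omega> - Zk k x \<omega>\<bar> \<le> \<Delta> k \<omega>"
            using Zk_mod[of x y k \<omega>] Zk_mod[of y x k \<omega>] x y by (cases "x \<le> y") (auto simp: dist_real_def)
          then show ?thesis
            using conv(2)[OF x True, of k] conv(2)[OF y(1) True, of k] k by (simp add: dist_real_def)
        qed
        then show "\<exists>d>0. \<forall>y\<in>{0..T}. dist y x < d \<longrightarrow> dist (Z' y \<omega>) (Z' x \<omega>) < e"
          using T by (intro exI[of _ "T / 2 ^ k"]) auto
      qed
    qed (simp add: Z'_def)
  next
    fix t assume t: "t \<in> {0..T}"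
    have [measurable]: "Zk k t \<in> borel_measurable M" "Z t \<in> borel_measurable M" for k
      unfolding Zk_def using t by (auto intro!: meas gp_in idx_le)
    \<comment> \<open>On the good event the values at the left grid points converge to
      \<open>Z'\<close>. Their moments of difference from \<open>Z t\<close> tend to 0, as the left
      grid points approach t, so by Fatou the limit is also \<open>Z t\<close>.\<close>
    have AEgood: "AE \<omega> in M. good \<omega>"
      using S(3) Z0 by eventually_elim (auto simp: good_def)
    have "(\<integral>\<^sup>+\<omega>. liminf (\<lambda>k. ennreal (\<bar>Z t \<omega> - Zk k t \<omega>\<bar> powr q)) \<partial>M)
       \<le> liminf (\<lambda>k. \<integral>\<^sup>+\<omega>. ennreal (\<bar>Z t \<omega> - Zk k t \<omega>\<bar> powr q) \<partial>M)"
      by (intro nn_integral_liminf) measurable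
    also have "\<dots> \<le> liminf (\<lambda>k. ennreal (C * (T / 2 ^ k) powr (1 + \<beta>)))"
    proof (intro Liminf_mono always_eventually allI)
      fix k
      have "(\<integral>\<^sup>+\<omega>. ennreal (\<bar>Z t \<omega> - Zk k t \<omega>\<bar> powr q) \<partial>M)
          \<le> ennreal (C * \<bar>t - gp k (idx k t)\<bar> powr (1 + \<beta>))"
        unfolding Zk_def using t by (intro incr gp_in idx_le)
      also have "\<dots> \<le> ennreal (C * (T / 2 ^ k) powr (1 + \<beta>))"
        using gp_idx[OF t, of k] C \<beta> by (intro ennreal_leI mult_left_mono powr_mono2) auto
      finally show "(\<integral>\<^sup>+\<omega>. ennreal (\<bar>Z t \<omega> - Zk k t \<omega>\<bar> powr q) \<partial>M) \<le> ennreal (C * (T / 2 ^ k) powr (1 + \<beta>))" .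
    qed
    also have "\<dots> = ennreal 0"
    proof (intro lim_imp_Liminf tendsto_ennrealI)
      have "(\<lambda>k. T / 2 ^ k) \<longlonglongrightarrow> 0"
        by (intro LIMSEQ_divide_realpow_zero) auto
      then have "(\<lambda>k. C * (T / 2 ^ k) powr (1 + \<beta>)) \<longlonglongrightarrow> C * 0 powr (1 + \<beta>)"
        using \<beta> T by (intro tendsto_intros tendsto_powr2) (auto intro!: always_eventually)
      then show "(\<lambda>k. C * (T / 2 ^ k) powr (1 + \<beta>)) \<longlonglongrightarrow> 0" by simp
    qed simp
    finally have "(\<integral>\<^sup>+\<omega>. liminf (\<lambda>k. ennreal (\<bar>Z t \<omega> - Zk k t \<omega>\<bar> powr q)) \<partial>M) = 0"
      by simp
    then have "AE \<omega> in M. liminf (\<lambda>k. ennreal (\<bar>Z t \<omega> - Zk k t \<omega>\<bar> powr q)) = 0"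
      by (subst (asm) nn_integral_0_iff_AE) measurable
    with AEgood show "AE \<omega> in M. Z' t \<omega> = Z t \<omega>"
    proof eventually_elim
      case (elim \<omega>)
      have "(\<lambda>k. \<bar>Z t \<omega> - Zk k t \<omega>\<bar> powr q) \<longlonglongrightarrow> \<bar>Z t \<omega> - Z' t \<omega>\<bar> powr q"
        using q by (intro tendsto_powr2 tendsto_intros conv t elim) auto
      then have "liminf (\<lambda>k. ennreal (\<bar>Z t \<omega> - Zk k t \<omega>\<bar> powr q)) = ennreal (\<bar>Z t \<omega> - Z' t \<omega>\<bar> powr q)"
        by (intro lim_imp_Liminf tendsto_ennrealI) auto
      with elim have "\<bar>Z t \<omega> - Z' t \<omega>\<bar> powr q = 0" by (simp add: ennreal_eq_0_iff)
      then show ?case by simp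
    qed
  next
    fix t \<omega> assume t: "t \<in> {0..T}"
    show "\<bar>Z' t \<omega>\<bar> \<le> S \<omega>"
    proof (cases "good \<omega>")
      case True
      then have sm: "summable (\<lambda>k. \<Delta> k \<omega>)" and Z00: "Z 0 \<omega> = 0" and le: "(\<Sum>k. \<Delta> k \<omega>) \<le> S \<omega>"
        by (auto simp: good_def)
      \<comment> \<open>At level 0 the grid consists of 0 and T only, and \<open>\<Delta> 0\<close>
        covers the step between them.\<close>
      have "Zk 0 0 \<omega> = 0" using Z00 by (simp add: Zk_def idx_def gp_def)
      then have "\<bar>Zk 0 t \<omega>\<bar> \<le> \<Delta> 0 \<omega>"
        using Zk_mod[of 0 t 0 \<omega>] t T by auto
      then have "\<bar>Z' t \<omega>\<bar> \<le> \<Delta> 0 \<omega> + (\<Sum>j. \<Delta> (Suc j) \<omega>)"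
        using conv(2)[OF t True, of 0] by simp
      also have "\<dots> = (\<Sum>k. \<Delta> k \<omega>)"
        using suminf_split_head[OF sm] by simp
      finally show ?thesis using le by simp
    qed (simp add: Z'_def S)
  qed (use S(1,4) in \<open>auto intro: le_less_trans\<close>)
qed

section \<open>Covariance of increments\<close>

text \<open>The exceptional points allow the kernel to be integrated across its singularity on the
  diagonal; the half-open interval fits the indicators of step functions.\<close>

lemma nn_integral_FTC_finite_exceptions:
  fixes f F :: "real \<Rightarrow> real"
  assumes [measurable]: "f \<in> borel_measurable borel" and nonneg: "\<And>x. 0 \<le> f x"
    and ab: "a \<le> b" and S: "finite S" and cont: "continuous_on {a..b} F"
    and deriv: "\<And>x. x \<notin> S \<Longrightarrow> (F has_real_derivative f x) (at x)"
  shows "(\<integral>\<^sup>+x. ennreal (f x) * indicator {a<..b} x \<partial>lborel) = ennreal (F b - F a)"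
proof -
  have "(f has_integral (F b - F a)) {a..b}"
    using deriv by (intro fundamental_theorem_of_calculus_strong[OF S ab _ cont])
      (auto simp: has_real_derivative_iff_has_vector_derivative)
  then have "((\<lambda>x. f x * indicator {a..b} x) has_integral (F b - F a)) UNIV"
    by (subst (asm) has_integral_restrict_UNIV[symmetric])
       (simp add: indicator_def of_bool_def if_distrib[of "(*) _"] cong: if_cong)
  then have "(\<integral>\<^sup>+x. ennreal (f x * indicator {a..b} x) \<partial>lborel) = ennreal (F b - F a)"
    by (intro nn_integral_has_integral_lborel) (auto simp: nonneg)
  moreover have "(\<integral>\<^sup>+x. ennreal (f x) * indicator {a<..b} x \<partial>lborel) = (\<integral>\<^sup>+x. ennreal (f x * indicator {a..b} x) \<partial>lborel)"
    using AE_lborel_singleton[of a]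
    by (intro nn_integral_cong_AE) (auto elim!: eventually_mono simp: indicator_def)
  ultimately show ?thesis by simp
qed

text \<open>This is the sign of x times |x| powr a, an antiderivative of a |x| powr (a - 1) on both
  sides of 0 and continuous through 0 for a > 0. The form with \<open>max\<close> makes continuity
  and measurability immediate.\<close>

definition signed_powr :: "real \<Rightarrow> real \<Rightarrow> real" where
  "signed_powr a x = max x 0 powr a - max (- x) 0 powr a"

lemma continuous_on_signed_powr [continuous_intros]:
  "a > 0 \<Longrightarrow> continuous_on S f \<Longrightarrow> continuous_on S (\<lambda>x. signed_powr a (f x))"
  unfolding signed_powr_def by (intro continuous_intros continuous_on_powr') auto

lemma borel_measurable_signed_powr [measurable]: "signed_powr a \<in> borel_measurable borel"
  unfolding signed_powr_def[abs_def] by measurable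

lemma has_real_derivative_signed_powr:
  assumes "x \<noteq> 0"
  shows "(signed_powr a has_real_derivative a * \<bar>x\<bar> powr (a - 1)) (at x)"
proof (cases "x > 0")
  case True
  have "((\<lambda>x. x powr a) has_real_derivative a * \<bar>x\<bar> powr (a - 1)) (at x)"
    using True by (auto intro!: derivative_eq_intros)
  then show ?thesis
    by (rule has_field_derivative_transform_within_open[of _ _ _ "{0<..}"]) (use True in \<open>auto simp: signed_powr_def\<close>)
next
  case False
  with assms have "x < 0" by simp
  have "((\<lambda>x. - ((- x) powr a)) has_real_derivative a * \<bar>x\<bar> powr (a - 1)) (at x)"
    using \<open>x < 0\<close> by (auto intro!: derivative_eq_intros)
  then show ?thesis
    by (rule has_field_derivative_transform_within_open[of _ _ _ "{..<0}"]) (use \<open>x < 0\<close> in \<open>auto simp: signed_powr_def\<close>)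
qed

lemma has_real_derivative_abs_powr:
  assumes "x \<noteq> 0"
  shows "((\<lambda>x. \<bar>x\<bar> powr a) has_real_derivative a * signed_powr (a - 1) x) (at x)"
proof (cases "x > 0")
  case True
  have "((\<lambda>x. x powr a) has_real_derivative a * signed_powr (a - 1) x) (at x)"
    using True by (auto intro!: derivative_eq_intros simp: signed_powr_def)
  then show ?thesis
    by (rule has_field_derivative_transform_within_open[of _ _ _ "{0<..}"]) (use True in auto)
next
  case False
  with assms have "x < 0" by simp
  have "((\<lambda>x. (- x) powr a) has_real_derivative a * signed_powr (a - 1) x) (at x)"
    using \<open>x < 0\<close> by (auto intro!: derivative_eq_intros simp: signed_powr_def)
  then show ?thesis
    by (rule has_field_derivative_transform_within_open[of _ _ _ "{..<0}"]) (use \<open>x < 0\<close> in auto)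
qed

lemma signed_powr_mono: "a \<ge> 0 \<Longrightarrow> x \<le> y \<Longrightarrow> signed_powr a x \<le> signed_powr a y"
  unfolding signed_powr_def by (intro diff_mono powr_mono2) auto

lemma nn_integral_kernel:
  fixes c d u H :: real
  assumes H: "1/2 < H" and cd: "c \<le> d"
  shows "(\<integral>\<^sup>+v. ennreal (\<bar>u - v\<bar> powr (2*H - 2)) * indicator {c<..d} v \<partial>lborel)
    = ennreal ((signed_powr (2*H - 1) (d - u) - signed_powr (2*H - 1) (c - u)) / (2*H - 1))"
proof -
  have "(\<integral>\<^sup>+v. ennreal (\<bar>u - v\<bar> powr (2*H - 2)) * indicator {c<..d} v \<partial>lborel)
    = ennreal (signed_powr (2*H - 1) (d - u) / (2*H - 1) - signed_powr (2*H - 1) (c - u) / (2*H - 1))"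
  proof (rule nn_integral_FTC_finite_exceptions[where S="{u}" and F="\<lambda>v. signed_powr (2*H - 1) (v - u) / (2*H - 1)"])
    show "continuous_on {c..d} (\<lambda>v. signed_powr (2*H - 1) (v - u) / (2*H - 1))"
      using H by (intro continuous_intros) auto
  next
    fix x assume "x \<notin> {u}"
    then have "x - u \<noteq> 0" by simp
    have "((\<lambda>v. signed_powr (2*H - 1) (v - u)) has_real_derivative ((2*H - 1) * \<bar>x - u\<bar> powr (2*H - 1 - 1)) * 1) (at x)"
      by (rule DERIV_chain2[where g="\<lambda>v. v - u", OF has_real_derivative_signed_powr[OF \<open>x - u \<noteq> 0\<close>]]) (auto intro!: derivative_eq_intros)
    then have "((\<lambda>v. signed_powr (2*H - 1) (v - u) / (2*H - 1)) has_real_derivative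
        ((2*H - 1) * \<bar>x - u\<bar> powr (2*H - 1 - 1)) * 1 / (2*H - 1)) (at x)"
      by (rule DERIV_cdivide)
    then show "((\<lambda>v. signed_powr (2*H - 1) (v - u) / (2*H - 1)) has_real_derivative \<bar>u - x\<bar> powr (2*H - 2)) (at x)"
      using H by (simp add: abs_minus_commute)
  qed (use cd in auto)
  then show ?thesis by (simp add: diff_divide_distrib)
qed

text \<open>The mass that |u - v| powr (2H - 2) gives to the rectangle from a to b in u and from c
  to d in v. It is a second difference of |x| powr (2H), whose second derivative is 2H (2H - 1)
  times the kernel.\<close>

definition kernel_mass :: "real \<Rightarrow> real \<Rightarrow> real \<Rightarrow> real \<Rightarrow> real \<Rightarrow> real" where
  "kernel_mass H a b c d = (\<bar>d - a\<bar> powr (2*H) + \<bar>c - b\<bar> powr (2*H) - \<bar>d - b\<bar> powr (2*H) - \<bar>c - a\<bar> powr (2*H))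
     / (2 * H * (2*H - 1))"

text \<open>An antiderivative in u of the inner integral over v from c to d; its increment from a to
  b is \<open>kernel_mass\<close>.\<close>

definition kernel_primitive :: "real \<Rightarrow> real \<Rightarrow> real \<Rightarrow> real \<Rightarrow> real" where
  "kernel_primitive H c d u = (\<bar>c - u\<bar> powr (2*H) - \<bar>d - u\<bar> powr (2*H)) / (2 * H * (2*H - 1))"

lemma continuous_on_kernel_primitive: "1/2 < H \<Longrightarrow> continuous_on S (kernel_primitive H c d)"
  unfolding kernel_primitive_def[abs_def]
  by (intro continuous_on_divide continuous_on_diff continuous_on_powr' continuous_on_rabs
      continuous_on_const continuous_on_id) auto

lemma has_real_derivative_kernel_primitive:
  assumes H: "1/2 < H" and x: "x \<notin> {c, d}"
  shows "(kernel_primitive H c d has_real_derivative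
    (signed_powr (2*H - 1) (d - x) - signed_powr (2*H - 1) (c - x)) / (2*H - 1)) (at x)"
proof -
  have D: "((\<lambda>u. \<bar>y - u\<bar> powr (2*H)) has_real_derivative (2*H * signed_powr (2*H - 1) (y - x)) * (-1)) (at x)"
    if "y - x \<noteq> 0" for y
    by (rule DERIV_chain2[where g="\<lambda>u. y - u", OF has_real_derivative_abs_powr[OF that]])
       (auto intro!: derivative_eq_intros)
  have "(kernel_primitive H c d has_real_derivative ((2*H * signed_powr (2*H - 1) (c - x)) * (-1)
      - (2*H * signed_powr (2*H - 1) (d - x)) * (-1)) / (2 * H * (2*H - 1))) (at x)"
    unfolding kernel_primitive_def[abs_def] using x by (intro DERIV_cdivide DERIV_diff D) auto
  also have "((2*H * signed_powr (2*H - 1) (c - x)) * (-1)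
      - (2*H * signed_powr (2*H - 1) (d - x)) * (-1)) / (2 * H * (2*H - 1))
      = (2*H * (signed_powr (2*H - 1) (d - x) - signed_powr (2*H - 1) (c - x))) / (2 * H * (2*H - 1))"
    by (simp add: algebra_simps)
  also have "\<dots> = (signed_powr (2*H - 1) (d - x) - signed_powr (2*H - 1) (c - x)) / (2*H - 1)"
    using H by (subst mult_divide_mult_cancel_left) auto
  finally show ?thesis .
qed

lemma kernel_primitive_diff: "kernel_primitive H c d b - kernel_primitive H c d a = kernel_mass H a b c d"
  unfolding kernel_mass_def kernel_primitive_def diff_divide_distrib[symmetric] by simp

lemma nn_integral_kernel_rectangle:
  fixes a b c d H :: real
  assumes H: "1/2 < H" and ab: "a \<le> b" and cd: "c \<le> d"
  shows "(\<integral>\<^sup>+u. \<integral>\<^sup>+v. ennreal (indicator {a<..b} u * indicator {c<..d} v * \<bar>u - v\<bar> powr (2*H - 2)) \<partial>lborel \<partial>lborel)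
    = ennreal (kernel_mass H a b c d)" (is "?L = _")
proof -
  let ?s = "\<lambda>u. (signed_powr (2*H - 1) (d - u) - signed_powr (2*H - 1) (c - u)) / (2*H - 1)"
  have "?L = (\<integral>\<^sup>+u. ennreal (?s u) * indicator {a<..b} u \<partial>lborel)"
  proof (intro nn_integral_cong)
    fix u
    have "(\<integral>\<^sup>+v. ennreal (indicator {a<..b} u * indicator {c<..d} v * \<bar>u - v\<bar> powr (2*H - 2)) \<partial>lborel)
       = (\<integral>\<^sup>+v. indicator {a<..b} u * (ennreal (\<bar>u - v\<bar> powr (2*H - 2)) * indicator {c<..d} v) \<partial>lborel)"
      by (intro nn_integral_cong) (auto simp: indicator_def)
    also have "\<dots> = indicator {a<..b} u * ennreal (?s u)"
      by (subst nn_integral_cmult) (auto simp: nn_integral_kernel[OF H cd])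
    finally show "(\<integral>\<^sup>+v. ennreal (indicator {a<..b} u * indicator {c<..d} v * \<bar>u - v\<bar> powr (2*H - 2)) \<partial>lborel)
      = ennreal (?s u) * indicator {a<..b} u" by (simp add: mult.commute)
  qed
  also have "\<dots> = ennreal (kernel_primitive H c d b - kernel_primitive H c d a)"
  proof (rule nn_integral_FTC_finite_exceptions[where S="{c,d}"])
    show "0 \<le> ?s x" for x
      using H cd signed_powr_mono[of "2*H-1" "c - x" "d - x"] by auto
  qed (use ab H in \<open>auto intro: continuous_on_kernel_primitive has_real_derivative_kernel_primitive\<close>)
  finally show ?thesis unfolding kernel_primitive_diff .
qed

text \<open>The identity in extended nonnegative reals does not show this, since
  \<open>ennreal\<close> sends negative numbers to 0. The sign is read off the gauge integral of the
  nonnegative inner integral instead.\<close>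

lemma kernel_mass_nonneg:
  fixes a b c d H :: real
  assumes H: "1/2 < H" and ab: "a \<le> b" and cd: "c \<le> d"
  shows "0 \<le> kernel_mass H a b c d"
proof -
  let ?s = "\<lambda>u. (signed_powr (2*H - 1) (d - u) - signed_powr (2*H - 1) (c - u)) / (2*H - 1)"
  have I: "(?s has_integral (kernel_primitive H c d b - kernel_primitive H c d a)) {a..b}"
    using ab H has_real_derivative_kernel_primitive[OF H, of _ c d]
    by (intro fundamental_theorem_of_calculus_strong[where S="{c,d}"] continuous_on_kernel_primitive)
       (auto simp: has_real_derivative_iff_has_vector_derivative)
  have "0 \<le> ?s x" for x
    using H cd signed_powr_mono[of "2*H-1" "c - x" "d - x"] by auto
  then have "0 \<le> kernel_primitive H c d b - kernel_primitive H c d a"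
    using has_integral_nonneg[OF I] by blast
  then show ?thesis unfolding kernel_primitive_diff .
qed

lemma has_bochner_integral_kernel_rectangle:
  fixes a b c d H :: real
  assumes "1/2 < H" "a \<le> b" "c \<le> d"
  shows "has_bochner_integral (lborel \<Otimes>\<^sub>M lborel)
    (\<lambda>z. indicator {a<..b} (fst z) * indicator {c<..d} (snd z) * \<bar>fst z - snd z\<bar> powr (2*H - 2)) (kernel_mass H a b c d)"
proof (rule has_bochner_integral_nn_integral)
  have "(\<integral>\<^sup>+ z. ennreal (indicator {a<..b} (fst z) * indicator {c<..d} (snd z) * \<bar>fst z - snd z\<bar> powr (2*H - 2)) \<partial>(lborel \<Otimes>\<^sub>M lborel))
      = (\<integral>\<^sup>+u. \<integral>\<^sup>+v. ennreal (indicator {a<..b} u * indicator {c<..d} v * \<bar>u - v\<bar> powr (2*H - 2)) \<partial>lborel \<partial>lborel)"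
    by (subst lborel.nn_integral_fst[symmetric]) auto
  then show "(\<integral>\<^sup>+ z. ennreal (indicator {a<..b} (fst z) * indicator {c<..d} (snd z) * \<bar>fst z - snd z\<bar> powr (2*H - 2)) \<partial>(lborel \<Otimes>\<^sub>M lborel))
      = ennreal (kernel_mass H a b c d)"
    by (simp only: nn_integral_kernel_rectangle[OF assms])
  show "0 \<le> kernel_mass H a b c d" by (rule kernel_mass_nonneg[OF assms])
qed auto

section \<open>Even moments of centred Gaussian variables\<close>

definition gaussian_moment :: "nat \<Rightarrow> real" where
  "gaussian_moment m = fact (2 * m) / (2 ^ m * fact m)"

lemma gaussian_moment_nonneg: "0 \<le> gaussian_moment m"
  by (simp add: gaussian_moment_def)

text \<open>\<open>gaussian_moment m\<close> is the double factorial (2m - 1)!!, and the 2m-th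
  moment of a centred normal variable is this number times the m-th power of the variance.
  \<open>gaussian_rv\<close> leaves the parameters unspecified: the mean is 0 by assumption, and the
  case m = 1 of the moment formula identifies the variance with the second moment, which v bounds. A
  degenerate variable is almost surely 0.\<close>

lemma (in prob_space) centered_gaussian_moment_le:
  assumes g: "gaussian_rv M Y" and int: "integrable M Y" "(\<integral>\<omega>. Y \<omega> \<partial>M) = 0"
    and v: "(\<integral>\<^sup>+\<omega>. ennreal ((Y \<omega>)\<^sup>2) \<partial>M) \<le> ennreal v" "0 \<le> v" and m: "m \<ge> 1"
  shows "(\<integral>\<^sup>+\<omega>. ennreal (Y \<omega> ^ (2 * m)) \<partial>M) \<le> ennreal (gaussian_moment m * v ^ m)"
proof -
  from g obtain \<mu> s where "(s > 0 \<and> distributed M lborel Y (normal_density \<mu> s)) \<or> (AE \<omega> in M. Y \<omega> = \<mu>)"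
    by (auto simp: gaussian_rv_def)
  then show ?thesis
  proof
    assume *: "s > 0 \<and> distributed M lborel Y (normal_density \<mu> s)"
    have "(\<integral>x. normal_density \<mu> s x * x \<partial>lborel) = (\<integral>\<omega>. Y \<omega> \<partial>M)"
      using * by (intro distributed_integral) auto
    then have \<mu>: "\<mu> = 0" using * int by (simp add: integral_normal_moment_nz_1)
    have mom: "(\<integral>\<^sup>+\<omega>. ennreal (Y \<omega> ^ (2 * k)) \<partial>M) = ennreal (gaussian_moment k * (s\<^sup>2) ^ k)" for k
    proof -
      have "(\<integral>\<^sup>+x. ennreal (normal_density \<mu> s x) * ennreal (x ^ (2 * k)) \<partial>lborel) = (\<integral>\<^sup>+\<omega>. ennreal (Y \<omega> ^ (2 * k)) \<partial>M)"
        using * by (intro distributed_nn_integral) auto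
      moreover have "(\<integral>\<^sup>+x. ennreal (normal_density \<mu> s x) * ennreal (x ^ (2 * k)) \<partial>lborel)
          = (\<integral>\<^sup>+x. ennreal (normal_density \<mu> s x * (x - \<mu>) ^ (2 * k)) \<partial>lborel)"
        by (intro nn_integral_cong) (simp add: ennreal_mult \<mu>)
      moreover have "\<dots> = ennreal (fact (2 * k) / ((2 / s\<^sup>2)^k * fact k))"
        using * normal_moment_even[of s \<mu> k]
        by (subst nn_integral_eq_integral) (auto simp: has_bochner_integral_iff)
      moreover have "fact (2 * k) / ((2 / s\<^sup>2)^k * fact k) = gaussian_moment k * (s\<^sup>2) ^ k"
        by (simp add: gaussian_moment_def power_divide)
      ultimately show ?thesis by simp
    qed
    have "ennreal (s\<^sup>2) \<le> ennreal v"
      using mom[of 1] v by (simp add: gaussian_moment_def)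
    then have "s\<^sup>2 \<le> v" using v by (simp add: ennreal_le_iff)
    then show ?thesis
      unfolding mom by (intro ennreal_leI mult_left_mono power_mono gaussian_moment_nonneg) auto
  next
    assume *: "AE \<omega> in M. Y \<omega> = \<mu>"
    then have "(\<integral>\<omega>. Y \<omega> \<partial>M) = (\<integral>\<omega>. \<mu> \<partial>M)"
      using int(1) by (intro integral_cong_AE) auto
    then have \<mu>: "\<mu> = 0" using int by (simp add: prob_space)
    have "(\<integral>\<^sup>+\<omega>. ennreal (Y \<omega> ^ (2 * m)) \<partial>M) = (\<integral>\<^sup>+\<omega>. 0 \<partial>M)"
      using * m by (intro nn_integral_cong_AE) (auto elim!: eventually_mono simp: \<mu>)
    then show ?thesis by simp
  qed
qed

text \<open>Unlike in \<open>step_fun_integral\<close>, the intervals may overlap and come in any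
  order, so the difference of two such sums is again one by concatenation, without a common
  refinement of the nodes.\<close>

definition interval_sum :: "(real \<Rightarrow> 'a \<Rightarrow> real) \<Rightarrow> real \<Rightarrow> (real \<Rightarrow> real) \<Rightarrow> ('a \<Rightarrow> real) \<Rightarrow> bool" where
  "interval_sum \<beta> T f I \<longleftrightarrow> (\<exists>(n::nat) c a b. (\<forall>k<n. 0 \<le> a k \<and> a k \<le> b k \<and> b k \<le> T) \<and>
     f = (\<lambda>u. \<Sum>k<n. c k * indicator {a k<..b k} u) \<and>
     I = (\<lambda>\<omega>. \<Sum>k<n. c k * (\<beta> (b k) \<omega> - \<beta> (a k) \<omega>)))"

lemma interval_sumE:
  assumes "interval_sum \<beta> T f I"
  obtains n :: nat and c a b where "\<And>k. k < n \<Longrightarrow> 0 \<le> a k \<and> a k \<le> b k \<and> b k \<le> T"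
     "f = (\<lambda>u. \<Sum>k<n. c k * indicator {a k<..b k} u)"
     "I = (\<lambda>\<omega>. \<Sum>k<n. c k * (\<beta> (b k) \<omega> - \<beta> (a k) \<omega>))"
  using assms unfolding interval_sum_def by blast

lemma sum_lessThan_add:
  fixes f :: "nat \<Rightarrow> 'b::comm_monoid_add"
  shows "(\<Sum>k<n + m. f k) = (\<Sum>k<n. f k) + (\<Sum>k<m. f (n + k))"
  by (induction m) (auto simp: add.assoc)

lemma interval_sum_diff:
  assumes "interval_sum \<beta> T f I" "interval_sum \<beta> T g J"
  shows "interval_sum \<beta> T (\<lambda>u. f u - g u) (\<lambda>\<omega>. I \<omega> - J \<omega>)"
proof -
  obtain n :: nat and c a b where 1: "\<And>k. k < n \<Longrightarrow> 0 \<le> a k \<and> a k \<le> b k \<and> b k \<le> T"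
     "f = (\<lambda>u. \<Sum>k<n. c k * indicator {a k<..b k} u)"
     "I = (\<lambda>\<omega>. \<Sum>k<n. c k * (\<beta> (b k) \<omega> - \<beta> (a k) \<omega>))"
    using assms(1) unfolding interval_sum_def by blast
  obtain n' :: nat and c' a' b' where 2: "\<And>k. k < n' \<Longrightarrow> 0 \<le> a' k \<and> a' k \<le> b' k \<and> b' k \<le> T"
     "g = (\<lambda>u. \<Sum>k<n'. c' k * indicator {a' k<..b' k} u)"
     "J = (\<lambda>\<omega>. \<Sum>k<n'. c' k * (\<beta> (b' k) \<omega> - \<beta> (a' k) \<omega>))"
    using assms(2) unfolding interval_sum_def by blast
  define c'' where "c'' k = (if k < n then c k else - c' (k - n))" for k
  define a'' where "a'' k = (if k < n then a k else a' (k - n))" for k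
  define b'' where "b'' k = (if k < n then b k else b' (k - n))" for k
  have "\<forall>k<n+n'. 0 \<le> a'' k \<and> a'' k \<le> b'' k \<and> b'' k \<le> T"
    using 1(1) 2(1) by (auto simp: a''_def b''_def)
  moreover have "(\<lambda>u. f u - g u) = (\<lambda>u. \<Sum>k<n+n'. c'' k * indicator {a'' k<..b'' k} u)"
    unfolding 1 2 sum_lessThan_add by (simp add: a''_def b''_def c''_def sum_negf)
  moreover have "(\<lambda>\<omega>. I \<omega> - J \<omega>) = (\<lambda>\<omega>. \<Sum>k<n+n'. c'' k * (\<beta> (b'' k) \<omega> - \<beta> (a'' k) \<omega>))"
    unfolding 1 2 sum_lessThan_add by (simp add: a''_def b''_def c''_def sum_negf)
  ultimately show ?thesis unfolding interval_sum_def by blast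
qed

lemma step_fun_nodes_mono:
  fixes s :: "nat \<Rightarrow> real"
  assumes "\<forall>k<n. s k \<le> s (Suc k)" "i \<le> j" "j \<le> n"
  shows "s i \<le> s j"
  using assms(2,3)
proof (induction j rule: dec_induct)
  case (step m)
  then have "s m \<le> s (Suc m)" using assms(1) by simp
  then show ?case using step by simp
qed simp

lemma step_fun_integral_imp_interval_sum:
  assumes "step_fun_integral \<beta> t f I" "t \<le> T"
  shows "interval_sum \<beta> T f I"
proof -
  obtain n :: nat and s c where s: "s 0 \<ge> 0" "s n \<le> t" "\<forall>k<n. s k \<le> s (Suc k)"
     "f = (\<lambda>u. \<Sum>k<n. c k * indicator {s k<..s (Suc k)} u)"
     "I = (\<lambda>\<omega>. \<Sum>k<n. c k * (\<beta> (s (Suc k)) \<omega> - \<beta> (s k) \<omega>))"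
    using assms(1) unfolding step_fun_integral_def by blast
  have *: "\<forall>k<n. 0 \<le> s k \<and> s k \<le> s (Suc k) \<and> s (Suc k) \<le> T"
  proof (intro allI impI)
    fix k assume "k < n"
    then show "0 \<le> s k \<and> s k \<le> s (Suc k) \<and> s (Suc k) \<le> T"
      using step_fun_nodes_mono[OF s(3), of 0 k] step_fun_nodes_mono[OF s(3), of "Suc k" n] s assms(2) by auto
  qed
  show ?thesis
    unfolding interval_sum_def s(4,5)
    by (rule exI[of _ n], rule exI[of _ c], rule exI[of _ s], rule exI[of _ "\<lambda>k. s (Suc k)"], intro conjI refl *)
qed

lemma step_fun_integral_support:
  assumes "step_fun_integral \<beta> t f I" "u \<notin> {0..t}"
  shows "f u = 0"
proof -
  obtain n :: nat and s c where s: "s 0 \<ge> 0" "s n \<le> t" "\<forall>k<n. s k \<le> s (Suc k)"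
     "f = (\<lambda>u. \<Sum>k<n. c k * indicator {s k<..s (Suc k)} u)"
    using assms(1) unfolding step_fun_integral_def by blast
  have "u \<notin> {s k<..s (Suc k)}" if "k < n" for k
    using step_fun_nodes_mono[OF s(3), of 0 k] step_fun_nodes_mono[OF s(3), of "Suc k" n] s(1,2) that assms(2) by auto
  then show ?thesis unfolding s(4) by (intro sum.neutral) auto
qed

lemma interval_sum_borel_measurable:
  "interval_sum \<beta> T f I \<Longrightarrow> f \<in> borel_measurable borel"
proof (elim interval_sumE)
  fix n :: nat and c a b
  assume f: "f = (\<lambda>u. \<Sum>k<n. c k * indicator {a k<..b k} u)"
  show "f \<in> borel_measurable borel" unfolding f by measurable
qed

lemma interval_sum_support:
  "interval_sum \<beta> T f I \<Longrightarrow> u \<notin> {0..T} \<Longrightarrow> f u = 0"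
proof (elim interval_sumE)
  fix n :: nat and c a b
  assume k: "\<And>k. k < n \<Longrightarrow> 0 \<le> a k \<and> a k \<le> b k \<and> b k \<le> T" and u: "u \<notin> {0..T}"
    and f: "f = (\<lambda>u. \<Sum>k<n. c k * indicator {a k<..b k} u)"
  have "u \<notin> {a j<..b j}" if "j < n" for j
    using k[OF that] u by auto
  then show "f u = 0" unfolding f by (intro sum.neutral) auto
qed

lemma interval_sum_measurable:
  assumes "interval_sum \<beta> T f I" "\<And>t. t \<in> {0..T} \<Longrightarrow> \<beta> t \<in> borel_measurable N"
  shows "I \<in> borel_measurable N"
proof -
  obtain n :: nat and c a b where 1: "\<And>k. k < n \<Longrightarrow> 0 \<le> a k \<and> a k \<le> b k \<and> b k \<le> T"
     "I = (\<lambda>\<omega>. \<Sum>k<n. c k * (\<beta> (b k) \<omega> - \<beta> (a k) \<omega>))"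
    using assms(1) unfolding interval_sum_def by blast
  show ?thesis unfolding 1(2)
  proof (intro borel_measurable_sum borel_measurable_times borel_measurable_diff borel_measurable_const assms(2))
    fix k assume "k \<in> {..<n}"
    then show "b k \<in> {0..T}" "a k \<in> {0..T}" using 1(1)[of k] by auto
  qed
qed

section \<open>Interval sums of one component of the fractional Brownian motion\<close>

locale scalar_fbm = prob_space M for M :: "'a measure" +
  fixes \<beta> :: "real \<Rightarrow> 'a \<Rightarrow> real" and T H :: real
  assumes T_pos: "T > 0" and H_half: "1/2 < H" and H_less1: "H < 1"
    and \<beta>_meas: "\<And>t. t \<in> {0..T} \<Longrightarrow> \<beta> t \<in> borel_measurable M"
    and \<beta>_zero: "\<And>\<omega>. \<omega> \<in> space M \<Longrightarrow> \<beta> 0 \<omega> = 0"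
    and \<beta>_gauss: "\<And>n ts (cs::nat \<Rightarrow> real). (\<And>k. k < n \<Longrightarrow> ts k \<in> {0..T}) \<Longrightarrow>
       gaussian_rv M (\<lambda>\<omega>. \<Sum>k<n. cs k * \<beta> (ts k) \<omega>)"
    and \<beta>_mean: "\<And>t. t \<in> {0..T} \<Longrightarrow> integrable M (\<beta> t)" "\<And>t. t \<in> {0..T} \<Longrightarrow> (\<integral>\<omega>. \<beta> t \<omega> \<partial>M) = 0"
    and \<beta>_cov: "\<And>t s. t \<in> {0..T} \<Longrightarrow> s \<in> {0..T} \<Longrightarrow> (\<integral>\<omega>. \<beta> t \<omega> * \<beta> s \<omega> \<partial>M) = R_H H t s"
begin

text \<open>The Bochner integral of a non-integrable function is 0, so the positive value t powr
  (2H) of the covariance at (t, t) forces integrability. At t = 0 that value is 0, and the variable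
  itself vanishes.\<close>

lemma integrable_square: 
  assumes t: "t \<in> {0..T}"
  shows "integrable M (\<lambda>\<omega>. \<beta> t \<omega> * \<beta> t \<omega>)"
proof (cases "t = 0")
  case True
  then have "integrable M (\<lambda>\<omega>. \<beta> t \<omega> * \<beta> t \<omega>) \<longleftrightarrow> integrable M (\<lambda>\<omega>. 0::real)"
    using \<beta>_zero by (intro Bochner_Integration.integrable_cong) auto
  then show ?thesis by simp
next
  case False
  then have "R_H H t t > 0" using t H_half by (auto simp: R_H_def)
  then show ?thesis using \<beta>_cov[OF t t] not_integrable_integral_eq by fastforce
qed

lemma integrable_product:
  assumes t: "t \<in> {0..T}" "s \<in> {0..T}"
  shows "integrable M (\<lambda>\<omega>. \<beta> t \<omega> * \<beta> s \<omega>)"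
proof (rule Bochner_Integration.integrable_bound)
  show "integrable M (\<lambda>\<omega>. \<beta> t \<omega> * \<beta> t \<omega> + \<beta> s \<omega> * \<beta> s \<omega>)"
    by (intro Bochner_Integration.integrable_add integrable_square t)
  show "(\<lambda>\<omega>. \<beta> t \<omega> * \<beta> s \<omega>) \<in> borel_measurable M"
    by (intro borel_measurable_times \<beta>_meas t)
  have "\<bar>x * y\<bar> \<le> x * x + y * y" for x y :: real
  proof -
    have "2 * \<bar>x\<bar> * \<bar>y\<bar> \<le> x\<^sup>2 + y\<^sup>2" using sum_squares_bound[of "\<bar>x\<bar>" "\<bar>y\<bar>"] by simp
    then show ?thesis unfolding abs_mult power2_eq_square using mult_nonneg_nonneg[of "\<bar>x\<bar>" "\<bar>y\<bar>"] by linarith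
  qed
  then show "AE \<omega> in M. norm (\<beta> t \<omega> * \<beta> s \<omega>) \<le> norm (\<beta> t \<omega> * \<beta> t \<omega> + \<beta> s \<omega> * \<beta> s \<omega>)"
    by (intro AE_I2) (auto intro: order_trans[OF _ abs_ge_self])
qed

text \<open>The normalisation that turns \<open>kernel_mass\<close> into the covariance of two
  increments: half of the factor 2H (2H - 1) from differentiating |x| powr (2H) twice, the half
  being that of \<open>R_H\<close>.\<close>

definition \<alpha> :: real where "\<alpha> = H * (2 * H - 1)"

lemma \<alpha>_nonneg: "0 \<le> \<alpha>" using H_half by (simp add: \<alpha>_def)

text \<open>In the second difference of \<open>R_H\<close> the powers of a single time cancel, and
  only the powers of the four time differences remain.\<close>

lemma increment_covariance:
  assumes "a \<in> {0..T}" "b \<in> {0..T}" "c \<in> {0..T}" "d \<in> {0..T}"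
  shows "has_bochner_integral M (\<lambda>\<omega>. (\<beta> b \<omega> - \<beta> a \<omega>) * (\<beta> d \<omega> - \<beta> c \<omega>)) (\<alpha> * kernel_mass H a b c d)"
proof -
  have hb: "has_bochner_integral M (\<lambda>\<omega>. \<beta> t \<omega> * \<beta> s \<omega>) (R_H H t s)" if "t \<in> {0..T}" "s \<in> {0..T}" for t s
    using integrable_product[OF that] \<beta>_cov[OF that] by (simp add: has_bochner_integral_iff)
  have "has_bochner_integral M (\<lambda>\<omega>. (\<beta> b \<omega> * \<beta> d \<omega> - \<beta> b \<omega> * \<beta> c \<omega>) - (\<beta> a \<omega> * \<beta> d \<omega> - \<beta> a \<omega> * \<beta> c \<omega>))
     ((R_H H b d - R_H H b c) - (R_H H a d - R_H H a c))"
    by (intro has_bochner_integral_diff hb assms)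
  also have "(\<lambda>\<omega>. (\<beta> b \<omega> * \<beta> d \<omega> - \<beta> b \<omega> * \<beta> c \<omega>) - (\<beta> a \<omega> * \<beta> d \<omega> - \<beta> a \<omega> * \<beta> c \<omega>))
     = (\<lambda>\<omega>. (\<beta> b \<omega> - \<beta> a \<omega>) * (\<beta> d \<omega> - \<beta> c \<omega>))"
    by (simp add: algebra_simps)
  also have "(R_H H b d - R_H H b c) - (R_H H a d - R_H H a c) = \<alpha> * kernel_mass H a b c d"
    using H_half unfolding R_H_def \<alpha>_def kernel_mass_def
    by (simp add: abs_minus_commute divide_simps) (simp add: algebra_simps)
  finally show ?thesis .
qed

lemma interval_sum_integrable:
  assumes "interval_sum \<beta> T f I"
  shows "integrable M I" "(\<integral>\<omega>. I \<omega> \<partial>M) = 0"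
proof -
  obtain n :: nat and c a b where 1: "\<And>k. k < n \<Longrightarrow> 0 \<le> a k \<and> a k \<le> b k \<and> b k \<le> T"
     "I = (\<lambda>\<omega>. \<Sum>k<n. c k * (\<beta> (b k) \<omega> - \<beta> (a k) \<omega>))"
    using assms(1) unfolding interval_sum_def by blast
  have m: "has_bochner_integral M (\<beta> t) 0" if "t \<in> {0..T}" for t
    using \<beta>_mean that by (simp add: has_bochner_integral_iff)
  have "has_bochner_integral M I (\<Sum>k<n. c k * (0 - 0))"
    unfolding 1(2)
  proof (intro has_bochner_integral_sum has_bochner_integral_mult_right has_bochner_integral_diff m)
    fix k assume "k \<in> {..<n}"
    then show "b k \<in> {0..T}" "a k \<in> {0..T}" using 1(1)[of k] by auto
  qed
  then show "integrable M I" "(\<integral>\<omega>. I \<omega> \<partial>M) = 0" by (auto simp: has_bochner_integral_iff)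
qed

lemma interval_sum_gaussian:
  assumes "interval_sum \<beta> T f I"
  shows "gaussian_rv M I"
proof -
  obtain n :: nat and c a b where 1: "\<And>k. k < n \<Longrightarrow> 0 \<le> a k \<and> a k \<le> b k \<and> b k \<le> T"
     "I = (\<lambda>\<omega>. \<Sum>k<n. c k * (\<beta> (b k) \<omega> - \<beta> (a k) \<omega>))"
    using assms(1) unfolding interval_sum_def by blast
  \<comment> \<open>The n right end points come first, with the coefficients c, then the n left end
    points, with the coefficients - c.\<close>
  define ts where "ts k = (if k < n then b k else a (k - n))" for k
  define cs where "cs k = (if k < n then c k else - c (k - n))" for k
  have "gaussian_rv M (\<lambda>\<omega>. \<Sum>k<n + n. cs k * \<beta> (ts k) \<omega>)"
  proof (rule \<beta>_gauss)
    fix k assume "k < n + n"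
    then have "k < n \<or> k - n < n" by linarith
    then show "ts k \<in> {0..T}" using 1(1)[of k] 1(1)[of "k - n"] by (cases "k < n") (auto simp: ts_def)
  qed
  also have "(\<lambda>\<omega>. \<Sum>k<n + n. cs k * \<beta> (ts k) \<omega>) = I"
    unfolding 1(2) sum_lessThan_add by (simp add: ts_def cs_def sum_negf right_diff_distrib sum_subtractf)
  finally show ?thesis .
qed

text \<open>Expanding the square and inserting the covariance of increments gives
  \<open>\<alpha>\<close> times the integral of f u f v against the kernel; passing to absolute
  values yields \<open>absH_norm2\<close>. The later moment bounds for Wiener integrals rest on this
  inequality.\<close>

lemma interval_sum_second_moment:
  assumes "interval_sum \<beta> T f I"
  shows "(\<integral>\<^sup>+\<omega>. ennreal ((I \<omega>)\<^sup>2) \<partial>M) \<le> ennreal \<alpha> * absH_norm2 H T f"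
proof -
  obtain n :: nat and c a b where 1: "\<And>k. k < n \<Longrightarrow> 0 \<le> a k \<and> a k \<le> b k \<and> b k \<le> T"
     and f: "f = (\<lambda>u. \<Sum>k<n. c k * indicator {a k<..b k} u)"
     and I: "I = (\<lambda>\<omega>. \<Sum>k<n. c k * (\<beta> (b k) \<omega> - \<beta> (a k) \<omega>))"
    using assms(1) unfolding interval_sum_def by blast
  let ?P = "lborel \<Otimes>\<^sub>M lborel :: (real \<times> real) measure"
  let ?\<kappa> = "\<lambda>z::real\<times>real. \<bar>fst z - snd z\<bar> powr (2*H - 2)"
  define J where "J = (\<Sum>k<n. \<Sum>l<n. (c k * c l) * kernel_mass H (a k) (b k) (a l) (b l))"
  have [measurable]: "f \<in> borel_measurable borel" using interval_sum_borel_measurable[OF assms] .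
  have "has_bochner_integral M (\<lambda>\<omega>. \<Sum>k<n. \<Sum>l<n. (c k * c l) * ((\<beta> (b k) \<omega> - \<beta> (a k) \<omega>) * (\<beta> (b l) \<omega> - \<beta> (a l) \<omega>)))
     (\<Sum>k<n. \<Sum>l<n. (c k * c l) * (\<alpha> * kernel_mass H (a k) (b k) (a l) (b l)))"
  proof (intro has_bochner_integral_sum has_bochner_integral_mult_right increment_covariance)
    fix k l assume "k \<in> {..<n}" "l \<in> {..<n}"
    then show "b k \<in> {0..T}" "a k \<in> {0..T}" "b l \<in> {0..T}" "a l \<in> {0..T}"
      using 1(1)[of k] 1(1)[of l] by auto
  qed
  also have "(\<lambda>\<omega>. \<Sum>k<n. \<Sum>l<n. (c k * c l) * ((\<beta> (b k) \<omega> - \<beta> (a k) \<omega>) * (\<beta> (b l) \<omega> - \<beta> (a l) \<omega>))) = (\<lambda>\<omega>. (I \<omega>)\<^sup>2)"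
    unfolding I power2_eq_square sum_product by (intro ext sum.cong refl) (simp add: algebra_simps)
  also have "(\<Sum>k<n. \<Sum>l<n. (c k * c l) * (\<alpha> * kernel_mass H (a k) (b k) (a l) (b l))) = \<alpha> * J"
    unfolding J_def sum_distrib_left by (intro sum.cong refl) (simp add: algebra_simps)
  finally have "(\<integral>\<^sup>+\<omega>. ennreal ((I \<omega>)\<^sup>2) \<partial>M) = ennreal (\<alpha> * J)"
    by (subst nn_integral_eq_integral) (auto simp: has_bochner_integral_iff)
  have "has_bochner_integral ?P (\<lambda>z. \<Sum>k<n. \<Sum>l<n. (c k * c l) *
      (indicator {a k<..b k} (fst z) * indicator {a l<..b l} (snd z) * ?\<kappa> z)) J"
    unfolding J_def
  proof (intro has_bochner_integral_sum has_bochner_integral_mult_right has_bochner_integral_kernel_rectangle H_half)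
    fix k l assume "k \<in> {..<n}" "l \<in> {..<n}"
    then show "a k \<le> b k" "a l \<le> b l"
      using 1(1)[of k] 1(1)[of l] by auto
  qed
  also have "(\<lambda>z. \<Sum>k<n. \<Sum>l<n. (c k * c l) *
      (indicator {a k<..b k} (fst z) * indicator {a l<..b l} (snd z) * ?\<kappa> z)) = (\<lambda>z. f (fst z) * f (snd z) * ?\<kappa> z)"
    unfolding f unfolding sum_product unfolding sum_distrib_right
    by (intro ext sum.cong refl) (simp add: algebra_simps)
  finally have hb: "has_bochner_integral ?P (\<lambda>z. f (fst z) * f (snd z) * ?\<kappa> z) J" .
  then have "ennreal J = ennreal (\<integral>z. f (fst z) * f (snd z) * ?\<kappa> z \<partial>?P)"
    by (simp add: has_bochner_integral_iff)
  also have "\<dots> \<le> ennreal (\<integral>z. \<bar>f (fst z) * f (snd z) * ?\<kappa> z\<bar> \<partial>?P)"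
    using hb by (intro ennreal_leI integral_mono) (auto simp: has_bochner_integral_iff)
  also have "\<dots> = (\<integral>\<^sup>+z. ennreal \<bar>f (fst z) * f (snd z) * ?\<kappa> z\<bar> \<partial>?P)"
    using hb by (intro nn_integral_eq_integral[symmetric]) (auto simp: has_bochner_integral_iff)
  also have "\<dots> = (\<integral>\<^sup>+u. \<integral>\<^sup>+v. ennreal \<bar>f u * f v * \<bar>u - v\<bar> powr (2*H-2)\<bar> \<partial>lborel \<partial>lborel)"
    by (subst lborel.nn_integral_fst[symmetric]) auto
  also have "\<dots> = absH_norm2 H T f"
    unfolding absH_norm2_def
  proof (intro nn_integral_cong arg_cong[where f=ennreal])
    fix u v
    show "\<bar>f u * f v * \<bar>u - v\<bar> powr (2*H-2)\<bar> = \<bar>f u\<bar> * \<bar>f v\<bar> * \<bar>u - v\<bar> powr (2 * H - 2) * indicator {0..T} u * indicator {0..T} v"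
      using interval_sum_support[OF assms, of u] interval_sum_support[OF assms, of v]
      by (cases "u \<in> {0..T}"; cases "v \<in> {0..T}") (simp_all add: abs_mult)
  qed
  finally have "ennreal J \<le> absH_norm2 H T f" .
  then show ?thesis
    unfolding \<open>(\<integral>\<^sup>+\<omega>. ennreal ((I \<omega>)\<^sup>2) \<partial>M) = ennreal (\<alpha> * J)\<close>
    using \<alpha>_nonneg by (subst ennreal_mult') (auto intro: mult_left_mono)
qed

lemma interval_sum_moment:
  assumes I: "interval_sum \<beta> T f I" and v: "ennreal \<alpha> * absH_norm2 H T f \<le> ennreal v" "0 \<le> v" and m: "m \<ge> 1"
  shows "(\<integral>\<^sup>+\<omega>. ennreal (I \<omega> ^ (2 * m)) \<partial>M) \<le> ennreal (gaussian_moment m * v ^ m)"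
proof -
  have "(\<integral>\<^sup>+\<omega>. ennreal ((I \<omega>)\<^sup>2) \<partial>M) \<le> ennreal v"
    using interval_sum_second_moment[OF I] v(1) by (rule order_trans)
  then show ?thesis
    by (intro centered_gaussian_moment_le[OF interval_sum_gaussian[OF I]] interval_sum_integrable[OF I] v(2) m)
qed

end

section \<open>The kernel norm and step functions\<close>

text \<open>For u in [0, t] the kernel integrates over v in [0, t] to (u powr (2H - 1) + (t - u)
  powr (2H - 1)) / (2H - 1), and each of the two powers is at most T powr (2H - 1).\<close>

definition kernel_bound :: "real \<Rightarrow> real \<Rightarrow> real" where
  "kernel_bound H T = 2 * T powr (2*H - 1) / (2*H - 1)"

lemma kernel_bound_nonneg: "1/2 < H \<Longrightarrow> 0 \<le> kernel_bound H T"
  by (simp add: kernel_bound_def)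

lemma nn_integral_kernel_le:
  assumes H: "1/2 < H" and t: "0 \<le> t" "t \<le> T" and u: "u \<in> {0..t}"
  shows "(\<integral>\<^sup>+v. ennreal (\<bar>u - v\<bar> powr (2*H - 2)) * indicator {0..t} v \<partial>lborel) \<le> ennreal (kernel_bound H T)"
proof -
  have "(\<integral>\<^sup>+v. ennreal (\<bar>u - v\<bar> powr (2*H - 2)) * indicator {0..t} v \<partial>lborel)
    = (\<integral>\<^sup>+v. ennreal (\<bar>u - v\<bar> powr (2*H - 2)) * indicator {0<..t} v \<partial>lborel)"
    using AE_lborel_singleton[of "0::real"]
    by (intro nn_integral_cong_AE) (auto elim!: eventually_mono simp: indicator_def)
  also have "\<dots> = ennreal ((signed_powr (2*H - 1) (t - u) - signed_powr (2*H - 1) (0 - u)) / (2*H - 1))"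
    using H t by (intro nn_integral_kernel) auto
  also have "\<dots> \<le> ennreal (kernel_bound H T)"
  proof (intro ennreal_leI)
    have "(t - u) powr (2*H - 1) \<le> T powr (2*H - 1)" "u powr (2*H - 1) \<le> T powr (2*H - 1)"
      using H t u by (auto intro!: powr_mono2)
    then show "(signed_powr (2*H - 1) (t - u) - signed_powr (2*H - 1) (0 - u)) / (2*H - 1) \<le> kernel_bound H T"
      unfolding kernel_bound_def using H u by (intro divide_right_mono) (auto simp: signed_powr_def)
  qed
  finally show ?thesis .
qed

lemma nn_integral_kernel_fst_le:
  fixes a :: "real \<Rightarrow> real"
  assumes H: "1/2 < H" and t: "0 \<le> t" "t \<le> T" and [measurable]: "a \<in> borel_measurable borel" and a: "\<And>u. 0 \<le> a u"
  shows "(\<integral>\<^sup>+u. \<integral>\<^sup>+v. ennreal (a u * \<bar>u - v\<bar> powr (2*H - 2) * indicator {0..t} u * indicator {0..t} v) \<partial>lborel \<partial>lborel)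
    \<le> ennreal (kernel_bound H T) * (\<integral>\<^sup>+u. ennreal (a u) * indicator {0..t} u \<partial>lborel)"
proof -
  have ptw: "(\<integral>\<^sup>+v. ennreal (a u * \<bar>u - v\<bar> powr (2*H - 2) * indicator {0..t} u * indicator {0..t} v) \<partial>lborel)
      \<le> ennreal (kernel_bound H T) * (ennreal (a u) * indicator {0..t} u)" for u
  proof (cases "u \<in> {0..t}")
    case True
    have "(\<integral>\<^sup>+v. ennreal (a u * \<bar>u - v\<bar> powr (2*H - 2) * indicator {0..t} u * indicator {0..t} v) \<partial>lborel)
      = (\<integral>\<^sup>+v. ennreal (a u) * (ennreal (\<bar>u - v\<bar> powr (2*H - 2)) * indicator {0..t} v) \<partial>lborel)"
      using True a by (intro nn_integral_cong) (auto simp: indicator_def ennreal_mult)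
    also have "\<dots> = ennreal (a u) * (\<integral>\<^sup>+v. ennreal (\<bar>u - v\<bar> powr (2*H - 2)) * indicator {0..t} v \<partial>lborel)"
      by (intro nn_integral_cmult) auto
    also have "\<dots> \<le> ennreal (a u) * ennreal (kernel_bound H T)"
      by (intro mult_left_mono nn_integral_kernel_le H t True) auto
    finally show ?thesis using True by (simp add: mult.commute)
  qed simp
  have "(\<integral>\<^sup>+u. \<integral>\<^sup>+v. ennreal (a u * \<bar>u - v\<bar> powr (2*H - 2) * indicator {0..t} u * indicator {0..t} v) \<partial>lborel \<partial>lborel)
    \<le> (\<integral>\<^sup>+u. ennreal (kernel_bound H T) * (ennreal (a u) * indicator {0..t} u) \<partial>lborel)"
    by (intro nn_integral_mono ptw)
  also have "\<dots> = ennreal (kernel_bound H T) * (\<integral>\<^sup>+u. ennreal (a u) * indicator {0..t} u \<partial>lborel)"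
    by (intro nn_integral_cmult) auto
  finally show ?thesis .
qed

text \<open>Tonelli's theorem together with the symmetry of the kernel.\<close>

lemma nn_integral_kernel_swap:
  fixes a b :: "real \<Rightarrow> real"
  assumes [measurable]: "a \<in> borel_measurable borel" "b \<in> borel_measurable borel"
  shows "(\<integral>\<^sup>+u. \<integral>\<^sup>+v. ennreal (a v * b u * \<bar>u - v\<bar> powr (2*H - 2) * indicator {0..t} u * indicator {0..t} v) \<partial>lborel \<partial>lborel)
    = (\<integral>\<^sup>+u. \<integral>\<^sup>+v. ennreal (a u * b v * \<bar>u - v\<bar> powr (2*H - 2) * indicator {0..t} u * indicator {0..t} v) \<partial>lborel \<partial>lborel)"
proof -
  have "(\<integral>\<^sup>+u. \<integral>\<^sup>+v. ennreal (a v * b u * \<bar>u - v\<bar> powr (2*H - 2) * indicator {0..t} u * indicator {0..t} v) \<partial>lborel \<partial>lborel)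
    = (\<integral>\<^sup>+v. \<integral>\<^sup>+u. ennreal (a v * b u * \<bar>u - v\<bar> powr (2*H - 2) * indicator {0..t} u * indicator {0..t} v) \<partial>lborel \<partial>lborel)"
    by (rule lborel_pair.Fubini'[symmetric]) (auto simp: case_prod_beta')
  also have "\<dots> = (\<integral>\<^sup>+u. \<integral>\<^sup>+v. ennreal (a u * b v * \<bar>u - v\<bar> powr (2*H - 2) * indicator {0..t} u * indicator {0..t} v) \<partial>lborel \<partial>lborel)"
    by (intro nn_integral_cong arg_cong[where f=ennreal]) (simp add: abs_minus_commute)
  finally show ?thesis .
qed

text \<open>Schur test: the product |h u| |h v| is at most the mean of the two squares, both halves
  contribute equally by the symmetry of the kernel, and integrating out the free variable costs
  \<open>kernel_bound\<close>.\<close>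

lemma absH_norm2_le_L2:
  assumes H: "1/2 < H" and t: "0 \<le> t" "t \<le> T" and [measurable]: "h \<in> borel_measurable borel"
  shows "absH_norm2 H t h \<le> ennreal (kernel_bound H T) * (\<integral>\<^sup>+u. ennreal ((h u)\<^sup>2) * indicator {0..t} u \<partial>lborel)"
proof -
  \<comment> \<open>The factor 1 is kept so that the terms match
    \<open>nn_integral_kernel_swap\<close> with the constant function 1 in the role of
    \<open>b\<close>.\<close>
  define K where "K = (\<integral>\<^sup>+u. \<integral>\<^sup>+v. ennreal ((h u)\<^sup>2 / 2 * 1 * \<bar>u - v\<bar> powr (2*H - 2) * indicator {0..t} u * indicator {0..t} v) \<partial>lborel \<partial>lborel)"
  have "absH_norm2 H t h \<le> (\<integral>\<^sup>+u. \<integral>\<^sup>+v.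
      (ennreal ((h u)\<^sup>2 / 2 * 1 * \<bar>u - v\<bar> powr (2*H - 2) * indicator {0..t} u * indicator {0..t} v)
      + ennreal ((h v)\<^sup>2 / 2 * 1 * \<bar>u - v\<bar> powr (2*H - 2) * indicator {0..t} u * indicator {0..t} v)) \<partial>lborel \<partial>lborel)"
    unfolding absH_norm2_def
  proof (intro nn_integral_mono)
    fix u v :: real
    have "\<bar>h u\<bar> * \<bar>h v\<bar> \<le> (h u)\<^sup>2 / 2 + (h v)\<^sup>2 / 2"
      using sum_squares_bound[of "\<bar>h u\<bar>" "\<bar>h v\<bar>"] by simp
    then have "\<bar>h u\<bar> * \<bar>h v\<bar> * (\<bar>u - v\<bar> powr (2*H - 2) * indicator {0..t} u * indicator {0..t} v)
      \<le> ((h u)\<^sup>2 / 2 + (h v)\<^sup>2 / 2) * (\<bar>u - v\<bar> powr (2*H - 2) * indicator {0..t} u * indicator {0..t} v)"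
      by (intro mult_right_mono) auto
    then have "ennreal (\<bar>h u\<bar> * \<bar>h v\<bar> * (\<bar>u - v\<bar> powr (2*H - 2) * indicator {0..t} u * indicator {0..t} v))
      \<le> ennreal ((h u)\<^sup>2 / 2 * (\<bar>u - v\<bar> powr (2*H - 2) * indicator {0..t} u * indicator {0..t} v)
         + (h v)\<^sup>2 / 2 * (\<bar>u - v\<bar> powr (2*H - 2) * indicator {0..t} u * indicator {0..t} v))"
      unfolding distrib_right by (rule ennreal_leI)
    also have "\<dots> = ennreal ((h u)\<^sup>2 / 2 * (\<bar>u - v\<bar> powr (2*H - 2) * indicator {0..t} u * indicator {0..t} v))
         + ennreal ((h v)\<^sup>2 / 2 * (\<bar>u - v\<bar> powr (2*H - 2) * indicator {0..t} u * indicator {0..t} v))"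
      by (intro ennreal_plus mult_nonneg_nonneg) auto
    finally show "ennreal (\<bar>h u\<bar> * \<bar>h v\<bar> * \<bar>u - v\<bar> powr (2*H - 2) * indicator {0..t} u * indicator {0..t} v)
      \<le> ennreal ((h u)\<^sup>2 / 2 * 1 * \<bar>u - v\<bar> powr (2*H - 2) * indicator {0..t} u * indicator {0..t} v)
      + ennreal ((h v)\<^sup>2 / 2 * 1 * \<bar>u - v\<bar> powr (2*H - 2) * indicator {0..t} u * indicator {0..t} v)"
      by (simp only: mult.assoc mult_1_left)
  qed
  also have "\<dots> = (\<integral>\<^sup>+u. (\<integral>\<^sup>+v. ennreal ((h u)\<^sup>2 / 2 * 1 * \<bar>u - v\<bar> powr (2*H - 2) * indicator {0..t} u * indicator {0..t} v) \<partial>lborel)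
      + (\<integral>\<^sup>+v. ennreal ((h v)\<^sup>2 / 2 * 1 * \<bar>u - v\<bar> powr (2*H - 2) * indicator {0..t} u * indicator {0..t} v) \<partial>lborel) \<partial>lborel)"
    by (intro nn_integral_cong nn_integral_add) auto
  also have "\<dots> = K + (\<integral>\<^sup>+u. \<integral>\<^sup>+v. ennreal ((h v)\<^sup>2 / 2 * 1 * \<bar>u - v\<bar> powr (2*H - 2) * indicator {0..t} u * indicator {0..t} v) \<partial>lborel \<partial>lborel)"
    unfolding K_def by (intro nn_integral_add) auto
  also have "\<dots> = K + K"
    unfolding K_def by (subst nn_integral_kernel_swap) auto
  also have "\<dots> \<le> ennreal (kernel_bound H T) * (\<integral>\<^sup>+u. ennreal ((h u)\<^sup>2 / 2) * indicator {0..t} u \<partial>lborel)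
     + ennreal (kernel_bound H T) * (\<integral>\<^sup>+u. ennreal ((h u)\<^sup>2 / 2) * indicator {0..t} u \<partial>lborel)"
  proof -
    have "K \<le> ennreal (kernel_bound H T) * (\<integral>\<^sup>+u. ennreal ((h u)\<^sup>2 / 2) * indicator {0..t} u \<partial>lborel)"
      using nn_integral_kernel_fst_le[OF H t, of "\<lambda>u. (h u)\<^sup>2 / 2"] by (simp add: K_def)
    then show ?thesis by (intro add_mono)
  qed
  also have "\<dots> = ennreal (kernel_bound H T) * (\<integral>\<^sup>+u. ennreal ((h u)\<^sup>2 / 2) * indicator {0..t} u
      + ennreal ((h u)\<^sup>2 / 2) * indicator {0..t} u \<partial>lborel)"
    by (subst nn_integral_add) (auto simp: distrib_left)
  also have "(\<integral>\<^sup>+u. ennreal ((h u)\<^sup>2 / 2) * indicator {0..t} u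
      + ennreal ((h u)\<^sup>2 / 2) * indicator {0..t} u \<partial>lborel) = (\<integral>\<^sup>+u. ennreal ((h u)\<^sup>2) * indicator {0..t} u \<partial>lborel)"
  proof (intro nn_integral_cong)
    fix u :: real
    have "ennreal ((h u)\<^sup>2 / 2) + ennreal ((h u)\<^sup>2 / 2) = ennreal ((h u)\<^sup>2)"
      by (subst ennreal_plus[symmetric]) auto
    then show "ennreal ((h u)\<^sup>2 / 2) * indicator {0..t} u + ennreal ((h u)\<^sup>2 / 2) * indicator {0..t} u
       = ennreal ((h u)\<^sup>2) * indicator {0..t} u" by (simp add: distrib_right[symmetric])
  qed
  finally show ?thesis .
qed

text \<open>The product of sums is multiplied out. In the two cross terms, equal by symmetry, the
  bounded factor \<open>k\<close> is replaced by its bound, which leaves the L1 norm of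
  \<open>h\<close>; this is how an \<open>h\<close> without any uniform bound can be
  treated.\<close>

lemma absH_norm2_diff_le:
  assumes H: "1/2 < H" and t: "0 \<le> t" "t \<le> T"
    and [measurable]: "h \<in> borel_measurable borel" "k \<in> borel_measurable borel"
    and G: "\<And>u. \<bar>k u\<bar> \<le> G"
  shows "absH_norm2 H t (\<lambda>u. h u - k u) \<le> absH_norm2 H t h + absH_norm2 H t k
    + 2 * (ennreal (G * kernel_bound H T) * (\<integral>\<^sup>+u. ennreal \<bar>h u\<bar> * indicator {0..t} u \<partial>lborel))"
proof -
  have G0: "0 \<le> G" using G[of 0] by simp
  let ?w = "\<lambda>u v. \<bar>u - v\<bar> powr (2*H - 2) * indicator {0..t} u * indicator {0..t} v :: real"
  let ?E = "\<lambda>a b u v. ennreal (a u * b v * \<bar>u - v\<bar> powr (2*H - 2) * indicator {0..t} u * indicator {0..t} v)"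
  let ?I = "\<lambda>f. \<integral>\<^sup>+u. \<integral>\<^sup>+v. f u v \<partial>lborel \<partial>lborel"
  define C where "C = ?I (?E (\<lambda>u. \<bar>h u\<bar>) (\<lambda>v. \<bar>k v\<bar>))"
  have "absH_norm2 H t (\<lambda>u. h u - k u) \<le> ?I (\<lambda>u v. (?E (\<lambda>u. \<bar>h u\<bar>) (\<lambda>v. \<bar>h v\<bar>) u v + ?E (\<lambda>u. \<bar>k u\<bar>) (\<lambda>v. \<bar>k v\<bar>) u v)
      + (?E (\<lambda>u. \<bar>h u\<bar>) (\<lambda>v. \<bar>k v\<bar>) u v + ennreal (\<bar>h v\<bar> * \<bar>k u\<bar> * \<bar>u - v\<bar> powr (2*H - 2) * indicator {0..t} u * indicator {0..t} v)))"
    unfolding absH_norm2_def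
  proof (intro nn_integral_mono)
    fix u v :: real
    have "\<bar>h u - k u\<bar> * \<bar>h v - k v\<bar> \<le> (\<bar>h u\<bar> + \<bar>k u\<bar>) * (\<bar>h v\<bar> + \<bar>k v\<bar>)"
      by (intro mult_mono) auto
    then have "\<bar>h u - k u\<bar> * \<bar>h v - k v\<bar> * ?w u v \<le> (\<bar>h u\<bar> + \<bar>k u\<bar>) * (\<bar>h v\<bar> + \<bar>k v\<bar>) * ?w u v"
      by (intro mult_right_mono) auto
    then have "ennreal (\<bar>h u - k u\<bar> * \<bar>h v - k v\<bar> * ?w u v) \<le> ennreal ((\<bar>h u\<bar> * \<bar>h v\<bar> * ?w u v + \<bar>k u\<bar> * \<bar>k v\<bar> * ?w u v)
        + (\<bar>h u\<bar> * \<bar>k v\<bar> * ?w u v + \<bar>h v\<bar> * \<bar>k u\<bar> * ?w u v))"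
      by (intro ennreal_leI) (simp add: algebra_simps)
    also have "\<dots> = (ennreal (\<bar>h u\<bar> * \<bar>h v\<bar> * ?w u v) + ennreal (\<bar>k u\<bar> * \<bar>k v\<bar> * ?w u v))
        + (ennreal (\<bar>h u\<bar> * \<bar>k v\<bar> * ?w u v) + ennreal (\<bar>h v\<bar> * \<bar>k u\<bar> * ?w u v))"
      by (simp add: ennreal_plus)
    finally show "ennreal (\<bar>h u - k u\<bar> * \<bar>h v - k v\<bar> * \<bar>u - v\<bar> powr (2*H - 2) * indicator {0..t} u * indicator {0..t} v)
     \<le> (?E (\<lambda>u. \<bar>h u\<bar>) (\<lambda>v. \<bar>h v\<bar>) u v + ?E (\<lambda>u. \<bar>k u\<bar>) (\<lambda>v. \<bar>k v\<bar>) u v)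
      + (?E (\<lambda>u. \<bar>h u\<bar>) (\<lambda>v. \<bar>k v\<bar>) u v + ennreal (\<bar>h v\<bar> * \<bar>k u\<bar> * \<bar>u - v\<bar> powr (2*H - 2) * indicator {0..t} u * indicator {0..t} v))"
      by (simp only: mult.assoc)
  qed
  also have "\<dots> = (\<integral>\<^sup>+u. ((\<integral>\<^sup>+v. ?E (\<lambda>u. \<bar>h u\<bar>) (\<lambda>v. \<bar>h v\<bar>) u v \<partial>lborel) + (\<integral>\<^sup>+v. ?E (\<lambda>u. \<bar>k u\<bar>) (\<lambda>v. \<bar>k v\<bar>) u v \<partial>lborel))
      + ((\<integral>\<^sup>+v. ?E (\<lambda>u. \<bar>h u\<bar>) (\<lambda>v. \<bar>k v\<bar>) u v \<partial>lborel)
       + (\<integral>\<^sup>+v. ennreal (\<bar>h v\<bar> * \<bar>k u\<bar> * \<bar>u - v\<bar> powr (2*H - 2) * indicator {0..t} u * indicator {0..t} v) \<partial>lborel)) \<partial>lborel)"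
    by (intro nn_integral_cong) (simp add: nn_integral_add)
  also have "\<dots> = (absH_norm2 H t h + absH_norm2 H t k) + (C + ?I (\<lambda>u v. ennreal (\<bar>h v\<bar> * \<bar>k u\<bar> * \<bar>u - v\<bar> powr (2*H - 2) * indicator {0..t} u * indicator {0..t} v)))"
    unfolding absH_norm2_def C_def by (simp add: nn_integral_add)
  also have "?I (\<lambda>u v. ennreal (\<bar>h v\<bar> * \<bar>k u\<bar> * \<bar>u - v\<bar> powr (2*H - 2) * indicator {0..t} u * indicator {0..t} v)) = C"
    unfolding C_def by (rule nn_integral_kernel_swap) auto
  also have "C \<le> ennreal (G * kernel_bound H T) * (\<integral>\<^sup>+u. ennreal \<bar>h u\<bar> * indicator {0..t} u \<partial>lborel)"
  proof -
    have "C \<le> ?I (\<lambda>u v. ennreal ((G * \<bar>h u\<bar>) * \<bar>u - v\<bar> powr (2*H - 2) * indicator {0..t} u * indicator {0..t} v))"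
      unfolding C_def
    proof (intro nn_integral_mono ennreal_leI mult_right_mono)
      show "\<bar>h u\<bar> * \<bar>k v\<bar> \<le> G * \<bar>h u\<bar>" for u v
        using mult_right_mono[OF G[of v], of "\<bar>h u\<bar>"] by (simp add: mult.commute)
    qed auto
    also have "\<dots> \<le> ennreal (kernel_bound H T) * (\<integral>\<^sup>+u. ennreal (G * \<bar>h u\<bar>) * indicator {0..t} u \<partial>lborel)"
      using G0 by (intro nn_integral_kernel_fst_le[OF H t]) auto
    also have "(\<integral>\<^sup>+u. ennreal (G * \<bar>h u\<bar>) * indicator {0..t} u \<partial>lborel) = (\<integral>\<^sup>+u. ennreal G * (ennreal \<bar>h u\<bar> * indicator {0..t} u) \<partial>lborel)"
      using G0 by (intro nn_integral_cong) (simp add: ennreal_mult mult.assoc)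
    also have "\<dots> = ennreal G * (\<integral>\<^sup>+u. ennreal \<bar>h u\<bar> * indicator {0..t} u \<partial>lborel)"
      by (intro nn_integral_cmult) auto
    finally show ?thesis
      using G0 kernel_bound_nonneg[OF H] by (simp add: ennreal_mult mult_ac)
  qed
  finally show ?thesis
    by (simp add: mult_2 add_mono)
qed

text \<open>The exponent 2H - 2 is negative and |u - v| is at most T, so off the diagonal the kernel
  is at least T powr (2H - 2), and the double integral dominates the square of the L1 norm.\<close>

lemma L1_le_absH_norm2:
  assumes H: "H < 1" and t: "0 \<le> t" "t \<le> T" and [measurable]: "h \<in> borel_measurable borel"
  shows "ennreal (T powr (2*H - 2)) * ((\<integral>\<^sup>+u. ennreal \<bar>h u\<bar> * indicator {0..t} u \<partial>lborel) * (\<integral>\<^sup>+u. ennreal \<bar>h u\<bar> * indicator {0..t} u \<partial>lborel))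
    \<le> absH_norm2 H t h"
proof -
  let ?J = "\<integral>\<^sup>+u. ennreal \<bar>h u\<bar> * indicator {0..t} u \<partial>lborel"
  have "ennreal (T powr (2*H - 2)) * (?J * ?J) = ennreal (T powr (2*H - 2)) * (\<integral>\<^sup>+u. ?J * (ennreal \<bar>h u\<bar> * indicator {0..t} u) \<partial>lborel)"
    by (subst nn_integral_cmult) auto
  also have "\<dots> = (\<integral>\<^sup>+u. ennreal (T powr (2*H - 2)) * ((ennreal \<bar>h u\<bar> * indicator {0..t} u) * ?J) \<partial>lborel)"
    by (subst nn_integral_cmult[symmetric]) (auto simp: mult_ac)
  also have "\<dots> \<le> absH_norm2 H t h"
    unfolding absH_norm2_def
  proof (intro nn_integral_mono)
    fix u :: real
    have "ennreal (T powr (2*H - 2)) * ((ennreal \<bar>h u\<bar> * indicator {0..t} u) * ?J)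
      = (\<integral>\<^sup>+v. (ennreal (T powr (2*H - 2)) * (ennreal \<bar>h u\<bar> * indicator {0..t} u)) * (ennreal \<bar>h v\<bar> * indicator {0..t} v) \<partial>lborel)"
      by (subst nn_integral_cmult) (auto simp: mult_ac)
    also have "\<dots> \<le> (\<integral>\<^sup>+v. ennreal (\<bar>h u\<bar> * \<bar>h v\<bar> * \<bar>u - v\<bar> powr (2*H - 2) * indicator {0..t} u * indicator {0..t} v) \<partial>lborel)"
    \<comment> \<open>On the diagonal the lower bound fails, because 0 powr (2H - 2) is 0; the
      single point v = u is discarded.\<close>
    proof (intro nn_integral_mono_AE, use AE_lborel_singleton[of u] in eventually_elim)
      fix v assume "v \<noteq> u"
      show "(ennreal (T powr (2*H - 2)) * (ennreal \<bar>h u\<bar> * indicator {0..t} u)) * (ennreal \<bar>h v\<bar> * indicator {0..t} v)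
        \<le> ennreal (\<bar>h u\<bar> * \<bar>h v\<bar> * \<bar>u - v\<bar> powr (2*H - 2) * indicator {0..t} u * indicator {0..t} v)"
      proof (cases "u \<in> {0..t} \<and> v \<in> {0..t}")
        case True
        have "T powr (2*H - 2) \<le> \<bar>u - v\<bar> powr (2*H - 2)"
          using True \<open>v \<noteq> u\<close> H t by (intro powr_mono2') auto
        then have "T powr (2*H - 2) * \<bar>h u\<bar> * \<bar>h v\<bar> \<le> \<bar>h u\<bar> * \<bar>h v\<bar> * \<bar>u - v\<bar> powr (2*H - 2)"
          using mult_right_mono[of "T powr (2*H - 2)" "\<bar>u - v\<bar> powr (2*H - 2)" "\<bar>h u\<bar> * \<bar>h v\<bar>"] by (simp add: mult_ac)
        then have "ennreal (T powr (2*H - 2) * \<bar>h u\<bar> * \<bar>h v\<bar>) \<le> ennreal (\<bar>h u\<bar> * \<bar>h v\<bar> * \<bar>u - v\<bar> powr (2*H - 2))"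
          by (rule ennreal_leI)
        then show ?thesis using True by (simp add: ennreal_mult)
      qed auto
    qed
    finally show "ennreal (T powr (2*H - 2)) * ((ennreal \<bar>h u\<bar> * indicator {0..t} u) * ?J)
      \<le> (\<integral>\<^sup>+v. ennreal (\<bar>h u\<bar> * \<bar>h v\<bar> * \<bar>u - v\<bar> powr (2*H - 2) * indicator {0..t} u * indicator {0..t} v) \<partial>lborel)" .
  qed
  finally show ?thesis .
qed

lemma ennreal_tendsto_0_of_squares:
  fixes x y :: "nat \<Rightarrow> ennreal"
  assumes c: "c > 0" and le: "\<And>n. ennreal c * (x n * x n) \<le> y n" and y: "y \<longlonglongrightarrow> 0"
  shows "x \<longlonglongrightarrow> 0"
proof (rule order_tendstoI)
  fix e :: ennreal assume e: "0 < e"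
  obtain r where r: "0 < r" "ennreal r \<le> e"
  proof (cases e)
    case (real r)
    then show ?thesis using that[of r] e by (auto simp: ennreal_less_zero_iff)
  next
    case top
    then show ?thesis using that[of 1] by auto
  qed
  have "\<forall>\<^sub>F n in sequentially. y n < ennreal (c * (r * r))"
    using order_tendstoD(2)[OF y, of "ennreal (c * (r * r))"] c r by (simp add: ennreal_less_zero_iff)
  then show "\<forall>\<^sub>F n in sequentially. x n < e"
  proof eventually_elim
    case (elim n)
    show ?case
    proof (rule ccontr)
      assume "\<not> x n < e"
      then have "ennreal r \<le> x n" using r by auto
      then have "ennreal c * (ennreal r * ennreal r) \<le> ennreal c * (x n * x n)"
        by (intro mult_left_mono mult_mono) auto
      then have "ennreal (c * (r * r)) \<le> y n"
        using le[of n] c r by (simp add: ennreal_mult)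
      then show False using elim by simp
    qed
  qed
qed auto

lemma absH_norm2_cong:
  "(\<And>u. u \<in> {0..t} \<Longrightarrow> h u = k u) \<Longrightarrow> absH_norm2 H t h = absH_norm2 H t k"
  unfolding absH_norm2_def by (intro nn_integral_cong) (auto simp: indicator_def)

lemma absH_norm2_support:
  assumes "\<And>u. u \<notin> {0..t} \<Longrightarrow> h u = 0" "t \<le> T"
  shows "absH_norm2 H T h = absH_norm2 H t h"
  unfolding absH_norm2_def
proof (intro nn_integral_cong arg_cong[where f=ennreal])
  fix u v
  show "\<bar>h u\<bar> * \<bar>h v\<bar> * \<bar>u - v\<bar> powr (2 * H - 2) * indicator {0..T} u * indicator {0..T} v
    = \<bar>h u\<bar> * \<bar>h v\<bar> * \<bar>u - v\<bar> powr (2 * H - 2) * indicator {0..t} u * indicator {0..t} v"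
    using assms(1)[of u] assms(1)[of v] assms(2)
    by (cases "u \<in> {0..t}"; cases "v \<in> {0..t}") (auto simp: indicator_def)
qed

section \<open>Approximation by step functions on a uniform grid\<close>

lemma grid_point_le:
  fixes T :: real
  assumes "k < N" "T > 0"
  shows "real (Suc k) * T / N \<le> T"
proof -
  have "real (Suc k) * T \<le> real N * T"
    using assms by (intro mult_right_mono) auto
  then show ?thesis using assms by (simp add: divide_le_eq mult.commute)
qed

text \<open>Cells are open on the left, so the cell of u is found with a ceiling. The coefficients
  are quantified inside the conclusion so that one index k serves every choice of them.\<close>

lemma grid_partition_value:
  fixes T u :: real
  assumes N: "N > 0" and T: "T > 0" and u: "0 < u" "u \<le> T"
  obtains k where "k < N" "real k * T / N < u" "u \<le> real (Suc k) * T / N"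
    "\<forall>c :: nat \<Rightarrow> real. (\<Sum>j<N. c j * indicator {real j * T / N<..real (Suc j) * T / N} u) = c k"
proof -
  define k where "k = nat (\<lceil>u * N / T\<rceil> - 1)"
  have pos: "0 < u * N / T" using assms by auto
  have le: "u * N / T \<le> N" using assms by (auto simp: field_simps)
  have "1 \<le> \<lceil>u * N / T\<rceil>" using pos by linarith
  then have k: "real k = of_int \<lceil>u * N / T\<rceil> - 1" by (simp add: k_def of_nat_nat)
  have b: "real k < u * N / T" "u * N / T \<le> real (Suc k)" using k by linarith+
  have b': "real k * T / N < u" "u \<le> real (Suc k) * T / N"
    using b N T by (auto simp: field_simps)
  have kN: "k < N" using b(1) le by linarith
  have uniq: "indicator {real j * T / N<..real (Suc j) * T / N} u = (if j = k then 1 else 0 :: real)" for j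
  proof (cases "j = k")
    case False
    have "\<not> (real j * T / N < u \<and> u \<le> real (Suc j) * T / N)"
    proof
      assume "real j * T / N < u \<and> u \<le> real (Suc j) * T / N"
      then have "real j < u * N / T" "u * N / T \<le> real (Suc j)"
        using N T by (auto simp: field_simps)
      then have "real j < real (Suc k)" "real k < real (Suc j)" using b by linarith+
      then show False using False by linarith
    qed
    then show ?thesis using False by (auto simp: indicator_def)
  qed (use b' in auto)
  show ?thesis
  proof (rule that[OF kN b'])
    show "\<forall>c :: nat \<Rightarrow> real. (\<Sum>j<N. c j * indicator {real j * T / N<..real (Suc j) * T / N} u) = c k"
      unfolding uniq using kN by (simp add: if_distrib[of "(*) _"] cong: if_cong)
  qed
qed

lemma grid_partition_value_0:
  fixes T u :: real
  assumes N: "N > 0" and T: "T > 0" and u: "\<not> (0 < u \<and> u \<le> T)"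
  shows "(\<Sum>j<N. c j * indicator {real j * T / N<..real (Suc j) * T / N} u) = (0::real)"
proof (intro sum.neutral ballI)
  fix j assume j: "j \<in> {..<N}"
  have "real (Suc j) * T / N \<le> T" "0 \<le> real j * T / N"
    using j N T grid_point_le[of j N T] by auto
  then have "u \<notin> {real j * T / N<..real (Suc j) * T / N}" using u by auto
  then show "c j * indicator {real j * T / N<..real (Suc j) * T / N} u = 0" by simp
qed

text \<open>A Lebesgue measurable function is an almost everywhere limit of continuous ones.
  Clipping these to [-G, G] does not move the limit, keeps the bound G and supplies the majorant for
  dominated convergence.\<close>

lemma continuous_approximation_L2:
  fixes g :: "real \<Rightarrow> real"
  assumes [measurable]: "g \<in> borel_measurable borel" and G: "\<And>u. \<bar>g u\<bar> \<le> G" and T: "T \<ge> 0" and e: "e > 0"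
  obtains h where "continuous_on UNIV h" "\<And>u. \<bar>h u\<bar> \<le> G"
    "(\<integral>\<^sup>+u. ennreal ((g u - h u)\<^sup>2) * indicator {0..T} u \<partial>lborel) < ennreal e"
proof -
  have G0: "0 \<le> G" using G[of 0] by simp
  have "g \<in> borel_measurable lebesgue" by (simp add: measurable_completion)
  then have "g measurable_on UNIV" by (intro lebesgue_measurable_imp_measurable_on) auto
  then obtain N gs where N: "negligible N" "\<And>n. continuous_on UNIV (gs n)" "\<And>x. x \<notin> N \<Longrightarrow> (\<lambda>n. gs n x) \<longlonglongrightarrow> g x"
    unfolding measurable_on_def by auto
  define h where "h n u = max (- G) (min G (gs n u))" for n :: nat and u
  have hc: "continuous_on UNIV (h n)" for n
    unfolding h_def by (intro continuous_intros N)
  have [measurable]: "h n \<in> borel_measurable borel" for n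
    using hc by (rule borel_measurable_continuous_onI)
  have hG: "\<bar>h n u\<bar> \<le> G" for n u using G0 by (auto simp: h_def)
  have "AE u in lebesgue. u \<notin> N"
    using N(1) by (intro AE_not_in) (simp add: negligible_iff_null_sets)
  then have AEN: "AE u in lborel. u \<notin> N" by (simp add: AE_completion_iff)
  have "(\<lambda>n. \<integral>\<^sup>+u. ennreal ((g u - h n u)\<^sup>2) * indicator {0..T} u \<partial>lborel) \<longlonglongrightarrow> (\<integral>\<^sup>+u. 0 \<partial>(lborel :: real measure))"
  proof (rule nn_integral_dominated_convergence[where w="\<lambda>u. ennreal ((2 * G)\<^sup>2) * indicator {0..T} u"])
    show "AE u in lborel. ennreal ((g u - h n u)\<^sup>2) * indicator {0..T} u \<le> ennreal ((2 * G)\<^sup>2) * indicator {0..T} u" for n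
    proof (intro AE_I2 mult_right_mono ennreal_leI)
      fix u
      have "\<bar>g u - h n u\<bar> \<le> 2 * G" using G[of u] hG[of n u] by auto
      then show "(g u - h n u)\<^sup>2 \<le> (2 * G)\<^sup>2" by (metis abs_ge_zero power2_abs power_mono)
    qed auto
    show "(\<integral>\<^sup>+u. ennreal ((2 * G)\<^sup>2) * indicator {0..T} u \<partial>lborel) < \<infinity>"
      using T by (subst nn_integral_cmult_indicator) (auto simp: ennreal_mult_less_top)
    show "AE u in lborel. (\<lambda>n. ennreal ((g u - h n u)\<^sup>2) * indicator {0..T} u) \<longlonglongrightarrow> 0"
      using AEN
    proof eventually_elim
      case (elim u)
      have "(\<lambda>n. h n u) \<longlonglongrightarrow> max (- G) (min G (g u))"
        unfolding h_def using N(3)[OF elim] by (intro tendsto_intros)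
      then have "(\<lambda>n. h n u) \<longlonglongrightarrow> g u" using G[of u] by (simp add: min_def max_def split: if_splits)
      then have "(\<lambda>n. ennreal ((g u - h n u)\<^sup>2) * indicator {0..T} u) \<longlonglongrightarrow> ennreal ((g u - g u)\<^sup>2) * indicator {0..T} u"
        by (intro tendsto_mult_ennreal tendsto_ennrealI tendsto_intros) (auto simp: indicator_def)
      then show ?case by simp
    qed
  qed auto
  then have "\<forall>\<^sub>F n in sequentially. (\<integral>\<^sup>+u. ennreal ((g u - h n u)\<^sup>2) * indicator {0..T} u \<partial>lborel) < ennreal e"
    using e by (intro order_tendstoD(2)) auto
  then obtain n where "(\<integral>\<^sup>+u. ennreal ((g u - h n u)\<^sup>2) * indicator {0..T} u \<partial>lborel) < ennreal e"
    by (auto simp: eventually_sequentially)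
  then show ?thesis using that[of "h n"] hc hG by blast
qed

text \<open>A continuous approximation is sampled at the right end points of a fine grid. The bound
  G on the coefficients is part of the conclusion because \<open>L2_wiener\<close> asks for
  approximations bounded uniformly in n.\<close>

lemma step_approximation_L2:
  fixes g :: "real \<Rightarrow> real"
  assumes [measurable]: "g \<in> borel_measurable borel" and G: "\<And>u. \<bar>g u\<bar> \<le> G" and T: "T > 0" and e: "e > 0"
  obtains N :: nat and c where "N > 0" "\<And>k. \<bar>c k\<bar> \<le> G"
    "(\<integral>\<^sup>+u. ennreal ((g u - (\<Sum>j<N. c j * indicator {real j * T / N<..real (Suc j) * T / N} u))\<^sup>2) * indicator {0..T} u \<partial>lborel) \<le> ennreal e"
proof -
  obtain h where h: "continuous_on UNIV h" "\<And>u. \<bar>h u\<bar> \<le> G"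
    "(\<integral>\<^sup>+u. ennreal ((g u - h u)\<^sup>2) * indicator {0..T} u \<partial>lborel) < ennreal (e / 4)"
    using continuous_approximation_L2[of g G T "e / 4"] assms by auto
  have [measurable]: "h \<in> borel_measurable borel"
    using h(1) by (rule borel_measurable_continuous_onI)
  \<comment> \<open>The continuous approximation contributes twice e / 4 and the sampling twice d^2
    T, each e / 2; the factors 2 come from squaring a sum of two terms.\<close>
  define d where "d = sqrt (e / (4 * T))"
  have d: "d > 0" "2 * (d\<^sup>2 * T) = e / 2" using e T by (auto simp: d_def)
  have "uniformly_continuous_on {0..T} h"
    using h(1) by (intro compact_uniformly_continuous) (auto intro: continuous_on_subset)
  then obtain r where r: "r > 0" "\<And>x y. x \<in> {0..T} \<Longrightarrow> y \<in> {0..T} \<Longrightarrow> dist y x < r \<Longrightarrow> dist (h y) (h x) < d"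
    using d(1) unfolding uniformly_continuous_on_def by meson
  obtain N where N: "T / r < real N" using reals_Archimedean2 by blast
  have N0: "N > 0" using N T r(1) by (cases N) (auto simp: field_simps)
  have Nr: "T / N < r" using N N0 r(1) T by (simp add: field_simps)
  define c where "c k = h (real (Suc k) * T / N)" for k
  let ?f = "\<lambda>u. \<Sum>j<N. c j * indicator {real j * T / N<..real (Suc j) * T / N} u"
  have close: "(h u - ?f u)\<^sup>2 \<le> d\<^sup>2" if u: "0 < u" "u \<le> T" for u
  proof -
    obtain k where k: "k < N" "real k * T / N < u" "u \<le> real (Suc k) * T / N"
      "\<forall>c :: nat \<Rightarrow> real. (\<Sum>j<N. c j * indicator {real j * T / N<..real (Suc j) * T / N} u) = c k"
      by (rule grid_partition_value[OF N0 T u])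
    have fk: "?f u = c k" by (rule k(4)[rule_format])
    have "real (Suc k) * T / N \<le> T" using k(1) T by (rule grid_point_le)
    moreover have "real (Suc k) * T / N - u < T / N" using k(2) by (simp add: distrib_right add_divide_distrib)
    ultimately have "dist (h u) (h (real (Suc k) * T / N)) < d"
      using u k Nr T by (intro r(2)) (auto simp: dist_real_def)
    then have "\<bar>h u - c k\<bar> \<le> d" unfolding c_def dist_real_def by (rule less_imp_le)
    then have "\<bar>h u - ?f u\<bar> \<le> d" by (simp only: fk)
    from power_mono[OF this, of 2] show ?thesis unfolding power2_abs by simp
  qed
  have "(\<integral>\<^sup>+u. ennreal ((g u - ?f u)\<^sup>2) * indicator {0..T} u \<partial>lborel)
     \<le> (\<integral>\<^sup>+u. ennreal 2 * (ennreal ((g u - h u)\<^sup>2) * indicator {0..T} u) + ennreal (2 * d\<^sup>2) * indicator {0..T} u \<partial>lborel)"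
  \<comment> \<open>The point 0 lies in no cell, because cells are open on the left, and is
    discarded.\<close>
  proof (intro nn_integral_mono_AE, use AE_lborel_singleton[of "0::real"] in eventually_elim)
    fix u :: real assume u0: "u \<noteq> 0"
    show "ennreal ((g u - ?f u)\<^sup>2) * indicator {0..T} u \<le> ennreal 2 * (ennreal ((g u - h u)\<^sup>2) * indicator {0..T} u) + ennreal (2 * d\<^sup>2) * indicator {0..T} u"
    proof (cases "u \<in> {0..T}")
      case True
      then have "(h u - ?f u)\<^sup>2 \<le> d\<^sup>2" using u0 by (intro close) auto
      moreover have "(g u - ?f u)\<^sup>2 \<le> 2 * (g u - h u)\<^sup>2 + 2 * (h u - ?f u)\<^sup>2"
        using sum_squares_bound[of "g u - h u" "h u - ?f u"] by (simp add: power2_eq_square algebra_simps)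
      ultimately have "ennreal ((g u - ?f u)\<^sup>2) \<le> ennreal (2 * (g u - h u)\<^sup>2 + 2 * d\<^sup>2)"
        by (intro ennreal_leI) linarith
      then show ?thesis using True by (simp add: ennreal_plus ennreal_mult)
    qed simp
  qed
  also have "\<dots> = ennreal 2 * (\<integral>\<^sup>+u. ennreal ((g u - h u)\<^sup>2) * indicator {0..T} u \<partial>lborel) + ennreal (2 * d\<^sup>2) * ennreal T"
    using T by (simp add: nn_integral_add nn_integral_cmult nn_integral_cmult_indicator)
  also have "\<dots> \<le> ennreal 2 * ennreal (e / 4) + ennreal (2 * d\<^sup>2) * ennreal T"
    using h(3) by (intro add_mono mult_left_mono) auto
  also have "\<dots> = ennreal (2 * (e / 4) + 2 * d\<^sup>2 * T)"
    using e T by (simp only: ennreal_mult[symmetric] ennreal_plus[symmetric] mult_nonneg_nonneg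
        zero_le_power2 zero_le_numeral divide_nonneg_nonneg less_imp_le)
  also have "2 * (e / 4) + 2 * d\<^sup>2 * T = e" using d(2) by simp
  finally show ?thesis using that[of N c] N0 h(2) by (simp add: c_def)
qed

section \<open>The Wiener integral\<close>

definition L2_norm2 :: "real \<Rightarrow> (real \<Rightarrow> real) \<Rightarrow> ennreal" where
  "L2_norm2 T h = (\<integral>\<^sup>+u. ennreal ((h u)\<^sup>2) * indicator {0..T} u \<partial>lborel)"

lemma nn_integral_square_add_le:
  fixes f g :: "'b \<Rightarrow> real"
  assumes [measurable]: "f \<in> borel_measurable N" "g \<in> borel_measurable N" "A \<in> sets N"
  shows "(\<integral>\<^sup>+x. ennreal ((f x + g x)\<^sup>2) * indicator A x \<partial>N)
    \<le> 2 * (\<integral>\<^sup>+x. ennreal ((f x)\<^sup>2) * indicator A x \<partial>N) + 2 * (\<integral>\<^sup>+x. ennreal ((g x)\<^sup>2) * indicator A x \<partial>N)"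
proof -
  have "(\<integral>\<^sup>+x. ennreal ((f x + g x)\<^sup>2) * indicator A x \<partial>N)
    \<le> (\<integral>\<^sup>+x. 2 * (ennreal ((f x)\<^sup>2) * indicator A x) + 2 * (ennreal ((g x)\<^sup>2) * indicator A x) \<partial>N)"
  proof (intro nn_integral_mono)
    fix x
    have "(f x + g x)\<^sup>2 \<le> 2 * (f x)\<^sup>2 + 2 * (g x)\<^sup>2"
      using sum_squares_bound[of "f x" "g x"] by (simp add: power2_sum)
    then have "ennreal ((f x + g x)\<^sup>2) \<le> ennreal (2 * (f x)\<^sup>2 + 2 * (g x)\<^sup>2)" by (rule ennreal_leI)
    then show "ennreal ((f x + g x)\<^sup>2) * indicator A x \<le> 2 * (ennreal ((f x)\<^sup>2) * indicator A x) + 2 * (ennreal ((g x)\<^sup>2) * indicator A x)"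
      by (auto simp: indicator_def ennreal_plus ennreal_mult)
  qed
  also have "\<dots> = 2 * (\<integral>\<^sup>+x. ennreal ((f x)\<^sup>2) * indicator A x \<partial>N) + 2 * (\<integral>\<^sup>+x. ennreal ((g x)\<^sup>2) * indicator A x \<partial>N)"
    by (simp add: nn_integral_add nn_integral_cmult)
  finally show ?thesis .
qed

lemma L2_norm2_add_le:
  "f \<in> borel_measurable borel \<Longrightarrow> g \<in> borel_measurable borel \<Longrightarrow>
    L2_norm2 T (\<lambda>u. f u + g u) \<le> 2 * L2_norm2 T f + 2 * L2_norm2 T g"
  unfolding L2_norm2_def by (intro nn_integral_square_add_le) auto

lemma nn_integral_square_sum_le:
  fixes f g :: "'b \<Rightarrow> real"
  assumes "f \<in> borel_measurable N" "g \<in> borel_measurable N"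
  shows "(\<integral>\<^sup>+x. ennreal ((f x + g x)\<^sup>2) \<partial>N) \<le> 2 * (\<integral>\<^sup>+x. ennreal ((f x)\<^sup>2) \<partial>N) + 2 * (\<integral>\<^sup>+x. ennreal ((g x)\<^sup>2) \<partial>N)"
proof -
  have eq: "(\<integral>\<^sup>+x. ennreal (h x) * indicator (space N) x \<partial>N) = (\<integral>\<^sup>+x. ennreal (h x) \<partial>N)" for h
    by (intro nn_integral_cong) auto
  show ?thesis using nn_integral_square_add_le[OF assms sets.top] unfolding eq .
qed

text \<open>Fatou's lemma, in the form that carries a uniform moment bound to an almost sure
  limit.\<close>

lemma nn_integral_le_of_AE_tendsto:
  fixes f :: "nat \<Rightarrow> 'a \<Rightarrow> real"
  assumes [measurable]: "\<And>k. f k \<in> borel_measurable M"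
    and lim: "AE \<omega> in M. (\<lambda>k. f k \<omega>) \<longlonglongrightarrow> g \<omega>"
    and le: "\<And>k. (\<integral>\<^sup>+\<omega>. ennreal (f k \<omega>) \<partial>M) \<le> c"
  shows "(\<integral>\<^sup>+\<omega>. ennreal (g \<omega>) \<partial>M) \<le> c"
proof -
  have "(\<integral>\<^sup>+\<omega>. ennreal (g \<omega>) \<partial>M) = (\<integral>\<^sup>+\<omega>. liminf (\<lambda>k. ennreal (f k \<omega>)) \<partial>M)"
  proof (intro nn_integral_cong_AE, use lim in eventually_elim)
    case (elim \<omega>)
    show "ennreal (g \<omega>) = liminf (\<lambda>k. ennreal (f k \<omega>))"
      by (intro lim_imp_Liminf[symmetric] tendsto_ennrealI elim) simp
  qed
  also have "\<dots> \<le> liminf (\<lambda>k. \<integral>\<^sup>+\<omega>. ennreal (f k \<omega>) \<partial>M)"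
    by (intro nn_integral_liminf) measurable
  also have "\<dots> \<le> liminf (\<lambda>k::nat. c)"
    by (intro Liminf_mono always_eventually allI le)
  also have "\<dots> = c" by (simp add: Liminf_const)
  finally show ?thesis .
qed

text \<open>Along indices with second moment at most 2^-k, \<open>summable_increments_moment\<close>
  makes the sum of the absolute values finite almost surely. The predicate \<open>P\<close> lets
  every chosen index also satisfy a property that holds eventually, such as a bound on the
  integrands.\<close>

lemma L2_convergence_AE_subsequence:
  fixes X :: "nat \<Rightarrow> 'a \<Rightarrow> real"
  assumes [measurable]: "\<And>n. X n \<in> borel_measurable M"
    and lim: "(\<lambda>n. \<integral>\<^sup>+\<omega>. ennreal ((X n \<omega>)\<^sup>2) \<partial>M) \<longlonglongrightarrow> 0"
    and P: "\<forall>\<^sub>F n in sequentially. P n"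
  obtains r :: "nat \<Rightarrow> nat" where "\<And>k. P (r k)" "AE \<omega> in M. (\<lambda>k. X (r k) \<omega>) \<longlonglongrightarrow> 0"
proof -
  have "\<exists>n. P n \<and> (\<integral>\<^sup>+\<omega>. ennreal ((X n \<omega>)\<^sup>2) \<partial>M) \<le> ennreal (1 * (1/2) ^ k)" for k :: nat
  proof -
    have "\<forall>\<^sub>F n in sequentially. (\<integral>\<^sup>+\<omega>. ennreal ((X n \<omega>)\<^sup>2) \<partial>M) < ennreal (1 * (1/2) ^ k)"
      by (intro order_tendstoD(2)[OF lim]) auto
    then have "\<forall>\<^sub>F n in sequentially. P n \<and> (\<integral>\<^sup>+\<omega>. ennreal ((X n \<omega>)\<^sup>2) \<partial>M) \<le> ennreal (1 * (1/2) ^ k)"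
      using P by eventually_elim auto
    then show ?thesis by (auto simp: eventually_sequentially)
  qed
  then obtain r where r: "\<And>k. P (r k)" "\<And>k. (\<integral>\<^sup>+\<omega>. ennreal ((X (r k) \<omega>)\<^sup>2) \<partial>M) \<le> ennreal (1 * (1/2) ^ k)"
    by metis
  have sq: "(\<integral>\<^sup>+\<omega>. ennreal (\<bar>X (r k) \<omega>\<bar> powr 2) \<partial>M) \<le> ennreal (1 * (1/2) ^ k)" for k
    using r(2)[of k] by (simp add: powr_numeral)
  obtain S where "AE \<omega> in M. summable (\<lambda>k. \<bar>X (r k) \<omega>\<bar>) \<and> (\<Sum>k. \<bar>X (r k) \<omega>\<bar>) \<le> S \<omega>"
    by (rule summable_increments_moment[of "\<lambda>k \<omega>. \<bar>X (r k) \<omega>\<bar>" M 2 "1/2" 1, OF _ _ _ _ _ _ sq]) auto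
  then have "AE \<omega> in M. (\<lambda>k. X (r k) \<omega>) \<longlonglongrightarrow> 0"
  proof eventually_elim
    case (elim \<omega>)
    then have "(\<lambda>k. \<bar>X (r k) \<omega>\<bar>) \<longlonglongrightarrow> 0" by (intro summable_LIMSEQ_zero) auto
    then show ?case by (simp add: tendsto_rabs_zero_iff)
  qed
  then show ?thesis using r(1) by (intro that)
qed

lemma tendsto_ennreal_numeral_mult_0:
  fixes f :: "nat \<Rightarrow> ennreal"
  shows "f \<longlonglongrightarrow> 0 \<Longrightarrow> c \<noteq> \<top> \<Longrightarrow> (\<lambda>n. c * f n) \<longlonglongrightarrow> 0"
  using ennreal_tendsto_cmult[of c f 0 sequentially] by (simp add: less_top)

lemma tendsto_ennreal_sandwich_0:
  fixes f g :: "nat \<Rightarrow> ennreal"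
  assumes "\<And>n. f n \<le> g n" "g \<longlonglongrightarrow> 0"
  shows "f \<longlonglongrightarrow> 0"
  by (rule tendsto_sandwich[OF _ _ tendsto_const assms(2)]) (auto simp: assms(1))

lemma AE_eq_of_square_nn_integral_0:
  fixes f g :: "'a \<Rightarrow> real"
  assumes [measurable]: "f \<in> borel_measurable M" "g \<in> borel_measurable M"
    and "(\<integral>\<^sup>+\<omega>. ennreal ((f \<omega> - g \<omega>)\<^sup>2) \<partial>M) = 0"
  shows "AE \<omega> in M. f \<omega> = g \<omega>"
proof -
  have "AE \<omega> in M. ennreal ((f \<omega> - g \<omega>)\<^sup>2) = 0"
    using assms(3) by (subst (asm) nn_integral_0_iff_AE) auto
  then show ?thesis by eventually_elim (simp add: ennreal_eq_0_iff)
qed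

text \<open>Changing an adapted variable on a null set keeps it adapted: by completeness every
  subset of a null set is itself a null set, and \<open>N\<close> contains all null sets. This is
  how the continuous version of the Wiener integral inherits adaptedness.\<close>

lemma complete_AE_measurable:
  fixes f f' :: "'a \<Rightarrow> 'b::topological_space"
  assumes M: "complete_measure M" and N: "space N = space M" "sets N \<subseteq> sets M" "null_sets M \<subseteq> sets N"
    and f: "f \<in> borel_measurable N" and eq: "AE \<omega> in M. f' \<omega> = f \<omega>"
  shows "f' \<in> borel_measurable N"
proof (rule measurableI)
  fix A :: "'b set" assume A: "A \<in> sets borel"
  obtain D where D: "D \<in> null_sets M" "{\<omega> \<in> space M. f' \<omega> \<noteq> f \<omega>} \<subseteq> D"
    using eq by (auto simp: eventually_ae_filter)
  have "f' -` A \<inter> space N \<inter> D \<in> null_sets M"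
    using D(1) complete_measure.complete[OF M, of "f' -` A \<inter> space N \<inter> D" D]
    by (intro null_sets_subset[OF D(1)]) auto
  then have 1: "f' -` A \<inter> space N \<inter> D \<in> sets N" using N(3) by auto
  have 2: "(f -` A \<inter> space N) - D \<in> sets N"
    using measurable_sets[OF f A] D(1) N(3) by auto
  have "f' -` A \<inter> space N = ((f -` A \<inter> space N) - D) \<union> (f' -` A \<inter> space N \<inter> D)"
    using D(2) N(1) by auto
  then show "f' -` A \<inter> space N \<in> sets N" using sets.Un[OF 2 1] by argo
qed auto

lemma is_wiener_integral_cong_AE:
  assumes W: "is_wiener_integral M \<beta> H t g Y" and Y': "Y' \<in> borel_measurable M" and eq: "AE \<omega> in M. Y' \<omega> = Y \<omega>"
  shows "is_wiener_integral M \<beta> H t g Y'"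
proof -
  have "(\<integral>\<^sup>+\<omega>. ennreal ((I \<omega> - Y' \<omega>)\<^sup>2) \<partial>M) = (\<integral>\<^sup>+\<omega>. ennreal ((I \<omega> - Y \<omega>)\<^sup>2) \<partial>M)" for I
    using eq by (intro nn_integral_cong_AE) (auto elim!: eventually_mono)
  then show ?thesis using W Y' unfolding is_wiener_integral_def by simp
qed

lemma is_wiener_integral_cong:
  assumes "\<And>u. u \<in> {0..t} \<Longrightarrow> g u = g' u"
  shows "is_wiener_integral M \<beta> H t g Y \<longleftrightarrow> is_wiener_integral M \<beta> H t g' Y"
proof -
  have "g \<in> borel_measurable (restrict_space borel {0..t}) \<longleftrightarrow> g' \<in> borel_measurable (restrict_space borel {0..t})"
    using assms by (intro measurable_cong) (auto simp: space_restrict_space)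
  moreover have "absH_norm2 H t (\<lambda>u. g u - f u) = absH_norm2 H t (\<lambda>u. g' u - f u)" for f
    using assms by (intro absH_norm2_cong) auto
  ultimately show ?thesis unfolding is_wiener_integral_def by simp
qed

context scalar_fbm
begin

text \<open>A variant of the Wiener integral over \<open>{0..T}\<close> in which the approximating sums are bounded and
  converge in \<open>L\<^sup>2\<close>; boundedness controls the cross terms when it is compared with
  \<^const>\<open>is_wiener_integral\<close> without using that the kernel is positive definite.\<close>

definition L2_wiener :: "(real \<Rightarrow> real) \<Rightarrow> ('a \<Rightarrow> real) \<Rightarrow> bool" where
  "L2_wiener g Y \<longleftrightarrow> Y \<in> borel_measurable M \<and>
     (\<exists>fs Is G. (\<forall>n. interval_sum \<beta> T (fs n) (Is n)) \<and> (\<forall>n u. \<bar>fs n u\<bar> \<le> G) \<and>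
        (\<lambda>n. L2_norm2 T (\<lambda>u. g u - fs n u)) \<longlonglongrightarrow> 0 \<and>
        (\<lambda>n. \<integral>\<^sup>+ \<omega>. ennreal ((Is n \<omega> - Y \<omega>)\<^sup>2) \<partial>M) \<longlonglongrightarrow> 0)"

text \<open>The normalisation of the covariance times the constant of the Schur test. It depends on
  T and H only, hence is the same for all components of the driving process.\<close>

definition wiener_const :: real where
  "wiener_const = \<alpha> * kernel_bound H T"

lemma wiener_const_nonneg: "0 \<le> wiener_const"
  unfolding wiener_const_def using \<alpha>_nonneg kernel_bound_nonneg[OF H_half] by simp

lemma \<alpha>_absH_norm2_le:
  assumes "h \<in> borel_measurable borel"
  shows "ennreal \<alpha> * absH_norm2 H T h \<le> ennreal wiener_const * L2_norm2 T h"
proof -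
  have "ennreal \<alpha> * absH_norm2 H T h \<le> ennreal \<alpha> * (ennreal (kernel_bound H T) * L2_norm2 T h)"
    unfolding L2_norm2_def using T_pos by (intro mult_left_mono absH_norm2_le_L2 H_half assms) auto
  then show ?thesis
    by (simp add: wiener_const_def ennreal_mult \<alpha>_nonneg kernel_bound_nonneg[OF H_half] mult.assoc)
qed

lemma interval_sum_L2_second_moment:
  assumes "interval_sum \<beta> T f I"
  shows "(\<integral>\<^sup>+\<omega>. ennreal ((I \<omega>)\<^sup>2) \<partial>M) \<le> ennreal wiener_const * L2_norm2 T f"
  using interval_sum_second_moment[OF assms] \<alpha>_absH_norm2_le[OF interval_sum_borel_measurable[OF assms]]
  by (rule order_trans)

text \<open>The moment bound is available for interval sums, and L2 convergence alone does not carry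
  moments of order above 2 to the limit; so an almost surely convergent subsequence is taken and
  Fatou applied. The factor 5 is 4 + 1: splitting \<open>fs n - fs' n\<close> through g and g' puts
  a factor 4 on the term of \<open>g - g'\<close>, and the remaining error is eventually below v,
  which is why v has to be positive.\<close>

lemma L2_wiener_stability:
  assumes Y: "L2_wiener g Y" and Y': "L2_wiener g' Y'"
    and [measurable]: "g \<in> borel_measurable borel" "g' \<in> borel_measurable borel"
    and v: "ennreal wiener_const * L2_norm2 T (\<lambda>u. g u - g' u) \<le> ennreal v" "0 < v" and m: "m \<ge> 1"
  shows "(\<integral>\<^sup>+\<omega>. ennreal ((Y \<omega> - Y' \<omega>) ^ (2 * m)) \<partial>M) \<le> ennreal (gaussian_moment m * (5 * v) ^ m)"
proof -
  obtain fs Is where fs: "\<And>n. interval_sum \<beta> T (fs n) (Is n)"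
    "(\<lambda>n. L2_norm2 T (\<lambda>u. g u - fs n u)) \<longlonglongrightarrow> 0" "(\<lambda>n. \<integral>\<^sup>+ \<omega>. ennreal ((Is n \<omega> - Y \<omega>)\<^sup>2) \<partial>M) \<longlonglongrightarrow> 0"
    and [measurable]: "Y \<in> borel_measurable M"
    using Y unfolding L2_wiener_def by blast
  obtain fs' Is' where fs': "\<And>n. interval_sum \<beta> T (fs' n) (Is' n)"
    "(\<lambda>n. L2_norm2 T (\<lambda>u. g' u - fs' n u)) \<longlonglongrightarrow> 0" "(\<lambda>n. \<integral>\<^sup>+ \<omega>. ennreal ((Is' n \<omega> - Y' \<omega>)\<^sup>2) \<partial>M) \<longlonglongrightarrow> 0"
    and [measurable]: "Y' \<in> borel_measurable M"
    using Y' unfolding L2_wiener_def by blast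
  have [measurable]: "fs n \<in> borel_measurable borel" "fs' n \<in> borel_measurable borel" for n
    using fs(1) fs'(1) by (auto intro: interval_sum_borel_measurable)
  have [measurable]: "Is n \<in> borel_measurable M" "Is' n \<in> borel_measurable M" for n
    using interval_sum_measurable[OF fs(1) \<beta>_meas] interval_sum_measurable[OF fs'(1) \<beta>_meas] by auto
  define c where "c = ennreal wiener_const"
  have cfin: "c \<noteq> \<top>" by (simp add: c_def)
  let ?err = "\<lambda>n. 4 * (c * L2_norm2 T (\<lambda>u. g u - fs n u)) + 8 * (c * L2_norm2 T (\<lambda>u. g' u - fs' n u))"
  have bound: "c * L2_norm2 T (\<lambda>u. fs n u - fs' n u) \<le> 4 * ennreal v + ?err n" for n
  proof -
    have neg: "L2_norm2 T (\<lambda>u. - h u) = L2_norm2 T h" for h by (simp add: L2_norm2_def)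
    have "L2_norm2 T (\<lambda>u. fs n u - fs' n u) = L2_norm2 T (\<lambda>u. - (g u - fs n u) + ((g u - g' u) + (g' u - fs' n u)))"
      by simp
    also have "\<dots> \<le> 2 * L2_norm2 T (\<lambda>u. - (g u - fs n u)) + 2 * L2_norm2 T (\<lambda>u. (g u - g' u) + (g' u - fs' n u))"
      by (intro L2_norm2_add_le) auto
    also have "\<dots> \<le> 2 * L2_norm2 T (\<lambda>u. g u - fs n u) + 2 * (2 * L2_norm2 T (\<lambda>u. g u - g' u) + 2 * L2_norm2 T (\<lambda>u. g' u - fs' n u))"
      unfolding neg by (intro add_mono mult_left_mono L2_norm2_add_le) auto
    finally have "c * L2_norm2 T (\<lambda>u. fs n u - fs' n u)
      \<le> c * (2 * L2_norm2 T (\<lambda>u. g u - fs n u) + 2 * (2 * L2_norm2 T (\<lambda>u. g u - g' u) + 2 * L2_norm2 T (\<lambda>u. g' u - fs' n u)))"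
      by (intro mult_left_mono) auto
    also have "\<dots> = 2 * (c * L2_norm2 T (\<lambda>u. g u - fs n u)) + (4 * (c * L2_norm2 T (\<lambda>u. g u - g' u)) + 4 * (c * L2_norm2 T (\<lambda>u. g' u - fs' n u)))"
      by (simp add: distrib_left mult_ac)
    also have "\<dots> \<le> 4 * (c * L2_norm2 T (\<lambda>u. g u - fs n u)) + (4 * ennreal v + 8 * (c * L2_norm2 T (\<lambda>u. g' u - fs' n u)))"
      using v(1) by (intro add_mono mult_mono) (auto simp: c_def)
    finally show ?thesis by (simp add: add_ac)
  qed
  have "?err \<longlonglongrightarrow> 0 + 0"
    using fs(2) fs'(2) cfin by (intro tendsto_add tendsto_ennreal_numeral_mult_0) auto
  then have "\<forall>\<^sub>F n in sequentially. ?err n < ennreal v"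
    using v(2) by (intro order_tendstoD(2)) auto
  then have ev: "\<forall>\<^sub>F n in sequentially. c * L2_norm2 T (\<lambda>u. fs n u - fs' n u) \<le> ennreal (5 * v)"
  proof eventually_elim
    case (elim n)
    have "c * L2_norm2 T (\<lambda>u. fs n u - fs' n u) \<le> 4 * ennreal v + ennreal v"
      using bound[of n] elim by (meson add_left_mono less_imp_le order_trans)
    also have "\<dots> = ennreal (5 * v)" using v(2)
      by (subst ennreal_numeral[symmetric], subst ennreal_mult[symmetric], simp, simp, subst ennreal_plus[symmetric]) auto
    finally show ?case .
  qed
  have "(\<lambda>n. \<integral>\<^sup>+ \<omega>. ennreal (((Is n \<omega> - Is' n \<omega>) - (Y \<omega> - Y' \<omega>))\<^sup>2) \<partial>M) \<longlonglongrightarrow> 0"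
  proof (rule tendsto_ennreal_sandwich_0)
    fix n
    have "(\<integral>\<^sup>+ \<omega>. ennreal (((Is n \<omega> - Y \<omega>) + (- (Is' n \<omega> - Y' \<omega>)))\<^sup>2) \<partial>M)
      \<le> 2 * (\<integral>\<^sup>+ \<omega>. ennreal ((Is n \<omega> - Y \<omega>)\<^sup>2) \<partial>M) + 2 * (\<integral>\<^sup>+ \<omega>. ennreal ((- (Is' n \<omega> - Y' \<omega>))\<^sup>2) \<partial>M)"
      by (intro nn_integral_square_sum_le) auto
    then show "(\<integral>\<^sup>+ \<omega>. ennreal (((Is n \<omega> - Is' n \<omega>) - (Y \<omega> - Y' \<omega>))\<^sup>2) \<partial>M)
      \<le> 2 * (\<integral>\<^sup>+ \<omega>. ennreal ((Is n \<omega> - Y \<omega>)\<^sup>2) \<partial>M) + 2 * (\<integral>\<^sup>+ \<omega>. ennreal ((Is' n \<omega> - Y' \<omega>)\<^sup>2) \<partial>M)"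
      unfolding power2_minus by (simp add: algebra_simps)
  next
    have "(\<lambda>n. 2 * (\<integral>\<^sup>+ \<omega>. ennreal ((Is n \<omega> - Y \<omega>)\<^sup>2) \<partial>M) + 2 * (\<integral>\<^sup>+ \<omega>. ennreal ((Is' n \<omega> - Y' \<omega>)\<^sup>2) \<partial>M)) \<longlonglongrightarrow> 0 + 0"
      using fs(3) fs'(3) by (intro tendsto_add tendsto_ennreal_numeral_mult_0) auto
    then show "(\<lambda>n. 2 * (\<integral>\<^sup>+ \<omega>. ennreal ((Is n \<omega> - Y \<omega>)\<^sup>2) \<partial>M) + 2 * (\<integral>\<^sup>+ \<omega>. ennreal ((Is' n \<omega> - Y' \<omega>)\<^sup>2) \<partial>M)) \<longlonglongrightarrow> 0"
      by simp
  qed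
  then obtain r where r: "\<And>k. c * L2_norm2 T (\<lambda>u. fs (r k) u - fs' (r k) u) \<le> ennreal (5 * v)"
    and lim: "AE \<omega> in M. (\<lambda>k. (Is (r k) \<omega> - Is' (r k) \<omega>) - (Y \<omega> - Y' \<omega>)) \<longlonglongrightarrow> 0"
    using L2_convergence_AE_subsequence[OF _ _ ev, where X="\<lambda>n \<omega>. (Is n \<omega> - Is' n \<omega>) - (Y \<omega> - Y' \<omega>)" and M=M] by auto
  show ?thesis
  proof (rule nn_integral_le_of_AE_tendsto[where f="\<lambda>k \<omega>. (Is (r k) \<omega> - Is' (r k) \<omega>) ^ (2 * m)"])
    show "AE \<omega> in M. (\<lambda>k. (Is (r k) \<omega> - Is' (r k) \<omega>) ^ (2 * m)) \<longlonglongrightarrow> (Y \<omega> - Y' \<omega>) ^ (2 * m)"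
      using lim
    proof eventually_elim
      case (elim \<omega>)
      then have "(\<lambda>k. Is (r k) \<omega> - Is' (r k) \<omega>) \<longlonglongrightarrow> Y \<omega> - Y' \<omega>"
        by (simp add: LIM_zero_iff)
      then show ?case by (intro tendsto_power)
    qed
    fix k
    have d: "interval_sum \<beta> T (\<lambda>u. fs (r k) u - fs' (r k) u) (\<lambda>\<omega>. Is (r k) \<omega> - Is' (r k) \<omega>)"
      by (intro interval_sum_diff fs fs')
    have "ennreal \<alpha> * absH_norm2 H T (\<lambda>u. fs (r k) u - fs' (r k) u) \<le> ennreal (5 * v)"
      using \<alpha>_absH_norm2_le[OF interval_sum_borel_measurable[OF d]] r[of k] unfolding c_def by (rule order_trans)
    then show "(\<integral>\<^sup>+\<omega>. ennreal ((Is (r k) \<omega> - Is' (r k) \<omega>) ^ (2 * m)) \<partial>M) \<le> ennreal (gaussian_moment m * (5 * v) ^ m)"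
      using v(2) m by (intro interval_sum_moment[OF d]) auto
  qed measurable
qed

lemma L2_wiener_cong_AE:
  assumes W: "L2_wiener g Y" and Y': "Y' \<in> borel_measurable M" and eq: "AE \<omega> in M. Y' \<omega> = Y \<omega>"
  shows "L2_wiener g Y'"
proof -
  have "(\<integral>\<^sup>+\<omega>. ennreal ((I \<omega> - Y' \<omega>)\<^sup>2) \<partial>M) = (\<integral>\<^sup>+\<omega>. ennreal ((I \<omega> - Y \<omega>)\<^sup>2) \<partial>M)" for I
    using eq by (intro nn_integral_cong_AE) (auto elim!: eventually_mono)
  then show ?thesis using W Y' unfolding L2_wiener_def by simp
qed

text \<open>Comparison with it turns \<open>L2_wiener_stability\<close> into a bound on a single
  integral; it is used to see that the integral at time 0 vanishes.\<close>

lemma L2_wiener_zero: "L2_wiener (\<lambda>u. 0) (\<lambda>\<omega>. 0)"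
proof -
  have "interval_sum \<beta> T (\<lambda>u. 0) (\<lambda>\<omega>. 0)"
    unfolding interval_sum_def by (intro exI[of _ 0]) auto
  then show ?thesis
    unfolding L2_wiener_def
    by (intro conjI exI[of _ "\<lambda>n u. 0"] exI[of _ "\<lambda>n \<omega>. 0"] exI[of _ 0]) (auto simp: L2_norm2_def)
qed

text \<open>Step functions with squared L2 error 2^-n are cut off at t. Their sums involve the
  process up to time t only and converge almost surely as well as in L2, so their limit is
  measurable for any sigma-algebra \<open>N\<close> that knows this part of the process. The same
  sums serve both notions of integral.\<close>

lemma wiener_integral_exists:
  assumes [measurable]: "g \<in> borel_measurable borel" and G: "\<And>u. \<bar>g u\<bar> \<le> G" and t: "t \<in> {0..T}"
    and N: "space N = space M" "sets N \<subseteq> sets M" "\<And>s. s \<in> {0..t} \<Longrightarrow> \<beta> s \<in> borel_measurable N"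
  obtains Y where "Y \<in> borel_measurable N" "is_wiener_integral M \<beta> H t g Y"
    "L2_wiener (\<lambda>u. g u * indicator {0..t} u) Y"
proof -
  define P where "P n m c \<longleftrightarrow> m > 0 \<and> (\<forall>k. \<bar>c k\<bar> \<le> G) \<and>
    L2_norm2 T (\<lambda>u. g u - (\<Sum>j<m. c j * indicator {real j * T / m<..real (Suc j) * T / m} u)) \<le> ennreal ((1/2)^n)" for n m :: nat and c
  have "\<exists>m c. P n m c" for n
    unfolding L2_norm2_def P_def by (rule step_approximation_L2[OF assms(1) G T_pos, of "(1/2)^n"]) (auto intro!: exI)
  then obtain m c where "\<And>n. P n (m n) (c n)" by metis
  then have m: "\<And>n. m n > 0" and c: "\<And>n k. \<bar>c n k\<bar> \<le> G"
    and appr: "\<And>n. L2_norm2 T (\<lambda>u. g u - (\<Sum>j<m n. c n j * indicator {real j * T / m n<..real (Suc j) * T / m n} u)) \<le> ennreal ((1/2)^n)"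
    unfolding P_def by blast+
  \<comment> \<open>Nodes beyond t are moved to t, which empties the intervals after t and
    multiplies the step function by the indicator of the times up to t.\<close>
  define s where "s n k = min (real k * T / m n) t" for n k
  define f0 where "f0 n u = (\<Sum>j<m n. c n j * indicator {real j * T / m n<..real (Suc j) * T / m n} u)" for n u
  define fs where "fs n u = (\<Sum>j<m n. c n j * indicator {s n j<..s n (Suc j)} u)" for n u
  define Is where "Is n \<omega> = (\<Sum>j<m n. c n j * (\<beta> (s n (Suc j)) \<omega> - \<beta> (s n j) \<omega>))" for n \<omega>
  have G0: "0 \<le> G" using G[of 0] by simp
  have step: "step_fun_integral \<beta> t (fs n) (Is n)" for n
    unfolding step_fun_integral_def
  proof (rule exI[of _ "m n"], rule exI[of _ "s n"], rule exI[of _ "c n"], intro conjI allI impI)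
    show "0 \<le> s n 0" using t by (simp add: s_def)
    show "s n (m n) \<le> t" by (simp add: s_def)
    show "s n k \<le> s n (Suc k)" for k
      unfolding s_def using T_pos by (intro min.mono divide_right_mono mult_right_mono) auto
  qed (auto simp: fs_def[abs_def] Is_def[abs_def])
  have isum: "interval_sum \<beta> T (fs n) (Is n)" for n
    using step_fun_integral_imp_interval_sum[OF step] t by auto
  have isum_t: "interval_sum \<beta> t (fs n) (Is n)" for n
    using step_fun_integral_imp_interval_sum[OF step] by auto
  have [measurable]: "Is n \<in> borel_measurable N" for n
    using interval_sum_measurable[OF isum_t N(3)] .
  have NM: "f \<in> borel_measurable N \<Longrightarrow> f \<in> borel_measurable M" for f :: "'a \<Rightarrow> real"
    using N(1,2) by (intro measurable_from_subalg[of M N]) (auto simp: subalgebra_def)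
  have [measurable]: "Is n \<in> borel_measurable M" for n by (rule NM) measurable
  have [measurable]: "f0 n \<in> borel_measurable borel" "fs n \<in> borel_measurable borel" for n
    unfolding f0_def[abs_def] fs_def[abs_def] by measurable
  have ind: "indicator {min a t<..min b t} u = (indicator {a<..b} u * indicator {..t} u :: real)" for a b u
    by (auto simp: indicator_def)
  have fs_eq: "fs n u = f0 n u * indicator {..t} u" for n u
    unfolding fs_def f0_def s_def ind sum_distrib_right by (simp add: mult.assoc)
  have f0_bound: "\<bar>f0 n u\<bar> \<le> G" for n u
  proof (cases "0 < u \<and> u \<le> T")
    case True
    then have u: "0 < u" "u \<le> T" by auto
    obtain k where "\<forall>c :: nat \<Rightarrow> real. (\<Sum>j<m n. c j * indicator {real j * T / m n<..real (Suc j) * T / m n} u) = c k"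
      by (rule grid_partition_value[OF m[of n] T_pos u])
    then have "f0 n u = c n k" unfolding f0_def by blast
    then show ?thesis using c by simp
  next
    case False
    then show ?thesis unfolding f0_def using G0 grid_partition_value_0[OF m[of n] T_pos False] by simp
  qed
  have fs_bound: "\<bar>fs n u\<bar> \<le> G" for n u
    using f0_bound[of n u] G0 by (auto simp: fs_eq indicator_def)
  have err: "L2_norm2 T (\<lambda>u. g u * indicator {0..t} u - fs n u) \<le> ennreal ((1/2)^n)" for n
  proof -
    have "L2_norm2 T (\<lambda>u. g u * indicator {0..t} u - fs n u) \<le> L2_norm2 T (\<lambda>u. g u - f0 n u)"
      unfolding L2_norm2_def fs_eq by (intro nn_integral_mono) (auto simp: indicator_def)
    also have "\<dots> \<le> ennreal ((1/2)^n)" using appr[of n] by (simp add: f0_def)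
    finally show ?thesis .
  qed
  have err0: "(\<lambda>n. L2_norm2 T (\<lambda>u. g u * indicator {0..t} u - fs n u)) \<longlonglongrightarrow> 0"
  proof (rule tendsto_ennreal_sandwich_0[OF err])
    have "(\<lambda>n. ennreal ((1/2)^n)) \<longlonglongrightarrow> ennreal 0"
      by (intro tendsto_ennrealI LIMSEQ_power_zero) auto
    then show "(\<lambda>n. ennreal ((1/2)^n)) \<longlonglongrightarrow> 0" by simp
  qed
  define \<Delta> where "\<Delta> n \<omega> = \<bar>Is (Suc n) \<omega> - Is n \<omega>\<bar>" for n \<omega>
  have [measurable]: "\<Delta> n \<in> borel_measurable M" for n unfolding \<Delta>_def by measurable
  have mom: "(\<integral>\<^sup>+\<omega>. ennreal (\<Delta> n \<omega> powr 2) \<partial>M) \<le> ennreal ((4 * wiener_const) * (1/2)^n)" for n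
  proof -
    have neg: "L2_norm2 T (\<lambda>u. - h u) = L2_norm2 T h" for h by (simp add: L2_norm2_def)
    have "L2_norm2 T (\<lambda>u. fs (Suc n) u - fs n u)
       = L2_norm2 T (\<lambda>u. - (g u * indicator {0..t} u - fs (Suc n) u) + (g u * indicator {0..t} u - fs n u))"
      by simp
    also have "\<dots> \<le> 2 * L2_norm2 T (\<lambda>u. - (g u * indicator {0..t} u - fs (Suc n) u)) + 2 * L2_norm2 T (\<lambda>u. g u * indicator {0..t} u - fs n u)"
      by (intro L2_norm2_add_le) auto
    also have "\<dots> \<le> 2 * ennreal ((1/2)^n) + 2 * ennreal ((1/2)^n)"
    proof (unfold neg, intro add_mono mult_left_mono err)
      show "L2_norm2 T (\<lambda>u. g u * indicator {0..t} u - fs (Suc n) u) \<le> ennreal ((1/2)^n)"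
        by (rule order_trans[OF err]) (auto intro!: ennreal_leI)
    qed auto
    also have "\<dots> = 4 * ennreal ((1/2)^n)" by (simp flip: distrib_right)
    finally have "ennreal wiener_const * L2_norm2 T (\<lambda>u. fs (Suc n) u - fs n u) \<le> ennreal wiener_const * (4 * ennreal ((1/2)^n))"
      by (intro mult_left_mono) auto
    moreover have "(\<integral>\<^sup>+\<omega>. ennreal (\<Delta> n \<omega> powr 2) \<partial>M) = (\<integral>\<^sup>+\<omega>. ennreal ((Is (Suc n) \<omega> - Is n \<omega>)\<^sup>2) \<partial>M)"
      by (simp add: \<Delta>_def powr_numeral)
    moreover have "\<dots> \<le> ennreal wiener_const * L2_norm2 T (\<lambda>u. fs (Suc n) u - fs n u)"
      by (intro interval_sum_L2_second_moment interval_sum_diff isum)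
    ultimately have "(\<integral>\<^sup>+\<omega>. ennreal (\<Delta> n \<omega> powr 2) \<partial>M) \<le> ennreal wiener_const * (4 * ennreal ((1/2)^n))"
      by simp
    also have "\<dots> = ennreal ((4 * wiener_const) * (1/2)^n)"
      using wiener_const_nonneg by (simp add: ennreal_mult mult_ac)
    finally show ?thesis .
  qed
  \<comment> \<open>\<open>lim\<close> is total and preserves measurability for \<open>N\<close>, so
    no exceptional set has to be removed before taking the limit.\<close>
  define Y where "Y \<omega> = lim (\<lambda>n. Is n \<omega>)" for \<omega>
  have YN: "Y \<in> borel_measurable N" unfolding Y_def by measurable
  then have [measurable]: "Y \<in> borel_measurable M" by (rule NM)
  have L2: "(\<integral>\<^sup>+ \<omega>. ennreal ((Is n \<omega> - Y \<omega>)\<^sup>2) \<partial>M) \<le> ennreal (4 * wiener_const * (1/2)^n * chain_const (1/2) 2)" for n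
  proof -
    have mom': "(\<integral>\<^sup>+\<omega>. ennreal (\<Delta> (k + n) \<omega> powr 2) \<partial>M) \<le> ennreal ((4 * wiener_const * (1/2)^n) * (1/2)^k)" for k
      using mom[of "k + n"] by (simp add: power_add mult_ac)
    obtain S where S: "S \<in> borel_measurable M" "\<And>\<omega>. 0 \<le> S \<omega>"
      "AE \<omega> in M. summable (\<lambda>k. \<Delta> (k + n) \<omega>) \<and> (\<Sum>k. \<Delta> (k + n) \<omega>) \<le> S \<omega>"
      "(\<integral>\<^sup>+\<omega>. ennreal (S \<omega> powr 2) \<partial>M) \<le> ennreal (4 * wiener_const * (1/2)^n * chain_const (1/2) 2)"
      by (rule summable_increments_moment[of "\<lambda>k. \<Delta> (k + n)" M 2 "1/2" "4 * wiener_const * (1/2)^n", OF _ _ _ _ _ _ mom'])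
         (use wiener_const_nonneg in \<open>auto simp: \<Delta>_def\<close>)
    have "AE \<omega> in M. (Is n \<omega> - Y \<omega>)\<^sup>2 \<le> S \<omega> powr 2"
      using S(3)
    proof eventually_elim
      case (elim \<omega>)
      then have "summable (\<lambda>k. \<Delta> k \<omega>)" using summable_iff_shift[of "\<lambda>k. \<Delta> k \<omega>" n] by simp
      then have "\<bar>Y \<omega> - Is n \<omega>\<bar> \<le> (\<Sum>k. \<Delta> (k + n) \<omega>)"
        using convergent_of_summable_increments(2)[of "\<lambda>k. \<Delta> k \<omega>" "\<lambda>k. Is k \<omega>" n] by (simp add: \<Delta>_def Y_def)
      then have "\<bar>Is n \<omega> - Y \<omega>\<bar> \<le> S \<omega>" using elim by linarith
      from power_mono[OF this, of 2] show ?case using S(2)[of \<omega>] by (simp add: powr_numeral)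
    qed
    then have "(\<integral>\<^sup>+ \<omega>. ennreal ((Is n \<omega> - Y \<omega>)\<^sup>2) \<partial>M) \<le> (\<integral>\<^sup>+\<omega>. ennreal (S \<omega> powr 2) \<partial>M)"
      by (intro nn_integral_mono_AE) (auto elim!: eventually_mono intro: ennreal_leI)
    then show ?thesis using S(4) by (rule order_trans)
  qed
  have L20: "(\<lambda>n. \<integral>\<^sup>+ \<omega>. ennreal ((Is n \<omega> - Y \<omega>)\<^sup>2) \<partial>M) \<longlonglongrightarrow> 0"
  proof (rule tendsto_ennreal_sandwich_0[OF L2])
    have "(\<lambda>n. ennreal (4 * wiener_const * (1/2)^n * chain_const (1/2) 2)) \<longlonglongrightarrow> ennreal (4 * wiener_const * 0 * chain_const (1/2) 2)"
      by (intro tendsto_ennrealI tendsto_mult tendsto_const LIMSEQ_power_zero) auto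
    then show "(\<lambda>n. ennreal (4 * wiener_const * (1/2)^n * chain_const (1/2) 2)) \<longlonglongrightarrow> 0" by simp
  qed
  have "L2_wiener (\<lambda>u. g u * indicator {0..t} u) Y"
    unfolding L2_wiener_def using isum fs_bound err0 L20 by (intro conjI exI[of _ fs] exI[of _ Is] exI[of _ G]) auto
  moreover have "is_wiener_integral M \<beta> H t g Y"
    unfolding is_wiener_integral_def
  proof (intro conjI exI[of _ fs] exI[of _ Is] allI step L20)
    show "g \<in> borel_measurable (restrict_space borel {0..t})"
      by (intro measurable_restrict_space1) measurable
    show "(\<lambda>n. absH_norm2 H t (\<lambda>u. g u - fs n u)) \<longlonglongrightarrow> 0"
    proof (rule tendsto_ennreal_sandwich_0)
      fix n
      have "absH_norm2 H t (\<lambda>u. g u - fs n u) \<le> ennreal (kernel_bound H T) * (\<integral>\<^sup>+u. ennreal ((g u - fs n u)\<^sup>2) * indicator {0..t} u \<partial>lborel)"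
        using t by (intro absH_norm2_le_L2 H_half) auto
      also have "\<dots> \<le> ennreal (kernel_bound H T) * L2_norm2 T (\<lambda>u. g u * indicator {0..t} u - fs n u)"
        unfolding L2_norm2_def using t by (intro mult_left_mono nn_integral_mono) (auto simp: indicator_def)
      finally show "absH_norm2 H t (\<lambda>u. g u - fs n u) \<le> ennreal (kernel_bound H T) * L2_norm2 T (\<lambda>u. g u * indicator {0..t} u - fs n u)" .
    next
      show "(\<lambda>n. ennreal (kernel_bound H T) * L2_norm2 T (\<lambda>u. g u * indicator {0..t} u - fs n u)) \<longlonglongrightarrow> 0"
        using err0 by (intro tendsto_ennreal_numeral_mult_0) auto
    qed
  qed measurable
  ultimately show ?thesis using YN by (intro that)
qed

text \<open>With \<open>h\<close> the error of the given step functions and \<open>k\<close> that of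
  the bounded ones, the two approximations differ by \<open>h - k\<close>. The kernel norm of
  \<open>h\<close> tends to 0, and with it the L1 norm, by the lower bound on the kernel. As
  \<open>k\<close> is bounded and tends to 0 in L2, its own term vanishes and the cross terms are at
  most a constant times the L1 norm of \<open>h\<close>.\<close>

lemma wiener_integral_unique:
  assumes [measurable]: "g \<in> borel_measurable borel" and G: "\<And>u. \<bar>g u\<bar> \<le> G" and t: "t \<in> {0..T}"
    and W: "is_wiener_integral M \<beta> H t g Y" and L: "L2_wiener (\<lambda>u. g u * indicator {0..t} u) Y'"
  shows "AE \<omega> in M. Y \<omega> = Y' \<omega>"
proof -
  obtain fs Is where fs: "\<And>n. step_fun_integral \<beta> t (fs n) (Is n)"
    "(\<lambda>n. absH_norm2 H t (\<lambda>u. g u - fs n u)) \<longlonglongrightarrow> 0" "(\<lambda>n. \<integral>\<^sup>+ \<omega>. ennreal ((Is n \<omega> - Y \<omega>)\<^sup>2) \<partial>M) \<longlonglongrightarrow> 0"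
    and [measurable]: "Y \<in> borel_measurable M"
    using W unfolding is_wiener_integral_def by blast
  define g1 where "g1 u = g u * indicator {0..t} u" for u
  have [measurable]: "g1 \<in> borel_measurable borel" unfolding g1_def by measurable
  obtain fs' Is' G' where fs': "\<And>n. interval_sum \<beta> T (fs' n) (Is' n)" "\<And>n u. \<bar>fs' n u\<bar> \<le> G'"
    "(\<lambda>n. L2_norm2 T (\<lambda>u. g1 u - fs' n u)) \<longlonglongrightarrow> 0" "(\<lambda>n. \<integral>\<^sup>+ \<omega>. ennreal ((Is' n \<omega> - Y' \<omega>)\<^sup>2) \<partial>M) \<longlonglongrightarrow> 0"
    and [measurable]: "Y' \<in> borel_measurable M"
    using L unfolding L2_wiener_def g1_def by blast
  have isum: "interval_sum \<beta> T (fs n) (Is n)" for n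
    using step_fun_integral_imp_interval_sum[OF fs(1)] t by auto
  have [measurable]: "fs n \<in> borel_measurable borel" "fs' n \<in> borel_measurable borel" for n
    using isum fs'(1) by (auto intro: interval_sum_borel_measurable)
  have [measurable]: "Is n \<in> borel_measurable M" "Is' n \<in> borel_measurable M" for n
    using interval_sum_measurable[OF isum \<beta>_meas] interval_sum_measurable[OF fs'(1) \<beta>_meas] by auto
  define h where "h n u = g1 u - fs n u" for n u
  define k where "k n u = g1 u - fs' n u" for n u
  have [measurable]: "h n \<in> borel_measurable borel" "k n \<in> borel_measurable borel" for n
    unfolding h_def[abs_def] k_def[abs_def] by measurable
  have kG: "\<bar>k n u\<bar> \<le> G + G'" for n u
  proof -
    have "\<bar>g1 u\<bar> \<le> G" using G[of u] G[of 0] by (auto simp: g1_def indicator_def)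
    then show ?thesis using fs'(2)[of n u] unfolding k_def by linarith
  qed
  have habs: "absH_norm2 H T (h n) = absH_norm2 H t (\<lambda>u. g u - fs n u)" for n
  proof -
    have "absH_norm2 H T (h n) = absH_norm2 H t (h n)"
      using step_fun_integral_support[OF fs(1)] t by (intro absH_norm2_support) (auto simp: h_def g1_def)
    also have "\<dots> = absH_norm2 H t (\<lambda>u. g u - fs n u)"
      by (intro absH_norm2_cong) (auto simp: h_def g1_def)
    finally show ?thesis .
  qed
  let ?L1 = "\<lambda>n. \<integral>\<^sup>+u. ennreal \<bar>h n u\<bar> * indicator {0..T} u \<partial>lborel"
  have L1: "?L1 \<longlonglongrightarrow> 0"
  proof (rule ennreal_tendsto_0_of_squares[of "T powr (2*H - 2)"])
    show "ennreal (T powr (2*H - 2)) * (?L1 n * ?L1 n) \<le> absH_norm2 H T (h n)" for n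
      using T_pos by (intro L1_le_absH_norm2 H_less1) auto
    show "(\<lambda>n. absH_norm2 H T (h n)) \<longlonglongrightarrow> 0" unfolding habs by (rule fs(2))
  qed (use T_pos in auto)
  have "(\<lambda>n. \<integral>\<^sup>+ \<omega>. ennreal ((Is' n \<omega> - Is n \<omega>)\<^sup>2) \<partial>M) \<longlonglongrightarrow> 0"
  proof (rule tendsto_ennreal_sandwich_0)
    fix n
    have "(\<integral>\<^sup>+ \<omega>. ennreal ((Is' n \<omega> - Is n \<omega>)\<^sup>2) \<partial>M) \<le> ennreal \<alpha> * absH_norm2 H T (\<lambda>u. fs' n u - fs n u)"
      by (intro interval_sum_second_moment interval_sum_diff fs' isum)
    also have "(\<lambda>u. fs' n u - fs n u) = (\<lambda>u. h n u - k n u)"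
      by (auto simp: h_def k_def)
    also have "ennreal \<alpha> * absH_norm2 H T (\<lambda>u. h n u - k n u) \<le> ennreal \<alpha> * (absH_norm2 H T (h n) + ennreal (kernel_bound H T) * L2_norm2 T (k n)
        + 2 * (ennreal ((G + G') * kernel_bound H T) * ?L1 n))"
    proof (intro mult_left_mono)
      have "absH_norm2 H T (\<lambda>u. h n u - k n u) \<le> absH_norm2 H T (h n) + absH_norm2 H T (k n)
        + 2 * (ennreal ((G + G') * kernel_bound H T) * ?L1 n)"
        using T_pos kG by (intro absH_norm2_diff_le H_half) auto
      also have "\<dots> \<le> absH_norm2 H T (h n) + ennreal (kernel_bound H T) * L2_norm2 T (k n)
        + 2 * (ennreal ((G + G') * kernel_bound H T) * ?L1 n)"
        unfolding L2_norm2_def using T_pos by (intro add_mono absH_norm2_le_L2 H_half order_refl) auto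
      finally show "absH_norm2 H T (\<lambda>u. h n u - k n u) \<le> absH_norm2 H T (h n) + ennreal (kernel_bound H T) * L2_norm2 T (k n)
        + 2 * (ennreal ((G + G') * kernel_bound H T) * ?L1 n)" .
    qed auto
    finally show "(\<integral>\<^sup>+ \<omega>. ennreal ((Is' n \<omega> - Is n \<omega>)\<^sup>2) \<partial>M) \<le> ennreal \<alpha> * (absH_norm2 H T (h n) + ennreal (kernel_bound H T) * L2_norm2 T (k n)
        + 2 * (ennreal ((G + G') * kernel_bound H T) * ?L1 n))" .
  next
    have "(\<lambda>n. absH_norm2 H T (h n) + ennreal (kernel_bound H T) * L2_norm2 T (k n)
        + 2 * (ennreal ((G + G') * kernel_bound H T) * ?L1 n)) \<longlonglongrightarrow> 0 + 0 + 0"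
      using fs(2) fs'(3) L1 unfolding habs
      by (intro tendsto_add tendsto_ennreal_numeral_mult_0) (auto simp: k_def[abs_def])
    then show "(\<lambda>n. ennreal \<alpha> * (absH_norm2 H T (h n) + ennreal (kernel_bound H T) * L2_norm2 T (k n)
        + 2 * (ennreal ((G + G') * kernel_bound H T) * ?L1 n))) \<longlonglongrightarrow> 0"
      by (intro tendsto_ennreal_numeral_mult_0) auto
  qed
  note II = this
  let ?R = "\<lambda>n. 2 * (\<integral>\<^sup>+ \<omega>. ennreal ((Is n \<omega> - Y \<omega>)\<^sup>2) \<partial>M) + 2 * (2 * (\<integral>\<^sup>+ \<omega>. ennreal ((Is' n \<omega> - Is n \<omega>)\<^sup>2) \<partial>M)
      + 2 * (\<integral>\<^sup>+ \<omega>. ennreal ((Is' n \<omega> - Y' \<omega>)\<^sup>2) \<partial>M))"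
  have le: "(\<integral>\<^sup>+ \<omega>. ennreal ((Y \<omega> - Y' \<omega>)\<^sup>2) \<partial>M) \<le> ?R n" for n
  proof -
    have "(\<integral>\<^sup>+ \<omega>. ennreal ((Y \<omega> - Y' \<omega>)\<^sup>2) \<partial>M) = (\<integral>\<^sup>+ \<omega>. ennreal ((- (Is n \<omega> - Y \<omega>) + (- (Is' n \<omega> - Is n \<omega>) + (Is' n \<omega> - Y' \<omega>)))\<^sup>2) \<partial>M)"
      by simp
    also have "\<dots> \<le> 2 * (\<integral>\<^sup>+ \<omega>. ennreal ((- (Is n \<omega> - Y \<omega>))\<^sup>2) \<partial>M) + 2 * (\<integral>\<^sup>+ \<omega>. ennreal ((- (Is' n \<omega> - Is n \<omega>) + (Is' n \<omega> - Y' \<omega>))\<^sup>2) \<partial>M)"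
      by (intro nn_integral_square_sum_le) auto
    also have "\<dots> \<le> 2 * (\<integral>\<^sup>+ \<omega>. ennreal ((- (Is n \<omega> - Y \<omega>))\<^sup>2) \<partial>M) + 2 * (2 * (\<integral>\<^sup>+ \<omega>. ennreal ((- (Is' n \<omega> - Is n \<omega>))\<^sup>2) \<partial>M) + 2 * (\<integral>\<^sup>+ \<omega>. ennreal ((Is' n \<omega> - Y' \<omega>)\<^sup>2) \<partial>M))"
      by (intro add_mono mult_left_mono nn_integral_square_sum_le order_refl) auto
    finally show ?thesis unfolding power2_minus .
  qed
  have "?R \<longlonglongrightarrow> 0 + 0"
  proof (intro tendsto_add tendsto_ennreal_numeral_mult_0 fs(3))
    have "(\<lambda>n. 2 * (\<integral>\<^sup>+ \<omega>. ennreal ((Is' n \<omega> - Is n \<omega>)\<^sup>2) \<partial>M) + 2 * (\<integral>\<^sup>+ \<omega>. ennreal ((Is' n \<omega> - Y' \<omega>)\<^sup>2) \<partial>M)) \<longlonglongrightarrow> 0 + 0"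
      using II fs'(4) by (intro tendsto_add tendsto_ennreal_numeral_mult_0) auto
    then show "(\<lambda>n. 2 * (\<integral>\<^sup>+ \<omega>. ennreal ((Is' n \<omega> - Is n \<omega>)\<^sup>2) \<partial>M) + 2 * (\<integral>\<^sup>+ \<omega>. ennreal ((Is' n \<omega> - Y' \<omega>)\<^sup>2) \<partial>M)) \<longlonglongrightarrow> 0"
      by simp
  qed auto
  then have "(\<integral>\<^sup>+ \<omega>. ennreal ((Y \<omega> - Y' \<omega>)\<^sup>2) \<partial>M) \<le> 0"
    using le by (intro LIMSEQ_le_const[of ?R]) auto
  then show ?thesis by (intro AE_eq_of_square_nn_integral_0) auto
qed

text \<open>The integrands for the times s and t differ only between s and t, so the 2m-th moment of
  the increment is at most a constant times |t - s|^m. Kolmogorov's criterion then applies with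
  \<beta> = m - 1, positive for m >= 2; the choice of m also fixes the integrability of the majorant
  \<open>S\<close>.\<close>

lemma wiener_process:
  assumes g[measurable]: "g \<in> borel_measurable borel" and G: "\<And>u. \<bar>g u\<bar> \<le> G"
    and M: "complete_measure M"
    and N: "\<And>t. t \<in> {0..T} \<Longrightarrow> space (N t) = space M" "\<And>t. t \<in> {0..T} \<Longrightarrow> sets (N t) \<subseteq> sets M"
      "\<And>t. t \<in> {0..T} \<Longrightarrow> null_sets M \<subseteq> sets (N t)"
      "\<And>s t. t \<in> {0..T} \<Longrightarrow> s \<in> {0..t} \<Longrightarrow> \<beta> s \<in> borel_measurable (N t)"
    and m: "m \<ge> 2"
  obtains Z S where "\<And>\<omega>. continuous_on {0..T} (\<lambda>t. Z t \<omega>)"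
    "\<And>t. t \<in> {0..T} \<Longrightarrow> Z t \<in> borel_measurable (N t)"
    "\<And>t. t \<in> {0..T} \<Longrightarrow> is_wiener_integral M \<beta> H t g (Z t)"
    "\<And>t. t \<in> {0..T} \<Longrightarrow> L2_wiener (\<lambda>u. g u * indicator {0..t} u) (Z t)"
    "S \<in> borel_measurable M" "\<And>t \<omega>. t \<in> {0..T} \<Longrightarrow> \<bar>Z t \<omega>\<bar> \<le> S \<omega>"
    "(\<integral>\<^sup>+\<omega>. ennreal (S \<omega> powr (2 * real m)) \<partial>M) < \<infinity>"
proof -
  have "\<forall>t\<in>{0..T}. \<exists>Y. Y \<in> borel_measurable (N t) \<and> is_wiener_integral M \<beta> H t g Y \<and>
    L2_wiener (\<lambda>u. g u * indicator {0..t} u) Y"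
  proof
    fix t assume t: "t \<in> {0..T}"
    show "\<exists>Y. Y \<in> borel_measurable (N t) \<and> is_wiener_integral M \<beta> H t g Y \<and> L2_wiener (\<lambda>u. g u * indicator {0..t} u) Y"
      by (rule wiener_integral_exists[OF g G t N(1)[OF t] N(2)[OF t] N(4)[OF t]]) auto
  qed
  then obtain Y where Y: "\<And>t. t \<in> {0..T} \<Longrightarrow> Y t \<in> borel_measurable (N t)"
    "\<And>t. t \<in> {0..T} \<Longrightarrow> is_wiener_integral M \<beta> H t g (Y t)"
    "\<And>t. t \<in> {0..T} \<Longrightarrow> L2_wiener (\<lambda>u. g u * indicator {0..t} u) (Y t)"
    unfolding bchoice_iff by blast
  have YM: "Y t \<in> borel_measurable M" if "t \<in> {0..T}" for t
    using Y(3)[OF that] by (simp add: L2_wiener_def)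
  have G0: "0 \<le> G" using G[of 0] by simp
  \<comment> \<open>The summand 1 makes the variance bound strictly positive even for G = 0, as
    \<open>L2_wiener_stability\<close> requires.\<close>
  define c where "c = wiener_const * G\<^sup>2 + 1"
  have c: "c > 0" using wiener_const_nonneg G0 by (simp add: c_def add_nonneg_pos)
  have m1: "m \<ge> 1" using m by simp
  have incr0: "(\<integral>\<^sup>+\<omega>. ennreal ((Y t \<omega> - Y s \<omega>) ^ (2 * m)) \<partial>M) \<le> ennreal (gaussian_moment m * (5 * (c * \<bar>t - s\<bar>)) ^ m)"
    if st: "s \<in> {0..T}" "t \<in> {0..T}" "s \<noteq> t" for s t
  proof (rule L2_wiener_stability[OF Y(3)[OF st(2)] Y(3)[OF st(1)]])
    have "L2_norm2 T (\<lambda>u. g u * indicator {0..t} u - g u * indicator {0..s} u)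
        \<le> (\<integral>\<^sup>+u. ennreal (G\<^sup>2) * indicator {min s t..max s t} u \<partial>lborel)"
      unfolding L2_norm2_def
    proof (intro nn_integral_mono)
      fix u
      have "(g u)\<^sup>2 \<le> G\<^sup>2" using power_mono[OF G[of u], of 2] by simp
      then show "ennreal ((g u * indicator {0..t} u - g u * indicator {0..s} u)\<^sup>2) * indicator {0..T} u \<le> ennreal (G\<^sup>2) * indicator {min s t..max s t} u"
        by (auto simp: indicator_def intro: ennreal_leI)
    qed
    also have "\<dots> = ennreal (G\<^sup>2) * ennreal \<bar>t - s\<bar>"
      by (subst nn_integral_cmult_indicator) (auto simp: min_def max_def)
    finally have "ennreal wiener_const * L2_norm2 T (\<lambda>u. g u * indicator {0..t} u - g u * indicator {0..s} u)
      \<le> ennreal wiener_const * (ennreal (G\<^sup>2) * ennreal \<bar>t - s\<bar>)"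
      by (intro mult_left_mono) auto
    also have "\<dots> = ennreal (wiener_const * G\<^sup>2 * \<bar>t - s\<bar>)"
      using wiener_const_nonneg by (simp add: ennreal_mult mult.assoc)
    also have "\<dots> \<le> ennreal (c * \<bar>t - s\<bar>)"
      by (intro ennreal_leI mult_right_mono) (auto simp: c_def)
    finally show "ennreal wiener_const * L2_norm2 T (\<lambda>u. g u * indicator {0..t} u - g u * indicator {0..s} u) \<le> ennreal (c * \<bar>t - s\<bar>)" .
    show "0 < c * \<bar>t - s\<bar>" using c st by simp
  qed (use m1 in measurable)
  define C where "C = gaussian_moment m * (5 * c) ^ m"
  have C: "0 \<le> C" using gaussian_moment_nonneg c by (simp add: C_def)
  have incr: "(\<integral>\<^sup>+\<omega>. ennreal (\<bar>Y t \<omega> - Y s \<omega>\<bar> powr (2 * real m)) \<partial>M) \<le> ennreal (C * \<bar>t - s\<bar> powr (1 + (real m - 1)))"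
    if st: "s \<in> {0..T}" "t \<in> {0..T}" for s t
  proof (cases "s = t")
    case False
    have pw: "\<bar>x\<bar> powr (2 * real m) = x ^ (2 * m)" if "m \<ge> 2" for x :: real
    proof (cases "x = 0")
      case False
      then have "\<bar>x\<bar> powr (real (2 * m)) = \<bar>x\<bar> ^ (2 * m)" by (intro powr_realpow) auto
      then show ?thesis by (simp add: power_even_abs)
    qed (use that in auto)
    have "\<bar>t - s\<bar> powr real m = \<bar>t - s\<bar> ^ m" using False by (intro powr_realpow) auto
    then have "C * \<bar>t - s\<bar> powr (1 + (real m - 1)) = gaussian_moment m * (5 * (c * \<bar>t - s\<bar>)) ^ m"
      by (simp add: C_def power_mult_distrib)
    then show ?thesis using incr0[OF st False] by (simp add: pw[OF m])
  qed simp
  \<comment> \<open>At time 0 the integrand lives on a single point and has L2 norm 0, so every v >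
    0 is admissible; the choice v = e / 5 undoes the factor 5, and \<open>gaussian_moment 1\<close>
    is 1.\<close>
  have Y0: "AE \<omega> in M. Y 0 \<omega> = 0"
  proof -
    have t0: "0 \<in> {0..T}" using T_pos by simp
    have [measurable]: "Y 0 \<in> borel_measurable M" by (rule YM[OF t0])
    have z: "L2_norm2 T (\<lambda>u. g u * indicator {0..0} u - 0) = 0"
    proof -
      have "L2_norm2 T (\<lambda>u. g u * indicator {0..0} u - 0) = (\<integral>\<^sup>+u. 0 \<partial>(lborel :: real measure))"
        unfolding L2_norm2_def using AE_lborel_singleton[of "0::real"]
        by (intro nn_integral_cong_AE) (auto elim!: eventually_mono simp: indicator_def)
      then show ?thesis by simp
    qed
    have "(\<integral>\<^sup>+\<omega>. ennreal ((Y 0 \<omega> - 0) ^ (2 * 1)) \<partial>M) \<le> 0"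
    proof (rule ennreal_le_epsilon)
      fix e :: real assume e: "0 < e"
      have "(\<integral>\<^sup>+\<omega>. ennreal ((Y 0 \<omega> - 0) ^ (2 * 1)) \<partial>M) \<le> ennreal (gaussian_moment 1 * (5 * (e / 5)) ^ 1)"
        using e by (intro L2_wiener_stability[OF Y(3)[OF t0] L2_wiener_zero]) (auto simp: z[simplified])
      then show "(\<integral>\<^sup>+\<omega>. ennreal ((Y 0 \<omega> - 0) ^ (2 * 1)) \<partial>M) \<le> 0 + ennreal e"
        by (simp add: gaussian_moment_def)
    qed
    then show ?thesis by (intro AE_eq_of_square_nn_integral_0) auto
  qed
  obtain Z S where Z: "\<And>\<omega>. continuous_on {0..T} (\<lambda>t. Z t \<omega>)"
    "\<And>t. t \<in> {0..T} \<Longrightarrow> AE \<omega> in M. Z t \<omega> = Y t \<omega>"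
    "S \<in> borel_measurable M" "\<And>t \<omega>. t \<in> {0..T} \<Longrightarrow> \<bar>Z t \<omega>\<bar> \<le> S \<omega>"
    "(\<integral>\<^sup>+\<omega>. ennreal (S \<omega> powr (2 * real m)) \<partial>M) < \<infinity>"
    by (rule kolmogorov_continuity[OF T_pos _ _ C YM Y0 incr]) (use m in auto)
  have ZN: "Z t \<in> borel_measurable (N t)" if t: "t \<in> {0..T}" for t
    using complete_AE_measurable[OF M N(1)[OF t] N(2)[OF t] N(3)[OF t] Y(1)[OF t] Z(2)[OF t]] .
  have ZM: "Z t \<in> borel_measurable M" if t: "t \<in> {0..T}" for t
    using ZN[OF t] N(1,2)[OF t] by (intro measurable_from_subalg[of M "N t"]) (auto simp: subalgebra_def)
  show ?thesis
    by (rule that[OF Z(1) ZN is_wiener_integral_cong_AE[OF Y(2) ZM Z(2)] L2_wiener_cong_AE[OF Y(3) ZM Z(2)] Z(3,4,5)])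
qed

end

section \<open>Integral equations with Lipschitz drift\<close>

text \<open>For a simple g there are finitely many cases, and continuity in x passes to the limit of
  simple functions. The drift is of this kind: measurable for each fixed x, and Lipschitz in
  x.\<close>

lemma caratheodory_measurable:
  fixes f :: "'z \<Rightarrow> 'x::{metric_space, second_countable_topology} \<Rightarrow> 'y::metric_space"
  assumes meas: "\<And>x. (\<lambda>z. f z x) \<in> borel_measurable N"
    and cont: "\<And>z. z \<in> space N \<Longrightarrow> continuous_on UNIV (f z)"
    and g: "g \<in> borel_measurable N"
  shows "(\<lambda>z. f z (g z)) \<in> borel_measurable N"
proof -
  obtain F where F: "\<And>i. simple_function N (F i)" "\<And>z. z \<in> space N \<Longrightarrow> (\<lambda>i. F i z) \<longlonglongrightarrow> g z"
    using borel_measurable_implies_sequence_metric[OF g] by blast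
  show ?thesis
  proof (rule borel_measurable_LIMSEQ_metric[where f="\<lambda>i z. f z (F i z)"])
    fix i
    have fin: "finite (F i ` space N)" using F(1) by (rule simple_functionD)
    have "F i \<in> measurable N (count_space (F i ` space N))"
      using simple_functionD(2)[OF F(1)] by (subst measurable_count_space_eq2[OF fin]) auto
    then show "(\<lambda>z. f z (F i z)) \<in> borel_measurable N"
      using measurable_compose_countable'[of "F i ` space N" "\<lambda>x z. f z x" N borel "F i"] meas fin
      by (auto intro: countable_finite)
  next
    fix z assume z: "z \<in> space N"
    show "(\<lambda>i. f z (F i z)) \<longlonglongrightarrow> f z (g z)"
      using continuous_on_tendsto_compose[OF cont[OF z] F(2)[OF z]] by simp
  qed
qed

text \<open>These approximants come from one countable set of times, so statements about all times
  of a continuous path reduce to countably many.\<close>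

lemma dyadic_floor_tendsto:
  fixes t :: real
  assumes "t \<ge> 0"
  shows "(\<lambda>k. real (nat \<lfloor>t * 2 ^ k\<rfloor>) / 2 ^ k) \<longlonglongrightarrow> t"
proof -
  define g where "g k = real (nat \<lfloor>t * 2 ^ k\<rfloor>) / 2 ^ k" for k :: nat
  have gb: "g k \<le> t" "t - 1 / 2 ^ k \<le> g k" for k
  proof -
    have "0 \<le> \<lfloor>t * 2 ^ k\<rfloor>" using assms by auto
    then have "real (nat \<lfloor>t * 2 ^ k\<rfloor>) = of_int \<lfloor>t * 2 ^ k\<rfloor>" by simp
    then have "real (nat \<lfloor>t * 2 ^ k\<rfloor>) \<le> t * 2 ^ k" "t * 2 ^ k - 1 \<le> real (nat \<lfloor>t * 2 ^ k\<rfloor>)"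
      by linarith+
    then have "g k * 2 ^ k \<le> t * 2 ^ k" "(t - 1 / 2 ^ k) * 2 ^ k \<le> g k * 2 ^ k"
      unfolding g_def by (simp_all add: left_diff_distrib)
    then show "g k \<le> t" "t - 1 / 2 ^ k \<le> g k" by simp_all
  qed
  have "(\<lambda>k. 1 / 2 ^ k :: real) \<longlonglongrightarrow> 0" by (rule LIMSEQ_divide_realpow_zero) simp
  then have "(\<lambda>k. t - 1 / 2 ^ k) \<longlonglongrightarrow> t - 0" by (intro tendsto_diff tendsto_const)
  then have "g \<longlonglongrightarrow> t"
    using gb by (intro tendsto_sandwich[of "\<lambda>k. t - 1 / 2 ^ k" g _ "\<lambda>k. t"]) auto
  then show ?thesis by (simp add: g_def[abs_def])
qed

text \<open>The path is sampled at dyadic times, capped at t, that converge to the given time. Only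
  \<open>X s\<close> with s at most t occur, so for \<open>N\<close> the sigma-algebra of time t
  this is progressive measurability.\<close>

lemma continuous_process_jointly_measurable:
  fixes X :: "real \<Rightarrow> 'a \<Rightarrow> 'b::metric_space"
  assumes t: "t \<ge> 0" and meas: "\<And>s. s \<in> {0..t} \<Longrightarrow> X s \<in> borel_measurable N"
    and cont: "\<And>\<omega>. \<omega> \<in> space N \<Longrightarrow> continuous_on {0..t} (\<lambda>s. X s \<omega>)"
  shows "(\<lambda>z. X (snd z) (fst z)) \<in> borel_measurable (N \<Otimes>\<^sub>M restrict_space borel {0..t})"
proof (rule borel_measurable_LIMSEQ_metric[where f="\<lambda>k z. X (min (real (nat \<lfloor>snd z * 2 ^ k\<rfloor>) / 2 ^ k) t) (fst z)"])
  fix k :: nat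
  have snd_meas: "snd \<in> borel_measurable (N \<Otimes>\<^sub>M restrict_space borel {0..t})"
    by (rule measurable_compose[OF measurable_snd]) (simp add: measurable_restrict_space1)
  have "(\<lambda>z. nat \<lfloor>snd z * 2 ^ k\<rfloor>) \<in> measurable (N \<Otimes>\<^sub>M restrict_space borel {0..t}) (count_space UNIV)"
    using snd_meas by measurable
  moreover have "(\<lambda>z. X (min (real i / 2 ^ k) t) (fst z)) \<in> borel_measurable (N \<Otimes>\<^sub>M restrict_space borel {0..t})" for i :: nat
    using t by (intro measurable_compose[OF measurable_fst] meas) auto
  ultimately show "(\<lambda>z. X (min (real (nat \<lfloor>snd z * 2 ^ k\<rfloor>) / 2 ^ k) t) (fst z)) \<in> borel_measurable (N \<Otimes>\<^sub>M restrict_space borel {0..t})"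
    by (rule measurable_compose_countable[rotated])
next
  fix z assume z: "z \<in> space (N \<Otimes>\<^sub>M restrict_space borel {0..t})"
  then have f: "fst z \<in> space N" and s: "snd z \<in> {0..t}"
    by (auto simp: space_pair_measure space_restrict_space)
  define g where "g k = real (nat \<lfloor>snd z * 2 ^ k\<rfloor>) / 2 ^ k" for k :: nat
  have "g \<longlonglongrightarrow> snd z" unfolding g_def[abs_def] using s by (intro dyadic_floor_tendsto) auto
  then have "(\<lambda>k. min (g k) t) \<longlonglongrightarrow> min (snd z) t" by (intro tendsto_min tendsto_const)
  then have "(\<lambda>k. min (g k) t) \<longlonglongrightarrow> snd z" using s by simp
  moreover have "min (g k) t \<in> {0..t}" for k using t by (auto simp: g_def)
  ultimately have "(\<lambda>k. X (min (g k) t) (fst z)) \<longlonglongrightarrow> X (snd z) (fst z)"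
    using cont[OF f] s by (intro continuous_on_tendsto_compose[of "{0..t}" "\<lambda>s. X s (fst z)"]) auto
  then show "(\<lambda>k. X (min (real (nat \<lfloor>snd z * 2 ^ k\<rfloor>) / 2 ^ k) t) (fst z)) \<longlonglongrightarrow> X (snd z) (fst z)"
    by (simp add: g_def)
qed

text \<open>Times outside [0, t] are redirected to 0, an arbitrary point of the interval. This moves
  the function from the restricted space to \<open>lborel\<close>, where parameter integrals and
  Tonelli's theorem are stated.\<close>

lemma jointly_measurable_extend:
  fixes g :: "'a \<times> real \<Rightarrow> 'b::real_normed_vector"
  assumes t: "t \<ge> 0" and g: "g \<in> borel_measurable (N \<Otimes>\<^sub>M restrict_space borel {0..t})"
  shows "(\<lambda>z. g (fst z, if snd z \<in> {0..t} then snd z else 0)) \<in> borel_measurable (N \<Otimes>\<^sub>M lborel)"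
proof (rule measurable_compose[OF _ g])
  have "(\<lambda>s::real. if s \<in> {0..t} then s else 0) \<in> measurable lborel (restrict_space borel {0..t})"
    using t by (intro measurable_restrict_space2) auto
  then show "(\<lambda>z. (fst z, if snd z \<in> {0..t} then snd z else 0)) \<in> N \<Otimes>\<^sub>M lborel \<rightarrow>\<^sub>M N \<Otimes>\<^sub>M restrict_space borel {0..t}"
    by (intro measurable_Pair measurable_fst measurable_compose[OF measurable_snd])
qed

lemma set_integral_jointly_measurable:
  fixes g :: "'a \<times> real \<Rightarrow> 'b::{banach, second_countable_topology}"
  assumes t: "t \<ge> 0" and g: "g \<in> borel_measurable (N \<Otimes>\<^sub>M restrict_space borel {0..t})"
  shows "(\<lambda>\<omega>. LINT s:{0..t}|lborel. g (\<omega>, s)) \<in> borel_measurable N"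
proof -
  have [measurable]: "(\<lambda>z. g (fst z, if snd z \<in> {0..t} then snd z else 0)) \<in> borel_measurable (N \<Otimes>\<^sub>M lborel)"
    using t g by (rule jointly_measurable_extend)
  have "(\<lambda>(\<omega>, s). indicator {0..t} s *\<^sub>R g (\<omega>, if s \<in> {0..t} then s else 0)) \<in> borel_measurable (N \<Otimes>\<^sub>M lborel)"
    unfolding case_prod_beta' by measurable
  then have "(\<lambda>\<omega>. \<integral>s. indicator {0..t} s *\<^sub>R g (\<omega>, if s \<in> {0..t} then s else 0) \<partial>lborel) \<in> borel_measurable N"
    by (rule lborel.borel_measurable_lebesgue_integral)
  moreover have "(\<integral>s. indicator {0..t} s *\<^sub>R g (\<omega>, if s \<in> {0..t} then s else 0) \<partial>lborel) = (LINT s:{0..t}|lborel. g (\<omega>, s))" for \<omega>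
    unfolding set_lebesgue_integral_def by (intro Bochner_Integration.integral_cong) (auto simp: indicator_def)
  ultimately show ?thesis by simp
qed

lemma set_integrable_bounded_interval:
  fixes h :: "real \<Rightarrow> 'b::{banach, second_countable_topology}"
  assumes h: "h \<in> borel_measurable (restrict_space borel {0..T})" and C: "\<And>s. s \<in> {0..T} \<Longrightarrow> norm (h s) \<le> C"
    and t: "a \<ge> 0" "b \<le> T" "A = {a..b} \<or> A = {a<..b}"
  shows "set_integrable lborel A h"
proof -
  have A: "A \<in> sets borel" "A \<subseteq> {0..T}" using t by auto
  have "(\<lambda>x. indicator {0..T} x *\<^sub>R h x) \<in> borel_measurable lborel"
    using h by (subst (asm) borel_measurable_restrict_space_iff) auto
  then have "(\<lambda>x. indicator A x *\<^sub>R (indicator {0..T} x *\<^sub>R h x)) \<in> borel_measurable lborel"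
    using A by measurable
  also have "(\<lambda>x. indicator A x *\<^sub>R (indicator {0..T} x *\<^sub>R h x)) = (\<lambda>x. indicator A x *\<^sub>R h x)"
    using A(2) by (intro ext) (auto simp: indicator_def)
  finally have m: "(\<lambda>x. indicator A x *\<^sub>R h x) \<in> borel_measurable lborel" .
  show ?thesis unfolding set_integrable_def
  proof (rule Bochner_Integration.integrable_bound[OF _ m])
    show "integrable lborel (\<lambda>x. indicator A x *\<^sub>R C)"
      using t by (cases "a \<le> b") auto
    show "AE x in lborel. norm (indicator A x *\<^sub>R h x) \<le> norm (indicator A x *\<^sub>R C)"
    proof (intro AE_I2)
      fix x
      show "norm (indicator A x *\<^sub>R h x) \<le> norm (indicator A x *\<^sub>R C)"
        using A(2) C[of x] by (cases "x \<in> A") auto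
    qed
  qed
qed

lemma norm_set_integral_le_nn_integral:
  fixes h :: "real \<Rightarrow> 'b::{banach, second_countable_topology}"
  assumes "set_integrable lborel A h"
  shows "ennreal (norm (LINT s:A|lborel. h s)) \<le> (\<integral>\<^sup>+s. ennreal (norm (h s)) * indicator A s \<partial>lborel)"
proof -
  have "ennreal (norm (LINT s:A|lborel. h s)) \<le> (\<integral>\<^sup>+s. ennreal (norm (indicator A s *\<^sub>R h s)) \<partial>lborel)"
    unfolding set_lebesgue_integral_def using assms by (intro integral_norm_bound_ennreal) (simp add: set_integrable_def)
  also have "\<dots> = (\<integral>\<^sup>+s. ennreal (norm (h s)) * indicator A s \<partial>lborel)"
    by (intro nn_integral_cong) (auto simp: indicator_def)
  finally show ?thesis .
qed

text \<open>A bounded integrand makes the integral Lipschitz in its upper limit, with the bound as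
  constant.\<close>

lemma continuous_on_set_integral:
  fixes h :: "real \<Rightarrow> 'b::{banach, second_countable_topology}"
  assumes h: "h \<in> borel_measurable (restrict_space borel {0..T})" and C: "\<And>s. s \<in> {0..T} \<Longrightarrow> norm (h s) \<le> C"
  shows "continuous_on {0..T} (\<lambda>t. LINT s:{0..t}|lborel. h s)"
proof (cases "T \<ge> 0")
  case T: True
  have C0: "0 \<le> C" using C[of 0] T by (auto intro: order_trans[OF norm_ge_zero])
  have lip: "norm ((LINT s:{0..t}|lborel. h s) - (LINT s:{0..r}|lborel. h s)) \<le> C * \<bar>t - r\<bar>"
    if "r \<in> {0..T}" "t \<in> {0..T}" "r \<le> t" for r t
  proof -
    have un: "{0..t} = {0..r} \<union> {r<..t}" and dis: "{0..r} \<inter> {r<..t} = {}" using that by auto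
    have "(LINT s:{0..t}|lborel. h s) = (LINT s:{0..r}|lborel. h s) + (LINT s:{r<..t}|lborel. h s)"
      unfolding un using that
      by (intro set_integral_Un dis set_integrable_bounded_interval[OF h C, of 0 r] set_integrable_bounded_interval[OF h C, of r t]) auto
    moreover have "ennreal (norm (LINT s:{r<..t}|lborel. h s)) \<le> ennreal (C * \<bar>t - r\<bar>)"
    proof -
      have "ennreal (norm (LINT s:{r<..t}|lborel. h s)) \<le> (\<integral>\<^sup>+s. ennreal (norm (h s)) * indicator {r<..t} s \<partial>lborel)"
        using that set_integrable_bounded_interval[OF h C, of r t "{r<..t}"] by (intro norm_set_integral_le_nn_integral) auto
      also have "\<dots> \<le> (\<integral>\<^sup>+s. ennreal C * indicator {r<..t} s \<partial>lborel)"
        using C that by (intro nn_integral_mono) (auto simp: indicator_def intro: ennreal_leI)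
      also have "\<dots> = ennreal (C * \<bar>t - r\<bar>)"
        using that C0 by (subst nn_integral_cmult_indicator) (auto simp: ennreal_mult)
      finally show ?thesis .
    qed
    ultimately show ?thesis using C0 by (simp add: ennreal_le_iff)
  qed
  have lip': "dist (LINT s:{0..t}|lborel. h s) (LINT s:{0..r}|lborel. h s) \<le> C * dist t r"
    if "r \<in> {0..T}" "t \<in> {0..T}" for r t
    using lip[of r t] lip[of t r] that by (cases "r \<le> t") (auto simp: dist_norm norm_minus_commute abs_minus_commute)
  have "C-lipschitz_on {0..T} (\<lambda>t. LINT s:{0..t}|lborel. h s)"
    using C0 lip' by (intro lipschitz_onI) auto
  then show ?thesis by (rule lipschitz_on_continuous_on)
qed simp

text \<open>Defined outside the locale, with f and a explicit, so that the iterates can also be read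
  as functions of the outcome when f and a depend on it; their measurability in the outcome is later
  shown by induction on n.\<close>

primrec picard :: "(real \<Rightarrow> 'v \<Rightarrow> 'v::{banach, second_countable_topology}) \<Rightarrow> (real \<Rightarrow> 'v) \<Rightarrow> nat \<Rightarrow> real \<Rightarrow> 'v" where
  "picard f a 0 = (\<lambda>t. 0)"
| "picard f a (Suc n) = (\<lambda>t. a t + (LINT s:{0..t}|lborel. f s (picard f a n s)))"

text \<open>The equation x t = a t + integral of f s (x s) over [0, t] for one fixed outcome: f will
  be the drift along a frozen flow of laws, and a the initial value plus the noise path.\<close>

locale integral_equation =
  fixes f :: "real \<Rightarrow> 'v::euclidean_space \<Rightarrow> 'v" and a :: "real \<Rightarrow> 'v" and T L B0 R :: real
  assumes T_nonneg: "T \<ge> 0" and L_pos: "L > 0"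
    and lip: "\<And>s x y. s \<in> {0..T} \<Longrightarrow> norm (f s x - f s y) \<le> L * norm (x - y)"
    and f0: "\<And>s. s \<in> {0..T} \<Longrightarrow> norm (f s 0) \<le> B0"
    and meas: "\<And>x. (\<lambda>s. f s x) \<in> borel_measurable (restrict_space borel {0..T})"
    and a_cont: "continuous_on {0..T} a" and a_bound: "\<And>t. t \<in> {0..T} \<Longrightarrow> norm (a t) \<le> R"
begin

lemma f_continuous: "s \<in> {0..T} \<Longrightarrow> continuous_on UNIV (f s)"
  using lip[of s] L_pos
  by (intro lipschitz_on_continuous_on[of L] lipschitz_onI) (auto simp: dist_norm)

lemma f_path_measurable:
  assumes "continuous_on {0..T} x"
  shows "(\<lambda>s. f s (x s)) \<in> borel_measurable (restrict_space borel {0..T})"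
  by (rule caratheodory_measurable[of f "restrict_space borel {0..T}" x,
        OF meas _ borel_measurable_continuous_on_restrict[OF assms]])
     (auto simp: space_restrict_space intro: f_continuous)

lemma f_path_bounded:
  assumes "continuous_on {0..T} x"
  obtains C where "\<And>s. s \<in> {0..T} \<Longrightarrow> norm (f s (x s)) \<le> C"
proof -
  have "bounded (x ` {0..T})"
    using assms by (intro compact_imp_bounded compact_continuous_image) auto
  then obtain D where D: "\<And>s. s \<in> {0..T} \<Longrightarrow> norm (x s) \<le> D"
    unfolding bounded_iff by blast
  show ?thesis
  proof (rule that)
    fix s assume s: "s \<in> {0..T}"
    have "norm (f s (x s)) \<le> norm (f s (x s) - f s 0) + norm (f s 0)"
      by (metis add.commute norm_triangle_sub)
    also have "\<dots> \<le> L * norm (x s - 0) + B0" by (intro add_mono lip f0 s)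
    also have "\<dots> \<le> L * D + B0" using D[OF s] L_pos by simp
    finally show "norm (f s (x s)) \<le> L * D + B0" .
  qed
qed

lemma f_path_integrable:
  assumes "continuous_on {0..T} x" "t \<in> {0..T}"
  shows "set_integrable lborel {0..t} (\<lambda>s. f s (x s))"
proof -
  obtain C where "\<And>s. s \<in> {0..T} \<Longrightarrow> norm (f s (x s)) \<le> C"
    using f_path_bounded[OF assms(1)] by blast
  then show ?thesis
    using assms(2) by (intro set_integrable_bounded_interval[OF f_path_measurable[OF assms(1)], where a=0 and b=t]) auto
qed

lemma picard_continuous: "continuous_on {0..T} (picard f a n)"
proof (induction n)
  case (Suc n)
  obtain C where C: "\<And>s. s \<in> {0..T} \<Longrightarrow> norm (f s (picard f a n s)) \<le> C"
    using f_path_bounded[OF Suc] by blast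
  show ?case
    using continuous_on_add[OF a_cont continuous_on_set_integral[OF f_path_measurable[OF Suc] C]] by simp
qed simp

lemma integral_difference_le:
  assumes x: "continuous_on {0..T} x" and y: "continuous_on {0..T} y" and t: "t \<in> {0..T}"
  shows "ennreal (norm ((LINT s:{0..t}|lborel. f s (x s)) - (LINT s:{0..t}|lborel. f s (y s))))
    \<le> (\<integral>\<^sup>+s. ennreal (L * norm (x s - y s)) * indicator {0..t} s \<partial>lborel)"
proof -
  have "(LINT s:{0..t}|lborel. f s (x s)) - (LINT s:{0..t}|lborel. f s (y s)) = (LINT s:{0..t}|lborel. f s (x s) - f s (y s))"
    by (intro set_integral_diff(2)[symmetric] f_path_integrable x y t)
  then have "ennreal (norm ((LINT s:{0..t}|lborel. f s (x s)) - (LINT s:{0..t}|lborel. f s (y s))))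
    \<le> (\<integral>\<^sup>+s. ennreal (norm (f s (x s) - f s (y s))) * indicator {0..t} s \<partial>lborel)"
    using norm_set_integral_le_nn_integral[OF set_integral_diff(1)[OF f_path_integrable[OF x t] f_path_integrable[OF y t]]] by simp
  also have "\<dots> \<le> (\<integral>\<^sup>+s. ennreal (L * norm (x s - y s)) * indicator {0..t} s \<partial>lborel)"
    using lip t by (intro nn_integral_mono) (auto simp: indicator_def intro: ennreal_leI)
  finally show ?thesis .
qed

definition A :: real where "A = R + B0 * T"

lemma A_nonneg: "0 \<le> A"
  using a_bound[of 0] f0[of 0] T_nonneg norm_ge_zero[of "a 0"] norm_ge_zero[of "f 0 0"]
  unfolding A_def by (smt (verit) atLeastAtMost_iff mult_nonneg_nonneg)

text \<open>Under the weight exp (2 L t) the increments halve in each step, since L exp (2 L s)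
  integrates up to t to at most exp (2 L t) / 2. \<open>A\<close> bounds the first iterate, which is
  a t plus the integral of f s 0.\<close>

lemma picard_increment:
  assumes t: "t \<in> {0..T}"
  shows "norm (picard f a (Suc n) t - picard f a n t) \<le> A * exp (2 * L * t) * (1/2) ^ n"
  using t
proof (induction n arbitrary: t)
  case 0
  have B0: "0 \<le> B0" using f0[of t] 0 by (auto intro: order_trans[OF norm_ge_zero])
  have "ennreal (norm (LINT s:{0..t}|lborel. f s 0)) \<le> (\<integral>\<^sup>+s. ennreal (norm (f s 0)) * indicator {0..t} s \<partial>lborel)"
    using f_path_integrable[of "\<lambda>s. 0" t] 0 by (intro norm_set_integral_le_nn_integral) auto
  also have "\<dots> \<le> (\<integral>\<^sup>+s. ennreal B0 * indicator {0..t} s \<partial>lborel)"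
    using f0 0 by (intro nn_integral_mono) (auto simp: indicator_def intro: ennreal_leI)
  also have "\<dots> = ennreal (B0 * t)"
    using 0 B0 by (subst nn_integral_cmult_indicator) (auto simp: ennreal_mult)
  finally have "norm (LINT s:{0..t}|lborel. f s 0) \<le> B0 * t" using B0 0 by (simp add: ennreal_le_iff)
  also have "\<dots> \<le> B0 * T" using B0 0 by (intro mult_left_mono) auto
  finally have "norm (a t + (LINT s:{0..t}|lborel. f s 0)) \<le> A"
    using a_bound[OF 0] norm_triangle_ineq[of "a t" "LINT s:{0..t}|lborel. f s 0"] unfolding A_def by linarith
  also have "A \<le> A * exp (2 * L * t)" using A_nonneg L_pos 0 mult_left_mono[of 1 "exp (2 * L * t)" A] by simp
  finally show ?case by simp
next
  case (Suc n)
  have t: "t \<in> {0..T}" by fact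
  have eq: "norm (picard f a (Suc (Suc n)) t - picard f a (Suc n) t)
    = norm ((LINT s:{0..t}|lborel. f s (picard f a (Suc n) s)) - (LINT s:{0..t}|lborel. f s (picard f a n s)))"
    by simp
  have "ennreal (norm (picard f a (Suc (Suc n)) t - picard f a (Suc n) t))
     \<le> (\<integral>\<^sup>+s. ennreal (L * norm (picard f a (Suc n) s - picard f a n s)) * indicator {0..t} s \<partial>lborel)"
    unfolding eq by (rule integral_difference_le[OF picard_continuous picard_continuous t])
  also have "\<dots> \<le> (\<integral>\<^sup>+s. ennreal (L * A * (1/2)^n) * (ennreal (exp (2 * L * s)) * indicator {0..t} s) \<partial>lborel)"
  proof (intro nn_integral_mono)
    fix s
    show "ennreal (L * norm (picard f a (Suc n) s - picard f a n s)) * indicator {0..t} s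
      \<le> ennreal (L * A * (1/2)^n) * (ennreal (exp (2 * L * s)) * indicator {0..t} s)"
    proof (cases "s \<in> {0..t}")
      case True
      then have "L * norm (picard f a (Suc n) s - picard f a n s) \<le> L * (A * exp (2 * L * s) * (1/2) ^ n)"
        using Suc.IH[of s] t L_pos by (intro mult_left_mono) auto
      then have "ennreal (L * norm (picard f a (Suc n) s - picard f a n s)) \<le> ennreal (L * A * (1/2)^n * exp (2 * L * s))"
        by (intro ennreal_leI) (simp add: mult_ac)
      then show ?thesis using True L_pos A_nonneg by (simp add: ennreal_mult)
    qed simp
  qed
  also have "\<dots> = ennreal (L * A * (1/2)^n) * (\<integral>\<^sup>+s. ennreal (exp ((2 * L) * s)) * indicator {0..t} s \<partial>lborel)"
    by (intro nn_integral_cmult) measurable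
  also have "\<dots> \<le> ennreal (L * A * (1/2)^n) * ennreal (exp ((2 * L) * t) / (2 * L))"
    using L_pos t by (intro mult_left_mono nn_integral_exp_le) auto
  also have "\<dots> = ennreal (A * exp (2 * L * t) * (1/2) ^ Suc n)"
    using L_pos A_nonneg by (subst ennreal_mult[symmetric]) auto
  finally show ?case using A_nonneg by (subst (asm) ennreal_le_iff) auto
qed

definition solution :: "real \<Rightarrow> 'v" where
  "solution t = lim (\<lambda>n. picard f a n t)"

lemma picard_converges:
  assumes t: "t \<in> {0..T}"
  shows "(\<lambda>n. picard f a n t) \<longlonglongrightarrow> solution t"
    and "norm (solution t - picard f a n t) \<le> 2 * A * exp (2 * L * T) * (1/2)^n"
proof -
  define d where "d k = A * exp (2 * L * T) * (1/2)^k" for k :: nat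
  have le: "norm (picard f a (Suc k) t - picard f a k t) \<le> d k" for k
  proof -
    have "norm (picard f a (Suc k) t - picard f a k t) \<le> A * exp (2 * L * t) * (1/2) ^ k"
      by (rule picard_increment[OF t])
    also have "\<dots> \<le> d k"
      unfolding d_def using A_nonneg L_pos t by (intro mult_right_mono mult_left_mono) auto
    finally show ?thesis .
  qed
  have sums: "(\<lambda>k. A * exp (2 * L * T) * (1/2)^n * (1/2)^k) sums (A * exp (2 * L * T) * (1/2)^n * (1 / (1 - 1/2)))" for n
    by (intro sums_mult geometric_sums) auto
  have "summable d" using sums[of 0] unfolding d_def by (simp add: sums_iff)
  note conv = convergent_of_summable_increments[of d "\<lambda>k. picard f a k t", OF this le]
  show "(\<lambda>n. picard f a n t) \<longlonglongrightarrow> solution t" using conv(1) by (simp add: solution_def)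
  have "(\<Sum>j. d (j + n)) = 2 * A * exp (2 * L * T) * (1/2)^n"
    using sums[of n] by (simp add: d_def power_add mult_ac sums_iff)
  then show "norm (solution t - picard f a n t) \<le> 2 * A * exp (2 * L * T) * (1/2)^n"
    using conv(2)[of n] by (simp add: solution_def)
qed

lemma solution_bound: "t \<in> {0..T} \<Longrightarrow> norm (solution t) \<le> 2 * A * exp (2 * L * T)"
  using picard_converges(2)[of t 0] by simp

lemma error_tendsto_0: "(\<lambda>n. 2 * A * exp (2 * L * T) * (1/2)^n) \<longlonglongrightarrow> 0"
  by (rule tendsto_mult_right_zero[OF LIMSEQ_power_zero]) auto

lemma solution_continuous: "continuous_on {0..T} solution"
proof (rule uniform_limit_theorem[where F=sequentially])
  show "\<forall>\<^sub>F n in sequentially. continuous_on {0..T} (picard f a n)"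
    by (intro always_eventually allI picard_continuous)
  show "uniform_limit {0..T} (picard f a) solution sequentially"
  proof (rule uniform_limitI)
    fix e :: real assume "e > 0"
    then have "\<forall>\<^sub>F n in sequentially. 2 * A * exp (2 * L * T) * (1/2)^n < e"
      by (intro order_tendstoD(2)[OF error_tendsto_0])
    then show "\<forall>\<^sub>F n in sequentially. \<forall>x\<in>{0..T}. dist (picard f a n x) (solution x) < e"
    proof eventually_elim
      case (elim n)
      show ?case
      proof
        fix x assume "x \<in> {0..T}"
        from picard_converges(2)[OF this, of n] elim show "dist (picard f a n x) (solution x) < e"
          unfolding dist_norm norm_minus_commute[of "picard f a n x"] by (rule le_less_trans)
      qed
    qed
  qed
qed simp

lemma solution_equation:
  assumes t: "t \<in> {0..T}"
  shows "solution t = a t + (LINT s:{0..t}|lborel. f s (solution s))"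
proof -
  have "(\<lambda>n. picard f a (Suc n) t) \<longlonglongrightarrow> a t + (LINT s:{0..t}|lborel. f s (solution s))"
  proof (rule LIM_zero_cancel, rule Lim_null_comparison)
    have "norm (picard f a (Suc n) t - (a t + (LINT s:{0..t}|lborel. f s (solution s)))) \<le> (L * T) * (2 * A * exp (2 * L * T) * (1/2)^n)" for n
    proof -
      let ?e = "2 * A * exp (2 * L * T) * (1/2)^n"
      have e0: "0 \<le> ?e" using A_nonneg by simp
      have "ennreal (norm (picard f a (Suc n) t - (a t + (LINT s:{0..t}|lborel. f s (solution s)))))
        = ennreal (norm ((LINT s:{0..t}|lborel. f s (picard f a n s)) - (LINT s:{0..t}|lborel. f s (solution s))))"
        by simp
      also have "\<dots> \<le> (\<integral>\<^sup>+s. ennreal (L * norm (picard f a n s - solution s)) * indicator {0..t} s \<partial>lborel)"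
        by (intro integral_difference_le picard_continuous solution_continuous t)
      also have "\<dots> \<le> (\<integral>\<^sup>+s. ennreal (L * ?e) * indicator {0..t} s \<partial>lborel)"
      proof (intro nn_integral_mono)
        fix s
        show "ennreal (L * norm (picard f a n s - solution s)) * indicator {0..t} s \<le> ennreal (L * ?e) * indicator {0..t} s"
          using picard_converges(2)[of s n] t L_pos
          by (cases "s \<in> {0..t}") (auto intro!: ennreal_leI mult_left_mono simp: norm_minus_commute)
      qed
      also have "\<dots> = ennreal (L * ?e * t)"
        using t e0 L_pos by (subst nn_integral_cmult_indicator) (auto simp: ennreal_mult)
      also have "\<dots> \<le> ennreal ((L * T) * ?e)"
      proof (intro ennreal_leI)
        have "(L * ?e) * t \<le> (L * ?e) * T" using t e0 L_pos by (intro mult_left_mono) auto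
        then show "L * ?e * t \<le> (L * T) * ?e" by (simp add: mult_ac)
      qed
      finally show ?thesis using e0 L_pos T_nonneg by (subst (asm) ennreal_le_iff) auto
    qed
    then show "\<forall>\<^sub>F n in sequentially. norm (picard f a (Suc n) t - (a t + (LINT s:{0..t}|lborel. f s (solution s)))) \<le> (L * T) * (2 * A * exp (2 * L * T) * (1/2)^n)"
      by (rule always_eventually[OF allI])
    show "(\<lambda>n. (L * T) * (2 * A * exp (2 * L * T) * (1/2)^n)) \<longlonglongrightarrow> 0"
      by (rule tendsto_mult_right_zero[OF error_tendsto_0])
  qed
  moreover have "(\<lambda>n. picard f a (Suc n) t) \<longlonglongrightarrow> solution t"
    by (rule LIMSEQ_Suc[OF picard_converges(1)[OF t]])
  ultimately show ?thesis by (rule LIMSEQ_unique[rotated])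
qed

end

text \<open>A convex function lies above its tangent at y. After scaling to z = x / y this is the
  weighted inequality of arithmetic and geometric means for z powr q and 1 with weights 1/q and 1 -
  1/q; x = 0 is computed directly.\<close>

lemma powr_above_tangent:
  fixes x y q :: real
  assumes "x \<ge> 0" "y > 0" "q \<ge> 1"
  shows "y powr q + q * y powr (q - 1) * (x - y) \<le> x powr q"
proof (cases "x = 0")
  case True
  have "y powr q = y powr (q - 1) * y" using assms by (simp add: powr_mult_base powr_diff)
  then have "y powr q + q * y powr (q - 1) * (x - y) = (1 - q) * y powr q" using True by (simp add: algebra_simps)
  also have "\<dots> \<le> 0" using assms by (intro mult_nonpos_nonneg) auto
  finally show ?thesis using True by simp
next
  case False
  define z where "z = x / y"
  have z: "z > 0" using False assms by (simp add: z_def)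
  have "(z powr q) powr (1/q) * 1 powr (1 - 1/q) \<le> (1/q) * z powr q + (1 - 1/q) * 1"
    using z assms by (intro Youngs_inequality_0) auto
  then have "z \<le> (1/q) * z powr q + (1 - 1/q)" using z assms by (simp add: powr_powr)
  then have "q * z \<le> q * ((1/q) * z powr q + (1 - 1/q))" using assms by (intro mult_left_mono) auto
  also have "\<dots> = z powr q + (q - 1)" using assms by (simp add: distrib_left right_diff_distrib)
  finally have *: "1 + q * (z - 1) \<le> z powr q" by (simp add: algebra_simps)
  have "y powr q * (1 + q * (z - 1)) \<le> y powr q * z powr q" by (intro mult_left_mono *) auto
  also have "y powr q * z powr q = x powr q" using assms by (simp add: z_def powr_divide)
  also have "y powr q * (1 + q * (z - 1)) = y powr q + q * y powr (q - 1) * (x - y)"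
  proof -
    have "y powr q = y powr (q - 1) * y" using assms by (simp add: powr_mult_base powr_diff)
    moreover have "y * (z - 1) = x - y" using assms by (simp add: z_def field_simps)
    ultimately show ?thesis by (simp add: algebra_simps)
  qed
  finally show ?thesis .
qed

text \<open>The tangent inequality at the mean value y = J / t is integrated: the linear term
  cancels, and t powr (q - 1) times t times y powr q is J powr q. The case J = 0 is separate because
  the tangent point has to be positive.\<close>

lemma jensen_interval:
  fixes h :: "real \<Rightarrow> real"
  assumes h: "continuous_on {0..t} h" "\<And>s. s \<in> {0..t} \<Longrightarrow> 0 \<le> h s" and t: "0 \<le> t" "t \<le> T" and q: "q \<ge> 1"
  shows "ennreal ((LINT s:{0..t}|lborel. h s) powr q)
    \<le> ennreal (T powr (q - 1)) * (\<integral>\<^sup>+s. ennreal (h s powr q) * indicator {0..t} s \<partial>lborel)"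
proof -
  define J where "J = (LINT s:{0..t}|lborel. h s)"
  have J0: "0 \<le> J" unfolding J_def set_lebesgue_integral_def using h(2)
    by (intro integral_nonneg_AE AE_I2) (auto simp: indicator_def)
  show ?thesis
  proof (cases "J = 0 \<or> t = 0")
    case True
    have "J = 0" if "t = 0"
      unfolding J_def set_lebesgue_integral_def
    proof (intro integral_eq_zero_AE, use AE_lborel_singleton[of "0::real"] in eventually_elim)
      fix x :: real assume "x \<noteq> 0"
      then show "indicator {0..t} x *\<^sub>R h x = 0" using that by simp
    qed
    then show ?thesis using True unfolding J_def[symmetric] by auto
  next
    case False
    then have Jp: "J > 0" and tp: "t > 0" using J0 t by auto
    define y where "y = J / t"
    have y: "y > 0" using Jp tp by (simp add: y_def)
    have ih: "set_integrable lborel {0..t} h"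
      using borel_integrable_compact[OF _ h(1)] unfolding set_integrable_def by (simp add: mult.commute)
    have cq: "continuous_on {0..t} (\<lambda>s. h s powr q)"
      using h q by (intro continuous_on_powr' continuous_on_const) auto
    have iq: "set_integrable lborel {0..t} (\<lambda>s. h s powr q)"
      using borel_integrable_compact[OF _ cq] unfolding set_integrable_def by (simp add: mult.commute)
    have ic: "set_integrable lborel {0..t} (\<lambda>s. c :: real)" for c
      unfolding set_integrable_def by (rule borel_integrable_compact) auto
    have il: "set_integrable lborel {0..t} (\<lambda>s. y powr q + q * y powr (q - 1) * (h s - y))"
      by (intro set_integral_add(1) set_integrable_mult_right set_integral_diff(1) ic ih) 
    have cint: "(LINT s:{0..t}|lborel. (c :: real)) = c * t" for c
      using tp by (simp add: set_lebesgue_integral_def)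
    have "(LINT s:{0..t}|lborel. y powr q + q * y powr (q - 1) * (h s - y)) = y powr q * t + q * y powr (q - 1) * (J - y * t)"
      by (simp add: set_integral_add(2) set_integral_diff set_integrable_mult_right ic ih cint J_def)
    also have "\<dots> = y powr q * t" using tp by (simp add: y_def)
    finally have eq: "(LINT s:{0..t}|lborel. y powr q + q * y powr (q - 1) * (h s - y)) = y powr q * t" .
    have "y powr q * t \<le> (LINT s:{0..t}|lborel. h s powr q)"
      unfolding eq[symmetric] using h(2) y q
      by (intro set_integral_mono il iq powr_above_tangent) auto
    then have "t powr (q - 1) * (y powr q * t) \<le> T powr (q - 1) * (LINT s:{0..t}|lborel. h s powr q)"
      using t tp q y by (intro mult_mono powr_mono2) auto
    also have "t powr (q - 1) * (y powr q * t) = J powr q"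
    proof -
      have "t powr (q - 1) * t = t powr q" using tp by (simp add: powr_diff)
      then have "t powr (q - 1) * (y powr q * t) = t powr q * y powr q" by (simp add: mult_ac)
      also have "\<dots> = J powr q" using tp Jp by (simp add: y_def powr_divide)
      finally show ?thesis .
    qed
    finally have "ennreal (J powr q) \<le> ennreal (T powr (q - 1) * (LINT s:{0..t}|lborel. h s powr q))"
      by (rule ennreal_leI)
    also have "\<dots> = ennreal (T powr (q - 1)) * ennreal (LINT s:{0..t}|lborel. h s powr q)"
      by (simp add: ennreal_mult')
    also have "ennreal (LINT s:{0..t}|lborel. h s powr q) = (\<integral>\<^sup>+s. ennreal (indicator {0..t} s *\<^sub>R h s powr q) \<partial>lborel)"
      unfolding set_lebesgue_integral_def using iq
      by (intro nn_integral_eq_integral[symmetric]) (auto simp: set_integrable_def)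
    also have "\<dots> = (\<integral>\<^sup>+s. ennreal (h s powr q) * indicator {0..t} s \<partial>lborel)"
      by (intro nn_integral_cong) (auto simp: indicator_def)
    finally show ?thesis unfolding J_def .
  qed
qed

section \<open>Flows of laws\<close>

lemma powr_le_one_plus_powr:
  fixes x :: real
  assumes "0 \<le> x" "0 \<le> q" "q \<le> r"
  shows "x powr q \<le> 1 + x powr r"
proof (cases "x \<le> 1")
  case True
  then have "x powr q \<le> 1" using assms by (intro powr_le1) auto
  then show ?thesis using powr_ge_zero[of x r] by linarith
next
  case False
  then have "x powr q \<le> x powr r" using assms by (intro powr_mono) auto
  then show ?thesis by linarith
qed

lemma vec_nth_measurable: "(\<lambda>x :: 'b::second_countable_topology ^ 'n. x $ i) \<in> borel_measurable borel"
  by (intro borel_measurable_continuous_onI continuous_intros)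

text \<open>The joint law of X and Y is a coupling, and all Wasserstein distances below are
  estimated through such couplings on the given space. For a nonnegative function the Bochner
  integral is \<open>enn2real\<close> of the extended one, so the moment bound carries over.\<close>

lemma (in prob_space) wasserstein_law:
  fixes X Y :: "'a \<Rightarrow> 'b::euclidean_space"
  assumes [measurable]: "X \<in> borel_measurable M" "Y \<in> borel_measurable M" and \<theta>: "\<theta> > 0"
  shows wasserstein_law_nonneg: "0 \<le> wasserstein \<theta> (law M X) (law M Y)"
    and wasserstein_law_le: "0 \<le> c \<Longrightarrow> (\<integral>\<^sup>+\<omega>. ennreal (norm (X \<omega> - Y \<omega>) powr \<theta>) \<partial>M) \<le> ennreal (c powr \<theta>)
      \<Longrightarrow> wasserstein \<theta> (law M X) (law M Y) \<le> c"
proof -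
  let ?\<pi> = "distr M (borel \<Otimes>\<^sub>M borel) (\<lambda>\<omega>. (X \<omega>, Y \<omega>))"
  let ?S = "{(\<integral> z. norm (fst z - snd z) powr \<theta> \<partial>\<pi>) powr (1 / \<theta>) | \<pi>. coupling (law M X) (law M Y) \<pi>}"
  have cp: "coupling (law M X) (law M Y) ?\<pi>"
    unfolding coupling_def law_def
    by (auto intro!: prob_space_distr simp: distr_distr comp_def)
  have nonneg: "\<And>v. v \<in> ?S \<Longrightarrow> 0 \<le> v" by auto
  show "0 \<le> wasserstein \<theta> (law M X) (law M Y)"
    unfolding wasserstein_def using cp nonneg by (intro cInf_greatest) auto
  assume c: "0 \<le> c" and le: "(\<integral>\<^sup>+\<omega>. ennreal (norm (X \<omega> - Y \<omega>) powr \<theta>) \<partial>M) \<le> ennreal (c powr \<theta>)"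
  have "wasserstein \<theta> (law M X) (law M Y) \<le> (\<integral> z. norm (fst z - snd z) powr \<theta> \<partial>?\<pi>) powr (1 / \<theta>)"
    unfolding wasserstein_def using cp nonneg by (intro cInf_lower bdd_belowI[of _ 0]) auto
  also have "(\<integral> z. norm (fst z - snd z) powr \<theta> \<partial>?\<pi>) = (\<integral>\<omega>. norm (X \<omega> - Y \<omega>) powr \<theta> \<partial>M)"
    by (subst integral_distr) auto
  also have "(\<integral>\<omega>. norm (X \<omega> - Y \<omega>) powr \<theta> \<partial>M) = enn2real (\<integral>\<^sup>+\<omega>. ennreal (norm (X \<omega> - Y \<omega>) powr \<theta>) \<partial>M)"
    by (intro integral_eq_nn_integral) auto
  also have "\<dots> powr (1 / \<theta>) \<le> (c powr \<theta>) powr (1 / \<theta>)"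
    using le \<theta> by (intro powr_mono2 enn2real_leI) auto
  also have "\<dots> = c" using c \<theta> by (simp add: powr_powr)
  finally show "wasserstein \<theta> (law M X) (law M Y) \<le> c" .
qed

lemma (in prob_space) P_moment_law:
  fixes X :: "'a \<Rightarrow> 'b::euclidean_space"
  assumes [measurable]: "X \<in> borel_measurable M" and "(\<integral>\<^sup>+\<omega>. ennreal (norm (X \<omega>) powr \<theta>) \<partial>M) < \<infinity>"
  shows "P_moment \<theta> (law M X)"
  using assms(2) unfolding P_moment_def law_def by (auto intro!: prob_space_distr simp: nn_integral_distr)

text \<open>A triangle inequality for \<theta>-th powers of the L-\<theta> distance, with the factor
  2 powr \<theta>; it plays the part of Minkowski's inequality.\<close>

lemma nn_integral_powr_triangle:
  fixes X Y Z :: "'a \<Rightarrow> 'b::euclidean_space"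
  assumes [measurable]: "X \<in> borel_measurable M" "Y \<in> borel_measurable M" "Z \<in> borel_measurable M" and \<theta>: "\<theta> \<ge> 0"
  shows "(\<integral>\<^sup>+\<omega>. ennreal (norm (X \<omega> - Z \<omega>) powr \<theta>) \<partial>M) \<le> ennreal (2 powr \<theta>) *
    ((\<integral>\<^sup>+\<omega>. ennreal (norm (X \<omega> - Y \<omega>) powr \<theta>) \<partial>M) + (\<integral>\<^sup>+\<omega>. ennreal (norm (Y \<omega> - Z \<omega>) powr \<theta>) \<partial>M))"
proof -
  have "(\<integral>\<^sup>+\<omega>. ennreal (norm (X \<omega> - Z \<omega>) powr \<theta>) \<partial>M)
    \<le> (\<integral>\<^sup>+\<omega>. ennreal (2 powr \<theta>) * (ennreal (norm (X \<omega> - Y \<omega>) powr \<theta>) + ennreal (norm (Y \<omega> - Z \<omega>) powr \<theta>)) \<partial>M)"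
  proof (intro nn_integral_mono)
    fix \<omega>
    have "norm (X \<omega> - Z \<omega>) \<le> norm (X \<omega> - Y \<omega>) + norm (Y \<omega> - Z \<omega>)"
      using norm_triangle_ineq[of "X \<omega> - Y \<omega>" "Y \<omega> - Z \<omega>"] by simp
    then have "norm (X \<omega> - Z \<omega>) powr \<theta> \<le> (norm (X \<omega> - Y \<omega>) + norm (Y \<omega> - Z \<omega>)) powr \<theta>"
      using \<theta> by (intro powr_mono2) auto
    also have "\<dots> \<le> 2 powr \<theta> * (norm (X \<omega> - Y \<omega>) powr \<theta> + norm (Y \<omega> - Z \<omega>) powr \<theta>)"
      using \<theta> by (intro powr_add_le) auto
    finally have "ennreal (norm (X \<omega> - Z \<omega>) powr \<theta>) \<le> ennreal (2 powr \<theta> * (norm (X \<omega> - Y \<omega>) powr \<theta> + norm (Y \<omega> - Z \<omega>) powr \<theta>))"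
      by (rule ennreal_leI)
    then show "ennreal (norm (X \<omega> - Z \<omega>) powr \<theta>) \<le> ennreal (2 powr \<theta>) * (ennreal (norm (X \<omega> - Y \<omega>) powr \<theta>) + ennreal (norm (Y \<omega> - Z \<omega>) powr \<theta>))"
      by (simp add: ennreal_mult ennreal_plus)
  qed
  also have "\<dots> = ennreal (2 powr \<theta>) *
    ((\<integral>\<^sup>+\<omega>. ennreal (norm (X \<omega> - Y \<omega>) powr \<theta>) \<partial>M) + (\<integral>\<^sup>+\<omega>. ennreal (norm (Y \<omega> - Z \<omega>) powr \<theta>) \<partial>M))"
    by (simp add: nn_integral_cmult nn_integral_add)
  finally show ?thesis .
qed

text \<open>Z is scaled by sqrt v, and x powr q is bounded by 1 plus the 2m-th power of x. The
  scaling preserves the dependence v powr (q / 2) on the variance, on which the contraction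
  rests.\<close>

lemma (in prob_space) absolute_moment_le:
  fixes Z :: "'a \<Rightarrow> real"
  assumes [measurable]: "Z \<in> borel_measurable M"
    and Z: "(\<integral>\<^sup>+\<omega>. ennreal (Z \<omega> ^ (2 * m)) \<partial>M) \<le> ennreal (C * v ^ m)" and v: "v > 0" and C: "C \<ge> 0"
    and q: "0 \<le> q" "q \<le> 2 * real m"
  shows "(\<integral>\<^sup>+\<omega>. ennreal (\<bar>Z \<omega>\<bar> powr q) \<partial>M) \<le> ennreal ((1 + C) * v powr (q / 2))"
proof -
  have ptw: "\<bar>z\<bar> powr q \<le> v powr (q / 2) * (1 + z ^ (2 * m) / v ^ m)" for z :: real
  proof -
    define x where "x = \<bar>z\<bar> / sqrt v"
    have x: "0 \<le> x" using v by (simp add: x_def)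
    have "x powr q \<le> 1 + x ^ (2 * m)" using x q by (intro powr_le_one_plus_power) auto
    also have "x ^ (2 * m) = z ^ (2 * m) / v ^ m"
      using v by (simp add: x_def power_divide power_even_abs power_mult)
    finally have "v powr (q / 2) * x powr q \<le> v powr (q / 2) * (1 + z ^ (2 * m) / v ^ m)"
      by (intro mult_left_mono) auto
    moreover have "v powr (q / 2) * x powr q = \<bar>z\<bar> powr q"
    proof -
      have "v powr (q / 2) = sqrt v powr q" using v by (simp add: powr_half_sqrt[symmetric] powr_powr)
      then show ?thesis using v by (simp add: x_def powr_divide)
    qed
    ultimately show ?thesis by simp
  qed
  have "(\<integral>\<^sup>+\<omega>. ennreal (\<bar>Z \<omega>\<bar> powr q) \<partial>M) \<le> (\<integral>\<^sup>+\<omega>. ennreal (v powr (q / 2)) * (1 + ennreal (1 / v ^ m) * ennreal (Z \<omega> ^ (2 * m))) \<partial>M)"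
  proof (intro nn_integral_mono)
    fix \<omega>
    have "ennreal (\<bar>Z \<omega>\<bar> powr q) \<le> ennreal (v powr (q / 2) * (1 + (1 / v ^ m) * Z \<omega> ^ (2 * m)))"
      using ptw[of "Z \<omega>"] by (intro ennreal_leI) simp
    also have "\<dots> = ennreal (v powr (q / 2)) * ennreal (1 + (1 / v ^ m) * Z \<omega> ^ (2 * m))"
      by (simp add: ennreal_mult')
    also have "ennreal (1 + (1 / v ^ m) * Z \<omega> ^ (2 * m)) = 1 + ennreal ((1 / v ^ m) * Z \<omega> ^ (2 * m))"
      using v by (subst ennreal_plus) auto
    also have "ennreal ((1 / v ^ m) * Z \<omega> ^ (2 * m)) = ennreal (1 / v ^ m) * ennreal (Z \<omega> ^ (2 * m))"
      using v by (subst ennreal_mult') auto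
    finally show "ennreal (\<bar>Z \<omega>\<bar> powr q) \<le> ennreal (v powr (q / 2)) * (1 + ennreal (1 / v ^ m) * ennreal (Z \<omega> ^ (2 * m)))" .
  qed
  also have "\<dots> = ennreal (v powr (q / 2)) * (1 + ennreal (1 / v ^ m) * (\<integral>\<^sup>+\<omega>. ennreal (Z \<omega> ^ (2 * m)) \<partial>M))"
    by (simp add: nn_integral_cmult nn_integral_add emeasure_space_1)
  also have "\<dots> \<le> ennreal (v powr (q / 2)) * (1 + ennreal (1 / v ^ m) * ennreal (C * v ^ m))"
    by (intro mult_left_mono add_mono Z order_refl) auto
  also have "ennreal (1 / v ^ m) * ennreal (C * v ^ m) = ennreal C"
    using v by (subst ennreal_mult'[symmetric]) auto
  also have "ennreal (v powr (q / 2)) * (1 + ennreal C) = ennreal ((1 + C) * v powr (q / 2))"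
    using C by (subst mult.commute) (simp add: ennreal_mult ennreal_plus)
  finally show ?thesis .
qed

text \<open>Any variable accepted by \<open>is_wiener_integral\<close> agrees almost surely with the
  constructed one, so the moment estimates apply to the integrals inside an arbitrary solution. The
  construction is run with M itself as the sigma-algebra.\<close>

lemma (in scalar_fbm) wiener_integral_imp_L2_wiener:
  assumes "g \<in> borel_measurable borel" "\<And>u. \<bar>g u\<bar> \<le> G" and t: "t \<in> {0..T}"
    and W: "is_wiener_integral M \<beta> H t g Y"
  shows "L2_wiener (\<lambda>u. g u * indicator {0..t} u) Y"
proof -
  obtain Y' where Y': "L2_wiener (\<lambda>u. g u * indicator {0..t} u) Y'"
    using wiener_integral_exists[OF assms(1,2) t refl order_refl] \<beta>_meas t by auto
  show ?thesis
  proof (rule L2_wiener_cong_AE[OF Y'])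
    show "Y \<in> borel_measurable M" using W by (simp add: is_wiener_integral_def)
    show "AE \<omega> in M. Y \<omega> = Y' \<omega>" by (rule wiener_integral_unique[OF assms(1,2) t W Y'])
  qed
qed

section \<open>The filtration, frozen flows and bounds on the coefficients\<close>

locale mckean_vlasov = prob_space M
  for M :: "'a measure" +
  fixes T H \<theta> p :: real and F0 :: "'a set set"
    and B :: "real \<Rightarrow> 'a \<Rightarrow> real^'d" and \<xi> :: "'a \<Rightarrow> real^'d"
    and b :: "'a \<Rightarrow> real \<Rightarrow> real^'d \<Rightarrow> (real^'d) measure \<Rightarrow> real^'d"
    and \<sigma> :: "real \<Rightarrow> (real^'d) measure \<Rightarrow> real^'d^'d"
    and K :: "real \<Rightarrow> real"
  assumes M_complete: "complete_measure M"
    and T: "T > 0" and H: "1/2 < H" "H < 1"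
    and fBm: "is_fBm M H T B"
    and F0: "sigma_algebra (space M) F0" "F0 \<subseteq> sets M"
    and \<theta>: "\<theta> \<ge> 1" and p: "p \<ge> \<theta>"
    and \<xi>: "\<xi> \<in> borel_measurable (sigma (space M) F0)"
        "(\<integral>\<^sup>+ \<omega>. ennreal (norm (\<xi> \<omega>) powr p) \<partial>M) < \<infinity>"
    and K: "mono_on {0..T} K" "\<forall>t\<in>{0..T}. K t \<ge> 0"
    and b_lip: "\<forall>\<omega>\<in>space M. \<forall>t\<in>{0..T}. \<forall>x y \<mu> \<nu>. P_moment \<theta> \<mu> \<longrightarrow> P_moment \<theta> \<nu> \<longrightarrow>
          norm (b \<omega> t x \<mu> - b \<omega> t y \<nu>) \<le> K t * (norm (x - y) + wasserstein \<theta> \<mu> \<nu>)"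
    and \<sigma>_lip: "\<forall>t\<in>{0..T}. \<forall>\<mu> \<nu>. P_moment \<theta> \<mu> \<longrightarrow> P_moment \<theta> \<nu> \<longrightarrow>
          norm (\<sigma> t \<mu> - \<sigma> t \<nu>) \<le> K t * wasserstein \<theta> \<mu> \<nu>"
    and bound0: "\<forall>\<omega>\<in>space M. \<forall>t\<in>{0..T}.
          norm (b \<omega> t 0 (return borel 0)) + norm (\<sigma> t (return borel 0)) \<le> K t"
    and \<sigma>_meas: "\<forall>m. W_continuous_flow \<theta> T m \<longrightarrow>
          (\<lambda>s. \<sigma> s (m s)) \<in> borel_measurable (restrict_space borel {0..T})"
    and b_meas: "\<forall>m. W_continuous_flow \<theta> T m \<longrightarrow> (\<forall>t\<in>{0..T}. \<forall>x.
          (\<lambda>(\<omega>, s). b \<omega> s x (m s)) \<in>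
            borel_measurable (fbm_filtration M F0 B t \<Otimes>\<^sub>M restrict_space borel {0..t}))"
begin

abbreviation Fil :: "real \<Rightarrow> 'a measure" where
  "Fil \<equiv> fbm_filtration M F0 B"

lemma B_meas: "t \<in> {0..T} \<Longrightarrow> B t \<in> borel_measurable M"
  using fBm by (auto simp: is_fBm_def)

lemma Fil_generator_Pow:
  "F0 \<union> {B s -` A \<inter> space M | s A. s \<in> {0..t} \<and> A \<in> sets borel} \<union> null_sets M \<subseteq> Pow (space M)"
proof (intro Un_least)
  show "F0 \<subseteq> Pow (space M)" using F0(2) sets.space_closed[of M] by (rule order_trans)
  show "null_sets M \<subseteq> Pow (space M)" using sets.space_closed[of M] by (auto simp: null_sets_def)
qed auto

lemma space_Fil: "space (Fil t) = space M"
  unfolding fbm_filtration_def by (rule space_measure_of[OF Fil_generator_Pow])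

lemma sets_Fil: "sets (Fil t) = sigma_sets (space M)
    (F0 \<union> {B s -` A \<inter> space M | s A. s \<in> {0..t} \<and> A \<in> sets borel} \<union> null_sets M)"
  unfolding fbm_filtration_def by (rule sets_measure_of[OF Fil_generator_Pow])

lemma sets_Fil_subset: "t \<in> {0..T} \<Longrightarrow> sets (Fil t) \<subseteq> sets M"
  unfolding sets_Fil using F0(2) B_meas
  by (intro sets.sigma_sets_subset) (auto intro!: measurable_sets[of _ M borel])

lemma null_sets_Fil: "null_sets M \<subseteq> sets (Fil t)"
  unfolding sets_Fil by (auto intro: sigma_sets.Basic)

lemma Fil_mono: "s \<le> t \<Longrightarrow> sets (Fil s) \<subseteq> sets (Fil t)"
  unfolding sets_Fil by (intro sigma_sets_mono' Un_mono order_refl Collect_mono ex_mono impI) auto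

lemma measurable_Fil_mono: "s \<le> t \<Longrightarrow> f \<in> borel_measurable (Fil s) \<Longrightarrow> f \<in> borel_measurable (Fil t)"
  using Fil_mono[of s t] by (intro measurable_from_subalg[of "Fil t" "Fil s"]) (auto simp: subalgebra_def space_Fil)

lemma measurable_Fil_M: "t \<in> {0..T} \<Longrightarrow> f \<in> borel_measurable (Fil t) \<Longrightarrow> f \<in> borel_measurable M"
  using sets_Fil_subset[of t] by (intro measurable_from_subalg[of M "Fil t"]) (auto simp: subalgebra_def space_Fil)

lemma B_Fil: "s \<in> {0..t} \<Longrightarrow> B s \<in> borel_measurable (Fil t)"
  unfolding measurable_def space_Fil sets_Fil by (auto intro!: sigma_sets.Basic)

lemma \<xi>_Fil: "\<xi> \<in> borel_measurable (Fil t)"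
proof (rule measurable_from_subalg[OF _ \<xi>(1)])
  interpret F: sigma_algebra "space M" F0 by (rule F0)
  have "space (sigma (space M) F0) = space M" "sets (sigma (space M) F0) = F0"
    using F.space_closed by (auto simp: F.sigma_sets_eq)
  then show "subalgebra (Fil t) (sigma (space M) F0)"
    unfolding subalgebra_def space_Fil sets_Fil by (auto intro: sigma_sets.Basic)
qed

lemma \<xi>_meas [measurable]: "\<xi> \<in> borel_measurable M"
  using measurable_Fil_M[OF _ \<xi>_Fil, of 0] T by auto

lemma component_fbm: "scalar_fbm M (\<lambda>s \<omega>. B s \<omega> $ j) T H"
proof (unfold_locales)
  show "t \<in> {0..T} \<Longrightarrow> (\<lambda>\<omega>. B t \<omega> $ j) \<in> borel_measurable M" for t
    using B_meas[of t] by (intro measurable_compose[OF _ vec_nth_measurable]) auto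
  show "\<omega> \<in> space M \<Longrightarrow> B 0 \<omega> $ j = 0" for \<omega> using fBm by (auto simp: is_fBm_def)
  show "gaussian_rv M (\<lambda>\<omega>. \<Sum>k<n. cs k * B (ts k) \<omega> $ j)" if "\<And>k. k < n \<Longrightarrow> ts k \<in> {0..T}" for n ts and cs :: "nat \<Rightarrow> real"
  proof -
    \<comment> \<open>Scalar coefficients are placed on the j-th axis, so that inner products pick
      out the j-th component.\<close>
    have "gaussian_rv M (\<lambda>\<omega>. \<Sum>k<n. axis j (cs k) \<bullet> B (ts k) \<omega>)"
    proof -
      have "\<forall>(n::nat) (ts::nat \<Rightarrow> real) (cs::nat \<Rightarrow> real^'d). (\<forall>k<n. ts k \<in> {0..T}) \<longrightarrow>
         gaussian_rv M (\<lambda>\<omega>. \<Sum>k<n. cs k \<bullet> B (ts k) \<omega>)"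
        using fBm unfolding is_fBm_def by (elim conjE)
      from this[rule_format, of n ts "\<lambda>k. axis j (cs k)"] that show ?thesis by simp
    qed
    then show ?thesis by (simp add: inner_axis')
  qed
qed (use T H fBm in \<open>auto simp: is_fBm_def\<close>)

text \<open>K is non-decreasing, so K T bounds it on [0, T]; the summand 1 makes this common
  Lipschitz constant strictly positive.\<close>

definition L :: real where "L = K T + 1"

lemma L_pos: "L > 0" using K T by (simp add: L_def add_nonneg_pos)

lemma K_le: "t \<in> {0..T} \<Longrightarrow> K t \<le> L"
  using K(1) T unfolding L_def mono_on_def by (smt (verit) atLeastAtMost_iff)

definition Lp_bounded :: "(real \<Rightarrow> 'a \<Rightarrow> real^'d) \<Rightarrow> real \<Rightarrow> bool" where
  "Lp_bounded V R \<longleftrightarrow> 0 \<le> R \<and> (\<forall>t\<in>{0..T}. V t \<in> borel_measurable M \<and>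
     (\<integral>\<^sup>+\<omega>. ennreal (norm (V t \<omega>) powr \<theta>) \<partial>M) \<le> ennreal (R powr \<theta>))"

text \<open>A flow of laws is carried by random variables on the given space, bounded and continuous
  in L-\<theta>. Paths need not be continuous nor values adapted, so that a limit taken separately
  at each time still qualifies.\<close>

definition flow_process :: "(real \<Rightarrow> 'a \<Rightarrow> real^'d) \<Rightarrow> bool" where
  "flow_process V \<longleftrightarrow> (\<exists>R. Lp_bounded V R) \<and>
     (\<forall>t\<in>{0..T}. ((\<lambda>s. \<integral>\<^sup>+\<omega>. ennreal (norm (V s \<omega> - V t \<omega>) powr \<theta>) \<partial>M) \<longlongrightarrow> 0) (at t within {0..T}))"

lemma flow_process_meas: "flow_process V \<Longrightarrow> t \<in> {0..T} \<Longrightarrow> V t \<in> borel_measurable M"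
  by (auto simp: flow_process_def Lp_bounded_def)

lemma Lp_bounded_P_moment: "Lp_bounded V R \<Longrightarrow> t \<in> {0..T} \<Longrightarrow> P_moment \<theta> (law M (V t))"
  unfolding Lp_bounded_def by (intro P_moment_law) (auto intro: le_less_trans[OF _ ennreal_less_top])

lemma flow_process_P_moment: "flow_process V \<Longrightarrow> t \<in> {0..T} \<Longrightarrow> P_moment \<theta> (law M (V t))"
  using Lp_bounded_P_moment by (auto simp: flow_process_def)

text \<open>Writing the Dirac mass at 0 as a law on the same space lets distances to it be bounded
  by coupling with the constant 0.\<close>

lemma law_zero: "law M (\<lambda>\<omega>. 0 :: real^'d) = return borel 0"
  unfolding law_def by (rule distr_const) simp

lemma P_moment_zero: "P_moment \<theta> (return borel (0 :: real^'d))"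
  unfolding law_zero[symmetric] by (rule P_moment_law) auto

lemma wasserstein_zero_le: "Lp_bounded V R \<Longrightarrow> t \<in> {0..T} \<Longrightarrow> wasserstein \<theta> (law M (V t)) (return borel 0) \<le> R"
  unfolding law_zero[symmetric] Lp_bounded_def using \<theta> by (intro wasserstein_law_le) auto

lemma wasserstein_self_le: "V \<in> borel_measurable M \<Longrightarrow> wasserstein \<theta> (law M V) (law M (V :: 'a \<Rightarrow> real^'d)) \<le> 0"
  using \<theta> by (intro wasserstein_law_le) auto

text \<open>The coefficients are known to be measurable along flows continuous for the Wasserstein
  distance; the coupling of V s with V t shows that the flows of this proof are such.\<close>

lemma flow_process_continuous_flow:
  assumes V: "flow_process V"
  shows "W_continuous_flow \<theta> T (\<lambda>s. law M (V s))"
  unfolding W_continuous_flow_def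
proof (intro conjI ballI)
  fix t assume t: "t \<in> {0..T}"
  show "P_moment \<theta> (law M (V t))" by (rule flow_process_P_moment[OF V t])
  have lim: "((\<lambda>s. \<integral>\<^sup>+\<omega>. ennreal (norm (V s \<omega> - V t \<omega>) powr \<theta>) \<partial>M) \<longlongrightarrow> 0) (at t within {0..T})"
    using V t by (auto simp: flow_process_def)
  have in_T: "\<forall>\<^sub>F s in at t within {0..T}. s \<in> {0..T}" by (simp add: eventually_at_filter)
  show "((\<lambda>s. wasserstein \<theta> (law M (V s)) (law M (V t))) \<longlongrightarrow> 0) (at t within {0..T})"
  proof (rule tendstoI)
    fix e :: real assume e: "e > 0"
    have "\<forall>\<^sub>F s in at t within {0..T}. (\<integral>\<^sup>+\<omega>. ennreal (norm (V s \<omega> - V t \<omega>) powr \<theta>) \<partial>M) < ennreal ((e/2) powr \<theta>)"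
      using e by (intro order_tendstoD(2)[OF lim]) auto
    with in_T show "\<forall>\<^sub>F s in at t within {0..T}. dist (wasserstein \<theta> (law M (V s)) (law M (V t))) 0 < e"
    proof eventually_elim
      case (elim s)
      have "wasserstein \<theta> (law M (V s)) (law M (V t)) \<le> e/2"
        using elim e \<theta> flow_process_meas[OF V] t by (intro wasserstein_law_le) auto
      moreover have "0 \<le> wasserstein \<theta> (law M (V s)) (law M (V t))"
        using elim \<theta> flow_process_meas[OF V] t by (intro wasserstein_law_nonneg) auto
      ultimately show ?case using e by (simp add: dist_real_def)
    qed
  qed
qed

lemma \<sigma>_bound:
  assumes V: "Lp_bounded V R" and t: "t \<in> {0..T}"
  shows "norm (\<sigma> t (law M (V t))) \<le> L * (1 + R)"
proof -
  \<comment> \<open>Some outcome is needed because the bound on \<open>\<sigma>\<close> at the Dirac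
    mass is stated jointly with that on \<open>b\<close>, outcome by outcome.\<close>
  obtain \<omega> where \<omega>: "\<omega> \<in> space M" using not_empty by auto
  have "norm (\<sigma> t (law M (V t))) \<le> norm (\<sigma> t (law M (V t)) - \<sigma> t (return borel 0)) + norm (\<sigma> t (return borel 0))"
    by (metis add.commute norm_triangle_sub)
  also have "norm (\<sigma> t (law M (V t)) - \<sigma> t (return borel 0)) \<le> K t * wasserstein \<theta> (law M (V t)) (return borel 0)"
    using \<sigma>_lip t Lp_bounded_P_moment[OF V t] P_moment_zero by blast
  also have "\<dots> \<le> K t * R" using wasserstein_zero_le[OF V t] K t by (intro mult_left_mono) auto
  also have "norm (\<sigma> t (return borel 0)) \<le> K t"
    using bound0[rule_format, OF \<omega> t] norm_ge_zero[of "b \<omega> t 0 (return borel 0)"] by linarith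
  finally have "norm (\<sigma> t (law M (V t))) \<le> K t * (1 + R)" by (simp add: algebra_simps)
  also have "\<dots> \<le> L * (1 + R)" using K_le[OF t] V by (intro mult_right_mono) (auto simp: Lp_bounded_def)
  finally show ?thesis .
qed

lemma b_bound:
  assumes V: "Lp_bounded V R" and t: "t \<in> {0..T}" and \<omega>: "\<omega> \<in> space M"
  shows "norm (b \<omega> t 0 (law M (V t))) \<le> L * (1 + R)"
proof -
  have "norm (b \<omega> t 0 (law M (V t))) \<le> norm (b \<omega> t 0 (law M (V t)) - b \<omega> t 0 (return borel 0)) + norm (b \<omega> t 0 (return borel 0))"
    by (metis add.commute norm_triangle_sub)
  also have "norm (b \<omega> t 0 (law M (V t)) - b \<omega> t 0 (return borel 0)) \<le> K t * (norm (0 - 0 :: real^'d) + wasserstein \<theta> (law M (V t)) (return borel 0))"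
    using b_lip \<omega> t Lp_bounded_P_moment[OF V t] P_moment_zero by blast
  also have "\<dots> \<le> K t * R" using wasserstein_zero_le[OF V t] K t by (intro mult_left_mono) auto
  also have "norm (b \<omega> t 0 (return borel 0)) \<le> K t"
    using bound0[rule_format, OF \<omega> t] norm_ge_zero[of "\<sigma> t (return borel 0)"] by linarith
  finally have "norm (b \<omega> t 0 (law M (V t))) \<le> K t * (1 + R)" by (simp add: algebra_simps)
  also have "\<dots> \<le> L * (1 + R)" using K_le[OF t] V by (intro mult_right_mono) (auto simp: Lp_bounded_def)
  finally show ?thesis .
qed

lemma b_lip_L:
  assumes \<omega>: "\<omega> \<in> space M" and t: "t \<in> {0..T}" and m: "P_moment \<theta> \<mu>" "P_moment \<theta> \<nu>"
    and w: "wasserstein \<theta> \<mu> \<nu> \<le> w" "0 \<le> w"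
  shows "norm (b \<omega> t x \<mu> - b \<omega> t y \<nu>) \<le> L * (norm (x - y) + w)"
proof -
  have "norm (b \<omega> t x \<mu> - b \<omega> t y \<nu>) \<le> K t * (norm (x - y) + wasserstein \<theta> \<mu> \<nu>)"
    using b_lip \<omega> t m by blast
  also have "\<dots> \<le> K t * (norm (x - y) + w)" using w K t by (intro mult_left_mono) auto
  also have "\<dots> \<le> L * (norm (x - y) + w)" using K_le[OF t] w by (intro mult_right_mono) auto
  finally show ?thesis .
qed

lemma \<sigma>_lip_L:
  assumes t: "t \<in> {0..T}" and m: "P_moment \<theta> \<mu>" "P_moment \<theta> \<nu>" and w: "wasserstein \<theta> \<mu> \<nu> \<le> w" "0 \<le> w"
  shows "norm (\<sigma> t \<mu> - \<sigma> t \<nu>) \<le> L * w"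
proof -
  have "norm (\<sigma> t \<mu> - \<sigma> t \<nu>) \<le> K t * wasserstein \<theta> \<mu> \<nu>" using \<sigma>_lip t m by blast
  also have "\<dots> \<le> K t * w" using w K t by (intro mult_left_mono) auto
  also have "\<dots> \<le> L * w" using K_le[OF t] w by (intro mult_right_mono) auto
  finally show ?thesis .
qed

lemma Sp_meas: "in_Sp M Fil T p X \<Longrightarrow> t \<in> {0..T} \<Longrightarrow> X t \<in> borel_measurable M"
  using measurable_Fil_M[of t "X t"] by (auto simp: in_Sp_def)

text \<open>The supremum over countably many times is measurable and, by continuity of the paths,
  still dominates every time. These times are the dyadic numbers capped at T, enumerated by pairs of
  numerator and exponent.\<close>

lemma Sp_sup_measurable:
  assumes X: "in_Sp M Fil T p X"
  obtains S where "S \<in> borel_measurable M" "(\<integral>\<^sup>+\<omega>. S \<omega> \<partial>M) < \<infinity>"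
    "\<And>t \<omega>. t \<in> {0..T} \<Longrightarrow> \<omega> \<in> space M \<Longrightarrow> ennreal (norm (X t \<omega>) powr p) \<le> S \<omega>"
proof -
  define pt where "pt k = min (real (fst (prod_decode k)) / 2 ^ snd (prod_decode k)) T" for k
  have pt: "pt k \<in> {0..T}" for k using T by (auto simp: pt_def)
  define S where "S \<omega> = (\<Squnion>k. ennreal (norm (X (pt k) \<omega>) powr p))" for \<omega>
  have [measurable]: "X (pt k) \<in> borel_measurable M" for k by (rule Sp_meas[OF X pt])
  have "S \<in> borel_measurable M" unfolding S_def by measurable
  moreover have "(\<integral>\<^sup>+\<omega>. S \<omega> \<partial>M) \<le> (\<integral>\<^sup>+ \<omega>. (\<Squnion>t\<in>{0..T}. ennreal (norm (X t \<omega>) powr p)) \<partial>M)"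
    unfolding S_def by (intro nn_integral_mono SUP_least SUP_upper pt)
  then have "(\<integral>\<^sup>+\<omega>. S \<omega> \<partial>M) < \<infinity>" using X by (auto simp: in_Sp_def)
  moreover have "ennreal (norm (X t \<omega>) powr p) \<le> S \<omega>" if t: "t \<in> {0..T}" and \<omega>: "\<omega> \<in> space M" for t \<omega>
  proof -
    define g where "g k = min (real (nat \<lfloor>t * 2 ^ k\<rfloor>) / 2 ^ k) T" for k :: nat
    have g_pt: "g k = pt (prod_encode (nat \<lfloor>t * 2 ^ k\<rfloor>, k))" for k by (simp add: g_def pt_def)
    have gT: "g k \<in> {0..T}" for k unfolding g_pt by (rule pt)
    have "g \<longlonglongrightarrow> min t T" unfolding g_def[abs_def] using t
      by (intro tendsto_min tendsto_const dyadic_floor_tendsto) auto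
    then have "g \<longlonglongrightarrow> t" using t by simp
    then have "(\<lambda>k. X (g k) \<omega>) \<longlonglongrightarrow> X t \<omega>"
      using X \<omega> t gT by (intro continuous_on_tendsto_compose[of "{0..T}" "\<lambda>s. X s \<omega>"]) (auto simp: in_Sp_def)
    then have conv: "(\<lambda>k. ennreal (norm (X (g k) \<omega>) powr p)) \<longlonglongrightarrow> ennreal (norm (X t \<omega>) powr p)"
      using \<theta> p by (intro tendsto_ennrealI tendsto_powr2 tendsto_norm tendsto_const) auto
    have "ennreal (norm (X (g k) \<omega>) powr p) \<le> S \<omega>" for k
      unfolding S_def g_pt by (rule SUP_upper) simp
    then show ?thesis by (intro LIMSEQ_le_const2[OF conv]) blast
  qed
  ultimately show ?thesis by (rule that)
qed

text \<open>Continuity in L-\<theta> follows from that of the paths by dominated convergence; the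
  majorant comes from the supremum \<open>S\<close> of p-th powers, as x powr \<theta> is at most 1
  + x powr p.\<close>

lemma Sp_flow_process:
  assumes X: "in_Sp M Fil T p X"
  shows "flow_process X"
proof -
  obtain S where S[measurable]: "S \<in> borel_measurable M" and Sfin: "(\<integral>\<^sup>+\<omega>. S \<omega> \<partial>M) < \<infinity>"
    and Sle: "\<And>t \<omega>. t \<in> {0..T} \<Longrightarrow> \<omega> \<in> space M \<Longrightarrow> ennreal (norm (X t \<omega>) powr p) \<le> S \<omega>"
    using Sp_sup_measurable[OF X] by blast
  have le1: "ennreal (norm (X t \<omega>) powr \<theta>) \<le> 1 + S \<omega>" if "t \<in> {0..T}" "\<omega> \<in> space M" for t \<omega>
  proof -
    have "norm (X t \<omega>) powr \<theta> \<le> 1 + norm (X t \<omega>) powr p" using \<theta> p by (intro powr_le_one_plus_powr) auto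
    then have "ennreal (norm (X t \<omega>) powr \<theta>) \<le> ennreal (1 + norm (X t \<omega>) powr p)" by (rule ennreal_leI)
    also have "\<dots> = 1 + ennreal (norm (X t \<omega>) powr p)" by (simp add: ennreal_plus)
    also have "\<dots> \<le> 1 + S \<omega>" by (intro add_mono Sle that order_refl)
    finally show ?thesis .
  qed
  have fin1: "(\<integral>\<^sup>+\<omega>. 1 + S \<omega> \<partial>M) < \<infinity>"
    using Sfin by (simp add: nn_integral_add emeasure_space_1)
  then obtain R0 where R0: "(\<integral>\<^sup>+\<omega>. 1 + S \<omega> \<partial>M) = ennreal R0" "0 \<le> R0"
    by (cases "\<integral>\<^sup>+\<omega>. 1 + S \<omega> \<partial>M") auto
  have "Lp_bounded X (R0 powr (1 / \<theta>))"
    unfolding Lp_bounded_def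
  proof (intro conjI ballI)
    fix t assume t: "t \<in> {0..T}"
    show "X t \<in> borel_measurable M" by (rule Sp_meas[OF X t])
    have "(\<integral>\<^sup>+\<omega>. ennreal (norm (X t \<omega>) powr \<theta>) \<partial>M) \<le> ennreal R0"
      unfolding R0(1)[symmetric] using t by (intro nn_integral_mono le1) auto
    then show "(\<integral>\<^sup>+\<omega>. ennreal (norm (X t \<omega>) powr \<theta>) \<partial>M) \<le> ennreal ((R0 powr (1 / \<theta>)) powr \<theta>)"
      using \<theta> R0(2) by (simp add: powr_powr)
  qed simp
  moreover have "((\<lambda>s. \<integral>\<^sup>+\<omega>. ennreal (norm (X s \<omega> - X t \<omega>) powr \<theta>) \<partial>M) \<longlongrightarrow> 0) (at t within {0..T})" if t: "t \<in> {0..T}" for t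
    unfolding tendsto_at_iff_sequentially comp_def
  proof (intro allI impI)
    fix g :: "nat \<Rightarrow> real" assume g: "\<forall>i. g i \<in> {0..T} - {t}" "g \<longlonglongrightarrow> t"
    have gT: "g i \<in> {0..T}" for i using g(1) by blast
    have [measurable]: "X (g i) \<in> borel_measurable M" "X t \<in> borel_measurable M" for i
      using Sp_meas[OF X] gT t by auto
    have "(\<lambda>i. \<integral>\<^sup>+\<omega>. ennreal (norm (X (g i) \<omega> - X t \<omega>) powr \<theta>) \<partial>M) \<longlonglongrightarrow> (\<integral>\<^sup>+\<omega>. 0 \<partial>M)"
    proof (rule nn_integral_dominated_convergence[where w="\<lambda>\<omega>. ennreal (2 powr \<theta>) * ((1 + S \<omega>) + (1 + S \<omega>))"])
      show "AE \<omega> in M. ennreal (norm (X (g i) \<omega> - X t \<omega>) powr \<theta>) \<le> ennreal (2 powr \<theta>) * ((1 + S \<omega>) + (1 + S \<omega>))" for i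
      proof (intro AE_I2)
        fix \<omega> assume \<omega>: "\<omega> \<in> space M"
        have "norm (X (g i) \<omega> - X t \<omega>) powr \<theta> \<le> (norm (X (g i) \<omega>) + norm (X t \<omega>)) powr \<theta>"
          using \<theta> by (intro powr_mono2 norm_triangle_ineq4) auto
        also have "\<dots> \<le> 2 powr \<theta> * (norm (X (g i) \<omega>) powr \<theta> + norm (X t \<omega>) powr \<theta>)"
          using \<theta> by (intro powr_add_le) auto
        finally have "ennreal (norm (X (g i) \<omega> - X t \<omega>) powr \<theta>) \<le> ennreal (2 powr \<theta> * (norm (X (g i) \<omega>) powr \<theta> + norm (X t \<omega>) powr \<theta>))"
          by (rule ennreal_leI)
        also have "\<dots> = ennreal (2 powr \<theta>) * (ennreal (norm (X (g i) \<omega>) powr \<theta>) + ennreal (norm (X t \<omega>) powr \<theta>))"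
          by (simp add: ennreal_mult ennreal_plus)
        also have "\<dots> \<le> ennreal (2 powr \<theta>) * ((1 + S \<omega>) + (1 + S \<omega>))"
          by (intro mult_left_mono add_mono le1 gT t \<omega>) auto
        finally show "ennreal (norm (X (g i) \<omega> - X t \<omega>) powr \<theta>) \<le> ennreal (2 powr \<theta>) * ((1 + S \<omega>) + (1 + S \<omega>))" .
      qed
      show "(\<integral>\<^sup>+\<omega>. ennreal (2 powr \<theta>) * ((1 + S \<omega>) + (1 + S \<omega>)) \<partial>M) < \<infinity>"
        using fin1 by (subst nn_integral_cmult, simp, subst nn_integral_add) (auto simp: ennreal_mult_less_top)
      show "AE \<omega> in M. (\<lambda>i. ennreal (norm (X (g i) \<omega> - X t \<omega>) powr \<theta>)) \<longlonglongrightarrow> 0"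
      proof (intro AE_I2)
        fix \<omega> assume \<omega>: "\<omega> \<in> space M"
        have "(\<lambda>i. X (g i) \<omega>) \<longlonglongrightarrow> X t \<omega>"
          using X \<omega> t gT g(2) by (intro continuous_on_tendsto_compose[of "{0..T}" "\<lambda>s. X s \<omega>"]) (auto simp: in_Sp_def)
        then have "(\<lambda>i. norm (X (g i) \<omega> - X t \<omega>)) \<longlonglongrightarrow> 0"
          using LIM_zero tendsto_norm_zero by blast
        then have "(\<lambda>i. ennreal (norm (X (g i) \<omega> - X t \<omega>) powr \<theta>)) \<longlonglongrightarrow> ennreal (0 powr \<theta>)"
          using \<theta> by (intro tendsto_ennrealI tendsto_powr2 tendsto_const) auto
        then show "(\<lambda>i. ennreal (norm (X (g i) \<omega> - X t \<omega>) powr \<theta>)) \<longlonglongrightarrow> 0" by simp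
      qed
    qed auto
    then show "(\<lambda>i. \<integral>\<^sup>+\<omega>. ennreal (norm (X (g i) \<omega> - X t \<omega>) powr \<theta>) \<partial>M) \<longlonglongrightarrow> 0" by simp
  qed
  ultimately show ?thesis unfolding flow_process_def by blast
qed

text \<open>Extended by 0 so as to be a Borel function on the whole line, the form in which the
  scalar integrals were studied.\<close>

definition diffusion :: "(real \<Rightarrow> 'a \<Rightarrow> real^'d) \<Rightarrow> 'd \<Rightarrow> 'd \<Rightarrow> real \<Rightarrow> real" where
  "diffusion V i j u = (if u \<in> {0..T} then \<sigma> u (law M (V u)) $ i $ j else 0)"

lemma diffusion_measurable:
  assumes "flow_process V"
  shows "diffusion V i j \<in> borel_measurable borel"
proof -
  have "(\<lambda>s. \<sigma> s (law M (V s))) \<in> borel_measurable (restrict_space borel {0..T})"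
    using \<sigma>_meas flow_process_continuous_flow[OF assms] by blast
  then have "(\<lambda>s. \<sigma> s (law M (V s)) $ i $ j) \<in> borel_measurable (restrict_space borel {0..T})"
    by (intro measurable_compose[OF _ vec_nth_measurable]) auto
  then have "(\<lambda>s. indicator {0..T} s *\<^sub>R \<sigma> s (law M (V s)) $ i $ j) \<in> borel_measurable borel"
    by (subst (asm) borel_measurable_restrict_space_iff) auto
  also have "(\<lambda>s. indicator {0..T} s *\<^sub>R \<sigma> s (law M (V s)) $ i $ j) = diffusion V i j"
    by (auto simp: diffusion_def indicator_def)
  finally show ?thesis .
qed

lemma matrix_component_le: "\<bar>(A :: real^'d^'d) $ i $ j\<bar> \<le> norm A"
proof -
  have "\<bar>A $ i $ j\<bar> \<le> norm (A $ i)" by (rule component_le_norm_cart)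
  also have "\<dots> \<le> norm A" by (rule Finite_Cartesian_Product.norm_nth_le)
  finally show ?thesis .
qed

lemma diffusion_bound:
  assumes "Lp_bounded V R"
  shows "\<bar>diffusion V i j u\<bar> \<le> L * (1 + R)"
proof (cases "u \<in> {0..T}")
  case True
  then show ?thesis
    using order_trans[OF matrix_component_le \<sigma>_bound[OF assms True], of i j] by (simp add: diffusion_def)
next
  case False
  then show ?thesis using L_pos assms by (auto simp: diffusion_def Lp_bounded_def)
qed

text \<open>The equation for X with the laws taken from V. The original equation is the diagonal
  case \<open>solves X X\<close>, a fixed point of the map that sends V to the solution X.\<close>

definition solves :: "(real \<Rightarrow> 'a \<Rightarrow> real^'d) \<Rightarrow> (real \<Rightarrow> 'a \<Rightarrow> real^'d) \<Rightarrow> bool" where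
  "solves V X \<longleftrightarrow> (\<forall>t\<in>{0..T}. \<exists>Y :: 'd \<Rightarrow> 'd \<Rightarrow> 'a \<Rightarrow> real.
        (\<forall>i j. is_wiener_integral M (\<lambda>s \<omega>. B s \<omega> $ j) H t (\<lambda>s. \<sigma> s (law M (V s)) $ i $ j) (Y i j)) \<and>
        (AE \<omega> in M.
           set_integrable lborel {0..t} (\<lambda>s. b \<omega> s (X s \<omega>) (law M (V s))) \<and>
           X t \<omega> = \<xi> \<omega> + (LINT s:{0..t}|lborel. b \<omega> s (X s \<omega>) (law M (V s)))
                   + (\<chi> i. \<Sum>j\<in>UNIV. Y i j \<omega>)))"

lemma is_solution_iff_solves: "is_solution M H T B \<xi> b \<sigma> X \<longleftrightarrow> solves X X"
  unfolding is_solution_def solves_def ..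

text \<open>The even moment of order 2 mexp has to dominate p, for the supremum of the noise, and
  \<theta>, for the contraction; the summand 2 gives the lower bound needed for Kolmogorov's
  criterion.\<close>

definition mexp :: nat where "mexp = nat \<lceil>p\<rceil> + 2"

lemma mexp: "mexp \<ge> 2" "p \<le> 2 * real mexp" "\<theta> \<le> 2 * real mexp"
proof -
  have "p \<le> real mexp" unfolding mexp_def by linarith
  then show "mexp \<ge> 2" "p \<le> 2 * real mexp" "\<theta> \<le> 2 * real mexp" using p \<theta> by (auto simp: mexp_def)
qed

definition wconst :: real where "wconst = scalar_fbm.wiener_const T H + 1"

lemma wconst_pos: "wconst > 0"
  unfolding wconst_def using scalar_fbm.wiener_const_nonneg[OF component_fbm] by (simp add: add_nonneg_pos)

text \<open>The factor 1 + C of \<open>absolute_moment_le\<close>, with the C that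
  \<open>L2_wiener_stability\<close> delivers; hence the power of 5.\<close>

definition noise_const :: real where "noise_const = 1 + gaussian_moment mexp * 5 ^ mexp"

lemma noise_const_nonneg: "0 \<le> noise_const"
  unfolding noise_const_def using gaussian_moment_nonneg[of mexp] by simp

text \<open>The weight enters squared and integrates up to t to at most exp (2 l t) / (2 l). The
  variance bound is thus of order a^2 exp (2 l t) / l, and in L-\<theta> norm the noise gains a
  factor l powr (- 1 / 2).\<close>

lemma wiener_difference_moment:
  assumes V: "flow_process V" and V': "flow_process V'" and t: "t \<in> {0..T}"
    and Y: "is_wiener_integral M (\<lambda>s \<omega>. B s \<omega> $ j) H t (\<lambda>s. \<sigma> s (law M (V s)) $ i $ j) Y"
    and Y': "is_wiener_integral M (\<lambda>s \<omega>. B s \<omega> $ j) H t (\<lambda>s. \<sigma> s (law M (V' s)) $ i $ j) Y'"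
    and w: "\<And>s. s \<in> {0..T} \<Longrightarrow> wasserstein \<theta> (law M (V s)) (law M (V' s)) \<le> a * exp (l * s)"
    and a: "a > 0" and l: "l > 0"
  shows "(\<integral>\<^sup>+\<omega>. ennreal (\<bar>Y \<omega> - Y' \<omega>\<bar> powr \<theta>) \<partial>M)
    \<le> ennreal (noise_const * (wconst * L\<^sup>2 * a\<^sup>2 * exp (2 * l * t) / (2 * l)) powr (\<theta> / 2))"
proof -
  interpret C: scalar_fbm M "\<lambda>s \<omega>. B s \<omega> $ j" T H by (rule component_fbm)
  obtain R where R: "Lp_bounded V R" using V by (auto simp: flow_process_def)
  obtain R' where R': "Lp_bounded V' R'" using V' by (auto simp: flow_process_def)
  note gm[measurable] = diffusion_measurable[OF V, of i j] diffusion_measurable[OF V', of i j]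
  have W: "is_wiener_integral M (\<lambda>s \<omega>. B s \<omega> $ j) H t (diffusion V i j) Y"
    using Y t by (subst is_wiener_integral_cong[of _ _ "\<lambda>s. \<sigma> s (law M (V s)) $ i $ j"]) (auto simp: diffusion_def)
  have W': "is_wiener_integral M (\<lambda>s \<omega>. B s \<omega> $ j) H t (diffusion V' i j) Y'"
    using Y' t by (subst is_wiener_integral_cong[of _ _ "\<lambda>s. \<sigma> s (law M (V' s)) $ i $ j"]) (auto simp: diffusion_def)
  define v where "v = wconst * L\<^sup>2 * a\<^sup>2 * exp (2 * l * t) / (2 * l)"
  have v: "v > 0" unfolding v_def using wconst_pos L_pos a l by simp
  have "L2_norm2 T (\<lambda>u. diffusion V i j u * indicator {0..t} u - diffusion V' i j u * indicator {0..t} u)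
     \<le> (\<integral>\<^sup>+u. ennreal (L\<^sup>2 * a\<^sup>2) * (ennreal (exp ((2 * l) * u)) * indicator {0..t} u) \<partial>lborel)"
    unfolding L2_norm2_def
  proof (intro nn_integral_mono)
    fix u
    show "ennreal ((diffusion V i j u * indicator {0..t} u - diffusion V' i j u * indicator {0..t} u)\<^sup>2) * indicator {0..T} u
      \<le> ennreal (L\<^sup>2 * a\<^sup>2) * (ennreal (exp ((2 * l) * u)) * indicator {0..t} u)"
    proof (cases "u \<in> {0..t}")
      case True
      then have u: "u \<in> {0..T}" using t by auto
      have "\<bar>diffusion V i j u - diffusion V' i j u\<bar> \<le> norm (\<sigma> u (law M (V u)) - \<sigma> u (law M (V' u)))"
        using u matrix_component_le[of "\<sigma> u (law M (V u)) - \<sigma> u (law M (V' u))" i j] by (simp add: diffusion_def)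
      also have "\<dots> \<le> L * (a * exp (l * u))"
        using a by (intro \<sigma>_lip_L u flow_process_P_moment V V' w) auto
      finally have "\<bar>diffusion V i j u - diffusion V' i j u\<bar>\<^sup>2 \<le> (L * (a * exp (l * u)))\<^sup>2"
        by (intro power_mono) auto
      then have "(diffusion V i j u - diffusion V' i j u)\<^sup>2 \<le> L\<^sup>2 * a\<^sup>2 * exp (2 * l * u)"
        by (simp add: power_mult_distrib exp_double[symmetric] mult.assoc)
      then have "ennreal ((diffusion V i j u - diffusion V' i j u)\<^sup>2) \<le> ennreal (L\<^sup>2 * a\<^sup>2 * exp (2 * l * u))"
        by (rule ennreal_leI)
      then show ?thesis using True u by (simp add: ennreal_mult)
    qed simp
  qed
  also have "\<dots> = ennreal (L\<^sup>2 * a\<^sup>2) * (\<integral>\<^sup>+u. ennreal (exp ((2 * l) * u)) * indicator {0..t} u \<partial>lborel)"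
    by (intro nn_integral_cmult) measurable
  also have "\<dots> \<le> ennreal (L\<^sup>2 * a\<^sup>2) * ennreal (exp ((2 * l) * t) / (2 * l))"
    using l t by (intro mult_left_mono nn_integral_exp_le) auto
  finally have "ennreal C.wiener_const * L2_norm2 T (\<lambda>u. diffusion V i j u * indicator {0..t} u - diffusion V' i j u * indicator {0..t} u)
    \<le> ennreal wconst * (ennreal (L\<^sup>2 * a\<^sup>2) * ennreal (exp ((2 * l) * t) / (2 * l)))"
    by (intro mult_mono ennreal_leI) (auto simp: wconst_def)
  also have "\<dots> = ennreal v"
    using wconst_pos l by (simp add: v_def ennreal_mult'[symmetric] mult.assoc)
  finally have le: "ennreal C.wiener_const * L2_norm2 T (\<lambda>u. diffusion V i j u * indicator {0..t} u - diffusion V' i j u * indicator {0..t} u) \<le> ennreal v" .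
  have "(\<integral>\<^sup>+\<omega>. ennreal ((Y \<omega> - Y' \<omega>) ^ (2 * mexp)) \<partial>M) \<le> ennreal (gaussian_moment mexp * (5 * v) ^ mexp)"
    using mexp(1) v le
    by (intro C.L2_wiener_stability[OF C.wiener_integral_imp_L2_wiener[OF gm(1) diffusion_bound[OF R] t W]
          C.wiener_integral_imp_L2_wiener[OF gm(2) diffusion_bound[OF R'] t W']]) auto
  also have "gaussian_moment mexp * (5 * v) ^ mexp = (gaussian_moment mexp * 5 ^ mexp) * v ^ mexp"
    by (simp add: power_mult_distrib)
  finally show ?thesis
    unfolding noise_const_def v_def[symmetric]
    using v mexp \<theta> gaussian_moment_nonneg[of mexp] Y Y' by (intro absolute_moment_le) (auto simp: is_wiener_integral_def)
qed

end

section \<open>Stability\<close>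

context mckean_vlasov
begin

text \<open>The three summands belong to the path argument of the drift, through Jensen's
  inequality, to its law argument, and to the noise, where the cardinality counts the scalar
  integrals. The factor 4 powr \<theta> comes from splitting a sum of three terms in two
  steps.\<close>

definition contraction_const :: real where
  "contraction_const = 4 powr \<theta> * (L powr \<theta> * T powr (\<theta> - 1) + L powr \<theta>
     + real (CARD('d \<times> 'd)) powr \<theta> * real (CARD('d \<times> 'd)) * noise_const * (wconst * L\<^sup>2) powr (\<theta> / 2))"

lemma contraction_const_nonneg: "0 \<le> contraction_const"
  unfolding contraction_const_def using noise_const_nonneg by simp

lemma path_difference_le:
  assumes X: "in_Sp M Fil T p X" and X': "in_Sp M Fil T p X'"
    and V: "flow_process V" and V': "flow_process V'"
    and w: "\<And>s. s \<in> {0..T} \<Longrightarrow> wasserstein \<theta> (law M (V s)) (law M (V' s)) \<le> a * exp (l * s)"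
    and a: "a > 0" and l: "l > 0" and t: "t \<in> {0..T}" and \<omega>: "\<omega> \<in> space M"
    and i: "set_integrable lborel {0..t} (\<lambda>s. b \<omega> s (X s \<omega>) (law M (V s)))"
    and i': "set_integrable lborel {0..t} (\<lambda>s. b \<omega> s (X' s \<omega>) (law M (V' s)))"
  shows "norm ((LINT s:{0..t}|lborel. b \<omega> s (X s \<omega>) (law M (V s))) - (LINT s:{0..t}|lborel. b \<omega> s (X' s \<omega>) (law M (V' s))))
    \<le> L * (LINT s:{0..t}|lborel. norm (X s \<omega> - X' s \<omega>)) + L * a * exp (l * t) / l"
proof -
  let ?f = "\<lambda>s. b \<omega> s (X s \<omega>) (law M (V s)) - b \<omega> s (X' s \<omega>) (law M (V' s))"
  define D where "D s = norm (X s \<omega> - X' s \<omega>)" for s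
  have "continuous_on {0..T} (\<lambda>s. X s \<omega>)" "continuous_on {0..T} (\<lambda>s. X' s \<omega>)"
    using X X' \<omega> by (auto simp: in_Sp_def)
  then have D: "continuous_on {0..t} D"
    unfolding D_def using t by (intro continuous_on_norm continuous_on_diff) (auto intro: continuous_on_subset)
  have iD: "set_integrable lborel {0..t} D"
    unfolding set_integrable_def by (rule borel_integrable_compact[OF _ D]) simp
  have Dm: "(\<lambda>s. ennreal (D s) * indicator {0..t} s) \<in> borel_measurable lborel"
  proof -
    have "(\<lambda>s. ennreal (indicator {0..t} s *\<^sub>R D s)) \<in> borel_measurable lborel"
      using iD unfolding set_integrable_def by measurable
    also have "(\<lambda>s. ennreal (indicator {0..t} s *\<^sub>R D s)) = (\<lambda>s. ennreal (D s) * indicator {0..t} s)"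
      by (auto simp: indicator_def)
    finally show ?thesis .
  qed
  have D_int: "(\<integral>\<^sup>+s. ennreal (D s) * indicator {0..t} s \<partial>lborel) = ennreal (LINT s:{0..t}|lborel. D s)"
  proof -
    have "(\<integral>\<^sup>+s. ennreal (D s) * indicator {0..t} s \<partial>lborel) = (\<integral>\<^sup>+s. ennreal (indicator {0..t} s *\<^sub>R D s) \<partial>lborel)"
      by (intro nn_integral_cong) (auto simp: indicator_def)
    also have "\<dots> = ennreal (LINT s:{0..t}|lborel. D s)"
      unfolding set_lebesgue_integral_def using iD
      by (intro nn_integral_eq_integral) (auto simp: set_integrable_def D_def)
    finally show ?thesis .
  qed
  have D0: "0 \<le> (LINT s:{0..t}|lborel. D s)"
    unfolding set_lebesgue_integral_def by (intro integral_nonneg_AE AE_I2) (simp add: D_def)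
  have "ennreal (norm ((LINT s:{0..t}|lborel. b \<omega> s (X s \<omega>) (law M (V s))) - (LINT s:{0..t}|lborel. b \<omega> s (X' s \<omega>) (law M (V' s)))))
    = ennreal (norm (LINT s:{0..t}|lborel. ?f s))"
    using i i' by (simp add: set_integral_diff(2))
  also have "\<dots> \<le> (\<integral>\<^sup>+s. ennreal (norm (?f s)) * indicator {0..t} s \<partial>lborel)"
    by (intro norm_set_integral_le_nn_integral set_integral_diff(1) i i')
  also have "\<dots> \<le> (\<integral>\<^sup>+s. ennreal L * (ennreal (D s) * indicator {0..t} s) + ennreal (L * a) * (ennreal (exp (l * s)) * indicator {0..t} s) \<partial>lborel)"
  proof (intro nn_integral_mono)
    fix s
    show "ennreal (norm (?f s)) * indicator {0..t} s \<le> ennreal L * (ennreal (D s) * indicator {0..t} s) + ennreal (L * a) * (ennreal (exp (l * s)) * indicator {0..t} s)"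
    proof (cases "s \<in> {0..t}")
      case True
      then have s: "s \<in> {0..T}" using t by auto
      have "norm (?f s) \<le> L * (norm (X s \<omega> - X' s \<omega>) + a * exp (l * s))"
        using a by (intro b_lip_L \<omega> s flow_process_P_moment V V' w) auto
      then have "ennreal (norm (?f s)) \<le> ennreal (L * D s + L * a * exp (l * s))"
        by (intro ennreal_leI) (simp add: D_def distrib_left mult.assoc)
      then show ?thesis using True L_pos a by (simp add: ennreal_plus ennreal_mult D_def)
    qed simp
  qed
  also have "\<dots> = ennreal L * (\<integral>\<^sup>+s. ennreal (D s) * indicator {0..t} s \<partial>lborel) + ennreal (L * a) * (\<integral>\<^sup>+s. ennreal (exp (l * s)) * indicator {0..t} s \<partial>lborel)"
    using Dm by (subst nn_integral_add) (auto simp: nn_integral_cmult)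
  also have "\<dots> \<le> ennreal L * ennreal (LINT s:{0..t}|lborel. D s) + ennreal (L * a) * ennreal (exp (l * t) / l)"
    unfolding D_int using l t by (intro add_mono mult_left_mono nn_integral_exp_le order_refl) auto
  also have "\<dots> = ennreal (L * (LINT s:{0..t}|lborel. D s) + L * a * exp (l * t) / l)"
    using L_pos a l D0 by (simp add: ennreal_mult'[symmetric] ennreal_plus[symmetric] del: ennreal_plus)
  finally have le: "ennreal (norm ((LINT s:{0..t}|lborel. b \<omega> s (X s \<omega>) (law M (V s))) - (LINT s:{0..t}|lborel. b \<omega> s (X' s \<omega>) (law M (V' s)))))
    \<le> ennreal (L * (LINT s:{0..t}|lborel. D s) + L * a * exp (l * t) / l)" .
  have nn: "0 \<le> L * (LINT s:{0..t}|lborel. D s) + L * a * exp (l * t) / l"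
    using L_pos a l D0 by (intro add_nonneg_nonneg mult_nonneg_nonneg divide_nonneg_nonneg) auto
  show ?thesis
    using le[unfolded ennreal_le_iff[OF nn]] unfolding D_def .
qed

lemma ennreal_combination:
  assumes "0 \<le> c" "0 \<le> k" "0 \<le> x" "0 \<le> y" "0 \<le> z"
  shows "ennreal c * (ennreal k * ennreal x + (ennreal y + ennreal z)) = ennreal (c * (k * x + (y + z)))"
  using assms by (simp add: ennreal_mult ennreal_plus)

text \<open>One step of a Gronwall iteration: a weighted bound S for the \<theta>-th moments of the
  difference is replaced by a small multiple of S + a powr \<theta>. The path term gains 1 / (l
  \<theta>), the law term l powr (- \<theta>) and the noise l powr (- \<theta> / 2); as l and
  \<theta> are at least 1, each gain is at most 1 / sqrt l.\<close>

lemma stability_step: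
  assumes X: "in_Sp M Fil T p X" and X': "in_Sp M Fil T p X'"
    and V: "flow_process V" and V': "flow_process V'"
    and sX: "solves V X" and sX': "solves V' X'"
    and w: "\<And>s. s \<in> {0..T} \<Longrightarrow> wasserstein \<theta> (law M (V s)) (law M (V' s)) \<le> a * exp (l * s)"
    and a: "a > 0" and l: "l \<ge> 1"
    and S: "S \<ge> 0" "\<And>s. s \<in> {0..T} \<Longrightarrow> (\<integral>\<^sup>+\<omega>. ennreal (norm (X s \<omega> - X' s \<omega>) powr \<theta>) \<partial>M) \<le> ennreal (S * exp (l * \<theta> * s))"
    and t: "t \<in> {0..T}"
  shows "(\<integral>\<^sup>+\<omega>. ennreal (norm (X t \<omega> - X' t \<omega>) powr \<theta>) \<partial>M)
    \<le> ennreal (contraction_const / sqrt l * (S + a powr \<theta>) * exp (l * \<theta> * t))"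
proof -
  have l0: "l > 0" using l by simp
  have \<theta>0: "\<theta> > 0" using \<theta> by simp
  obtain Y where Y: "\<And>i j. is_wiener_integral M (\<lambda>s \<omega>. B s \<omega> $ j) H t (\<lambda>s. \<sigma> s (law M (V s)) $ i $ j) (Y i j)"
    and YX: "AE \<omega> in M. set_integrable lborel {0..t} (\<lambda>s. b \<omega> s (X s \<omega>) (law M (V s))) \<and>
           X t \<omega> = \<xi> \<omega> + (LINT s:{0..t}|lborel. b \<omega> s (X s \<omega>) (law M (V s))) + (\<chi> i. \<Sum>j\<in>UNIV. Y i j \<omega>)"
    using sX t unfolding solves_def by blast
  obtain Y' where Y': "\<And>i j. is_wiener_integral M (\<lambda>s \<omega>. B s \<omega> $ j) H t (\<lambda>s. \<sigma> s (law M (V' s)) $ i $ j) (Y' i j)"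
    and YX': "AE \<omega> in M. set_integrable lborel {0..t} (\<lambda>s. b \<omega> s (X' s \<omega>) (law M (V' s))) \<and>
           X' t \<omega> = \<xi> \<omega> + (LINT s:{0..t}|lborel. b \<omega> s (X' s \<omega>) (law M (V' s))) + (\<chi> i. \<Sum>j\<in>UNIV. Y' i j \<omega>)"
    using sX' t unfolding solves_def by blast
  have [measurable]: "Y i j \<in> borel_measurable M" "Y' i j \<in> borel_measurable M" for i j
    using Y Y' by (auto simp: is_wiener_integral_def)
  define D where "D s \<omega> = norm (X s \<omega> - X' s \<omega>)" for s \<omega>
  define J where "J \<omega> = (LINT s:{0..t}|lborel. D s \<omega>)" for \<omega>
  define N where "N \<omega> = (\<Sum>z\<in>(UNIV :: ('d \<times> 'd) set). \<bar>Y (fst z) (snd z) \<omega> - Y' (fst z) (snd z) \<omega>\<bar>)" for \<omega>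
  define d where "d = real (CARD('d \<times> 'd))"
  have J0: "0 \<le> J \<omega>" for \<omega>
    unfolding J_def set_lebesgue_integral_def by (intro integral_nonneg_AE AE_I2) (simp add: D_def)
  have N0: "0 \<le> N \<omega>" for \<omega> unfolding N_def by (intro sum_nonneg) auto
  have Dcont: "continuous_on {0..t} (\<lambda>s. D s \<omega>)" if "\<omega> \<in> space M" for \<omega>
  proof -
    have "continuous_on {0..T} (\<lambda>s. X s \<omega>)" "continuous_on {0..T} (\<lambda>s. X' s \<omega>)"
      using X X' that by (auto simp: in_Sp_def)
    then show ?thesis
      unfolding D_def using t by (intro continuous_on_norm continuous_on_diff) (auto intro: continuous_on_subset)
  qed
  have Dm: "D s \<in> borel_measurable M" if "s \<in> {0..T}" for s
    unfolding D_def using Sp_meas[OF X that] Sp_meas[OF X' that] by measurable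
  have "(\<lambda>z. D (snd z) (fst z)) \<in> borel_measurable (M \<Otimes>\<^sub>M restrict_space borel {0..t})"
    using t Dm Dcont by (intro continuous_process_jointly_measurable) auto
  from jointly_measurable_extend[OF _ this]
  have [measurable]: "(\<lambda>z. D (if snd z \<in> {0..t} then snd z else 0) (fst z)) \<in> borel_measurable (M \<Otimes>\<^sub>M lborel)"
    using t by simp
  \<comment> \<open>Exchanging expectation and time integral needs measurability on the product with
    \<open>lborel\<close>, hence the redirection of times outside [0, t] to 0.\<close>
  have joint: "(\<lambda>(\<omega>, s). ennreal (D (if s \<in> {0..t} then s else 0) \<omega> powr \<theta>) * indicator {0..t} s) \<in> borel_measurable (M \<Otimes>\<^sub>M lborel)"
    unfolding case_prod_beta' by measurable
  have [measurable]: "J \<in> borel_measurable M"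
    using set_integral_jointly_measurable[of t "\<lambda>z. D (snd z) (fst z)" M] t
      \<open>(\<lambda>z. D (snd z) (fst z)) \<in> borel_measurable (M \<Otimes>\<^sub>M restrict_space borel {0..t})\<close>
    by (simp add: J_def[abs_def])
  have [measurable]: "N \<in> borel_measurable M" unfolding N_def by measurable
  have AE_le: "AE \<omega> in M. norm (X t \<omega> - X' t \<omega>) \<le> L * J \<omega> + (L * a * exp (l * t) / l + N \<omega>)"
    using YX YX' AE_space
  proof eventually_elim
    case (elim \<omega>)
    let ?b = "(LINT s:{0..t}|lborel. b \<omega> s (X s \<omega>) (law M (V s))) - (LINT s:{0..t}|lborel. b \<omega> s (X' s \<omega>) (law M (V' s)))"
    let ?n = "(\<chi> i. \<Sum>j\<in>UNIV. Y i j \<omega>) - (\<chi> i. \<Sum>j\<in>UNIV. Y' i j \<omega>)"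
    have eq: "X t \<omega> - X' t \<omega> = ?b + ?n" using elim by simp
    have "norm (X t \<omega> - X' t \<omega>) \<le> norm ?b + norm ?n" unfolding eq by (rule norm_triangle_ineq)
    moreover have "norm ?b \<le> L * J \<omega> + L * a * exp (l * t) / l"
      unfolding J_def D_def using elim by (intro path_difference_le[OF X X' V V' w a l0 t]) auto
    moreover have "norm ?n \<le> N \<omega>"
    proof -
      have "norm ?n \<le> (\<Sum>i\<in>UNIV. \<bar>?n $ i\<bar>)" by (rule norm_le_l1_cart)
      also have "\<dots> \<le> (\<Sum>i\<in>UNIV. \<Sum>j\<in>UNIV. \<bar>Y i j \<omega> - Y' i j \<omega>\<bar>)"
      proof (intro sum_mono)
        fix i
        have eq: "?n $ i = (\<Sum>j\<in>UNIV. Y i j \<omega> - Y' i j \<omega>)" by (simp add: sum_subtractf)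
        show "\<bar>?n $ i\<bar> \<le> (\<Sum>j\<in>UNIV. \<bar>Y i j \<omega> - Y' i j \<omega>\<bar>)" unfolding eq by (rule sum_abs)
      qed
      also have "\<dots> = N \<omega>"
        unfolding N_def by (simp add: sum.cartesian_product case_prod_beta' UNIV_Times_UNIV[symmetric] del: UNIV_Times_UNIV)
      finally show ?thesis .
    qed
    ultimately show ?case by linarith
  qed
  define cI where "cI = L * a * exp (l * t) / l"
  have cI0: "0 \<le> cI" using L_pos a l0 by (simp add: cI_def)
  have "(\<integral>\<^sup>+\<omega>. ennreal (norm (X t \<omega> - X' t \<omega>) powr \<theta>) \<partial>M)
     \<le> (\<integral>\<^sup>+\<omega>. ennreal (4 powr \<theta>) * (ennreal (L powr \<theta>) * ennreal (J \<omega> powr \<theta>) + (ennreal (cI powr \<theta>) + ennreal (N \<omega> powr \<theta>))) \<partial>M)"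
  proof (intro nn_integral_mono_AE, use AE_le in eventually_elim)
    case (elim \<omega>)
    have "norm (X t \<omega> - X' t \<omega>) powr \<theta> \<le> (L * J \<omega> + (cI + N \<omega>)) powr \<theta>"
      using elim \<theta> unfolding cI_def by (intro powr_mono2) auto
    also have "\<dots> \<le> 2 powr \<theta> * ((L * J \<omega>) powr \<theta> + (cI + N \<omega>) powr \<theta>)"
      using L_pos J0[of \<omega>] cI0 N0[of \<omega>] \<theta> by (intro powr_add_le) auto
    also have "\<dots> \<le> 2 powr \<theta> * (2 powr \<theta> * (L * J \<omega>) powr \<theta> + 2 powr \<theta> * (cI powr \<theta> + N \<omega> powr \<theta>))"
    proof (intro mult_left_mono add_mono)
      show "(L * J \<omega>) powr \<theta> \<le> 2 powr \<theta> * (L * J \<omega>) powr \<theta>"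
        using ge_one_powr_ge_zero[of 2 \<theta>] \<theta> mult_right_mono[of 1 "2 powr \<theta>" "(L * J \<omega>) powr \<theta>"] by simp
      show "(cI + N \<omega>) powr \<theta> \<le> 2 powr \<theta> * (cI powr \<theta> + N \<omega> powr \<theta>)"
        using cI0 N0[of \<omega>] \<theta> by (intro powr_add_le) auto
    qed auto
    also have "\<dots> = 4 powr \<theta> * (L powr \<theta> * J \<omega> powr \<theta> + (cI powr \<theta> + N \<omega> powr \<theta>))"
    proof -
      have "(4::real) powr \<theta> = 2 powr \<theta> * 2 powr \<theta>" by (simp flip: powr_mult)
      then show ?thesis using L_pos J0[of \<omega>] by (simp add: powr_mult algebra_simps)
    qed
    finally have "ennreal (norm (X t \<omega> - X' t \<omega>) powr \<theta>) \<le> ennreal (4 powr \<theta> * (L powr \<theta> * J \<omega> powr \<theta> + (cI powr \<theta> + N \<omega> powr \<theta>)))"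
      by (rule ennreal_leI)
    then show ?case by (simp add: ennreal_mult ennreal_plus)
  qed
  also have "\<dots> = ennreal (4 powr \<theta>) * (ennreal (L powr \<theta>) * (\<integral>\<^sup>+\<omega>. ennreal (J \<omega> powr \<theta>) \<partial>M) + (ennreal (cI powr \<theta>) + (\<integral>\<^sup>+\<omega>. ennreal (N \<omega> powr \<theta>) \<partial>M)))"
    by (simp add: nn_integral_cmult nn_integral_add emeasure_space_1)
  also have "\<dots> \<le> ennreal (4 powr \<theta>) * (ennreal (L powr \<theta>) * ennreal (T powr (\<theta> - 1) * (S * exp (l * \<theta> * t) / sqrt l))
      + (ennreal (L powr \<theta> * (a powr \<theta> * exp (l * \<theta> * t) / sqrt l))
       + ennreal (d powr \<theta> * d * noise_const * (wconst * L\<^sup>2) powr (\<theta> / 2) * (a powr \<theta> * exp (l * \<theta> * t) / sqrt l))))"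
  proof (intro mult_left_mono add_mono)
    have sql: "sqrt l \<le> l" using l by (simp add: real_sqrt_le_iff real_le_lsqrt power2_eq_square)
    have sq0: "0 < sqrt l" using l0 by simp
    have "(\<integral>\<^sup>+\<omega>. ennreal (J \<omega> powr \<theta>) \<partial>M)
       \<le> (\<integral>\<^sup>+\<omega>. ennreal (T powr (\<theta> - 1)) * (\<integral>\<^sup>+s. ennreal (D (if s \<in> {0..t} then s else 0) \<omega> powr \<theta>) * indicator {0..t} s \<partial>lborel) \<partial>M)"
    proof (intro nn_integral_mono)
      fix \<omega> assume \<omega>: "\<omega> \<in> space M"
      have "ennreal (J \<omega> powr \<theta>) \<le> ennreal (T powr (\<theta> - 1)) * (\<integral>\<^sup>+s. ennreal (D s \<omega> powr \<theta>) * indicator {0..t} s \<partial>lborel)"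
        unfolding J_def using t \<theta> by (intro jensen_interval Dcont \<omega>) (auto simp: D_def)
      also have "(\<integral>\<^sup>+s. ennreal (D s \<omega> powr \<theta>) * indicator {0..t} s \<partial>lborel)
          = (\<integral>\<^sup>+s. ennreal (D (if s \<in> {0..t} then s else 0) \<omega> powr \<theta>) * indicator {0..t} s \<partial>lborel)"
        by (intro nn_integral_cong) (auto simp: indicator_def)
      finally show "ennreal (J \<omega> powr \<theta>) \<le> ennreal (T powr (\<theta> - 1)) * (\<integral>\<^sup>+s. ennreal (D (if s \<in> {0..t} then s else 0) \<omega> powr \<theta>) * indicator {0..t} s \<partial>lborel)" .
    qed
    also have "\<dots> = ennreal (T powr (\<theta> - 1)) * (\<integral>\<^sup>+\<omega>. \<integral>\<^sup>+s. ennreal (D (if s \<in> {0..t} then s else 0) \<omega> powr \<theta>) * indicator {0..t} s \<partial>lborel \<partial>M)"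
      by (intro nn_integral_cmult lborel.borel_measurable_nn_integral joint)
    also have "(\<integral>\<^sup>+\<omega>. \<integral>\<^sup>+s. ennreal (D (if s \<in> {0..t} then s else 0) \<omega> powr \<theta>) * indicator {0..t} s \<partial>lborel \<partial>M)
        = (\<integral>\<^sup>+s. \<integral>\<^sup>+\<omega>. ennreal (D (if s \<in> {0..t} then s else 0) \<omega> powr \<theta>) * indicator {0..t} s \<partial>M \<partial>lborel)"
    proof -
      interpret P: pair_sigma_finite M lborel
        by (simp add: pair_sigma_finite_def sigma_finite_measure_axioms lborel.sigma_finite_measure_axioms)
      show ?thesis by (rule P.Fubini'[symmetric, OF joint])
    qed
    also have "\<dots> \<le> (\<integral>\<^sup>+s. ennreal S * (ennreal (exp ((l * \<theta>) * s)) * indicator {0..t} s) \<partial>lborel)"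
    proof (intro nn_integral_mono)
      fix s
      show "(\<integral>\<^sup>+\<omega>. ennreal (D (if s \<in> {0..t} then s else 0) \<omega> powr \<theta>) * indicator {0..t} s \<partial>M) \<le> ennreal S * (ennreal (exp ((l * \<theta>) * s)) * indicator {0..t} s)"
        using S(2)[of s] t S(1) by (cases "s \<in> {0..t}") (auto simp: D_def ennreal_mult)
    qed
    also have "\<dots> = ennreal S * (\<integral>\<^sup>+s. ennreal (exp ((l * \<theta>) * s)) * indicator {0..t} s \<partial>lborel)"
      by (intro nn_integral_cmult) measurable
    also have "\<dots> \<le> ennreal S * ennreal (exp ((l * \<theta>) * t) / (l * \<theta>))"
      using l0 \<theta>0 t by (intro mult_left_mono nn_integral_exp_le) auto
    also have "\<dots> = ennreal (S * exp (l * \<theta> * t) / (l * \<theta>))" using S(1) by (simp add: ennreal_mult'[symmetric])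
    also have "\<dots> \<le> ennreal (S * exp (l * \<theta> * t) / sqrt l)"
    proof (intro ennreal_leI divide_left_mono)
      have "sqrt l * 1 \<le> l * \<theta>" using sql \<theta> l0 by (intro mult_mono) auto
      then show "sqrt l \<le> l * \<theta>" by simp
    qed (use S(1) l0 \<theta>0 in auto)
    finally have "(\<integral>\<^sup>+\<omega>. ennreal (J \<omega> powr \<theta>) \<partial>M) \<le> ennreal (T powr (\<theta> - 1)) * ennreal (S * exp (l * \<theta> * t) / sqrt l)"
      by (simp add: mult_left_mono)
    then show "(\<integral>\<^sup>+\<omega>. ennreal (J \<omega> powr \<theta>) \<partial>M) \<le> ennreal (T powr (\<theta> - 1) * (S * exp (l * \<theta> * t) / sqrt l))"
      by (subst ennreal_mult') auto
    have expp: "exp (l * t) powr \<theta> = exp (l * \<theta> * t)" by (simp add: exp_powr_real mult_ac)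
    \<comment> \<open>Applied with q = \<theta> and q = \<theta> / 2, both at least 1/2; the second,
      from the noise, is the reason for the square root.\<close>
    have lp: "l powr q \<ge> sqrt l" if "q \<ge> 1/2" for q
      using powr_mono[OF that l] l0 by (simp add: powr_half_sqrt)
    have "cI powr \<theta> = L powr \<theta> * (a powr \<theta> * exp (l * \<theta> * t) / l powr \<theta>)"
      unfolding cI_def using L_pos a l0 by (simp add: powr_divide powr_mult expp)
    also have "\<dots> \<le> L powr \<theta> * (a powr \<theta> * exp (l * \<theta> * t) / sqrt l)"
      using lp[of \<theta>] \<theta> sq0 l0 by (intro mult_left_mono divide_left_mono) auto
    finally show "ennreal (cI powr \<theta>) \<le> ennreal (L powr \<theta> * (a powr \<theta> * exp (l * \<theta> * t) / sqrt l))"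
      by (rule ennreal_leI)
    define v where "v = wconst * L\<^sup>2 * a\<^sup>2 * exp (2 * l * t) / (2 * l)"
    have "(\<integral>\<^sup>+\<omega>. ennreal (N \<omega> powr \<theta>) \<partial>M)
       \<le> (\<integral>\<^sup>+\<omega>. ennreal (d powr \<theta>) * (\<Sum>z\<in>(UNIV :: ('d \<times> 'd) set). ennreal (\<bar>Y (fst z) (snd z) \<omega> - Y' (fst z) (snd z) \<omega>\<bar> powr \<theta>)) \<partial>M)"
    proof (intro nn_integral_mono)
      fix \<omega>
      have "N \<omega> powr \<theta> \<le> d powr \<theta> * (\<Sum>z\<in>(UNIV :: ('d \<times> 'd) set). \<bar>Y (fst z) (snd z) \<omega> - Y' (fst z) (snd z) \<omega>\<bar> powr \<theta>)"
        unfolding N_def d_def using \<theta> by (intro powr_sum_le) auto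
      then have "ennreal (N \<omega> powr \<theta>) \<le> ennreal (d powr \<theta> * (\<Sum>z\<in>(UNIV :: ('d \<times> 'd) set). \<bar>Y (fst z) (snd z) \<omega> - Y' (fst z) (snd z) \<omega>\<bar> powr \<theta>))"
        by (rule ennreal_leI)
      then show "ennreal (N \<omega> powr \<theta>) \<le> ennreal (d powr \<theta>) * (\<Sum>z\<in>(UNIV :: ('d \<times> 'd) set). ennreal (\<bar>Y (fst z) (snd z) \<omega> - Y' (fst z) (snd z) \<omega>\<bar> powr \<theta>))"
        by (simp add: ennreal_mult' sum_ennreal)
    qed
    also have "\<dots> = ennreal (d powr \<theta>) * (\<Sum>z\<in>(UNIV :: ('d \<times> 'd) set). \<integral>\<^sup>+\<omega>. ennreal (\<bar>Y (fst z) (snd z) \<omega> - Y' (fst z) (snd z) \<omega>\<bar> powr \<theta>) \<partial>M)"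
      by (subst nn_integral_cmult, measurable, subst nn_integral_sum) auto
    also have "\<dots> \<le> ennreal (d powr \<theta>) * (\<Sum>z\<in>(UNIV :: ('d \<times> 'd) set). ennreal (noise_const * v powr (\<theta> / 2)))"
      unfolding v_def by (intro mult_left_mono sum_mono wiener_difference_moment[OF V V' t Y Y' w a l0]) auto
    also have "\<dots> = ennreal (d powr \<theta> * (d * (noise_const * v powr (\<theta> / 2))))"
      using noise_const_nonneg by (simp add: d_def ennreal_mult'[symmetric] ennreal_of_nat_eq_real_of_nat)
    also have "\<dots> \<le> ennreal (d powr \<theta> * d * noise_const * (wconst * L\<^sup>2) powr (\<theta> / 2) * (a powr \<theta> * exp (l * \<theta> * t) / sqrt l))"
    proof (intro ennreal_leI)
      have "v powr (\<theta> / 2) \<le> (wconst * L\<^sup>2 * (a\<^sup>2 * exp (2 * l * t)) / l) powr (\<theta> / 2)"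
      proof (intro powr_mono2)
        show "v \<le> wconst * L\<^sup>2 * (a\<^sup>2 * exp (2 * l * t)) / l"
          unfolding v_def mult.assoc using wconst_pos L_pos a l0 by (intro divide_left_mono mult_pos_pos) auto
      qed (use \<theta> wconst_pos l0 in \<open>auto simp: v_def\<close>)
      also have "\<dots> = (wconst * L\<^sup>2) powr (\<theta> / 2) * ((a\<^sup>2) powr (\<theta> / 2) * exp (2 * l * t) powr (\<theta> / 2)) / l powr (\<theta> / 2)"
        using wconst_pos L_pos a l0 by (simp add: powr_divide powr_mult)
      also have "(a\<^sup>2) powr (\<theta> / 2) = a powr \<theta>" using a by (simp add: powr_powr flip: powr_numeral)
      also have "exp (2 * l * t) powr (\<theta> / 2) = exp (l * \<theta> * t)" by (simp add: exp_powr_real mult_ac)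
      also have "(wconst * L\<^sup>2) powr (\<theta> / 2) * (a powr \<theta> * exp (l * \<theta> * t)) / l powr (\<theta> / 2)
          \<le> (wconst * L\<^sup>2) powr (\<theta> / 2) * (a powr \<theta> * exp (l * \<theta> * t)) / sqrt l"
        using lp[of "\<theta> / 2"] \<theta> sq0 l0 by (intro divide_left_mono) auto
      finally have "(d powr \<theta> * d * noise_const) * v powr (\<theta> / 2) \<le> (d powr \<theta> * d * noise_const) * ((wconst * L\<^sup>2) powr (\<theta> / 2) * (a powr \<theta> * exp (l * \<theta> * t)) / sqrt l)"
        using noise_const_nonneg by (intro mult_left_mono) (auto simp: d_def)
      then show "d powr \<theta> * (d * (noise_const * v powr (\<theta> / 2))) \<le> d powr \<theta> * d * noise_const * (wconst * L\<^sup>2) powr (\<theta> / 2) * (a powr \<theta> * exp (l * \<theta> * t) / sqrt l)"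
        by (simp add: mult_ac)
    qed
    finally show "(\<integral>\<^sup>+\<omega>. ennreal (N \<omega> powr \<theta>) \<partial>M) \<le> ennreal (d powr \<theta> * d * noise_const * (wconst * L\<^sup>2) powr (\<theta> / 2) * (a powr \<theta> * exp (l * \<theta> * t) / sqrt l))" .
  qed auto
  also have "\<dots> = ennreal (4 powr \<theta> * (L powr \<theta> * (T powr (\<theta> - 1) * (S * exp (l * \<theta> * t) / sqrt l))
      + (L powr \<theta> * (a powr \<theta> * exp (l * \<theta> * t) / sqrt l)
       + d powr \<theta> * d * noise_const * (wconst * L\<^sup>2) powr (\<theta> / 2) * (a powr \<theta> * exp (l * \<theta> * t) / sqrt l))))"
    using S(1) noise_const_nonneg l0
    by (intro ennreal_combination mult_nonneg_nonneg divide_nonneg_nonneg) (auto simp: d_def)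
  also have "\<dots> \<le> ennreal (contraction_const / sqrt l * (S + a powr \<theta>) * exp (l * \<theta> * t))"
  proof (intro ennreal_leI)
    define E where "E = exp (l * \<theta> * t) / sqrt l"
    define c1 where "c1 = L powr \<theta> * T powr (\<theta> - 1)"
    define c3 where "c3 = d powr \<theta> * d * noise_const * (wconst * L\<^sup>2) powr (\<theta> / 2)"
    have nn: "0 \<le> E" "0 \<le> c1" "0 \<le> c3" "0 \<le> L powr \<theta>" "0 \<le> a powr \<theta>"
      using l0 noise_const_nonneg by (auto simp: E_def c1_def c3_def d_def)
    have "c1 * (S * E) + (L powr \<theta> * (a powr \<theta> * E) + c3 * (a powr \<theta> * E))
      \<le> c1 * ((S + a powr \<theta>) * E) + (L powr \<theta> * ((S + a powr \<theta>) * E) + c3 * ((S + a powr \<theta>) * E))"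
      using nn S(1) by (intro add_mono mult_left_mono mult_right_mono) auto
    also have "\<dots> = (c1 + L powr \<theta> + c3) * (S + a powr \<theta>) * E" by (simp add: algebra_simps)
    finally have "4 powr \<theta> * (c1 * (S * E) + (L powr \<theta> * (a powr \<theta> * E) + c3 * (a powr \<theta> * E)))
      \<le> 4 powr \<theta> * ((c1 + L powr \<theta> + c3) * (S + a powr \<theta>) * E)"
      by (intro mult_left_mono) auto
    moreover have "4 powr \<theta> * ((c1 + L powr \<theta> + c3) * (S + a powr \<theta>) * E) = contraction_const / sqrt l * (S + a powr \<theta>) * exp (l * \<theta> * t)"
      by (simp add: contraction_const_def c1_def c3_def E_def d_def mult.assoc)
    moreover have "4 powr \<theta> * (L powr \<theta> * (T powr (\<theta> - 1) * (S * exp (l * \<theta> * t) / sqrt l))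
      + (L powr \<theta> * (a powr \<theta> * exp (l * \<theta> * t) / sqrt l) + d powr \<theta> * d * noise_const * (wconst * L\<^sup>2) powr (\<theta> / 2) * (a powr \<theta> * exp (l * \<theta> * t) / sqrt l)))
      = 4 powr \<theta> * (c1 * (S * E) + (L powr \<theta> * (a powr \<theta> * E) + c3 * (a powr \<theta> * E)))"
      by (simp add: c1_def c3_def E_def mult.assoc)
    ultimately show "4 powr \<theta> * (L powr \<theta> * (T powr (\<theta> - 1) * (S * exp (l * \<theta> * t) / sqrt l))
      + (L powr \<theta> * (a powr \<theta> * exp (l * \<theta> * t) / sqrt l) + d powr \<theta> * d * noise_const * (wconst * L\<^sup>2) powr (\<theta> / 2) * (a powr \<theta> * exp (l * \<theta> * t) / sqrt l)))
      \<le> contraction_const / sqrt l * (S + a powr \<theta>) * exp (l * \<theta> * t)" by simp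
  qed
  finally show ?thesis .
qed

end

section \<open>The contraction rate and solvability along a frozen flow\<close>

lemma vec_lambda_measurable:
  fixes f :: "'n::finite \<Rightarrow> 'a \<Rightarrow> real"
  assumes "\<And>i. f i \<in> borel_measurable N"
  shows "(\<lambda>\<omega>. \<chi> i. f i \<omega>) \<in> borel_measurable N"
  using assms by (subst borel_measurable_euclidean_space) (auto simp: Basis_vec_def inner_axis)

context mckean_vlasov
begin

text \<open>Chosen so that e = contraction_const / sqrt rate satisfies 2 e <= 2 powr (- \<theta>),
  which is what halving in L-\<theta> requires; the maximum with 1 meets the condition on l in
  \<open>stability_step\<close>.\<close>

definition rate :: real where
  "rate = max 1 ((2 * 2 powr \<theta> * contraction_const)\<^sup>2)"

lemma rate_ge_1: "rate \<ge> 1" by (simp add: rate_def)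

lemma contraction_rate: "contraction_const / sqrt rate \<le> 1 / (2 * 2 powr \<theta>)"
proof -
  have "2 * 2 powr \<theta> * contraction_const = sqrt ((2 * 2 powr \<theta> * contraction_const)\<^sup>2)"
    using contraction_const_nonneg by simp
  also have "\<dots> \<le> sqrt rate" unfolding rate_def by (intro real_sqrt_le_mono) simp
  finally show ?thesis using rate_ge_1 by (simp add: field_simps)
qed

text \<open>\<open>stability_step\<close> is iterated from the crude bound \<open>S0\<close>, which
  comes from the boundedness of both processes. Since e is at most 1/2, the map sending S to e (S +
  A) takes e^n S0 + 2 e A to at most e^(n+1) S0 + 2 e A. In the limit 2 e A remains, at most (a / 2)
  powr \<theta> by the choice of the rate.\<close>

lemma stability:
  assumes X: "in_Sp M Fil T p X" and X': "in_Sp M Fil T p X'"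
    and V: "flow_process V" and V': "flow_process V'"
    and sX: "solves V X" and sX': "solves V' X'"
    and w: "\<And>s. s \<in> {0..T} \<Longrightarrow> wasserstein \<theta> (law M (V s)) (law M (V' s)) \<le> a * exp (rate * s)"
    and a: "a > 0" and t: "t \<in> {0..T}"
  shows "(\<integral>\<^sup>+\<omega>. ennreal (norm (X t \<omega> - X' t \<omega>) powr \<theta>) \<partial>M) \<le> ennreal ((a / 2 * exp (rate * t)) powr \<theta>)"
proof -
  define e where "e = contraction_const / sqrt rate"
  have e0: "0 \<le> e" using contraction_const_nonneg rate_ge_1 by (simp add: e_def)
  have e1: "2 * e \<le> 1 / 2 powr \<theta>" using contraction_rate unfolding e_def by (simp add: field_simps)
  have "1 / 2 powr \<theta> \<le> (1::real)" using ge_one_powr_ge_zero[of 2 \<theta>] \<theta> by simp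
  then have e2: "2 * e \<le> 1" using e1 by linarith
  obtain R where R: "Lp_bounded X R" using Sp_flow_process[OF X] by (auto simp: flow_process_def)
  obtain R' where R': "Lp_bounded X' R'" using Sp_flow_process[OF X'] by (auto simp: flow_process_def)
  define S0 where "S0 = 2 powr \<theta> * (R powr \<theta> + R' powr \<theta>)"
  have S0: "0 \<le> S0" by (simp add: S0_def)
  have init: "(\<integral>\<^sup>+\<omega>. ennreal (norm (X s \<omega> - X' s \<omega>) powr \<theta>) \<partial>M) \<le> ennreal S0" if s: "s \<in> {0..T}" for s
  proof -
    have "(\<integral>\<^sup>+\<omega>. ennreal (norm (X s \<omega> - X' s \<omega>) powr \<theta>) \<partial>M)
      \<le> ennreal (2 powr \<theta>) * ((\<integral>\<^sup>+\<omega>. ennreal (norm (X s \<omega> - 0) powr \<theta>) \<partial>M) + (\<integral>\<^sup>+\<omega>. ennreal (norm (0 - X' s \<omega>) powr \<theta>) \<partial>M))"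
      using \<theta> Sp_meas[OF X s] Sp_meas[OF X' s] by (intro nn_integral_powr_triangle[where Y="\<lambda>\<omega>. 0"]) auto
    also have "\<dots> \<le> ennreal (2 powr \<theta>) * (ennreal (R powr \<theta>) + ennreal (R' powr \<theta>))"
      using R R' s by (intro mult_left_mono add_mono) (auto simp: Lp_bounded_def)
    also have "\<dots> = ennreal S0" by (simp add: S0_def ennreal_mult ennreal_plus)
    finally show ?thesis .
  qed
  define A where "A = a powr \<theta>"
  have A0: "0 \<le> A" by (simp add: A_def)
  have iter: "(\<integral>\<^sup>+\<omega>. ennreal (norm (X s \<omega> - X' s \<omega>) powr \<theta>) \<partial>M) \<le> ennreal ((e ^ n * S0 + 2 * e * A) * exp (rate * \<theta> * s))"
    if "s \<in> {0..T}" for n s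
    using that
  proof (induction n arbitrary: s)
    case 0
    have "S0 * 1 \<le> (e ^ 0 * S0 + 2 * e * A) * exp (rate * \<theta> * s)"
      using S0 e0 A0 rate_ge_1 \<theta> 0 by (intro mult_mono) auto
    then show ?case using order_trans[OF init[OF 0] ennreal_leI] by simp
  next
    case (Suc n)
    have "(\<integral>\<^sup>+\<omega>. ennreal (norm (X s \<omega> - X' s \<omega>) powr \<theta>) \<partial>M)
      \<le> ennreal (contraction_const / sqrt rate * ((e ^ n * S0 + 2 * e * A) + a powr \<theta>) * exp (rate * \<theta> * s))"
      using e0 S0 A0 Suc.IH by (intro stability_step[OF X X' V V' sX sX' w a rate_ge_1 _ _ Suc.prems]) auto
    also have "\<dots> \<le> ennreal ((e ^ Suc n * S0 + 2 * e * A) * exp (rate * \<theta> * s))"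
    proof (intro ennreal_leI mult_right_mono)
      have "(2 * e) * (e * A) \<le> 1 * (e * A)" using e2 e0 A0 by (intro mult_right_mono) auto
      then have "e * ((e ^ n * S0 + 2 * e * A) + A) \<le> e ^ Suc n * S0 + 2 * e * A"
        by (simp add: algebra_simps)
      then show "contraction_const / sqrt rate * ((e ^ n * S0 + 2 * e * A) + a powr \<theta>) \<le> e ^ Suc n * S0 + 2 * e * A"
        by (simp add: e_def A_def)
    qed simp
    finally show ?case .
  qed
  have "e < 1" using e2 by simp
  then have "(\<lambda>n. ennreal ((e ^ n * S0 + 2 * e * A) * exp (rate * \<theta> * t))) \<longlonglongrightarrow> ennreal ((0 * S0 + 2 * e * A) * exp (rate * \<theta> * t))"
    using e0 by (intro tendsto_ennrealI tendsto_mult tendsto_add tendsto_const LIMSEQ_power_zero) auto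
  then have "(\<integral>\<^sup>+\<omega>. ennreal (norm (X t \<omega> - X' t \<omega>) powr \<theta>) \<partial>M) \<le> ennreal ((0 * S0 + 2 * e * A) * exp (rate * \<theta> * t))"
    by (rule LIMSEQ_le_const) (use iter[OF t] in blast)
  also have "\<dots> \<le> ennreal ((a / 2 * exp (rate * t)) powr \<theta>)"
  proof (intro ennreal_leI)
    have "2 * e * A \<le> (1 / 2 powr \<theta>) * A" using e1 A0 by (intro mult_right_mono) auto
    also have "\<dots> = (a / 2) powr \<theta>" using a by (simp add: A_def powr_divide)
    finally have "(2 * e * A) * exp (rate * \<theta> * t) \<le> (a / 2) powr \<theta> * exp (rate * \<theta> * t)"
      by (intro mult_right_mono) auto
    also have "\<dots> = (a / 2 * exp (rate * t)) powr \<theta>"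
      using a by (subst powr_mult) (auto simp: exp_powr_real mult_ac)
    finally show "(0 * S0 + 2 * e * A) * exp (rate * \<theta> * t) \<le> (a / 2 * exp (rate * t)) powr \<theta>" by simp
  qed
  finally show ?thesis .
qed

lemma b_section_measurable:
  assumes V: "flow_process V" and \<omega>: "\<omega> \<in> space M"
  shows "(\<lambda>s. b \<omega> s x (law M (V s))) \<in> borel_measurable (restrict_space borel {0..T})"
proof -
  have "(\<lambda>(\<omega>, s). b \<omega> s x (law M (V s))) \<in> borel_measurable (Fil T \<Otimes>\<^sub>M restrict_space borel {0..T})"
    using b_meas[rule_format, OF flow_process_continuous_flow[OF V], of T x] T by auto
  from measurable_compose[OF measurable_Pair1' this, of \<omega>] show ?thesis using \<omega> by (simp add: space_Fil)
qed

lemma frozen_flow_solution_exists: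
  assumes V: "flow_process V"
  obtains X where "in_Sp M Fil T p X" "solves V X"
proof -
  obtain R where R: "Lp_bounded V R" using V by (auto simp: flow_process_def)
  \<comment> \<open>Bundled in one predicate so that a single choice over i and j provides the
    continuous noise together with its majorant.\<close>
  define good where "good i j Z S \<longleftrightarrow> (\<forall>\<omega>. continuous_on {0..T} (\<lambda>t. Z t \<omega>)) \<and> (\<forall>t\<in>{0..T}. Z t \<in> borel_measurable (Fil t)) \<and>
      (\<forall>t\<in>{0..T}. is_wiener_integral M (\<lambda>s \<omega>. B s \<omega> $ j) H t (diffusion V i j) (Z t)) \<and>
      S \<in> borel_measurable M \<and> (\<forall>t\<in>{0..T}. \<forall>\<omega>. \<bar>Z t \<omega>\<bar> \<le> S \<omega>) \<and>
      (\<integral>\<^sup>+\<omega>. ennreal (S \<omega> powr (2 * real mexp)) \<partial>M) < \<infinity>" for i j Z S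
  have "\<exists>Z S. good i j Z S" for i j
  proof -
    interpret C: scalar_fbm M "\<lambda>s \<omega>. B s \<omega> $ j" T H by (rule component_fbm)
    have B: "(\<lambda>\<omega>. B s \<omega> $ j) \<in> borel_measurable (Fil t)" if "s \<in> {0..t}" for s t
      using B_Fil[OF that] by (intro measurable_compose[OF _ vec_nth_measurable])
    show ?thesis
    proof (rule C.wiener_process[OF diffusion_measurable[OF V, of i j] diffusion_bound[OF R] M_complete
            space_Fil sets_Fil_subset null_sets_Fil B mexp(1)])
      fix Z S
      assume zs: "\<And>\<omega>. continuous_on {0..T} (\<lambda>t. Z t \<omega>)"
        "\<And>t. t \<in> {0..T} \<Longrightarrow> Z t \<in> borel_measurable (Fil t)"
        "\<And>t. t \<in> {0..T} \<Longrightarrow> is_wiener_integral M (\<lambda>s \<omega>. B s \<omega> $ j) H t (diffusion V i j) (Z t)"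
        "S \<in> borel_measurable M" "\<And>t \<omega>. t \<in> {0..T} \<Longrightarrow> \<bar>Z t \<omega>\<bar> \<le> S \<omega>"
        "(\<integral>\<^sup>+\<omega>. ennreal (S \<omega> powr (2 * real mexp)) \<partial>M) < \<infinity>"
      have "good i j Z S" unfolding good_def by (intro conjI allI ballI zs)
      then show "\<exists>Z S. good i j Z S" by blast
    qed
  qed
  then obtain Z S where "\<And>i j. good i j (Z i j) (S i j)" by metis
  then have Z: "\<And>i j \<omega>. continuous_on {0..T} (\<lambda>t. Z i j t \<omega>)"
      "\<And>i j t. t \<in> {0..T} \<Longrightarrow> Z i j t \<in> borel_measurable (Fil t)"
      "\<And>i j t. t \<in> {0..T} \<Longrightarrow> is_wiener_integral M (\<lambda>s \<omega>. B s \<omega> $ j) H t (diffusion V i j) (Z i j t)"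
    and S[measurable]: "\<And>i j. S i j \<in> borel_measurable M"
    and ZS: "\<And>i j t \<omega>. t \<in> {0..T} \<Longrightarrow> \<bar>Z i j t \<omega>\<bar> \<le> S i j \<omega>"
    and Sm: "\<And>i j. (\<integral>\<^sup>+\<omega>. ennreal (S i j \<omega> powr (2 * real mexp)) \<partial>M) < \<infinity>"
    unfolding good_def by blast+
  define noise where "noise t \<omega> = (\<chi> i. \<Sum>j\<in>UNIV. Z i j t \<omega>)" for t \<omega>
  define a where "a t \<omega> = \<xi> \<omega> + noise t \<omega>" for t \<omega>
  define f where "f \<omega> s x = b \<omega> s x (law M (V s))" for \<omega> s x
  define sumS where "sumS \<omega> = (\<Sum>z\<in>(UNIV :: ('d \<times> 'd) set). S (fst z) (snd z) \<omega>)" for \<omega>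
  define Ra where "Ra \<omega> = norm (\<xi> \<omega>) + sumS \<omega>" for \<omega>
  define B0 where "B0 = L * (1 + R)"
  have S0: "0 \<le> S i j \<omega>" for i j \<omega> using ZS[of 0 i j \<omega>] T by (auto intro: order_trans[OF abs_ge_zero])
  have noise_le: "norm (noise t \<omega>) \<le> sumS \<omega>" if t: "t \<in> {0..T}" for t \<omega>
  proof -
    have "norm (noise t \<omega>) \<le> (\<Sum>i\<in>UNIV. \<bar>noise t \<omega> $ i\<bar>)" by (rule norm_le_l1_cart)
    also have "\<dots> \<le> (\<Sum>i\<in>UNIV. \<Sum>j\<in>UNIV. S i j \<omega>)"
      unfolding noise_def using ZS[OF t] by (intro sum_mono) (auto intro!: order_trans[OF sum_abs] sum_mono)
    also have "\<dots> = sumS \<omega>"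
      unfolding sumS_def by (simp add: sum.cartesian_product case_prod_beta' UNIV_Times_UNIV[symmetric] del: UNIV_Times_UNIV)
    finally show ?thesis .
  qed
  have a_cont: "continuous_on {0..T} (\<lambda>t. a t \<omega>)" for \<omega>
    unfolding a_def noise_def by (intro continuous_on_add continuous_on_const continuous_on_vec_lambda continuous_on_sum Z)
  have eqn: "integral_equation (f \<omega>) (\<lambda>t. a t \<omega>) T L B0 (Ra \<omega>)" if \<omega>: "\<omega> \<in> space M" for \<omega>
  proof
    show "norm (f \<omega> s x - f \<omega> s y) \<le> L * norm (x - y)" if s: "s \<in> {0..T}" for s x y
      unfolding f_def using b_lip_L[OF \<omega> s flow_process_P_moment[OF V s] flow_process_P_moment[OF V s]
          wasserstein_self_le[OF flow_process_meas[OF V s]] order_refl, of x y] by simp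
    show "norm (f \<omega> s 0) \<le> B0" if "s \<in> {0..T}" for s
      unfolding f_def B0_def by (rule b_bound[OF R that \<omega>])
    show "(\<lambda>s. f \<omega> s x) \<in> borel_measurable (restrict_space borel {0..T})" for x
      unfolding f_def by (rule b_section_measurable[OF V \<omega>])
    show "norm (a t \<omega>) \<le> Ra \<omega>" if "t \<in> {0..T}" for t
      using norm_triangle_ineq[of "\<xi> \<omega>" "noise t \<omega>"] noise_le[OF that, of \<omega>] by (simp add: a_def Ra_def)
  qed (use T L_pos a_cont in auto)
  \<comment> \<open>Defined for every outcome, outside the locale, whose assumptions hold on
    \<open>space M\<close>; this form also exhibits X t as a limit of adapted variables.\<close>
  define X where "X t \<omega> = lim (\<lambda>n. picard (f \<omega>) (\<lambda>t. a t \<omega>) n t)" for t \<omega>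
  have X_sol: "X t \<omega> = integral_equation.solution (f \<omega>) (\<lambda>t. a t \<omega>) t" if "\<omega> \<in> space M" for t \<omega>
    unfolding X_def integral_equation.solution_def[OF eqn[OF that]] ..
  have a_Fil: "a t \<in> borel_measurable (Fil t)" if t: "t \<in> {0..T}" for t
  proof -
    have "noise t \<in> borel_measurable (Fil t)"
      unfolding noise_def
    proof (rule vec_lambda_measurable)
      show "(\<lambda>\<omega>. \<Sum>j\<in>UNIV. Z i j t \<omega>) \<in> borel_measurable (Fil t)" for i
        by (intro borel_measurable_sum Z(2)[OF t])
    qed
    then show ?thesis unfolding a_def[abs_def] using \<xi>_Fil[of t] by measurable
  qed
  have picard_Fil: "(\<lambda>\<omega>. picard (f \<omega>) (\<lambda>t. a t \<omega>) n t) \<in> borel_measurable (Fil t)" if "t \<in> {0..T}" for n t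
    using that
  proof (induction n arbitrary: t)
    case (Suc n)
    have t: "t \<in> {0..T}" by fact
    \<comment> \<open>Only times up to t enter, and what is measurable at time s is measurable at
      time t; this is what keeps the integral adapted.\<close>
    let ?N = "Fil t \<Otimes>\<^sub>M restrict_space borel {0..t}"
    have g: "(\<lambda>z. picard (f (fst z)) (\<lambda>t. a t (fst z)) n (snd z)) \<in> borel_measurable ?N"
    proof (rule continuous_process_jointly_measurable[where X="\<lambda>s \<omega>. picard (f \<omega>) (\<lambda>t. a t \<omega>) n s"])
      show "0 \<le> t" using t by simp
      show "(\<lambda>\<omega>. picard (f \<omega>) (\<lambda>t. a t \<omega>) n s) \<in> borel_measurable (Fil t)" if "s \<in> {0..t}" for s
        using that t by (intro measurable_Fil_mono[of s t] Suc.IH) auto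
      show "continuous_on {0..t} (\<lambda>s. picard (f \<omega>) (\<lambda>t. a t \<omega>) n s)" if "\<omega> \<in> space (Fil t)" for \<omega>
      proof -
        have "\<omega> \<in> space M" using that by (simp add: space_Fil)
        from integral_equation.picard_continuous[OF eqn[OF this], of n]
        show ?thesis by (rule continuous_on_subset) (use t in auto)
      qed
    qed
    have "(\<lambda>z. f (fst z) (snd z) (picard (f (fst z)) (\<lambda>t. a t (fst z)) n (snd z))) \<in> borel_measurable ?N"
    proof (rule caratheodory_measurable[where f="\<lambda>z. f (fst z) (snd z)" and g="\<lambda>z. picard (f (fst z)) (\<lambda>t. a t (fst z)) n (snd z)", OF _ _ g])
      show "(\<lambda>z. f (fst z) (snd z) x) \<in> borel_measurable ?N" for x
        using b_meas[rule_format, OF flow_process_continuous_flow[OF V] t, of x] by (simp add: f_def case_prod_beta')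
      show "continuous_on UNIV (f (fst z) (snd z))" if "z \<in> space ?N" for z
        using that t by (intro integral_equation.f_continuous[OF eqn]) (auto simp: space_pair_measure space_restrict_space space_Fil)
    qed
    then have "(\<lambda>\<omega>. LINT s:{0..t}|lborel. f \<omega> s (picard (f \<omega>) (\<lambda>t. a t \<omega>) n s)) \<in> borel_measurable (Fil t)"
      using set_integral_jointly_measurable[of t "\<lambda>z. f (fst z) (snd z) (picard (f (fst z)) (\<lambda>t. a t (fst z)) n (snd z))" "Fil t"] t by simp
    then show ?case using a_Fil[OF t] by simp
  qed simp
  have X_Fil: "X t \<in> borel_measurable (Fil t)" if "t \<in> {0..T}" for t
    unfolding X_def by (intro borel_measurable_lim_metric picard_Fil[OF that])
  have X_bound: "norm (X t \<omega>) \<le> 2 * (Ra \<omega> + B0 * T) * exp (2 * L * T)" if "t \<in> {0..T}" "\<omega> \<in> space M" for t \<omega>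
    using integral_equation.solution_bound[OF eqn[OF that(2)] that(1)]
    by (simp add: X_sol[OF that(2)] integral_equation.A_def[OF eqn[OF that(2)]])
  have "in_Sp M Fil T p X"
    unfolding in_Sp_def
  proof (intro conjI ballI)
    show "continuous_on {0..T} (\<lambda>t. X t \<omega>)" if "\<omega> \<in> space M" for \<omega>
      using integral_equation.solution_continuous[OF eqn[OF that]] by (simp add: X_sol[OF that])
    show "X t \<in> borel_measurable (Fil t)" if "t \<in> {0..T}" for t by (rule X_Fil[OF that])
    define c where "c = 2 * exp (2 * L * T)"
    define d where "d = real (CARD('d \<times> 'd))"
    have p0: "0 \<le> p" using \<theta> p by simp
    have B00: "0 \<le> B0 * T" unfolding B0_def using L_pos R T by (auto simp: Lp_bounded_def)
    have c0: "0 \<le> c" by (simp add: c_def)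
    have sum0: "0 \<le> sumS \<omega>" for \<omega> unfolding sumS_def using S0 by (intro sum_nonneg) auto
    \<comment> \<open>A measurable majorant independent of t. The noise enters through its moment of
      order 2 mexp, which is at least p.\<close>
    let ?maj = "\<lambda>\<omega>. ennreal (c powr p * 4 powr p) * (ennreal (norm (\<xi> \<omega>) powr p) + (ennreal ((B0 * T) powr p)
        + ennreal (d powr p) * (\<Sum>z\<in>(UNIV :: ('d \<times> 'd) set). 1 + ennreal (S (fst z) (snd z) \<omega> powr (2 * real mexp)))))"
    have maj: "ennreal (norm (X t \<omega>) powr p) \<le> ?maj \<omega>" if t: "t \<in> {0..T}" and \<omega>: "\<omega> \<in> space M" for t \<omega>
    proof -
      have "norm (X t \<omega>) powr p \<le> (c * (norm (\<xi> \<omega>) + (B0 * T + sumS \<omega>))) powr p"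
        using X_bound[OF t \<omega>] p0 by (intro powr_mono2) (auto simp: c_def Ra_def algebra_simps)
      also have "\<dots> = c powr p * (norm (\<xi> \<omega>) + (B0 * T + sumS \<omega>)) powr p"
        using c0 B00 sum0[of \<omega>] by (simp add: powr_mult)
      also have "\<dots> \<le> c powr p * (4 powr p * (norm (\<xi> \<omega>) powr p + ((B0 * T) powr p + sumS \<omega> powr p)))"
      proof (intro mult_left_mono)
        have "(norm (\<xi> \<omega>) + (B0 * T + sumS \<omega>)) powr p \<le> 2 powr p * (norm (\<xi> \<omega>) powr p + (B0 * T + sumS \<omega>) powr p)"
          using p0 B00 sum0[of \<omega>] by (intro powr_add_le) auto
        also have "\<dots> \<le> 2 powr p * (2 powr p * norm (\<xi> \<omega>) powr p + 2 powr p * ((B0 * T) powr p + sumS \<omega> powr p))"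
        proof (intro mult_left_mono add_mono)
          show "norm (\<xi> \<omega>) powr p \<le> 2 powr p * norm (\<xi> \<omega>) powr p"
            using ge_one_powr_ge_zero[of 2 p] p0 mult_right_mono[of 1 "2 powr p" "norm (\<xi> \<omega>) powr p"] by simp
          show "(B0 * T + sumS \<omega>) powr p \<le> 2 powr p * ((B0 * T) powr p + sumS \<omega> powr p)"
            using p0 B00 sum0[of \<omega>] by (intro powr_add_le) auto
        qed auto
        also have "\<dots> = 4 powr p * (norm (\<xi> \<omega>) powr p + ((B0 * T) powr p + sumS \<omega> powr p))"
        proof -
          have "(4::real) powr p = 2 powr p * 2 powr p" by (simp flip: powr_mult)
          then show ?thesis by (simp add: algebra_simps)
        qed
        finally show "(norm (\<xi> \<omega>) + (B0 * T + sumS \<omega>)) powr p \<le> 4 powr p * (norm (\<xi> \<omega>) powr p + ((B0 * T) powr p + sumS \<omega> powr p))" .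
      qed simp
      also have "\<dots> \<le> c powr p * (4 powr p * (norm (\<xi> \<omega>) powr p + ((B0 * T) powr p
          + d powr p * (\<Sum>z\<in>(UNIV :: ('d \<times> 'd) set). 1 + S (fst z) (snd z) \<omega> powr (2 * real mexp)))))"
      proof (intro mult_left_mono add_mono order_refl)
        have "sumS \<omega> powr p \<le> d powr p * (\<Sum>z\<in>(UNIV :: ('d \<times> 'd) set). S (fst z) (snd z) \<omega> powr p)"
          unfolding sumS_def d_def using p0 S0 by (intro powr_sum_le) auto
        also have "\<dots> \<le> d powr p * (\<Sum>z\<in>(UNIV :: ('d \<times> 'd) set). 1 + S (fst z) (snd z) \<omega> powr (2 * real mexp))"
          using p0 mexp S0 by (intro mult_left_mono sum_mono powr_le_one_plus_powr) auto
        finally show "sumS \<omega> powr p \<le> d powr p * (\<Sum>z\<in>(UNIV :: ('d \<times> 'd) set). 1 + S (fst z) (snd z) \<omega> powr (2 * real mexp))" .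
      qed auto
      finally have "ennreal (norm (X t \<omega>) powr p) \<le> ennreal (c powr p * 4 powr p * (norm (\<xi> \<omega>) powr p + ((B0 * T) powr p
          + d powr p * (\<Sum>z\<in>(UNIV :: ('d \<times> 'd) set). 1 + S (fst z) (snd z) \<omega> powr (2 * real mexp)))))"
        by (intro ennreal_leI) (simp add: mult.assoc)
      also have "\<dots> = ?maj \<omega>"
        by (simp add: ennreal_mult ennreal_plus sum_nonneg flip: sum_ennreal)
      finally show ?thesis .
    qed
    have "(\<integral>\<^sup>+ \<omega>. (\<Squnion>t\<in>{0..T}. ennreal (norm (X t \<omega>) powr p)) \<partial>M) \<le> (\<integral>\<^sup>+\<omega>. ?maj \<omega> \<partial>M)"
      using maj by (intro nn_integral_mono SUP_least) auto
    also have "\<dots> = ennreal (c powr p * 4 powr p) * ((\<integral>\<^sup>+\<omega>. ennreal (norm (\<xi> \<omega>) powr p) \<partial>M) + (ennreal ((B0 * T) powr p)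
        + ennreal (d powr p) * (\<Sum>z\<in>(UNIV :: ('d \<times> 'd) set). 1 + (\<integral>\<^sup>+\<omega>. ennreal (S (fst z) (snd z) \<omega> powr (2 * real mexp)) \<partial>M))))"
      by (simp add: nn_integral_cmult nn_integral_add nn_integral_sum emeasure_space_1)
    also have "\<dots> < \<infinity>"
      using \<xi>(2) Sm by (auto simp: ennreal_mult_less_top)
    finally show "(\<integral>\<^sup>+ \<omega>. (\<Squnion>t\<in>{0..T}. ennreal (norm (X t \<omega>) powr p)) \<partial>M) < \<infinity>" .
  qed
  moreover have "solves V X"
    unfolding solves_def
  proof (intro ballI exI[of _ "\<lambda>i j. Z i j _"] conjI allI)
    fix t i j assume t: "t \<in> {0..T}"
    show "is_wiener_integral M (\<lambda>s \<omega>. B s \<omega> $ j) H t (\<lambda>s. \<sigma> s (law M (V s)) $ i $ j) (Z i j t)"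
      using Z(3)[OF t, of j i] t by (subst is_wiener_integral_cong[of _ _ "diffusion V i j"]) (auto simp: diffusion_def)
  next
    fix t assume t: "t \<in> {0..T}"
    show "AE \<omega> in M. set_integrable lborel {0..t} (\<lambda>s. b \<omega> s (X s \<omega>) (law M (V s))) \<and>
           X t \<omega> = \<xi> \<omega> + (LINT s:{0..t}|lborel. b \<omega> s (X s \<omega>) (law M (V s))) + (\<chi> i. \<Sum>j\<in>UNIV. Z i j t \<omega>)"
    proof (intro AE_I2 conjI)
      fix \<omega> assume \<omega>: "\<omega> \<in> space M"
      have Xe: "X s \<omega> = integral_equation.solution (f \<omega>) (\<lambda>t. a t \<omega>) s" for s by (rule X_sol[OF \<omega>])
      show "set_integrable lborel {0..t} (\<lambda>s. b \<omega> s (X s \<omega>) (law M (V s)))"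
        using integral_equation.f_path_integrable[OF eqn[OF \<omega>] integral_equation.solution_continuous[OF eqn[OF \<omega>]] t]
        by (simp add: f_def Xe)
      have "X t \<omega> = a t \<omega> + (LINT s:{0..t}|lborel. f \<omega> s (X s \<omega>))"
        unfolding Xe by (rule integral_equation.solution_equation[OF eqn[OF \<omega>] t])
      then show "X t \<omega> = \<xi> \<omega> + (LINT s:{0..t}|lborel. b \<omega> s (X s \<omega>) (law M (V s))) + (\<chi> i. \<Sum>j\<in>UNIV. Z i j t \<omega>)"
        by (simp add: a_def f_def noise_def algebra_simps)
    qed
  qed
  ultimately show ?thesis by (rule that)
qed

end

section \<open>Fixed point of the law map\<close>

context mckean_vlasov
begin

lemma zero_in_Sp: "in_Sp M Fil T p (\<lambda>t \<omega>. 0)"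
  unfolding in_Sp_def using T \<theta> p by (auto simp: image_constant_conv)

lemma AE_eq_of_moment_tendsto_0:
  fixes U W :: "'a \<Rightarrow> real^'d"
  assumes [measurable]: "U \<in> borel_measurable M" "W \<in> borel_measurable M"
    and le: "\<And>n :: nat. (\<integral>\<^sup>+\<omega>. ennreal (norm (U \<omega> - W \<omega>) powr \<theta>) \<partial>M) \<le> e n" and e: "e \<longlonglongrightarrow> 0"
  shows "AE \<omega> in M. U \<omega> = W \<omega>"
proof -
  have "(\<integral>\<^sup>+\<omega>. ennreal (norm (U \<omega> - W \<omega>) powr \<theta>) \<partial>M) \<le> 0"
    using le by (intro LIMSEQ_le_const[OF e]) blast
  then have "(\<integral>\<^sup>+\<omega>. ennreal (norm (U \<omega> - W \<omega>) powr \<theta>) \<partial>M) = 0" by simp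
  then have "AE \<omega> in M. ennreal (norm (U \<omega> - W \<omega>) powr \<theta>) = 0"
    by (subst (asm) nn_integral_0_iff_AE) auto
  then show ?thesis by eventually_elim (simp add: ennreal_eq_0_iff)
qed

lemma geometric_powr_tendsto_0:
  assumes "c \<ge> 0"
  shows "(\<lambda>n. ennreal ((c * (1/2) ^ n) powr \<theta>)) \<longlonglongrightarrow> 0"
proof -
  have "(\<lambda>n. c * (1/2) ^ n) \<longlonglongrightarrow> c * 0"
    by (intro tendsto_mult tendsto_const LIMSEQ_power_zero) auto
  then have "(\<lambda>n. (c * (1/2) ^ n) powr \<theta>) \<longlonglongrightarrow> (c * 0) powr \<theta>"
    using \<theta> assms by (intro tendsto_powr2 tendsto_const) auto
  then have "(\<lambda>n. ennreal ((c * (1/2) ^ n) powr \<theta>)) \<longlonglongrightarrow> ennreal ((c * 0) powr \<theta>)"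
    by (rule tendsto_ennrealI)
  then show ?thesis by simp
qed

text \<open>A crude distance between two bounded flows, which starts the geometric decay in the
  uniqueness and in the existence argument.\<close>

lemma Lp_bounded_wasserstein_le:
  assumes X: "Lp_bounded X R" and Y: "Lp_bounded Y R'" and t: "t \<in> {0..T}"
  shows "wasserstein \<theta> (law M (X t)) (law M (Y t)) \<le> 2 * (R powr \<theta> + R' powr \<theta>) powr (1 / \<theta>)"
proof -
  have [measurable]: "X t \<in> borel_measurable M" "Y t \<in> borel_measurable M"
    using X Y t by (auto simp: Lp_bounded_def)
  have "(\<integral>\<^sup>+\<omega>. ennreal (norm (X t \<omega> - Y t \<omega>) powr \<theta>) \<partial>M)
      \<le> ennreal (2 powr \<theta>) * ((\<integral>\<^sup>+\<omega>. ennreal (norm (X t \<omega> - 0) powr \<theta>) \<partial>M) + (\<integral>\<^sup>+\<omega>. ennreal (norm (0 - Y t \<omega>) powr \<theta>) \<partial>M))"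
    using \<theta> by (intro nn_integral_powr_triangle[where Y="\<lambda>\<omega>. 0"]) auto
  also have "\<dots> \<le> ennreal (2 powr \<theta>) * (ennreal (R powr \<theta>) + ennreal (R' powr \<theta>))"
    using X Y t by (intro mult_left_mono add_mono) (auto simp: Lp_bounded_def)
  also have "\<dots> = ennreal (2 powr \<theta> * (R powr \<theta> + R' powr \<theta>))" by (simp add: ennreal_mult ennreal_plus)
  also have "2 powr \<theta> * (R powr \<theta> + R' powr \<theta>) = (2 * (R powr \<theta> + R' powr \<theta>) powr (1 / \<theta>)) powr \<theta>"
    using \<theta> by (simp add: powr_mult powr_powr)
  finally show ?thesis using \<theta> by (intro wasserstein_law_le) auto
qed

text \<open>Applying \<open>stability\<close> with X and Y as their own flows halves any weighted
  bound on the distance of the laws, so a 2^-n is such a bound for all n. Almost sure equality at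
  each time extends to all times at once by path continuity and a countable dense set of
  times.\<close>

lemma solution_unique:
  assumes X: "in_Sp M Fil T p X" "solves X X" and Y: "in_Sp M Fil T p Y" "solves Y Y"
  shows "AE \<omega> in M. \<forall>t\<in>{0..T}. X t \<omega> = Y t \<omega>"
proof -
  note fX = Sp_flow_process[OF X(1)] and fY = Sp_flow_process[OF Y(1)]
  obtain R R' where R: "Lp_bounded X R" "Lp_bounded Y R'" using fX fY by (auto simp: flow_process_def)
  \<comment> \<open>The summand 1 gives the strict positivity that \<open>stability\<close> asks
    for.\<close>
  define a where "a = 2 * (R powr \<theta> + R' powr \<theta>) powr (1 / \<theta>) + 1"
  have a: "a > 0" by (simp add: a_def add_nonneg_pos)
  have W: "wasserstein \<theta> (law M (X s)) (law M (Y s)) \<le> (a * (1/2) ^ n) * exp (rate * s)" if "s \<in> {0..T}" for n s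
    using that
  proof (induction n arbitrary: s)
    case 0
    have "wasserstein \<theta> (law M (X s)) (law M (Y s)) \<le> a"
      using Lp_bounded_wasserstein_le[OF R 0] by (simp add: a_def)
    also have "a * 1 \<le> a * exp (rate * s)" using a rate_ge_1 0 by (intro mult_left_mono) auto
    finally show ?case by simp
  next
    case (Suc n)
    have "(\<integral>\<^sup>+\<omega>. ennreal (norm (X s \<omega> - Y s \<omega>) powr \<theta>) \<partial>M) \<le> ennreal ((a * (1/2) ^ n / 2 * exp (rate * s)) powr \<theta>)"
      using a Suc.IH by (intro stability[OF X(1) Y(1) fX fY X(2) Y(2) _ _ Suc.prems]) auto
    then have "wasserstein \<theta> (law M (X s)) (law M (Y s)) \<le> a * (1/2) ^ n / 2 * exp (rate * s)"
      using \<theta> a Sp_meas[OF X(1) Suc.prems] Sp_meas[OF Y(1) Suc.prems] by (intro wasserstein_law_le) auto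
    then show ?case by simp
  qed
  have eq: "AE \<omega> in M. X t \<omega> = Y t \<omega>" if t: "t \<in> {0..T}" for t
  proof (rule AE_eq_of_moment_tendsto_0[OF Sp_meas[OF X(1) t] Sp_meas[OF Y(1) t] _ geometric_powr_tendsto_0[of "a / 2 * exp (rate * t)"]])
    show "0 \<le> a / 2 * exp (rate * t)" using a by simp
    fix n
    have "(\<integral>\<^sup>+\<omega>. ennreal (norm (X t \<omega> - Y t \<omega>) powr \<theta>) \<partial>M) \<le> ennreal ((a * (1/2) ^ n / 2 * exp (rate * t)) powr \<theta>)"
      using a W by (intro stability[OF X(1) Y(1) fX fY X(2) Y(2) _ _ t]) auto
    then show "(\<integral>\<^sup>+\<omega>. ennreal (norm (X t \<omega> - Y t \<omega>) powr \<theta>) \<partial>M) \<le> ennreal ((a / 2 * exp (rate * t) * (1/2) ^ n) powr \<theta>)"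
      by (simp add: mult_ac)
  qed
  define pt where "pt k = min (real (fst (prod_decode k)) / 2 ^ snd (prod_decode k)) T" for k
  have pt: "pt k \<in> {0..T}" for k using T by (auto simp: pt_def)
  have "AE \<omega> in M. \<forall>k. X (pt k) \<omega> = Y (pt k) \<omega>"
    using eq[OF pt] by (simp add: AE_all_countable)
  with AE_space show ?thesis
  proof eventually_elim
    case (elim \<omega>)
    show ?case
    proof
      fix t assume t: "t \<in> {0..T}"
      define g where "g k = min (real (nat \<lfloor>t * 2 ^ k\<rfloor>) / 2 ^ k) T" for k :: nat
      have g_pt: "g k = pt (prod_encode (nat \<lfloor>t * 2 ^ k\<rfloor>, k))" for k by (simp add: g_def pt_def)
      have gT: "g k \<in> {0..T}" for k unfolding g_pt by (rule pt)
      have "g \<longlonglongrightarrow> min t T" unfolding g_def[abs_def] using t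
        by (intro tendsto_min tendsto_const dyadic_floor_tendsto) auto
      then have g: "g \<longlonglongrightarrow> t" using t by simp
      have "(\<lambda>k. X (g k) \<omega>) \<longlonglongrightarrow> X t \<omega>"
        using X(1) elim(1) t gT g by (intro continuous_on_tendsto_compose[of "{0..T}" "\<lambda>s. X s \<omega>"]) (auto simp: in_Sp_def)
      moreover have "(\<lambda>k. Y (g k) \<omega>) \<longlonglongrightarrow> Y t \<omega>"
        using Y(1) elim(1) t gT g by (intro continuous_on_tendsto_compose[of "{0..T}" "\<lambda>s. Y s \<omega>"]) (auto simp: in_Sp_def)
      moreover have "X (g k) \<omega> = Y (g k) \<omega>" for k unfolding g_pt using elim(2) by blast
      ultimately show "X t \<omega> = Y t \<omega>" by (auto intro: LIMSEQ_unique)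
    qed
  qed
qed

lemma solves_cong_law:
  assumes s: "solves V X" and eq: "\<And>s. s \<in> {0..T} \<Longrightarrow> law M (V s) = law M (V' s)"
  shows "solves V' X"
  unfolding solves_def
proof
  fix t assume t: "t \<in> {0..T}"
  obtain Y where Y: "\<And>i j. is_wiener_integral M (\<lambda>s \<omega>. B s \<omega> $ j) H t (\<lambda>s. \<sigma> s (law M (V s)) $ i $ j) (Y i j)"
    and YX: "AE \<omega> in M. set_integrable lborel {0..t} (\<lambda>s. b \<omega> s (X s \<omega>) (law M (V s))) \<and>
           X t \<omega> = \<xi> \<omega> + (LINT s:{0..t}|lborel. b \<omega> s (X s \<omega>) (law M (V s))) + (\<chi> i. \<Sum>j\<in>UNIV. Y i j \<omega>)"
    using s t unfolding solves_def by blast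
  have eq': "law M (V s) = law M (V' s)" if "s \<in> {0..t}" for s using that t by (intro eq) auto
  have W: "is_wiener_integral M (\<lambda>s \<omega>. B s \<omega> $ j) H t (\<lambda>s. \<sigma> s (law M (V' s)) $ i $ j) (Y i j)" for i j
    using Y[of j i] eq' by (subst is_wiener_integral_cong[of _ _ "\<lambda>s. \<sigma> s (law M (V s)) $ i $ j"]) auto
  have i: "set_integrable lborel {0..t} (\<lambda>s. b \<omega> s (X s \<omega>) (law M (V s))) \<longleftrightarrow> set_integrable lborel {0..t} (\<lambda>s. b \<omega> s (X s \<omega>) (law M (V' s)))" for \<omega>
    using eq' by (intro set_integrable_cong) auto
  have l: "(LINT s:{0..t}|lborel. b \<omega> s (X s \<omega>) (law M (V s))) = (LINT s:{0..t}|lborel. b \<omega> s (X s \<omega>) (law M (V' s)))" for \<omega>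
    using eq' by (intro set_lebesgue_integral_cong) auto
  show "\<exists>Y :: 'd \<Rightarrow> 'd \<Rightarrow> 'a \<Rightarrow> real.
        (\<forall>i j. is_wiener_integral M (\<lambda>s \<omega>. B s \<omega> $ j) H t (\<lambda>s. \<sigma> s (law M (V' s)) $ i $ j) (Y i j)) \<and>
        (AE \<omega> in M. set_integrable lborel {0..t} (\<lambda>s. b \<omega> s (X s \<omega>) (law M (V' s))) \<and>
           X t \<omega> = \<xi> \<omega> + (LINT s:{0..t}|lborel. b \<omega> s (X s \<omega>) (law M (V' s))) + (\<chi> i. \<Sum>j\<in>UNIV. Y i j \<omega>))"
    using W YX unfolding i l by blast
qed

text \<open>V s is compared with V t through X n s and X n t: the approximation is uniform in time,
  and continuity is that of one fixed iterate.\<close>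

lemma uniform_limit_flow_process:
  assumes X: "\<And>n. flow_process (X n)" and V: "\<And>t. t \<in> {0..T} \<Longrightarrow> V t \<in> borel_measurable M"
    and le: "\<And>n t. t \<in> {0..T} \<Longrightarrow> (\<integral>\<^sup>+\<omega>. ennreal (norm (V t \<omega> - X n t \<omega>) powr \<theta>) \<partial>M) \<le> ennreal (e n)"
    and e: "e \<longlonglongrightarrow> 0" "\<And>n. 0 \<le> e n"
  shows "flow_process V"
proof -
  note Xm = flow_process_meas[OF X]
  obtain R where R: "Lp_bounded (X 0) R" using X[of 0] by (auto simp: flow_process_def)
  define R' where "R' = (2 powr \<theta> * (e 0 + R powr \<theta>)) powr (1 / \<theta>)"
  have "Lp_bounded V R'"
    unfolding Lp_bounded_def
  proof (intro conjI ballI V)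
    fix t assume t: "t \<in> {0..T}"
    have "(\<integral>\<^sup>+\<omega>. ennreal (norm (V t \<omega> - 0) powr \<theta>) \<partial>M)
      \<le> ennreal (2 powr \<theta>) * ((\<integral>\<^sup>+\<omega>. ennreal (norm (V t \<omega> - X 0 t \<omega>) powr \<theta>) \<partial>M) + (\<integral>\<^sup>+\<omega>. ennreal (norm (X 0 t \<omega> - 0) powr \<theta>) \<partial>M))"
      using \<theta> V[OF t] Xm[OF t] by (intro nn_integral_powr_triangle) auto
    also have "\<dots> \<le> ennreal (2 powr \<theta>) * (ennreal (e 0) + ennreal (R powr \<theta>))"
      using R t le[OF t, of 0] by (intro mult_left_mono add_mono) (auto simp: Lp_bounded_def)
    also have "\<dots> = ennreal (R' powr \<theta>)"
      using e(2)[of 0] \<theta> by (simp add: R'_def powr_powr ennreal_mult ennreal_plus)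
    finally show "(\<integral>\<^sup>+\<omega>. ennreal (norm (V t \<omega>) powr \<theta>) \<partial>M) \<le> ennreal (R' powr \<theta>)" by simp
  qed (simp add: R'_def)
  moreover have "((\<lambda>s. \<integral>\<^sup>+\<omega>. ennreal (norm (V s \<omega> - V t \<omega>) powr \<theta>) \<partial>M) \<longlongrightarrow> 0) (at t within {0..T})" if t: "t \<in> {0..T}" for t
  proof (rule order_tendstoI)
    fix x :: ennreal assume x: "0 < x"
    obtain r where r: "0 < r" "ennreal r \<le> x"
    proof (cases x)
      case (real r)
      then show ?thesis using that[of r] x by (auto simp: ennreal_less_zero_iff)
    next
      case top
      then show ?thesis using that[of 1] by auto
    qed
    define C where "C = (2::real) powr \<theta>"
    have C1: "C \<ge> 1" unfolding C_def using ge_one_powr_ge_zero[of 2 \<theta>] \<theta> by simp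
    \<comment> \<open>Two triangle inequalities give C (d + C (d + d)), at most 3 C^2 d because C is
      at least 1; this is 3 r / 4.\<close>
    define d where "d = r / (4 * C * C)"
    have d: "d > 0" using r C1 by (simp add: d_def)
    have d0: "0 \<le> d" and C0: "0 \<le> C" using d C1 by auto
    have "\<forall>\<^sub>F n in sequentially. e n < d" by (rule order_tendstoD(2)[OF e(1) d])
    then obtain n where n: "e n < d" by (auto simp: eventually_sequentially)
    have "((\<lambda>s. \<integral>\<^sup>+\<omega>. ennreal (norm (X n s \<omega> - X n t \<omega>) powr \<theta>) \<partial>M) \<longlongrightarrow> 0) (at t within {0..T})"
      using X[of n] t by (auto simp: flow_process_def)
    then have "\<forall>\<^sub>F s in at t within {0..T}. (\<integral>\<^sup>+\<omega>. ennreal (norm (X n s \<omega> - X n t \<omega>) powr \<theta>) \<partial>M) < ennreal d"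
      using d by (intro order_tendstoD(2)) auto
    moreover have "\<forall>\<^sub>F s in at t within {0..T}. s \<in> {0..T}" by (simp add: eventually_at_filter)
    ultimately show "\<forall>\<^sub>F s in at t within {0..T}. (\<integral>\<^sup>+\<omega>. ennreal (norm (V s \<omega> - V t \<omega>) powr \<theta>) \<partial>M) < x"
    proof eventually_elim
      case (elim s)
      have m: "V s \<in> borel_measurable M" "V t \<in> borel_measurable M" "X n s \<in> borel_measurable M" "X n t \<in> borel_measurable M"
        using V Xm elim t by auto
      have sym: "(\<integral>\<^sup>+\<omega>. ennreal (norm (X n t \<omega> - V t \<omega>) powr \<theta>) \<partial>M) = (\<integral>\<^sup>+\<omega>. ennreal (norm (V t \<omega> - X n t \<omega>) powr \<theta>) \<partial>M)"
        by (simp add: norm_minus_commute)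
      have "(\<integral>\<^sup>+\<omega>. ennreal (norm (V s \<omega> - V t \<omega>) powr \<theta>) \<partial>M)
        \<le> ennreal C * ((\<integral>\<^sup>+\<omega>. ennreal (norm (V s \<omega> - X n s \<omega>) powr \<theta>) \<partial>M) + (\<integral>\<^sup>+\<omega>. ennreal (norm (X n s \<omega> - V t \<omega>) powr \<theta>) \<partial>M))"
        unfolding C_def using \<theta> m by (intro nn_integral_powr_triangle) auto
      also have "\<dots> \<le> ennreal C * (ennreal d + ennreal C * (ennreal d + ennreal d))"
      proof (intro mult_left_mono add_mono)
        show "(\<integral>\<^sup>+\<omega>. ennreal (norm (V s \<omega> - X n s \<omega>) powr \<theta>) \<partial>M) \<le> ennreal d"
          using order_trans[OF le ennreal_leI[OF less_imp_le[OF n]]] elim by auto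
        have "(\<integral>\<^sup>+\<omega>. ennreal (norm (X n s \<omega> - V t \<omega>) powr \<theta>) \<partial>M)
          \<le> ennreal C * ((\<integral>\<^sup>+\<omega>. ennreal (norm (X n s \<omega> - X n t \<omega>) powr \<theta>) \<partial>M) + (\<integral>\<^sup>+\<omega>. ennreal (norm (X n t \<omega> - V t \<omega>) powr \<theta>) \<partial>M))"
          unfolding C_def using \<theta> m by (intro nn_integral_powr_triangle) auto
        also have "\<dots> \<le> ennreal C * (ennreal d + ennreal d)"
          unfolding sym using elim order_trans[OF le[OF t, of n] ennreal_leI[OF less_imp_le[OF n]]]
          by (intro mult_left_mono add_mono) auto
        finally show "(\<integral>\<^sup>+\<omega>. ennreal (norm (X n s \<omega> - V t \<omega>) powr \<theta>) \<partial>M) \<le> ennreal C * (ennreal d + ennreal d)" .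
      qed auto
      also have "\<dots> = ennreal (C * (d + C * (d + d)))"
        by (simp only: ennreal_plus[symmetric] ennreal_mult[symmetric] d0 C0 add_nonneg_nonneg mult_nonneg_nonneg)
      also have "\<dots> < ennreal r"
      proof (rule ennreal_lessI[OF r(1)])
        have "1 * d \<le> C * d" using d C1 by (intro mult_right_mono) auto
        then have "C * (d + C * (d + d)) \<le> C * (3 * (C * d))" using C1 by (intro mult_left_mono) auto
        also have "\<dots> = 3 / 4 * r" using C1 by (simp add: d_def field_simps)
        also have "\<dots> < r" using r(1) by simp
        finally show "C * (d + C * (d + d)) < r" .
      qed
      also have "ennreal r \<le> x" by (rule r)
      finally show ?case .
    qed
  qed auto
  ultimately show ?thesis unfolding flow_process_def by blast
qed

text \<open>The iterates converge almost surely at each fixed time to V, whose paths are not shown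
  to be continuous; V only carries the limit flow of laws. The solution Y for this flow lies in S^p,
  and comparing it with X (n + 2), which solves for the flow of X (n + 1), shows that Y t = V t
  almost surely.\<close>

lemma solution_exists:
  obtains X where "in_Sp M Fil T p X" "solves X X"
proof -
  define \<Phi> where "\<Phi> V = (SOME X. in_Sp M Fil T p X \<and> solves V X)" for V
  have \<Phi>: "in_Sp M Fil T p (\<Phi> V)" "solves V (\<Phi> V)" if "flow_process V" for V
  proof -
    have "\<exists>X. in_Sp M Fil T p X \<and> solves V X" using frozen_flow_solution_exists[OF that] by blast
    from someI_ex[OF this] show "in_Sp M Fil T p (\<Phi> V)" "solves V (\<Phi> V)" by (auto simp: \<Phi>_def)
  qed
  define X where "X n = (\<Phi> ^^ n) (\<lambda>t \<omega>. 0)" for n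
  have X_Suc: "X (Suc n) = \<Phi> (X n)" for n by (simp add: X_def)
  have XSp: "in_Sp M Fil T p (X n)" for n
  proof (induction n)
    case 0
    show ?case using zero_in_Sp by (simp add: X_def)
  next
    case (Suc n)
    then show ?case unfolding X_Suc by (intro \<Phi> Sp_flow_process)
  qed
  have Xf: "flow_process (X n)" for n by (rule Sp_flow_process[OF XSp])
  have Xs: "solves (X n) (X (Suc n))" for n unfolding X_Suc by (rule \<Phi>(2)[OF Xf])
  have Xm: "X n t \<in> borel_measurable M" if "t \<in> {0..T}" for n t by (rule Sp_meas[OF XSp that])
  obtain R R' where R: "Lp_bounded (X 1) R" "Lp_bounded (X 0) R'"
    using Xf[of 1] Xf[of 0] unfolding flow_process_def by blast
  define a where "a = 2 * (R powr \<theta> + R' powr \<theta>) powr (1 / \<theta>) + 1"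
  have a: "a > 0" by (simp add: a_def add_nonneg_pos)
  have W: "wasserstein \<theta> (law M (X (Suc n) s)) (law M (X n s)) \<le> (a * (1/2) ^ n) * exp (rate * s)" if "s \<in> {0..T}" for n s
    using that
  proof (induction n arbitrary: s)
    case 0
    have "wasserstein \<theta> (law M (X 1 s)) (law M (X 0 s)) \<le> a"
      using Lp_bounded_wasserstein_le[OF R 0] by (simp add: a_def)
    also have "a * 1 \<le> a * exp (rate * s)" using a rate_ge_1 0 by (intro mult_left_mono) auto
    finally show ?case by simp
  next
    case (Suc n)
    have "(\<integral>\<^sup>+\<omega>. ennreal (norm (X (Suc (Suc n)) s \<omega> - X (Suc n) s \<omega>) powr \<theta>) \<partial>M) \<le> ennreal ((a * (1/2) ^ n / 2 * exp (rate * s)) powr \<theta>)"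
      using a Suc.IH by (intro stability[OF XSp XSp Xf Xf Xs Xs _ _ Suc.prems]) auto
    then have "wasserstein \<theta> (law M (X (Suc (Suc n)) s)) (law M (X (Suc n) s)) \<le> a * (1/2) ^ n / 2 * exp (rate * s)"
      using \<theta> a Xm[OF Suc.prems] by (intro wasserstein_law_le) auto
    then show ?case by simp
  qed
  \<comment> \<open>Halving the distance in L-\<theta> multiplies \<theta>-th moments by q, the
    ratio handed to \<open>summable_increments_moment\<close>.\<close>
  define q where "q = (1/2 :: real) powr \<theta>"
  have q: "0 < q" "q < 1" using \<theta> powr_less_mono2[of \<theta> "1/2" 1] by (auto simp: q_def)
  define C where "C = (a / 2 * exp (rate * T)) powr \<theta>"
  have C: "0 \<le> C" by (simp add: C_def)
  have incr: "(\<integral>\<^sup>+\<omega>. ennreal (norm (X (Suc (Suc n)) t \<omega> - X (Suc n) t \<omega>) powr \<theta>) \<partial>M) \<le> ennreal (C * q ^ n)" if t: "t \<in> {0..T}" for n t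
  proof -
    have "(\<integral>\<^sup>+\<omega>. ennreal (norm (X (Suc (Suc n)) t \<omega> - X (Suc n) t \<omega>) powr \<theta>) \<partial>M) \<le> ennreal ((a * (1/2) ^ n / 2 * exp (rate * t)) powr \<theta>)"
      using a W by (intro stability[OF XSp XSp Xf Xf Xs Xs _ _ t]) auto
    also have "\<dots> \<le> ennreal ((a / 2 * exp (rate * T) * (1/2) ^ n) powr \<theta>)"
    proof (intro ennreal_leI powr_mono2)
      have "a * (1/2) ^ n / 2 * exp (rate * t) \<le> a * (1/2) ^ n / 2 * exp (rate * T)"
        using a t rate_ge_1 by (intro mult_left_mono) auto
      then show "a * (1/2) ^ n / 2 * exp (rate * t) \<le> a / 2 * exp (rate * T) * (1/2) ^ n" by (simp add: mult_ac)
    qed (use a \<theta> in auto)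
    also have "(a / 2 * exp (rate * T) * (1/2) ^ n) powr \<theta> = C * ((1/2) ^ n) powr \<theta>"
      unfolding C_def using a by (subst powr_mult) auto
    also have "((1/2 :: real) ^ n) powr \<theta> = q ^ n"
      unfolding q_def by (simp add: powr_power powr_realpow[symmetric] powr_powr mult.commute)
    finally show ?thesis .
  qed
  \<comment> \<open>The index starts at 1 because X 0 is the zero process and not the solution of a
    frozen equation; \<open>stability\<close> controls the increments from X 2 - X 1 on.\<close>
  define V where "V t \<omega> = lim (\<lambda>n. X (Suc n) t \<omega>)" for t \<omega>
  have Vm: "V t \<in> borel_measurable M" if "t \<in> {0..T}" for t
    unfolding V_def by (intro borel_measurable_lim_metric Xm that)
  define e where "e n = C * q ^ n * chain_const q \<theta>" for n
  have e0: "0 \<le> e n" for n unfolding e_def using C q chain_const_nonneg[OF q] by simp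
  have elim: "e \<longlonglongrightarrow> 0"
  proof -
    have "(\<lambda>n. C * q ^ n * chain_const q \<theta>) \<longlonglongrightarrow> C * 0 * chain_const q \<theta>"
      using q by (intro tendsto_mult tendsto_const LIMSEQ_power_zero) auto
    then show ?thesis by (simp add: e_def[abs_def])
  qed
  have VX: "(\<integral>\<^sup>+\<omega>. ennreal (norm (V t \<omega> - X (Suc n) t \<omega>) powr \<theta>) \<partial>M) \<le> ennreal (e n)" if t: "t \<in> {0..T}" for n t
  proof -
    define \<Delta> where "\<Delta> k \<omega> = norm (X (Suc (Suc k)) t \<omega> - X (Suc k) t \<omega>)" for k \<omega>
    have \<Delta>m: "\<Delta> k \<in> borel_measurable M" for k
      unfolding \<Delta>_def using Xm[OF t, of "Suc (Suc k)"] Xm[OF t, of "Suc k"] by measurable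
    have mom: "(\<integral>\<^sup>+\<omega>. ennreal (\<Delta> (k + n) \<omega> powr \<theta>) \<partial>M) \<le> ennreal (C * q ^ n * q ^ k)" for k
      using incr[OF t, of "k + n"] by (simp add: \<Delta>_def power_add mult_ac)
    have Cq: "0 \<le> C * q ^ n" using C q by simp
    have \<theta>0: "0 < \<theta>" using \<theta> by simp
    obtain S where S: "S \<in> borel_measurable M" "\<And>\<omega>. 0 \<le> S \<omega>"
      "AE \<omega> in M. summable (\<lambda>k. \<Delta> (k + n) \<omega>) \<and> (\<Sum>k. \<Delta> (k + n) \<omega>) \<le> S \<omega>"
      "(\<integral>\<^sup>+\<omega>. ennreal (S \<omega> powr \<theta>) \<partial>M) \<le> ennreal (C * q ^ n * chain_const q \<theta>)"
      by (rule summable_increments_moment[of "\<lambda>k. \<Delta> (k + n)" M \<theta> q "C * q ^ n", OF \<Delta>m _ \<theta>0 q Cq mom]) (auto simp: \<Delta>_def)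
    have "AE \<omega> in M. norm (V t \<omega> - X (Suc n) t \<omega>) powr \<theta> \<le> S \<omega> powr \<theta>"
      using S(3)
    proof eventually_elim
      case (elim \<omega>)
      then have sm: "summable (\<lambda>k. \<Delta> k \<omega>)" using summable_iff_shift[of "\<lambda>k. \<Delta> k \<omega>" n] by simp
      have "norm (V t \<omega> - X (Suc n) t \<omega>) \<le> (\<Sum>k. \<Delta> (k + n) \<omega>)"
        unfolding V_def
        by (rule convergent_of_summable_increments(2)[of "\<lambda>k. \<Delta> k \<omega>" "\<lambda>k. X (Suc k) t \<omega>" n, OF sm]) (simp add: \<Delta>_def)
      then show ?case using elim \<theta> by (intro powr_mono2) auto
    qed
    then have "(\<integral>\<^sup>+\<omega>. ennreal (norm (V t \<omega> - X (Suc n) t \<omega>) powr \<theta>) \<partial>M) \<le> (\<integral>\<^sup>+\<omega>. ennreal (S \<omega> powr \<theta>) \<partial>M)"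
      by (intro nn_integral_mono_AE) (auto elim!: eventually_mono intro: ennreal_leI)
    then show ?thesis using S(4) unfolding e_def by (rule order_trans)
  qed
  have Vf: "flow_process V"
    using uniform_limit_flow_process[of "\<lambda>n. X (Suc n)" V e, OF Xf Vm VX elim e0] .
  define Y where "Y = \<Phi> V"
  have Y: "in_Sp M Fil T p Y" "solves V Y" unfolding Y_def by (rule \<Phi>[OF Vf])+
  have YV: "AE \<omega> in M. Y t \<omega> = V t \<omega>" if t: "t \<in> {0..T}" for t
  proof -
    \<comment> \<open>The bound on the L-\<theta> distance from V to X (n + 1), plus 2^-n for the
      strict positivity that \<open>stability\<close> asks for.\<close>
    define c where "c n = (e n) powr (1 / \<theta>) + (1/2) ^ n" for n
    have c: "c n > 0" for n by (simp add: c_def add_nonneg_pos)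
    have W': "wasserstein \<theta> (law M (V s)) (law M (X (Suc n) s)) \<le> c n * exp (rate * s)" if s: "s \<in> {0..T}" for n s
    proof -
      have "wasserstein \<theta> (law M (V s)) (law M (X (Suc n) s)) \<le> (e n) powr (1 / \<theta>)"
        using \<theta> VX[OF s, of n] e0[of n] Vm[OF s] Xm[OF s] by (intro wasserstein_law_le) (auto simp: powr_powr)
      also have "\<dots> \<le> c n * 1" by (simp add: c_def)
      also have "\<dots> \<le> c n * exp (rate * s)" using c[of n] rate_ge_1 s by (intro mult_left_mono) auto
      finally show ?thesis .
    qed
    define x where "x n = ennreal (2 powr \<theta>) * (ennreal ((c n / 2 * exp (rate * t)) powr \<theta>) + ennreal (e (Suc n)))" for n
    have le: "(\<integral>\<^sup>+\<omega>. ennreal (norm (Y t \<omega> - V t \<omega>) powr \<theta>) \<partial>M) \<le> x n" for n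
    proof -
      have "(\<integral>\<^sup>+\<omega>. ennreal (norm (Y t \<omega> - V t \<omega>) powr \<theta>) \<partial>M)
        \<le> ennreal (2 powr \<theta>) * ((\<integral>\<^sup>+\<omega>. ennreal (norm (Y t \<omega> - X (Suc (Suc n)) t \<omega>) powr \<theta>) \<partial>M) + (\<integral>\<^sup>+\<omega>. ennreal (norm (X (Suc (Suc n)) t \<omega> - V t \<omega>) powr \<theta>) \<partial>M))"
        using \<theta> Sp_meas[OF Y(1) t] Xm[OF t] Vm[OF t] by (intro nn_integral_powr_triangle) auto
      also have "\<dots> \<le> x n"
        unfolding x_def
      proof (intro mult_left_mono add_mono)
        show "(\<integral>\<^sup>+\<omega>. ennreal (norm (Y t \<omega> - X (Suc (Suc n)) t \<omega>) powr \<theta>) \<partial>M) \<le> ennreal ((c n / 2 * exp (rate * t)) powr \<theta>)"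
          by (intro stability[OF Y(1) XSp Vf Xf Y(2) Xs _ _ t] W' c)
        show "(\<integral>\<^sup>+\<omega>. ennreal (norm (X (Suc (Suc n)) t \<omega> - V t \<omega>) powr \<theta>) \<partial>M) \<le> ennreal (e (Suc n))"
          using VX[OF t, of "Suc n"] by (simp add: norm_minus_commute)
      qed auto
      finally show ?thesis .
    qed
    have clim: "c \<longlonglongrightarrow> 0"
    proof -
      have "(\<lambda>n. e n powr (1 / \<theta>)) \<longlonglongrightarrow> 0 powr (1 / \<theta>)"
        using elim e0 \<theta> by (intro tendsto_powr2 tendsto_const) auto
      then have "(\<lambda>n. e n powr (1 / \<theta>) + (1/2) ^ n) \<longlonglongrightarrow> 0 powr (1 / \<theta>) + 0"
        by (intro tendsto_add LIMSEQ_power_zero) auto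
      then show ?thesis by (simp add: c_def[abs_def])
    qed
    have xlim: "x \<longlonglongrightarrow> 0"
    proof -
      have "(\<lambda>n. c n / 2 * exp (rate * t)) \<longlonglongrightarrow> 0 / 2 * exp (rate * t)"
        by (intro tendsto_mult tendsto_divide tendsto_const clim) auto
      then have "(\<lambda>n. (c n / 2 * exp (rate * t)) powr \<theta>) \<longlonglongrightarrow> 0 powr \<theta>"
        using c less_imp_le[OF c] \<theta> by (intro tendsto_powr2 tendsto_const) auto
      then have "(\<lambda>n. ennreal ((c n / 2 * exp (rate * t)) powr \<theta>) + ennreal (e (Suc n))) \<longlonglongrightarrow> ennreal (0 powr \<theta>) + ennreal 0"
        by (intro tendsto_add tendsto_ennrealI LIMSEQ_Suc elim)
      then show ?thesis unfolding x_def[abs_def] by (intro tendsto_ennreal_numeral_mult_0) auto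
    qed
    show ?thesis by (rule AE_eq_of_moment_tendsto_0[OF Sp_meas[OF Y(1) t] Vm[OF t] le xlim])
  qed
  have "law M (V s) = law M (Y s)" if s: "s \<in> {0..T}" for s
    unfolding law_def using YV[OF s] Vm[OF s] Sp_meas[OF Y(1) s]
    by (intro distr_cong_AE) (auto elim: eventually_mono)
  then have "solves Y Y" by (rule solves_cong_law[OF Y(2)])
  then show ?thesis using Y(1) by (intro that)
qed

end

theorem theorem3p3:
  fixes M :: "'a measure" and T H \<theta> p :: real and F0 :: "'a set set"
    and B :: "real \<Rightarrow> 'a \<Rightarrow> real^'d" and \<xi> :: "'a \<Rightarrow> real^'d"
    and b :: "'a \<Rightarrow> real \<Rightarrow> real^'d \<Rightarrow> (real^'d) measure \<Rightarrow> real^'d"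
    and \<sigma> :: "real \<Rightarrow> (real^'d) measure \<Rightarrow> real^'d^'d"
    and K :: "real \<Rightarrow> real"
  assumes M: "prob_space M" "complete_measure M"
    and T: "T > 0" and H: "1/2 < H" "H < 1"
    and fBm: "is_fBm M H T B"
    and F0: "sigma_algebra (space M) F0" "F0 \<subseteq> sets M"
    and F0_indep: "\<forall>A\<in>F0. \<forall>C\<in>sigma_sets (space M) {B s -` U \<inter> space M | s U. s \<in> {0..T} \<and> U \<in> sets borel}.
                     measure M (A \<inter> C) = measure M A * measure M C"
    and F0_rich: "\<forall>\<mu> :: (real^'d) measure. P_moment 2 \<mu> \<longrightarrow>
                     (\<exists>Z. Z \<in> borel_measurable (sigma (space M) F0) \<and> distr M borel Z = \<mu>)"
    and \<theta>: "\<theta> \<ge> 1" and p: "p \<ge> \<theta>" "p > 1 / H"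
    and \<xi>: "\<xi> \<in> borel_measurable (sigma (space M) F0)"
        "(\<integral>\<^sup>+ \<omega>. ennreal (norm (\<xi> \<omega>) powr p) \<partial>M) < \<infinity>"
    and K: "mono_on {0..T} K" "\<forall>t\<in>{0..T}. K t \<ge> 0"
    and b_lip: "\<forall>\<omega>\<in>space M. \<forall>t\<in>{0..T}. \<forall>x y \<mu> \<nu>. P_moment \<theta> \<mu> \<longrightarrow> P_moment \<theta> \<nu> \<longrightarrow>
          norm (b \<omega> t x \<mu> - b \<omega> t y \<nu>) \<le> K t * (norm (x - y) + wasserstein \<theta> \<mu> \<nu>)"
    and \<sigma>_lip: "\<forall>t\<in>{0..T}. \<forall>\<mu> \<nu>. P_moment \<theta> \<mu> \<longrightarrow> P_moment \<theta> \<nu> \<longrightarrow>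
          norm (\<sigma> t \<mu> - \<sigma> t \<nu>) \<le> K t * wasserstein \<theta> \<mu> \<nu>"
    and bound0: "\<forall>\<omega>\<in>space M. \<forall>t\<in>{0..T}.
          norm (b \<omega> t 0 (return borel 0)) + norm (\<sigma> t (return borel 0)) \<le> K t"
    and \<sigma>_meas: "\<forall>m. W_continuous_flow \<theta> T m \<longrightarrow>
          (\<lambda>s. \<sigma> s (m s)) \<in> borel_measurable (restrict_space borel {0..T})"
    and b_meas: "\<forall>m. W_continuous_flow \<theta> T m \<longrightarrow> (\<forall>t\<in>{0..T}. \<forall>x.
          (\<lambda>(\<omega>, s). b \<omega> s x (m s)) \<in>
            borel_measurable (fbm_filtration M F0 B t \<Otimes>\<^sub>M restrict_space borel {0..t}))"
  shows "(\<exists>X. in_Sp M (fbm_filtration M F0 B) T p X \<and> is_solution M H T B \<xi> b \<sigma> X) \<and>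
         (\<forall>X Y. in_Sp M (fbm_filtration M F0 B) T p X \<and> is_solution M H T B \<xi> b \<sigma> X \<and>
                in_Sp M (fbm_filtration M F0 B) T p Y \<and> is_solution M H T B \<xi> b \<sigma> Y \<longrightarrow>
                (AE \<omega> in M. \<forall>t\<in>{0..T}. X t \<omega> = Y t \<omega>))"
proof -
  interpret prob_space M by (rule M)
  interpret mckean_vlasov M T H \<theta> p F0 B \<xi> b \<sigma> K
    by (intro mckean_vlasov.intro mckean_vlasov_axioms.intro) fact+
  obtain X where "in_Sp M (fbm_filtration M F0 B) T p X" "solves X X"
    by (rule solution_exists)
  then show ?thesis
    using solution_unique unfolding is_solution_iff_solves by blast
qed

end
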